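(* Let $\Omega\subset\mathbb{R}^2$ be a bounded, possibly multiply connected domain with Lipschitz boundary, let $f\in H^{-1}(\Omega)$, and fix $\mathrm{Pe}\ge0$. For each positive integer $n$ let $\Xi_n\subset H^1_0(\Omega)$, $\Theta_n\subset H^1_0(\Omega)$ and $\Psi_n\subset\mathcal{H}$ be $n$-dimensional subspaces. Assume: (i) for every $\xi\in H^1_0(\Omega)$ there exist $\xi_n\in\Xi_n$ with $\|\xi_n-\xi\|_{H^1_0(\Omega)}\to0$ as $n\to\infty$; (ii) for every $\theta\in H^1_0(\Omega)$ there exist $\theta_n\in\Theta_n$ with $\|\theta_n-\theta\|_{H^1_0(\Omega)}\to0$ as $n\to\infty$; (iii) for every $\psi\in\mathcal{H}$ there exist $\psi_n\in\Psi_n$ with $\|\psi_n-\psi\|_{H^1(\Omega)}\to0$ as $n\to\infty$. Let $\mathcal{L}(\mathrm{Pe})$ and $(a^*,\xi^* )$ be the optimal value and the (unique) optimizer of $$\max\left\{ \int_\Omega \Big( f\xi-\tfrac14|\nabla\xi|^2\Big)\,d\mathbf{x} - a \;:\; a\in\mathbb{R},\ \xi\in H^1_0(\Omega),\ \mathcal{Q}(a,\xi)\succeq 0\right\},$$ and for each $n$ let $\mathcal{L}_n(\mathrm{Pe})$ and $(a_n^*,\xi_n^* )$ be the optimal value and the (unique) optimizer of $$\max\left\{ \int_\Omega \Big( f\xi_n-\tfrac14|\nabla\xi_n|^2\Big)\,d\mathbf{x} - a \;:\; a\in\mathbb{R},\ \xi_n\in \Xi_n,\ \mathcal{Q}(a,\xi_n)[\psi_n,\theta_n]\ge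 0\ \ \forall\,(\psi_n,\theta_n)\in\Psi_n\times\Theta_n\right\}.$$ Then, as $n\to\infty$: a) $\mathcal{L}_n(\mathrm{Pe})\to\mathcal{L}(\mathrm{Pe})$; b) $a_n^*\to a^*$; c) $\xi_n^*\to\xi^*$ strongly in $H^1_0(\Omega)$.
   Context: The pairing of $f\in H^{-1}(\Omega)$ with $\xi\in H^1_0(\Omega)$ is written $\int_\Omega f\xi\,d\mathbf{x}$. Let $\Gamma_0$ be the exterior boundary of $\Omega$ and $\Gamma_1,\dots,\Gamma_p$ the other connected components of $\partial\Omega$ (if any). $\mathcal{H}$ is the space of $\psi\in H^1(\Omega)$ with $\psi|_{\Gamma_0}=0$ and $\psi|_{\Gamma_i}$ equal to a constant $c_i\in\mathbb{R}$ for each $1\le i\le p$; thus $\mathcal{H}=H^1_0(\Omega)$ if $\Omega$ is simply connected. Write $\nabla^\perp\psi=(\partial_y\psi,-\partial_x\psi)$. There is a constant $c(\Omega)>0$ such that $\left|\int_\Omega \xi\,\nabla^\perp\psi\cdot\nabla\theta\,d\mathbf{x}\right|\le c(\Omega)\|\nabla\xi\|_{L^2}\|\nabla\psi\|_{L^2}\|\nabla\theta\|_{L^2}$ for $\xi,\theta\in H^1_0(\Omega)$, $\psi\in\mathcal{H}$; the integral is understood as the continuous extension in $\xi$ from $H^1_0(\Omega)\cap L^\infty(\Omega)$. For $(a,\xi)\in\mathbb{R}\times H^1_0(\Omega)$, $\mathcal{Q}(a,\xi):\mathcal{H}\times H^1_0(\Omega)\to\mathbb{R}$ is $$\mathcal{Q}(a,\xi)[\psi,\theta]=\int_\Omega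 \big(a|\nabla\psi|^2+|\nabla\theta|^2-\mathrm{Pe}\,\xi\,\nabla^\perp\psi\cdot\nabla\theta\big)\,d\mathbf{x},$$ and $\mathcal{Q}(a,\xi)\succeq0$ means $\mathcal{Q}(a,\xi)[\psi,\theta]\ge0$ for all $(\psi,\theta)\in\mathcal{H}\times H^1_0(\Omega)$. Both maximization problems in the claim have a unique optimizer. *)

theory Defs
  imports "HOL-Analysis.Analysis"
begin

type_synonym plane = "real \<times> real"

text \<open>
  Elements of the function spaces below are functions on the whole plane of which only the
  values on \<open>\<Omega>\<close> matter; two of them represent the same element when they agree almost
  everywhere on \<open>\<Omega>\<close>.
\<close>

section \<open>Smooth functions and test functions\<close>

definition pderiv_along :: "plane \<Rightarrow> (plane \<Rightarrow> real) \<Rightarrow> plane \<Rightarrow> real" where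
  "pderiv_along v \<phi> x = frechet_derivative \<phi> (at x) v"

primrec Ck :: "nat \<Rightarrow> (plane \<Rightarrow> real) \<Rightarrow> bool" where
  "Ck 0 \<phi> \<longleftrightarrow> continuous_on UNIV \<phi>"
| "Ck (Suc k) \<phi> \<longleftrightarrow> (\<forall>x. \<phi> differentiable (at x)) \<and>
     Ck k (pderiv_along (1, 0) \<phi>) \<and> Ck k (pderiv_along (0, 1) \<phi>)"

definition smooth :: "(plane \<Rightarrow> real) \<Rightarrow> bool" where
  "smooth \<phi> \<longleftrightarrow> (\<forall>k. Ck k \<phi>)"

definition test_function :: "plane set \<Rightarrow> (plane \<Rightarrow> real) \<Rightarrow> bool" where
  "test_function \<Omega> \<phi> \<longleftrightarrow>
     smooth \<phi> \<and> compact (closure {x. \<phi> x \<noteq> 0}) \<and> closure {x. \<phi> x \<noteq> 0} \<subseteq> \<Omega>"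

section \<open>Sobolev spaces\<close>

definition L2 :: "plane set \<Rightarrow> (plane \<Rightarrow> 'b::euclidean_space) set" where
  "L2 \<Omega> = {u. set_borel_measurable lborel \<Omega> u \<and> set_integrable lborel \<Omega> (\<lambda>x. (norm (u x))\<^sup>2)}"

definition L2_norm :: "plane set \<Rightarrow> (plane \<Rightarrow> 'b::euclidean_space) \<Rightarrow> real" where
  "L2_norm \<Omega> u = sqrt (LINT x:\<Omega>|lborel. (norm (u x))\<^sup>2)"

definition weak_gradient :: "plane set \<Rightarrow> (plane \<Rightarrow> real) \<Rightarrow> (plane \<Rightarrow> plane) \<Rightarrow> bool" where
  "weak_gradient \<Omega> u g \<longleftrightarrow> g \<in> L2 \<Omega> \<and>
     (\<forall>\<phi>. test_function \<Omega> \<phi> \<longrightarrow>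
        (LINT x:\<Omega>|lborel. u x * pderiv_along (1, 0) \<phi> x) = - (LINT x:\<Omega>|lborel. fst (g x) * \<phi> x) \<and>
        (LINT x:\<Omega>|lborel. u x * pderiv_along (0, 1) \<phi> x) = - (LINT x:\<Omega>|lborel. snd (g x) * \<phi> x))"

definition H1 :: "plane set \<Rightarrow> (plane \<Rightarrow> real) set" where
  "H1 \<Omega> = {u \<in> L2 \<Omega>. \<exists>g. weak_gradient \<Omega> u g}"

text \<open>The choice below is unique up to a null subset of \<open>\<Omega>\<close>.\<close>

definition wgrad :: "plane set \<Rightarrow> (plane \<Rightarrow> real) \<Rightarrow> plane \<Rightarrow> plane" where
  "wgrad \<Omega> u = (SOME g. weak_gradient \<Omega> u g)"

definition H1_norm :: "plane set \<Rightarrow> (plane \<Rightarrow> real) \<Rightarrow> real" where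
  "H1_norm \<Omega> u = sqrt ((L2_norm \<Omega> u)\<^sup>2 + (L2_norm \<Omega> (wgrad \<Omega> u))\<^sup>2)"

definition H10 :: "plane set \<Rightarrow> (plane \<Rightarrow> real) set" where
  "H10 \<Omega> = {u \<in> H1 \<Omega>. \<exists>\<phi>. (\<forall>k. test_function \<Omega> (\<phi> k)) \<and>
                           (\<lambda>k. H1_norm \<Omega> (\<lambda>x. \<phi> k x - u x)) \<longlonglongrightarrow> 0}"

text \<open>As usual on bounded domains, \<open>H\<^sub>0\<^sup>1\<close> is normed by the gradient alone.\<close>

definition H10_norm :: "plane set \<Rightarrow> (plane \<Rightarrow> real) \<Rightarrow> real" where
  "H10_norm \<Omega> u = L2_norm \<Omega> (wgrad \<Omega> u)"

text \<open>
  \<open>H\<^sup>-\<^sup>1\<close> is the dual of \<open>H\<^sub>0\<^sup>1\<close>; the pairing of \<open>f\<close> with \<open>\<xi>\<close> is \<open>f \<xi>\<close>. Linearity and the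
  bound force \<open>f\<close> to respect almost-everywhere equality.
\<close>

definition H_minus1 :: "plane set \<Rightarrow> ((plane \<Rightarrow> real) \<Rightarrow> real) set" where
  "H_minus1 \<Omega> = {f.
     (\<forall>u\<in>H10 \<Omega>. \<forall>v\<in>H10 \<Omega>. \<forall>a b. f (\<lambda>x. a * u x + b * v x) = a * f u + b * f v) \<and>
     (\<exists>C. \<forall>u\<in>H10 \<Omega>. \<bar>f u\<bar> \<le> C * H10_norm \<Omega> u)}"

text \<open>Linear independence and span are taken modulo almost-everywhere equality on \<open>\<Omega>\<close>.\<close>

definition subspace_of_dim ::
  "plane set \<Rightarrow> nat \<Rightarrow> (plane \<Rightarrow> real) set \<Rightarrow> (plane \<Rightarrow> real) set \<Rightarrow> bool" where
  "subspace_of_dim \<Omega> n V X \<longleftrightarrow> (\<exists>b :: nat \<Rightarrow> plane \<Rightarrow> real.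
     (\<forall>i<n. b i \<in> X) \<and>
     (\<forall>c :: nat \<Rightarrow> real. (AE x in lborel. x \<in> \<Omega> \<longrightarrow> (\<Sum>i<n. c i * b i x) = 0) \<longrightarrow> (\<forall>i<n. c i = 0)) \<and>
     V = {u \<in> X. \<exists>c :: nat \<Rightarrow> real. AE x in lborel. x \<in> \<Omega> \<longrightarrow> u x = (\<Sum>i<n. c i * b i x)})"

section \<open>Lipschitz boundary, traces and the space \<open>\<H>\<close>\<close>

definition lipschitz_chart ::
  "plane set \<Rightarrow> plane \<Rightarrow> real \<Rightarrow> plane \<Rightarrow> plane \<Rightarrow> (real \<Rightarrow> real) \<Rightarrow> bool" where
  "lipschitz_chart \<Omega> x\<^sub>0 r e\<^sub>1 e\<^sub>2 \<gamma> \<longleftrightarrow>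
     x\<^sub>0 \<in> frontier \<Omega> \<and> 0 < r \<and> norm e\<^sub>1 = 1 \<and> norm e\<^sub>2 = 1 \<and> e\<^sub>1 \<bullet> e\<^sub>2 = 0 \<and>
     (\<exists>L. L-lipschitz_on UNIV \<gamma>) \<and>
     \<Omega> \<inter> ball x\<^sub>0 r = {x \<in> ball x\<^sub>0 r. \<gamma> (x \<bullet> e\<^sub>1) < x \<bullet> e\<^sub>2}"

definition lipschitz_boundary :: "plane set \<Rightarrow> bool" where
  "lipschitz_boundary \<Omega> \<longleftrightarrow> (\<forall>x\<^sub>0\<in>frontier \<Omega>. \<exists>r e\<^sub>1 e\<^sub>2 \<gamma>. lipschitz_chart \<Omega> x\<^sub>0 r e\<^sub>1 e\<^sub>2 \<gamma>)"

text \<open>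
  The trace map is the continuous extension to \<open>H\<^sup>1(\<Omega>)\<close> of the restriction of smooth functions
  to the boundary, with values in \<open>L\<^sup>2(\<partial>\<Omega>)\<close>. Convergence in \<open>L\<^sup>2(\<partial>\<Omega>)\<close> is expressed in every
  local chart: on a Lipschitz graph arc length and the parameter \<open>s\<close> give equivalent measures,
  with density between \<open>1\<close> and \<open>sqrt (1 + L\<^sup>2)\<close>, and finitely many charts cover the boundary.
\<close>

definition has_trace :: "plane set \<Rightarrow> (plane \<Rightarrow> real) \<Rightarrow> (plane \<Rightarrow> real) \<Rightarrow> bool" where
  "has_trace \<Omega> u g \<longleftrightarrow> g \<in> borel_measurable borel \<and>
     (\<exists>\<phi>. (\<forall>k. smooth (\<phi> k)) \<and> (\<lambda>k. H1_norm \<Omega> (\<lambda>x. \<phi> k x - u x)) \<longlonglongrightarrow> 0 \<and>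
        (\<forall>x\<^sub>0 r e\<^sub>1 e\<^sub>2 \<gamma>. lipschitz_chart \<Omega> x\<^sub>0 r e\<^sub>1 e\<^sub>2 \<gamma> \<longrightarrow>
           (\<lambda>k. \<integral>\<^sup>+ s \<in> {s. s *\<^sub>R e\<^sub>1 + \<gamma> s *\<^sub>R e\<^sub>2 \<in> ball x\<^sub>0 r}.
              ennreal ((\<phi> k (s *\<^sub>R e\<^sub>1 + \<gamma> s *\<^sub>R e\<^sub>2) - g (s *\<^sub>R e\<^sub>1 + \<gamma> s *\<^sub>R e\<^sub>2))\<^sup>2) \<partial>lborel)
           \<longlonglongrightarrow> 0))"

text \<open>For bounded \<open>\<Omega>\<close>, \<open>outside \<Omega>\<close> is the unbounded component of the complement.\<close>

definition exterior_boundary :: "plane set \<Rightarrow> plane set" where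
  "exterior_boundary \<Omega> = frontier (outside \<Omega>)"

definition H_space :: "plane set \<Rightarrow> (plane \<Rightarrow> real) set" where
  "H_space \<Omega> = {\<psi> \<in> H1 \<Omega>. \<exists>g. has_trace \<Omega> \<psi> g \<and>
     (\<forall>x\<in>exterior_boundary \<Omega>. g x = 0) \<and>
     (\<forall>\<Gamma>\<in>components (frontier \<Omega>). \<exists>c. \<forall>x\<in>\<Gamma>. g x = c)}"

section \<open>The quadratic form and the maximization problems\<close>

definition perp :: "plane \<Rightarrow> plane" where
  "perp v = (snd v, - fst v)"

definition ess_bounded :: "plane set \<Rightarrow> (plane \<Rightarrow> real) \<Rightarrow> bool" where
  "ess_bounded \<Omega> u \<longleftrightarrow> (\<exists>M. AE x in lborel. x \<in> \<Omega> \<longrightarrow> \<bar>u x\<bar> \<le> M)"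

text \<open>
  The integral of \<open>\<xi> \<nabla>\<^sup>\<bottom>\<psi> \<bullet> \<nabla>\<theta>\<close>, extended by continuity in \<open>\<xi>\<close> from the essentially bounded
  elements of \<open>H\<^sub>0\<^sup>1\<close> (for unbounded \<open>\<xi>\<close> the integrand need not be integrable).
\<close>

definition advection ::
  "plane set \<Rightarrow> (plane \<Rightarrow> real) \<Rightarrow> (plane \<Rightarrow> real) \<Rightarrow> (plane \<Rightarrow> real) \<Rightarrow> real" where
  "advection \<Omega> \<xi> \<psi> \<theta> = (THE t. \<forall>\<zeta>.
     (\<forall>k. \<zeta> k \<in> H10 \<Omega> \<and> ess_bounded \<Omega> (\<zeta> k)) \<and>
     (\<lambda>k. H10_norm \<Omega> (\<lambda>x. \<zeta> k x - \<xi> x)) \<longlonglongrightarrow> 0 \<longrightarrow>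
     (\<lambda>k. LINT x:\<Omega>|lborel. \<zeta> k x * (perp (wgrad \<Omega> \<psi> x) \<bullet> wgrad \<Omega> \<theta> x)) \<longlonglongrightarrow> t)"

definition Q_form ::
  "plane set \<Rightarrow> real \<Rightarrow> real \<Rightarrow> (plane \<Rightarrow> real) \<Rightarrow> (plane \<Rightarrow> real) \<Rightarrow> (plane \<Rightarrow> real) \<Rightarrow> real" where
  "Q_form \<Omega> Pe a \<xi> \<psi> \<theta> =
     (LINT x:\<Omega>|lborel. a * (norm (wgrad \<Omega> \<psi> x))\<^sup>2 + (norm (wgrad \<Omega> \<theta> x))\<^sup>2)
     - Pe * advection \<Omega> \<xi> \<psi> \<theta>"

definition objective ::
  "plane set \<Rightarrow> ((plane \<Rightarrow> real) \<Rightarrow> real) \<Rightarrow> real \<times> (plane \<Rightarrow> real) \<Rightarrow> real" where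
  "objective \<Omega> f = (\<lambda>(a, \<xi>). f \<xi> - (LINT x:\<Omega>|lborel. 1/4 * (norm (wgrad \<Omega> \<xi> x))\<^sup>2) - a)"

text \<open>
  \<open>X\<close>, \<open>Y\<close>, \<open>Z\<close> are the spaces of \<open>\<xi>\<close>, \<open>\<psi>\<close>, \<open>\<theta>\<close>: \<open>H\<^sub>0\<^sup>1\<close>, \<open>\<H>\<close>, \<open>H\<^sub>0\<^sup>1\<close> in the full problem and their
  finite-dimensional subspaces in the discretized one.
\<close>

definition feasible ::
  "plane set \<Rightarrow> real \<Rightarrow> (plane \<Rightarrow> real) set \<Rightarrow> (plane \<Rightarrow> real) set \<Rightarrow> (plane \<Rightarrow> real) set
     \<Rightarrow> (real \<times> (plane \<Rightarrow> real)) set" where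
  "feasible \<Omega> Pe X Y Z = {(a, \<xi>). \<xi> \<in> X \<and> (\<forall>\<psi>\<in>Y. \<forall>\<theta>\<in>Z. Q_form \<Omega> Pe a \<xi> \<psi> \<theta> \<ge> 0)}"

definition optimal_value ::
  "plane set \<Rightarrow> ((plane \<Rightarrow> real) \<Rightarrow> real) \<Rightarrow> real
     \<Rightarrow> (plane \<Rightarrow> real) set \<Rightarrow> (plane \<Rightarrow> real) set \<Rightarrow> (plane \<Rightarrow> real) set \<Rightarrow> real" where
  "optimal_value \<Omega> f Pe X Y Z = (SUP p\<in>feasible \<Omega> Pe X Y Z. objective \<Omega> f p)"

definition optimizer ::
  "plane set \<Rightarrow> ((plane \<Rightarrow> real) \<Rightarrow> real) \<Rightarrow> real
     \<Rightarrow> (plane \<Rightarrow> real) set \<Rightarrow> (plane \<Rightarrow> real) set \<Rightarrow> (plane \<Rightarrow> real) set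
     \<Rightarrow> real \<Rightarrow> (plane \<Rightarrow> real) \<Rightarrow> bool" where
  "optimizer \<Omega> f Pe X Y Z a \<xi> \<longleftrightarrow>
     is_arg_max (objective \<Omega> f) (\<lambda>p. p \<in> feasible \<Omega> Pe X Y Z) (a, \<xi>)"

end

theory Submission
  imports Defs
begin

text \<open>
  Everything rests on the continuity of the trilinear form
  \<open>\<integral> \<xi> \<nabla>\<^sup>\<bottom>\<psi> \<bullet> \<nabla>\<theta>\<close> in the three gradient norms. An element \<open>\<psi>\<close> of
  \<open>\<H>\<close>, extended by 0 outside and by its constant boundary values into the holes, has the weak
  gradient of \<open>\<psi>\<close> on \<open>\<Omega>\<close> and 0 elsewhere as its weak gradient on the plane. The form is then the
  pairing of \<open>\<psi>\<close> with a Jacobian, and Wente's inequality bounds it: on each circle around a point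
  \<open>p\<close> the angular derivatives control the Jacobian, so its logarithmic potential at \<open>p\<close> is bounded
  by the energies, uniformly in \<open>p\<close>.

  An almost feasible \<open>(a, \<xi>)\<close> becomes feasible after replacing it by \<open>(a + \<delta>, (1 - \<delta>)\<xi>)\<close>. This gives
  recovery sequences for the lower bound. For the upper bound, weak limits of the discrete
  optimizers are replaced by near-maximizers of the objective over the decreasing convex sets of
  pairs that satisfy every lower bound on \<open>\<Q>\<close> shared by the tail of the sequence; strong concavity
  makes these near-maximizers Cauchy. Applied to the midpoints of the discrete optimizers and the
  continuous one, the same argument gives strong convergence.
\<close>

section \<open>Functions of class \<open>C\<^sup>k\<close>\<close>

text \<open>Functions in H^1 of a planar domain may be unbounded, so the product of \<xi> with two
  gradients is not controlled by size alone; what saves the bound is the cancellation in a Jacobian.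
  It shows only after integrating by parts over the whole plane. There \<xi> and \<theta> extend by
  0, whereas \<psi> has nonzero constants as boundary values; constants are exactly what can be
  continued into a hole without creating a gradient. The continued function enters Wente's
  inequality only through its weak gradient, so the extension is never approximated by smooth
  functions on the plane.

  Polar coordinates are avoided: all circles around a point are turned simultaneously by
  \<open>rot\<close>, and the mean value theorem in the angle replaces Poincare's inequality on each
  circle. A parameter e > 0 removes the singularity of the logarithm; the resulting bounds are
  uniform in e, which tends to 0 at the end of \<open>wente_inequality\<close>.

  The optimization part sees the function spaces only through the seminorm of the gradient and the
  inequalities collected in \<open>advection_form\<close>.\<close>

abbreviation dx :: "(plane \<Rightarrow> real) \<Rightarrow> plane \<Rightarrow> real" where
  "dx \<equiv> pderiv_along (1, 0)"

abbreviation dy :: "(plane \<Rightarrow> real) \<Rightarrow> plane \<Rightarrow> real" where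
  "dy \<equiv> pderiv_along (0, 1)"

declare Ck.simps(2) [simp del]

lemma has_derivative_pderiv:
  assumes "\<phi> differentiable (at x)"
  shows "(\<phi> has_derivative (\<lambda>v. fst v * dx \<phi> x + snd v * dy \<phi> x)) (at x)"
proof -
  let ?L = "frechet_derivative \<phi> (at x)"
  have d: "(\<phi> has_derivative ?L) (at x)"
    using assms frechet_derivative_works by blast
  then have lin: "linear ?L"
    using has_derivative_linear by blast
  have "?L v = fst v * dx \<phi> x + snd v * dy \<phi> x" for v
  proof -
    have "v = fst v *\<^sub>R (1, 0) + snd v *\<^sub>R (0, 1)"
      by (simp add: prod_eq_iff)
    then have "?L v = ?L (fst v *\<^sub>R (1, 0) + snd v *\<^sub>R (0, 1))"
      by simp
    also have "\<dots> = fst v *\<^sub>R ?L (1, 0) + snd v *\<^sub>R ?L (0, 1)"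
      by (simp only: linear_add[OF lin] linear_scale[OF lin])
    finally show ?thesis
      by (simp add: pderiv_along_def)
  qed
  then have "?L = (\<lambda>v. fst v * dx \<phi> x + snd v * dy \<phi> x)"
    by (rule ext)
  with d show ?thesis
    by (rule has_derivative_eq_rhs)
qed

lemma pderiv_eqI:
  assumes "(\<phi> has_derivative (\<lambda>v. fst v * p + snd v * q)) (at x)"
  shows "dx \<phi> x = p" "dy \<phi> x = q"
  using frechet_derivative_at[OF assms, symmetric] by (simp_all add: pderiv_along_def)

lemma Ck_Suc_has_derivative:
  "Ck (Suc k) \<phi> \<Longrightarrow> (\<phi> has_derivative (\<lambda>v. fst v * dx \<phi> x + snd v * dy \<phi> x)) (at x)"
  unfolding Ck.simps by (rule has_derivative_pderiv) blast

lemma Ck_SucI: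
  assumes "\<And>x. (\<phi> has_derivative (\<lambda>v. fst v * p x + snd v * q x)) (at x)" "Ck k p" "Ck k q"
  shows "Ck (Suc k) \<phi>" "dx \<phi> = p" "dy \<phi> = q"
proof -
  show *: "dx \<phi> = p" "dy \<phi> = q"
    using pderiv_eqI[OF assms(1)] by auto
  show "Ck (Suc k) \<phi>"
    unfolding Ck.simps * using assms by (auto simp only: differentiable_def)
qed

lemma Ck_Suc_dx: "Ck (Suc k) \<phi> \<Longrightarrow> Ck k (dx \<phi>)"
  and Ck_Suc_dy: "Ck (Suc k) \<phi> \<Longrightarrow> Ck k (dy \<phi>)"
  by (simp_all add: Ck.simps(2))

lemma Ck_SucD: "Ck (Suc k) \<phi> \<Longrightarrow> Ck k \<phi>"
proof (induction k arbitrary: \<phi>)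
  case 0
  then have "\<phi> differentiable (at x)" for x
    unfolding Ck.simps by blast
  then have "continuous_on UNIV \<phi>"
    by (intro continuous_at_imp_continuous_on ballI differentiable_imp_continuous_within)
  then show ?case
    by simp
next
  case (Suc k)
  then show ?case
    by (metis Ck.simps(2))
qed

lemma Ck_mono:
  assumes "Ck m \<phi>" "k \<le> m" shows "Ck k \<phi>"
  using assms(2) by (rule inc_induct) (fact assms(1), rule Ck_SucD)

lemma Ck_continuous: "Ck k \<phi> \<Longrightarrow> continuous_on UNIV \<phi>"
  using Ck_mono[of k \<phi> 0] by (simp only: Ck.simps le0)

lemma smooth_Ck: "smooth \<phi> \<Longrightarrow> Ck k \<phi>"
  by (simp add: smooth_def)

lemma Ck_const: "Ck k (\<lambda>x. c)" and pderiv_const: "dx (\<lambda>x. c) = (\<lambda>x. 0)" "dy (\<lambda>x. c) = (\<lambda>x. 0)"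
proof -
  have d: "((\<lambda>x::plane. c) has_derivative (\<lambda>v. fst v * 0 + snd v * 0)) (at x)" for x and c :: real
    by simp
  show "dx (\<lambda>x. c) = (\<lambda>x. 0)" "dy (\<lambda>x. c) = (\<lambda>x. 0)"
    using pderiv_eqI[OF d] by auto
  show "Ck k (\<lambda>x. c)"
  proof (induction k arbitrary: c)
    case (Suc k)
    show ?case
      by (rule Ck_SucI(1)[OF d Suc Suc])
  qed simp
qed

lemma Ck_add:
  assumes "Ck k u" "Ck k v" shows "Ck k (\<lambda>x. u x + v x)"
  using assms
proof (induction k arbitrary: u v)
  case (Suc k)
  have "((\<lambda>x. u x + v x) has_derivative (\<lambda>h. fst h * (dx u x + dx v x) + snd h * (dy u x + dy v x))) (at x)" for x
    by (rule has_derivative_eq_rhs[OF has_derivative_add[OF Ck_Suc_has_derivative Ck_Suc_has_derivative, OF Suc.prems]])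
      (auto simp: algebra_simps)
  then show ?case
    by (rule Ck_SucI) (intro Suc.IH Ck_Suc_dx Ck_Suc_dy Suc.prems)+
qed (simp add: continuous_on_add)

lemma pderiv_add:
  assumes "Ck (Suc k) u" "Ck (Suc k) v"
  shows "dx (\<lambda>x. u x + v x) = (\<lambda>x. dx u x + dx v x)" "dy (\<lambda>x. u x + v x) = (\<lambda>x. dy u x + dy v x)"
proof -
  have "((\<lambda>x. u x + v x) has_derivative (\<lambda>h. fst h * (dx u x + dx v x) + snd h * (dy u x + dy v x))) (at x)" for x
    by (rule has_derivative_eq_rhs[OF has_derivative_add[OF Ck_Suc_has_derivative Ck_Suc_has_derivative, OF assms]])
      (auto simp: algebra_simps)
  from pderiv_eqI[OF this] show "dx (\<lambda>x. u x + v x) = (\<lambda>x. dx u x + dx v x)" "dy (\<lambda>x. u x + v x) = (\<lambda>x. dy u x + dy v x)"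
    by auto
qed

lemma pderiv_mult:
  assumes "Ck (Suc k) u" "Ck (Suc k) v"
  shows "dx (\<lambda>x. u x * v x) = (\<lambda>x. dx u x * v x + u x * dx v x)"
    "dy (\<lambda>x. u x * v x) = (\<lambda>x. dy u x * v x + u x * dy v x)"
proof -
  have "((\<lambda>x. u x * v x) has_derivative
     (\<lambda>h. fst h * (dx u x * v x + u x * dx v x) + snd h * (dy u x * v x + u x * dy v x))) (at x)" for x
    by (rule has_derivative_eq_rhs[OF has_derivative_mult[OF Ck_Suc_has_derivative Ck_Suc_has_derivative, OF assms]])
      (auto simp: algebra_simps)
  from pderiv_eqI[OF this] show "dx (\<lambda>x. u x * v x) = (\<lambda>x. dx u x * v x + u x * dx v x)"
    "dy (\<lambda>x. u x * v x) = (\<lambda>x. dy u x * v x + u x * dy v x)"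
    by auto
qed

lemma Ck_mult:
  assumes "Ck k u" "Ck k v" shows "Ck k (\<lambda>x. u x * v x)"
  using assms
proof (induction k arbitrary: u v)
  case (Suc k)
  have "((\<lambda>x. u x * v x) has_derivative
     (\<lambda>h. fst h * (dx u x * v x + u x * dx v x) + snd h * (dy u x * v x + u x * dy v x))) (at x)" for x
    by (rule has_derivative_eq_rhs[OF has_derivative_mult[OF Ck_Suc_has_derivative Ck_Suc_has_derivative, OF Suc.prems]])
      (auto simp: algebra_simps)
  then show ?case
    by (rule Ck_SucI) (intro Ck_add Suc.IH Suc.prems[THEN Ck_Suc_dx] Suc.prems[THEN Ck_Suc_dy] Suc.prems[THEN Ck_SucD])+
qed (simp add: continuous_on_mult)

lemma Ck_cmult: "Ck k u \<Longrightarrow> Ck k (\<lambda>x. c * u x)"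
  by (rule Ck_mult[OF Ck_const])

lemma Ck_diff: "Ck k u \<Longrightarrow> Ck k v \<Longrightarrow> Ck k (\<lambda>x. u x - v x)"
  using Ck_add[OF _ Ck_cmult[of k v "-1"], of u] by simp

lemma pderiv_diff:
  assumes "Ck (Suc k) u" "Ck (Suc k) v"
  shows "dx (\<lambda>x. u x - v x) = (\<lambda>x. dx u x - dx v x)" "dy (\<lambda>x. u x - v x) = (\<lambda>x. dy u x - dy v x)"
proof -
  have "((\<lambda>x. u x - v x) has_derivative (\<lambda>h. fst h * (dx u x - dx v x) + snd h * (dy u x - dy v x))) (at x)" for x
    by (rule has_derivative_eq_rhs[OF has_derivative_diff[OF Ck_Suc_has_derivative Ck_Suc_has_derivative, OF assms]])
      (auto simp: algebra_simps)
  from pderiv_eqI[OF this] show "dx (\<lambda>x. u x - v x) = (\<lambda>x. dx u x - dx v x)" "dy (\<lambda>x. u x - v x) = (\<lambda>x. dy u x - dy v x)"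
    by auto
qed

lemma Ck_sum: "(\<And>i. i \<in> I \<Longrightarrow> Ck k (u i)) \<Longrightarrow> Ck k (\<lambda>x. \<Sum>i\<in>I. u i x)"
  by (induction I rule: infinite_finite_induct) (simp_all add: Ck_const Ck_add)

lemma Ck_fst: "Ck k fst" and pderiv_fst: "dx fst = (\<lambda>x. 1)" "dy fst = (\<lambda>x. 0)"
proof -
  have d: "(fst has_derivative (\<lambda>v. fst v * 1 + snd v * 0)) (at x)" for x :: plane
    by (rule has_derivative_eq_rhs[OF bounded_linear_imp_has_derivative[OF bounded_linear_fst]]) simp
  show "dx fst = (\<lambda>x. 1)" "dy fst = (\<lambda>x. 0)"
    using pderiv_eqI[OF d] by auto
  show "Ck k fst"
  proof (cases k)
    case (Suc k)
    show ?thesis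
      unfolding Suc by (rule Ck_SucI(1)[OF d Ck_const Ck_const])
  qed (simp add: continuous_on_fst continuous_on_snd)
qed

lemma Ck_snd: "Ck k snd" and pderiv_snd: "dx snd = (\<lambda>x. 0)" "dy snd = (\<lambda>x. 1)"
proof -
  have d: "(snd has_derivative (\<lambda>v. fst v * 0 + snd v * 1)) (at x)" for x :: plane
    by (rule has_derivative_eq_rhs[OF bounded_linear_imp_has_derivative[OF bounded_linear_snd]]) simp
  show "dx snd = (\<lambda>x. 0)" "dy snd = (\<lambda>x. 1)"
    using pderiv_eqI[OF d] by auto
  show "Ck k snd"
  proof (cases k)
    case (Suc k)
    show ?thesis
      unfolding Suc by (rule Ck_SucI(1)[OF d Ck_const Ck_const])
  qed (simp add: continuous_on_fst continuous_on_snd)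
qed

lemma pderiv_real_comp:
  assumes "Ck (Suc k) u" "\<And>x. (F has_real_derivative G (u x)) (at (u x))"
  shows "dx (\<lambda>x. F (u x)) = (\<lambda>x. G (u x) * dx u x)" "dy (\<lambda>x. F (u x)) = (\<lambda>x. G (u x) * dy u x)"
    "(\<lambda>x. F (u x)) differentiable (at x)"
proof -
  have *: "((\<lambda>x. F (u x)) has_derivative (\<lambda>h. fst h * (G (u x) * dx u x) + snd h * (G (u x) * dy u x))) (at x)" for x
    by (rule has_derivative_eq_rhs[OF has_derivative_compose[OF Ck_Suc_has_derivative[OF assms(1)] assms(2)[unfolded has_field_derivative_def]]])
      (auto simp: algebra_simps)
  from pderiv_eqI[OF this] show "dx (\<lambda>x. F (u x)) = (\<lambda>x. G (u x) * dx u x)" "dy (\<lambda>x. F (u x)) = (\<lambda>x. G (u x) * dy u x)"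
    by auto
  show "(\<lambda>x. F (u x)) differentiable (at x)"
    using *[of x] unfolding differentiable_def by blast
qed

text \<open>Differentiating a reciprocal yields products of the same reciprocal with a partial
  derivative of \<open>u\<close>, so the induction on \<open>k\<close> closes with products and the
  induction hypothesis.\<close>

lemma Ck_inverse:
  assumes "Ck k u" "\<And>x. u x \<noteq> 0" shows "Ck k (\<lambda>x. inverse (u x))"
  using assms
proof (induction k arbitrary: u)
  case 0
  then show ?case by (simp add: continuous_on_inverse)
next
  case (Suc k)
  have d: "(inverse has_real_derivative - (inverse (u x) * inverse (u x))) (at (u x))" for x
    using DERIV_inverse[of "u x"] Suc.prems by (simp add: power2_eq_square)
  have "Ck k (\<lambda>x. -1 * (inverse (u x) * inverse (u x)) * dx u x)"
    "Ck k (\<lambda>x. -1 * (inverse (u x) * inverse (u x)) * dy u x)"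
    by (intro Ck_mult Ck_const Suc.IH Ck_SucD[OF Suc.prems(1)] Suc.prems(2) Ck_Suc_dx[OF Suc.prems(1)] Ck_Suc_dy[OF Suc.prems(1)])+
  then show ?case
    unfolding Ck.simps pderiv_real_comp[where F=inverse and G="\<lambda>t. - (inverse t * inverse t)", OF Suc.prems(1) d]
    using pderiv_real_comp(3)[where F=inverse and G="\<lambda>t. - (inverse t * inverse t)", OF Suc.prems(1) d] by simp
qed

lemma Ck_ln:
  assumes "Ck k u" "\<And>x. u x > 0" shows "Ck k (\<lambda>x. ln (u x))"
proof (cases k)
  case 0
  have "\<forall>x\<in>UNIV. u x \<noteq> 0" using assms(2) by (metis less_irrefl)
  then show ?thesis using 0 assms by (simp add: continuous_on_ln)
next
  case (Suc k')
  have d: "(ln has_real_derivative inverse (u x)) (at (u x))" for x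
    using DERIV_ln[OF assms(2)] by simp
  have u: "Ck (Suc k') u" using assms Suc by simp
  have nz: "u x \<noteq> 0" for x using assms(2)[of x] by simp
  show ?thesis
    unfolding Suc Ck.simps pderiv_real_comp[where F=ln, OF u d]
    by (intro conjI allI pderiv_real_comp(3)[where F=ln, OF u d] Ck_mult Ck_inverse Ck_Suc_dx Ck_Suc_dy u nz Ck_SucD[OF u])
qed

section \<open>Derivatives along the axes and symmetry of the mixed derivative\<close>

lemma partial_x_real_derivative:
  assumes "Ck (Suc k) u" shows "((\<lambda>s. u (s, t)) has_real_derivative dx u (s, t)) (at s within A)"
proof -
  have "((\<lambda>s. (s, t)) has_derivative (\<lambda>h. (h, 0))) (at s within A)"
    by (auto intro!: derivative_eq_intros)
  from has_derivative_compose[OF this Ck_Suc_has_derivative[OF assms]]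
  have "((\<lambda>s. u (s, t)) has_derivative (\<lambda>h. h * dx u (s, t))) (at s within A)"
    by simp
  then show ?thesis
    unfolding has_field_derivative_def by (rule has_derivative_eq_rhs) (auto simp: mult.commute)
qed

lemma partial_y_real_derivative:
  assumes "Ck (Suc k) u" shows "((\<lambda>t. u (s, t)) has_real_derivative dy u (s, t)) (at t within A)"
proof -
  have "((\<lambda>t. (s, t)) has_derivative (\<lambda>h. (0, h))) (at t within A)"
    by (auto intro!: derivative_eq_intros)
  from has_derivative_compose[OF this Ck_Suc_has_derivative[OF assms]]
  have "((\<lambda>t. u (s, t)) has_derivative (\<lambda>h. h * dy u (s, t))) (at t within A)"
    by simp
  then show ?thesis
    unfolding has_field_derivative_def by (rule has_derivative_eq_rhs) (auto simp: mult.commute)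
qed

text \<open>The second difference over a square is symmetric in the two variables, while the mean
  value theorem can be applied to it in either order. Taking x first yields \<open>dy (dx u)\<close>
  at some point of the square; taking y first, as in \<open>mixed_difference_dx_dy\<close>, yields
  \<open>dx (dy u)\<close> at another one.\<close>

lemma mixed_difference_dy_dx:
  assumes "Ck (Suc (Suc k)) u" "h > 0"
  shows "\<exists>q. s < fst q \<and> fst q < s + h \<and> t < snd q \<and> snd q < t + h \<and>
    u (s + h, t + h) - u (s + h, t) - u (s, t + h) + u (s, t) = h * h * dy (dx u) q"
proof -
  let ?g = "\<lambda>\<sigma>. u (\<sigma>, t + h) - u (\<sigma>, t)"
  have "(?g has_real_derivative dx u (\<sigma>, t + h) - dx u (\<sigma>, t)) (at \<sigma>)" for \<sigma>
    by (intro DERIV_diff partial_x_real_derivative[OF assms(1)])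
  from MVT2[of s "s + h" ?g, OF _ this] assms(2)
  obtain \<sigma> where \<sigma>: "s < \<sigma>" "\<sigma> < s + h" "?g (s + h) - ?g s = h * (dx u (\<sigma>, t + h) - dx u (\<sigma>, t))"
    by auto
  have "((\<lambda>\<tau>. dx u (\<sigma>, \<tau>)) has_real_derivative dy (dx u) (\<sigma>, \<tau>)) (at \<tau>)" for \<tau>
    by (intro partial_y_real_derivative[OF Ck_Suc_dx[OF assms(1)]])
  from MVT2[of t "t + h", OF _ this] assms(2)
  obtain \<tau> where \<tau>: "t < \<tau>" "\<tau> < t + h" "dx u (\<sigma>, t + h) - dx u (\<sigma>, t) = h * dy (dx u) (\<sigma>, \<tau>)"
    by auto
  then show ?thesis
    using \<sigma> \<tau> by (intro exI[of _ "(\<sigma>, \<tau>)"]) (simp add: algebra_simps)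
qed

lemma mixed_difference_dx_dy:
  assumes "Ck (Suc (Suc k)) u" "h > 0"
  shows "\<exists>q. s < fst q \<and> fst q < s + h \<and> t < snd q \<and> snd q < t + h \<and>
    u (s + h, t + h) - u (s + h, t) - u (s, t + h) + u (s, t) = h * h * dx (dy u) q"
proof -
  let ?g = "\<lambda>\<tau>. u (s + h, \<tau>) - u (s, \<tau>)"
  have "(?g has_real_derivative dy u (s + h, \<tau>) - dy u (s, \<tau>)) (at \<tau>)" for \<tau>
    by (intro DERIV_diff partial_y_real_derivative[OF assms(1)])
  from MVT2[of t "t + h" ?g, OF _ this] assms(2)
  obtain \<tau> where \<tau>: "t < \<tau>" "\<tau> < t + h" "?g (t + h) - ?g t = h * (dy u (s + h, \<tau>) - dy u (s, \<tau>))"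
    by auto
  have "((\<lambda>\<sigma>. dy u (\<sigma>, \<tau>)) has_real_derivative dx (dy u) (\<sigma>, \<tau>)) (at \<sigma>)" for \<sigma>
    by (intro partial_x_real_derivative[OF Ck_Suc_dy[OF assms(1)]])
  from MVT2[of s "s + h", OF _ this] assms(2)
  obtain \<sigma> where \<sigma>: "s < \<sigma>" "\<sigma> < s + h" "dy u (s + h, \<tau>) - dy u (s, \<tau>) = h * dx (dy u) (\<sigma>, \<tau>)"
    by auto
  then show ?thesis
    using \<sigma> \<tau> by (intro exI[of _ "(\<sigma>, \<tau>)"]) (simp add: algebra_simps)
qed

text \<open>Both points supplied by the mean value theorem are squeezed to \<open>p\<close> as the
  side of the square shrinks, and continuity of the second derivatives identifies the
  limits.\<close>

lemma dx_dy_commute: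
  assumes "Ck (Suc (Suc k)) u"
  shows "dx (dy u) = dy (dx u)"
proof (rule ext)
  fix p :: plane
  obtain s t where p: "p = (s, t)" by (cases p)
  obtain h :: "nat \<Rightarrow> real" where h: "\<And>n. h n > 0" and h0: "h \<longlonglongrightarrow> 0"
    by (rule that[of "\<lambda>n. inverse (real (Suc n))"]) (simp, rule LIMSEQ_inverse_real_of_nat)
  have "\<exists>q. \<forall>n. s < fst (q n) \<and> fst (q n) < s + h n \<and> t < snd (q n) \<and> snd (q n) < t + h n \<and>
    u (s + h n, t + h n) - u (s + h n, t) - u (s, t + h n) + u (s, t) = h n * h n * dy (dx u) (q n)"
    by (rule choice) (intro allI mixed_difference_dy_dx[OF assms] h)
  then obtain q where q: "\<And>n. s < fst (q n) \<and> fst (q n) < s + h n \<and> t < snd (q n) \<and> snd (q n) < t + h n \<and>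
    u (s + h n, t + h n) - u (s + h n, t) - u (s, t + h n) + u (s, t) = h n * h n * dy (dx u) (q n)"
    by (elim exE) (rule that, erule spec)
  have "\<exists>r. \<forall>n. s < fst (r n) \<and> fst (r n) < s + h n \<and> t < snd (r n) \<and> snd (r n) < t + h n \<and>
    u (s + h n, t + h n) - u (s + h n, t) - u (s, t + h n) + u (s, t) = h n * h n * dx (dy u) (r n)"
    by (rule choice) (intro allI mixed_difference_dx_dy[OF assms] h)
  then obtain r where r: "\<And>n. s < fst (r n) \<and> fst (r n) < s + h n \<and> t < snd (r n) \<and> snd (r n) < t + h n \<and>
    u (s + h n, t + h n) - u (s + h n, t) - u (s, t + h n) + u (s, t) = h n * h n * dx (dy u) (r n)"
    by (elim exE) (rule that, erule spec)
  have lim: "z \<longlonglongrightarrow> p" if "\<And>n. s < fst (z n) \<and> fst (z n) < s + h n \<and> t < snd (z n) \<and> snd (z n) < t + h n" for z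
  proof -
    have le: "\<forall>n. s \<le> fst (z n)" "\<forall>n. fst (z n) \<le> s + h n" "\<forall>n. t \<le> snd (z n)" "\<forall>n. snd (z n) \<le> t + h n"
      using that less_imp_le by blast+
    have "(\<lambda>n. fst (z n)) \<longlonglongrightarrow> s"
      by (rule tendsto_sandwich[OF always_eventually[OF le(1)] always_eventually[OF le(2)] tendsto_const])
        (use tendsto_add[OF tendsto_const h0, of s] in simp)
    moreover have "(\<lambda>n. snd (z n)) \<longlonglongrightarrow> t"
      by (rule tendsto_sandwich[OF always_eventually[OF le(3)] always_eventually[OF le(4)] tendsto_const])
        (use tendsto_add[OF tendsto_const h0, of t] in simp)
    ultimately show ?thesis
      unfolding p using tendsto_Pair by fastforce
  qed
  have c: "continuous_on UNIV (dy (dx u))" "continuous_on UNIV (dx (dy u))"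
    using assms Ck_continuous by (meson Ck_Suc_dx Ck_Suc_dy)+
  have "(\<lambda>n. dy (dx u) (q n)) \<longlonglongrightarrow> dy (dx u) p"
    by (rule continuous_on_tendsto_compose[OF c(1) lim]) (use q in auto)
  moreover have "(\<lambda>n. dx (dy u) (r n)) \<longlonglongrightarrow> dx (dy u) p"
    by (rule continuous_on_tendsto_compose[OF c(2) lim]) (use r in auto)
  moreover have "dy (dx u) (q n) = dx (dy u) (r n)" for n
    using q[of n] r[of n] h[of n] by simp
  ultimately show "dx (dy u) p = dy (dx u) p"
    using LIMSEQ_unique by auto
qed

section \<open>Integrals of functions with bounded support\<close>

declare split_paired_All [simp del] split_paired_Ex [simp del]

text \<open>A radius instead of a compact support: the property passes to derivatives and to
  products with arbitrary factors, one radius can serve a whole family of functions, and it confines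
  integrals to a square.\<close>

definition vanishes_beyond :: "real \<Rightarrow> (plane \<Rightarrow> real) \<Rightarrow> bool" where
  "vanishes_beyond R u \<longleftrightarrow> (\<forall>x. R < norm x \<longrightarrow> u x = 0)"

lemma vanishes_beyondD: "vanishes_beyond R u \<Longrightarrow> R < norm x \<Longrightarrow> u x = 0"
  by (simp add: vanishes_beyond_def)

lemma vanishes_beyond_mono: "vanishes_beyond R u \<Longrightarrow> R \<le> R' \<Longrightarrow> vanishes_beyond R' u"
  by (simp add: vanishes_beyond_def)

lemma vanishes_beyond_add: "vanishes_beyond R u \<Longrightarrow> vanishes_beyond R v \<Longrightarrow> vanishes_beyond R (\<lambda>x. u x + v x)"
  and vanishes_beyond_diff: "vanishes_beyond R u \<Longrightarrow> vanishes_beyond R v \<Longrightarrow> vanishes_beyond R (\<lambda>x. u x - v x)"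
  and vanishes_beyond_mult_left: "vanishes_beyond R u \<Longrightarrow> vanishes_beyond R (\<lambda>x. u x * v x)"
  and vanishes_beyond_mult_right: "vanishes_beyond R v \<Longrightarrow> vanishes_beyond R (\<lambda>x. u x * v x)"
  by (simp_all add: vanishes_beyond_def)

lemma vanishes_beyond_pderiv:
  assumes u: "vanishes_beyond R u"
  shows "vanishes_beyond R (dx u)" "vanishes_beyond R (dy u)"
proof -
  have "(u has_derivative (\<lambda>v. fst v * 0 + snd v * 0)) (at x)" if "R < norm x" for x
  proof (rule has_derivative_transform_within_open)
    show "((\<lambda>x. 0) has_derivative (\<lambda>v. fst v * 0 + snd v * 0)) (at x)"
      by simp
    show "open {x::plane. R < norm x}"
      by (intro open_Collect_less continuous_intros)
    show "x \<in> {x. R < norm x}" using that by simp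
    show "0 = u y" if "y \<in> {x. R < norm x}" for y
      using u that by (simp add: vanishes_beyond_def)
  qed
  from pderiv_eqI[OF this] show "vanishes_beyond R (dx u)" "vanishes_beyond R (dy u)"
    by (simp_all add: vanishes_beyond_def)
qed

lemma vanishes_outside_square:
  assumes "vanishes_beyond R u" "x \<notin> cbox (-R, -R) (R, R)" shows "u x = 0"
proof -
  have "R < \<bar>fst x\<bar> \<or> R < \<bar>snd x\<bar>"
    using assms(2) by (cases x) (auto simp: cbox_Pair_eq)
  then have "R < norm x"
    using norm_fst_le[of "fst x" "snd x"] norm_snd_le[of "snd x" "fst x"] by auto
  then show ?thesis
    using assms(1) by (simp add: vanishes_beyond_def)
qed

lemma continuous_bounded_support_integrable:
  assumes "continuous_on UNIV u" "vanishes_beyond R u"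
  shows "integrable lborel u"
proof -
  have "integrable lborel (\<lambda>x. indicator (cbox (-R, -R) (R, R)) x *\<^sub>R u x)"
    using assms(1) by (intro borel_integrable_compact compact_cbox continuous_on_subset[OF assms(1)]) auto
  also have "(\<lambda>x. indicator (cbox (-R, -R) (R, R)) x *\<^sub>R u x) = u"
    by (rule ext) (metis (no_types) indicator_simps(1) indicator_simps(2) scaleR_one scaleR_zero_left vanishes_outside_square[OF assms(2)])
  finally show ?thesis .
qed

text \<open>Bridge from the Lebesgue integral to the gauge integral on a square, where Fubini for
  continuous integrands, the fundamental theorem of calculus and the Leibniz rule for parameters are
  at hand.\<close>

lemma lborel_integral_eq_square:
  assumes "continuous_on UNIV u" "vanishes_beyond R u"
  shows "(\<integral>x. u x \<partial>lborel) = integral (cbox (-R, -R) (R, R)) u"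
proof -
  have "(u has_integral (\<integral>x. u x \<partial>lborel)) UNIV"
    using continuous_bounded_support_integrable[OF assms] has_integral_integral_lborel by blast
  moreover have "(u has_integral integral (cbox (-R, -R) (R, R)) u) UNIV"
    by (rule has_integral_on_superset[where S="cbox (-R, -R) (R, R)"])
      (auto intro!: integrable_integral integrable_continuous continuous_on_subset[OF assms(1)]
        vanishes_outside_square[OF assms(2)])
  ultimately show ?thesis
    using has_integral_unique by blast
qed

lemma continuous_bounded_support_bounded:
  assumes "continuous_on UNIV u" "vanishes_beyond R u"
  obtains B where "B \<ge> 0" "\<And>x. \<bar>u x\<bar> \<le> B"
proof -
  have "compact (u ` cbox (-R, -R) (R, R))"
    by (intro compact_continuous_image compact_cbox continuous_on_subset[OF assms(1)]) auto
  then obtain B where B: "\<forall>y\<in>u ` cbox (-R, -R) (R, R). norm y \<le> B"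
    using compact_imp_bounded bounded_iff by blast
  have "\<bar>u x\<bar> \<le> max 0 B" for x
    using B vanishes_outside_square[OF assms(2), of x] by (cases "x \<in> cbox (-R, -R) (R, R)") fastforce+
  then show ?thesis using that[of "max 0 B"] by simp
qed

lemma integral_dx_eq_0:
  assumes u: "Ck 1 u" "vanishes_beyond R u"
  shows "(\<integral>x. dx u x \<partial>lborel) = 0"
proof -
  \<comment> \<open>Strictly larger than the radius, because nothing is assumed about
    \<open>u\<close> at norm exactly \<open>R\<close>; the absolute value covers negative
    \<open>R\<close>, so that the interval from \<open>-Q\<close> to \<open>Q\<close> is not
    degenerate.\<close>
  define Q where "Q = \<bar>R\<bar> + 1"
  have uQ: "vanishes_beyond Q (dx u)" "vanishes_beyond R u"
    using u vanishes_beyond_pderiv vanishes_beyond_mono by (auto simp: Q_def)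
  have c: "continuous_on UNIV (dx u)"
    using u Ck_Suc_dx[of 0 u] by (simp add: Ck_continuous)
  have "(\<integral>x. dx u x \<partial>lborel) = integral (cbox (-Q, -Q) (Q, Q)) (\<lambda>(x, y). dx u (x, y))"
    using lborel_integral_eq_square[OF c uQ(1)] by simp
  also have "\<dots> = integral (cbox (-Q) Q) (\<lambda>x. integral (cbox (-Q) Q) (\<lambda>y. dx u (x, y)))"
    by (subst integral_prod_continuous) (simp_all add: continuous_on_subset[OF c] cbox_Pair_eq)
  also have "\<dots> = integral (cbox (-Q) Q) (\<lambda>y. integral (cbox (-Q) Q) (\<lambda>x. dx u (x, y)))"
    by (rule integral_swap_continuous) (simp, rule continuous_on_subset[OF c], simp)
  also have "\<dots> = integral (cbox (-Q) Q) (\<lambda>y. 0)"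
  proof (rule integral_cong)
    fix y
    have "((\<lambda>x. dx u (x, y)) has_integral u (Q, y) - u (- Q, y)) {-Q..Q}"
      using u partial_x_real_derivative[of 0 u]
      by (intro fundamental_theorem_of_calculus)
        (auto simp: Q_def has_real_derivative_iff_has_vector_derivative[symmetric])
    moreover have "u (Q, y) = 0" "u (-Q, y) = 0"
      using norm_fst_le[of Q y] norm_fst_le[of "-Q" y]
      by (auto intro!: vanishes_beyondD[OF uQ(2)] simp: Q_def)
    ultimately show "integral (cbox (-Q) Q) (\<lambda>x. dx u (x, y)) = 0"
      by (simp add: integral_unique)
  qed
  finally show ?thesis by simp
qed

lemma integral_dy_eq_0:
  assumes u: "Ck 1 u" "vanishes_beyond R u"
  shows "(\<integral>x. dy u x \<partial>lborel) = 0"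
proof -
  define Q where "Q = \<bar>R\<bar> + 1"
  have uQ: "vanishes_beyond Q (dy u)" "vanishes_beyond R u"
    using u vanishes_beyond_pderiv vanishes_beyond_mono by (auto simp: Q_def)
  have c: "continuous_on UNIV (dy u)"
    using u Ck_Suc_dy[of 0 u] by (simp add: Ck_continuous)
  have "(\<integral>x. dy u x \<partial>lborel) = integral (cbox (-Q, -Q) (Q, Q)) (\<lambda>(x, y). dy u (x, y))"
    using lborel_integral_eq_square[OF c uQ(1)] by simp
  also have "\<dots> = integral (cbox (-Q) Q) (\<lambda>x. integral (cbox (-Q) Q) (\<lambda>y. dy u (x, y)))"
    by (subst integral_prod_continuous) (simp_all add: continuous_on_subset[OF c] cbox_Pair_eq)
  also have "\<dots> = integral (cbox (-Q) Q) (\<lambda>x. 0)"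
  proof (rule integral_cong)
    fix x
    have "((\<lambda>y. dy u (x, y)) has_integral u (x, Q) - u (x, - Q)) {-Q..Q}"
      using u partial_y_real_derivative[of 0 u]
      by (intro fundamental_theorem_of_calculus)
        (auto simp: Q_def has_real_derivative_iff_has_vector_derivative[symmetric])
    moreover have "u (x, Q) = 0" "u (x, -Q) = 0"
      using norm_snd_le[of Q x] norm_snd_le[of "-Q" x]
      by (auto intro!: vanishes_beyondD[OF uQ(2)] simp: Q_def)
    ultimately show "integral (cbox (-Q) Q) (\<lambda>y. dy u (x, y)) = 0"
      by (simp add: integral_unique)
  qed
  finally show ?thesis by simp
qed

text \<open>A radius common to all parameters keeps the integral on one fixed square, which is what
  the Leibniz rule requires. The parameter will be the angle of a rotation.\<close>

lemma has_real_derivative_integral: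
  fixes f f' :: "real \<Rightarrow> plane \<Rightarrow> real"
  assumes f: "\<And>t x. ((\<lambda>t. f t x) has_real_derivative f' t x) (at t)"
    and cf: "\<And>t. continuous_on UNIV (f t)"
    and cf': "continuous_on UNIV (\<lambda>(t, x). f' t x)"
    and supp: "\<And>t. vanishes_beyond R (f t)"
  shows "((\<lambda>t. \<integral>x. f t x \<partial>lborel) has_real_derivative (\<integral>x. f' t x \<partial>lborel)) (at t)"
    and "vanishes_beyond R (f' t)" and "continuous_on UNIV (f' t)"
proof -
  have supp': "vanishes_beyond R (f' t)" for t
  proof (unfold vanishes_beyond_def, intro allI impI)
    fix x :: plane assume "R < norm x"
    then have "(\<lambda>t. f t x) = (\<lambda>t. 0)"
      using supp by (auto simp: vanishes_beyond_def)
    then show "f' t x = 0"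
      using f[of x t] DERIV_unique by (metis DERIV_const)
  qed
  have c': "continuous_on UNIV (f' t)" for t
    using continuous_on_compose2[OF cf', of UNIV "\<lambda>x. (t, x)"] by (auto simp: continuous_on_Pair)
  have "((\<lambda>t. integral (cbox (-R, -R) (R, R)) (f t)) has_real_derivative integral (cbox (-R, -R) (R, R)) (f' t)) (at t within UNIV)"
    by (rule leibniz_rule_field_derivative)
      (auto intro!: f integrable_continuous continuous_on_subset[OF cf] continuous_on_subset[OF cf'])
  then show "((\<lambda>t. \<integral>x. f t x \<partial>lborel) has_real_derivative (\<integral>x. f' t x \<partial>lborel)) (at t)"
    by (simp add: lborel_integral_eq_square[OF cf supp] lborel_integral_eq_square[OF c' supp'])
  show "vanishes_beyond R (f' t)" "continuous_on UNIV (f' t)"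
    using supp' c' by blast+
qed

section \<open>Convolution with a smooth kernel\<close>

definition conv :: "(plane \<Rightarrow> real) \<Rightarrow> (plane \<Rightarrow> real) \<Rightarrow> plane \<Rightarrow> real" where
  "conv K m x = (\<integral>y. K (x - y) * m y \<partial>lborel)"

lemma continuous_on_diff_compose:
  fixes K :: "plane \<Rightarrow> real"
  assumes "continuous_on UNIV K"
  shows "continuous_on A (\<lambda>x. K (x - y))" "continuous_on A (\<lambda>y. K (x - y))" "continuous_on B (\<lambda>(x, y). K (x - y))"
  unfolding split_beta by (rule continuous_on_compose2[OF assms]; auto intro!: continuous_intros)+

lemma conv_eq_square:
  assumes "continuous_on UNIV K" "continuous_on UNIV m" "vanishes_beyond R m"
  shows "conv K m x = integral (cbox (-R, -R) (R, R)) (\<lambda>y. K (x - y) * m y)"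
  unfolding conv_def
  by (rule lborel_integral_eq_square)
    (intro continuous_on_mult continuous_on_diff_compose assms vanishes_beyond_mult_right)+

lemma continuous_on_conv:
  assumes "continuous_on UNIV K" "continuous_on UNIV m" "vanishes_beyond R m"
  shows "continuous_on UNIV (conv K m)"
proof -
  have "continuous_on UNIV (\<lambda>x. integral (cbox (-R, -R) (R, R)) (\<lambda>y. K (x - y) * m y))"
    by (rule integral_continuous_on_param)
      (auto simp: split_beta intro!: continuous_intros continuous_on_compose2[OF assms(1)] continuous_on_compose2[OF assms(2)])
  then show ?thesis
    by (simp add: conv_eq_square[OF assms, abs_def] cong: continuous_on_cong)
qed

text \<open>The Leibniz rule asks for the derivative as a continuous family of bounded linear maps;
  hence the coordinate projections appear as \<open>Blinfun\<close>, and the derivative as their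
  combination \<open>D\<close>, whose integral splits into the two convolutions.\<close>

lemma has_derivative_conv:
  assumes K: "Ck 1 K" and m: "continuous_on UNIV m" "vanishes_beyond R m"
  shows "(conv K m has_derivative (\<lambda>v. fst v * conv (dx K) m x + snd v * conv (dy K) m x)) (at x)"
proof -
  let ?C = "cbox (-R, -R) (R, R) :: plane set"
  let ?B1 = "Blinfun fst :: plane \<Rightarrow>\<^sub>L real" and ?B2 = "Blinfun snd :: plane \<Rightarrow>\<^sub>L real"
  have B: "blinfun_apply ?B1 = fst" "blinfun_apply ?B2 = snd"
    by (auto simp: bounded_linear_Blinfun_apply bounded_linear_fst bounded_linear_snd)
  have cK: "continuous_on UNIV K" "continuous_on UNIV (dx K)" "continuous_on UNIV (dy K)"
    using K Ck_continuous Ck_Suc_dx[of 0 K] Ck_Suc_dy[of 0 K] by (auto simp del: Ck.simps(1))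
  define D where "D x y = (dx K (x - y) * m y) *\<^sub>R ?B1 + (dy K (x - y) * m y) *\<^sub>R ?B2" for x y
  have 1: "((\<lambda>x. K (x - y) * m y) has_derivative blinfun_apply (D x y)) (at x within UNIV)" for x y
  proof -
    have "((\<lambda>x. K (x - y)) has_derivative (\<lambda>v. fst v * dx K (x - y) + snd v * dy K (x - y))) (at x)"
      by (rule has_derivative_compose[OF _ Ck_Suc_has_derivative[OF K[unfolded One_nat_def]], of "\<lambda>x. x - y" "\<lambda>v. v" x UNIV])
        (auto intro!: derivative_eq_intros)
    from has_derivative_mult_left[OF this, of "m y"]
    show ?thesis
      by (rule has_derivative_eq_rhs) (auto simp: D_def B blinfun.add_left blinfun.scaleR_left algebra_simps)
  qed
  have "((\<lambda>x. integral ?C (\<lambda>y. K (x - y) * m y)) has_derivative integral ?C (D x)) (at x within UNIV)"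
  proof (rule leibniz_rule[OF 1])
    show "(\<lambda>y. K (x - y) * m y) integrable_on ?C" for x
      by (intro integrable_continuous continuous_on_mult continuous_on_diff_compose cK continuous_on_subset[OF m(1)]) auto
    show "continuous_on (UNIV \<times> ?C) (\<lambda>(x, t). D x t)"
      unfolding D_def split_beta
      by (auto intro!: continuous_intros continuous_on_compose2[OF cK(2)] continuous_on_compose2[OF cK(3)] continuous_on_compose2[OF m(1)])
  qed auto
  moreover have "blinfun_apply (integral ?C (D x)) = (\<lambda>v. fst v * conv (dx K) m x + snd v * conv (dy K) m x)"
  proof -
    have i: "(\<lambda>y. dx K (x - y) * m y) integrable_on ?C" "(\<lambda>y. dy K (x - y) * m y) integrable_on ?C"
      by (intro integrable_continuous continuous_on_mult continuous_on_diff_compose cK continuous_on_subset[OF m(1)]; simp)+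
    have "(D x has_integral (conv (dx K) m x) *\<^sub>R ?B1 + (conv (dy K) m x) *\<^sub>R ?B2) ?C"
      unfolding D_def conv_eq_square[OF cK(2) m] conv_eq_square[OF cK(3) m]
      by (intro has_integral_add has_integral_scaleR_left integrable_integral i)
    then have "integral ?C (D x) = (conv (dx K) m x) *\<^sub>R ?B1 + (conv (dy K) m x) *\<^sub>R ?B2"
      by (rule integral_unique)
    then show ?thesis
      by (auto simp: B blinfun.add_left blinfun.scaleR_left algebra_simps)
  qed
  ultimately show ?thesis
    by (simp add: conv_eq_square[OF cK(1) m, abs_def])
qed

text \<open>All derivatives fall on the kernel, so continuity of \<open>m\<close> suffices.\<close>

lemma Ck_conv:
  assumes "Ck k K" "continuous_on UNIV m" "vanishes_beyond R m"
  shows "Ck k (conv K m)"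
  using assms(1)
proof (induction k arbitrary: K)
  case 0
  then show ?case
    using continuous_on_conv assms by simp
next
  case (Suc k)
  have "Ck 1 K" using Ck_mono[OF Suc.prems, of 1] by simp
  from has_derivative_conv[OF this assms(2,3)]
  show ?case
    by (rule Ck_SucI(1)) (intro Suc.IH Ck_Suc_dx[OF Suc.prems] Ck_Suc_dy[OF Suc.prems])+
qed

lemma pderiv_conv:
  assumes "Ck 1 K" "continuous_on UNIV m" "vanishes_beyond R m"
  shows "dx (conv K m) = conv (dx K) m" "dy (conv K m) = conv (dy K) m"
  using pderiv_eqI[OF has_derivative_conv[OF assms]] by auto

section \<open>Wente's inequality\<close>

text \<open>The integral of the square of \<open>t * u + v\<close> is a nonnegative quadratic in
  \<open>t\<close>, so its discriminant cannot be positive.\<close>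

lemma integral_Cauchy_Schwarz:
  fixes u v :: "'a \<Rightarrow> real"
  assumes [measurable]: "u \<in> borel_measurable M" "v \<in> borel_measurable M"
    and iu: "integrable M (\<lambda>x. (u x)\<^sup>2)" and iv: "integrable M (\<lambda>x. (v x)\<^sup>2)"
  shows "integrable M (\<lambda>x. u x * v x)"
    and "\<bar>\<integral>x. u x * v x \<partial>M\<bar> \<le> sqrt (\<integral>x. (u x)\<^sup>2 \<partial>M) * sqrt (\<integral>x. (v x)\<^sup>2 \<partial>M)"
proof -
  show iuv: "integrable M (\<lambda>x. u x * v x)"
  proof (rule Bochner_Integration.integrable_bound)
    show "integrable M (\<lambda>x. (u x)\<^sup>2 + (v x)\<^sup>2)" using iu iv by simp
    show "AE x in M. norm (u x * v x) \<le> norm ((u x)\<^sup>2 + (v x)\<^sup>2)"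
    proof (rule AE_I2)
      fix x
      have "2 * (\<bar>u x\<bar> * \<bar>v x\<bar>) \<le> (u x)\<^sup>2 + (v x)\<^sup>2"
        using sum_squares_bound[of "\<bar>u x\<bar>" "\<bar>v x\<bar>"] by simp
      moreover have "0 \<le> \<bar>u x\<bar> * \<bar>v x\<bar>" by simp
      ultimately show "norm (u x * v x) \<le> norm ((u x)\<^sup>2 + (v x)\<^sup>2)"
        unfolding real_norm_def abs_mult by linarith
    qed
  qed simp
  define A B C where "A = (\<integral>x. (u x)\<^sup>2 \<partial>M)" and "B = (\<integral>x. (v x)\<^sup>2 \<partial>M)" and "C = (\<integral>x. u x * v x \<partial>M)"
  have pos: "0 \<le> t\<^sup>2 * A + 2 * t * C + B" for t
  proof -
    have "0 \<le> (\<integral>x. (t * u x + v x)\<^sup>2 \<partial>M)" by simp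
    also have "\<dots> = (\<integral>x. t\<^sup>2 * (u x)\<^sup>2 + 2 * t * (u x * v x) + (v x)\<^sup>2 \<partial>M)"
      by (intro Bochner_Integration.integral_cong) (simp_all add: power2_eq_square algebra_simps)
    also have "\<dots> = t\<^sup>2 * A + 2 * t * C + B"
      unfolding A_def B_def C_def using iu iv iuv by simp
    finally show ?thesis .
  qed
  have AB: "A \<ge> 0" "B \<ge> 0" by (simp_all add: A_def B_def)
  have "C\<^sup>2 \<le> A * B"
  proof (cases "A = 0")
    case True
    have "C = 0"
    proof (rule ccontr)
      assume "C \<noteq> 0"
      \<comment> \<open>At this \<open>t\<close> the quadratic, reduced to
        \<open>2 * t * C + B\<close> since \<open>A = 0\<close>, takes the value -1.\<close>
      then show False using pos[of "- (B + 1) / (2 * C)"] True by (simp add: field_simps)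
    qed
    then show ?thesis using True by simp
  next
    case False
    with AB have "A > 0" by simp
    \<comment> \<open>\<open>- C / A\<close> minimizes the quadratic; multiplying by
      \<open>A\<close> clears the denominators.\<close>
    have "0 \<le> A * ((- C / A)\<^sup>2 * A + 2 * (- C / A) * C + B)"
      using pos[of "- C / A"] AB by (intro mult_nonneg_nonneg)
    also have "\<dots> = A * B - C\<^sup>2"
      using \<open>A > 0\<close> by (simp add: field_simps power2_eq_square)
    finally show ?thesis by simp
  qed
  then have "sqrt (C\<^sup>2) \<le> sqrt (A * B)" by (rule real_sqrt_le_mono)
  then show "\<bar>\<integral>x. u x * v x \<partial>M\<bar> \<le> sqrt (\<integral>x. (u x)\<^sup>2 \<partial>M) * sqrt (\<integral>x. (v x)\<^sup>2 \<partial>M)"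
    by (simp only: real_sqrt_mult real_sqrt_abs A_def B_def C_def)
qed

section \<open>Rotations about a point\<close>

definition rot :: "plane \<Rightarrow> real \<Rightarrow> plane \<Rightarrow> plane" where
  "rot p \<alpha> y = (fst p + cos \<alpha> * (fst y - fst p) - sin \<alpha> * (snd y - snd p),
              snd p + sin \<alpha> * (fst y - fst p) + cos \<alpha> * (snd y - snd p))"

text \<open>The derivative along the rotation flow \<open>rot p\<close>.\<close>

definition angular_deriv :: "plane \<Rightarrow> (plane \<Rightarrow> real) \<Rightarrow> plane \<Rightarrow> real" where
  "angular_deriv p u y = (fst y - fst p) * dy u y - (snd y - snd p) * dx u y"

lemma rot_0: "rot p 0 y = y" and rot_2pi: "rot p (2 * pi) y = y"
  by (simp_all add: rot_def prod_eq_iff)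

lemma norm_rot: "norm (rot p \<alpha> y - p) = norm (y - p)"
proof -
  have "(cos \<alpha> * X - sin \<alpha> * Y)\<^sup>2 + (sin \<alpha> * X + cos \<alpha> * Y)\<^sup>2 = ((sin \<alpha>)\<^sup>2 + (cos \<alpha>)\<^sup>2) * (X\<^sup>2 + Y\<^sup>2)" for X Y :: real
    by (simp only: power2_eq_square) algebra
  from this[of "fst y - fst p" "snd y - snd p"] show ?thesis
    by (simp add: norm_prod_def rot_def fst_diff snd_diff algebra_simps)
qed

lemma vanishes_beyond_rot:
  assumes "vanishes_beyond R u" shows "vanishes_beyond (R + 2 * norm p) (\<lambda>y. u (rot p \<alpha> y))"
  unfolding vanishes_beyond_def
proof (intro allI impI)
  fix y :: plane assume "R + 2 * norm p < norm y"
  then have "R < norm (rot p \<alpha> y)"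
    using norm_triangle_sub[of y p] norm_rot[of p \<alpha> y] norm_triangle_ineq4[of "rot p \<alpha> y" p] by linarith
  then show "u (rot p \<alpha> y) = 0" by (rule vanishes_beyondD[OF assms])
qed

lemma has_derivative_rot:
  "(rot p \<alpha> has_derivative (\<lambda>v. (cos \<alpha> * fst v - sin \<alpha> * snd v, sin \<alpha> * fst v + cos \<alpha> * snd v))) (at y)"
  unfolding rot_def[abs_def] by (auto intro!: derivative_eq_intros)

lemma has_derivative_compose_rot:
  assumes "Ck (Suc k) u"
  shows "((\<lambda>y. u (rot p \<alpha> y)) has_derivative
    (\<lambda>v. fst v * (cos \<alpha> * dx u (rot p \<alpha> y) + sin \<alpha> * dy u (rot p \<alpha> y)) +
         snd v * (- sin \<alpha> * dx u (rot p \<alpha> y) + cos \<alpha> * dy u (rot p \<alpha> y)))) (at y)"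
  by (rule has_derivative_eq_rhs[OF has_derivative_compose[OF has_derivative_rot Ck_Suc_has_derivative[OF assms]]])
    (auto simp: algebra_simps)

lemma pderiv_rot:
  assumes "Ck (Suc k) u"
  shows "dx (\<lambda>y. u (rot p \<alpha> y)) = (\<lambda>y. cos \<alpha> * dx u (rot p \<alpha> y) + sin \<alpha> * dy u (rot p \<alpha> y))"
    "dy (\<lambda>y. u (rot p \<alpha> y)) = (\<lambda>y. - sin \<alpha> * dx u (rot p \<alpha> y) + cos \<alpha> * dy u (rot p \<alpha> y))"
  using pderiv_eqI[OF has_derivative_compose_rot[OF assms, of p \<alpha>]] by auto

lemma continuous_on_rot: "continuous_on A (rot p \<alpha>)" "continuous_on B (\<lambda>(\<alpha>, y). rot p \<alpha> y)"
  unfolding rot_def split_beta by (intro continuous_intros)+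

lemma Ck_rot: "Ck k u \<Longrightarrow> Ck k (\<lambda>y. u (rot p \<alpha> y))"
proof (induction k arbitrary: u)
  case 0
  then show ?case
    by (auto intro: continuous_on_compose2[OF _ continuous_on_rot(1)])
next
  case (Suc k)
  show ?case
    by (rule Ck_SucI(1)[OF has_derivative_compose_rot[OF Suc.prems]])
      (intro Ck_add Ck_cmult Suc.IH Ck_Suc_dx[OF Suc.prems] Ck_Suc_dy[OF Suc.prems])+
qed

text \<open>Rotations about \<open>p\<close> commute with their own generator, so differentiating
  along the angle before or after rotating gives the same function.\<close>

lemma angular_deriv_rot:
  assumes "Ck (Suc k) u"
  shows "angular_deriv p (\<lambda>y. u (rot p \<alpha> y)) = (\<lambda>y. angular_deriv p u (rot p \<alpha> y))"
proof
  fix y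
  have "fst (rot p \<alpha> y) - fst p = cos \<alpha> * (fst y - fst p) - sin \<alpha> * (snd y - snd p)"
    "snd (rot p \<alpha> y) - snd p = sin \<alpha> * (fst y - fst p) + cos \<alpha> * (snd y - snd p)"
    by (simp_all add: rot_def)
  note coords = this
  show "angular_deriv p (\<lambda>y. u (rot p \<alpha> y)) y = angular_deriv p u (rot p \<alpha> y)"
    unfolding angular_deriv_def pderiv_rot[OF assms] coords by (simp add: algebra_simps)
qed

lemma rot_has_real_derivative:
  assumes "Ck (Suc k) u"
  shows "((\<lambda>\<alpha>. u (rot p \<alpha> y)) has_real_derivative angular_deriv p u (rot p \<alpha> y)) (at \<alpha>)"
proof -
  have "((\<lambda>\<alpha>. rot p \<alpha> y) has_derivative (\<lambda>h. (h * (snd p - snd (rot p \<alpha> y)), h * (fst (rot p \<alpha> y) - fst p)))) (at \<alpha>)"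
    unfolding rot_def by (auto intro!: derivative_eq_intros simp: algebra_simps)
  from has_derivative_compose[OF this Ck_Suc_has_derivative[OF assms]] show ?thesis
    unfolding has_field_derivative_def
    by (rule has_derivative_eq_rhs) (auto simp: angular_deriv_def algebra_simps)
qed

lemma Ck_angular_deriv: "Ck (Suc k) u \<Longrightarrow> Ck k (angular_deriv p u)"
  unfolding angular_deriv_def[abs_def]
  by (intro Ck_diff Ck_mult Ck_fst Ck_snd Ck_const Ck_Suc_dx Ck_Suc_dy)

lemma vanishes_beyond_angular_deriv: "vanishes_beyond R u \<Longrightarrow> vanishes_beyond R (angular_deriv p u)"
  unfolding angular_deriv_def[abs_def]
  by (intro vanishes_beyond_diff vanishes_beyond_mult_right vanishes_beyond_pderiv)

lemma angular_deriv_mult: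
  assumes "Ck (Suc k) u" "Ck (Suc k) v"
  shows "angular_deriv p (\<lambda>y. u y * v y) = (\<lambda>y. angular_deriv p u y * v y + u y * angular_deriv p v y)"
  by (rule ext) (simp add: angular_deriv_def pderiv_mult[OF assms] algebra_simps)

text \<open>The rotation field is divergence free. The angular derivative of \<open>u\<close> is
  therefore the divergence of \<open>u\<close> times that field, and integrals of such divergences
  vanish.\<close>

lemma integral_angular_deriv_eq_0:
  assumes u: "Ck 1 u" "vanishes_beyond R u"
  shows "(\<integral>y. angular_deriv p u y \<partial>lborel) = 0"
proof -
  let ?X = "\<lambda>y. (fst y - fst p) * u y" and ?Y = "\<lambda>y. (snd y - snd p) * u y"
  have C: "Ck 1 (\<lambda>y::plane. fst y - fst p)" "Ck 1 (\<lambda>y::plane. snd y - snd p)"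
    by (intro Ck_diff Ck_fst Ck_snd Ck_const)+
  have XY: "Ck 1 ?X" "Ck 1 ?Y" "vanishes_beyond R ?X" "vanishes_beyond R ?Y"
    using u C by (auto intro: Ck_mult vanishes_beyond_mult_right)
  have "angular_deriv p u = (\<lambda>y. dy ?X y - dx ?Y y)"
    using pderiv_mult[OF C(1)[unfolded One_nat_def] u(1)[unfolded One_nat_def]]
      pderiv_mult[OF C(2)[unfolded One_nat_def] u(1)[unfolded One_nat_def]]
      pderiv_diff[OF Ck_fst Ck_const, of "fst p"] pderiv_diff[OF Ck_snd Ck_const, of "snd p"]
    by (intro ext) (simp add: angular_deriv_def pderiv_fst pderiv_snd pderiv_const)
  moreover have "integrable lborel (dy ?X)" "integrable lborel (dx ?Y)"
    using XY by (auto intro!: continuous_bounded_support_integrable[of _ R] vanishes_beyond_pderiv Ck_continuous[of 0] Ck_Suc_dx Ck_Suc_dy simp del: Ck.simps)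
  ultimately show ?thesis
    using integral_dx_eq_0[OF XY(2,4)] integral_dy_eq_0[OF XY(1,3)] by simp
qed

text \<open>Rotation invariance of the integral is the vanishing of its derivative along the flow.\<close>

lemma integral_rot:
  assumes u: "Ck 1 u" "vanishes_beyond R u"
  shows "(\<integral>y. u (rot p \<alpha> y) \<partial>lborel) = (\<integral>y. u y \<partial>lborel)"
proof -
  let ?F = "\<lambda>\<alpha>. \<integral>y. u (rot p \<alpha> y) \<partial>lborel"
  note u1 = u(1)[unfolded One_nat_def]
  have "(?F has_real_derivative (\<integral>y. angular_deriv p u (rot p \<alpha> y) \<partial>lborel)) (at \<alpha>)" for \<alpha>
  proof (rule has_real_derivative_integral[OF rot_has_real_derivative[OF u1]])
    show "continuous_on UNIV (\<lambda>y. u (rot p t y))" for t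
      using Ck_continuous[OF Ck_rot[OF u(1)]] .
    show "continuous_on UNIV (\<lambda>(t, y). angular_deriv p u (rot p t y))"
      using continuous_on_compose2[OF Ck_continuous[OF Ck_angular_deriv[OF u1]] continuous_on_rot(2)]
      by (simp add: split_beta)
    show "vanishes_beyond (R + 2 * norm p) (\<lambda>y. u (rot p t y))" for t
      by (rule vanishes_beyond_rot[OF u(2)])
  qed
  moreover have "(\<integral>y. angular_deriv p u (rot p \<alpha> y) \<partial>lborel) = 0" for \<alpha>
    using integral_angular_deriv_eq_0[OF Ck_rot[OF u(1)] vanishes_beyond_rot[OF u(2)], of p p \<alpha>]
    by (simp add: angular_deriv_rot[OF u1])
  ultimately have "(?F has_real_derivative 0) (at \<alpha>)" for \<alpha>
    by simp
  then have "?F \<alpha> = ?F 0"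
    by (rule DERIV_isconst_all[OF allI])
  then show ?thesis by (simp add: rot_0)
qed

section \<open>Angular estimates with a rotation invariant weight\<close>

definition energy :: "(plane \<Rightarrow> real) \<Rightarrow> real" where
  "energy u = (\<integral>y. (dx u y)\<^sup>2 + (dy u y)\<^sup>2 \<partial>lborel)"

definition jacobian :: "(plane \<Rightarrow> real) \<Rightarrow> (plane \<Rightarrow> real) \<Rightarrow> plane \<Rightarrow> real" where
  "jacobian b c y = dx b y * dy c y - dy b y * dx c y"

text \<open>The squared distance to \<open>p\<close>, kept away from 0 by \<open>e\<close>, so that
  its reciprocal and its logarithm are smooth on the whole plane.\<close>

definition reg_sq :: "real \<Rightarrow> plane \<Rightarrow> plane \<Rightarrow> real" where
  "reg_sq e p y = (fst y - fst p)\<^sup>2 + (snd y - snd p)\<^sup>2 + e\<^sup>2"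

text \<open>Radial, hence unchanged by rotations about \<open>p\<close> and annihilated by the
  angular derivative. Multiplied by \<open>y - p\<close> it is the gradient of the logarithmic
  kernel.\<close>

definition weight :: "real \<Rightarrow> plane \<Rightarrow> plane \<Rightarrow> real" where
  "weight e p y = inverse (reg_sq e p y)"

lemma reg_sq_pos: "e > 0 \<Longrightarrow> reg_sq e p y > 0"
  unfolding reg_sq_def by (simp add: add_nonneg_pos)

lemma weight_pos: "e > 0 \<Longrightarrow> weight e p y > 0"
  by (simp add: weight_def reg_sq_pos)

lemma Ck_reg_sq: "Ck k (reg_sq e p)"
  unfolding reg_sq_def[abs_def] power2_eq_square
  by (intro Ck_add Ck_mult Ck_diff Ck_fst Ck_snd Ck_const)

lemma pderiv_reg_sq: "dx (reg_sq e p) = (\<lambda>y. 2 * (fst y - fst p))" "dy (reg_sq e p) = (\<lambda>y. 2 * (snd y - snd p))"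
proof -
  have "(reg_sq e p has_derivative (\<lambda>v. fst v * (2 * (fst y - fst p)) + snd v * (2 * (snd y - snd p)))) (at y)" for y
    unfolding reg_sq_def[abs_def] by (auto intro!: derivative_eq_intros simp: algebra_simps)
  from pderiv_eqI[OF this] show "dx (reg_sq e p) = (\<lambda>y. 2 * (fst y - fst p))" "dy (reg_sq e p) = (\<lambda>y. 2 * (snd y - snd p))"
    by auto
qed

lemma Ck_weight: "e > 0 \<Longrightarrow> Ck k (weight e p)"
  unfolding weight_def[abs_def]
  by (intro Ck_inverse Ck_reg_sq) (metis less_irrefl reg_sq_pos)

lemma pderiv_weight:
  assumes "e > 0"
  shows "dx (weight e p) = (\<lambda>y. - 2 * (fst y - fst p) * (weight e p y)\<^sup>2)"
    "dy (weight e p) = (\<lambda>y. - 2 * (snd y - snd p) * (weight e p y)\<^sup>2)"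
proof -
  have d: "(inverse has_real_derivative - (inverse (reg_sq e p y))\<^sup>2) (at (reg_sq e p y))" for y
    using DERIV_inverse[of "reg_sq e p y"] reg_sq_pos[OF assms, of p y] by (simp add: numeral_2_eq_2)
  show "dx (weight e p) = (\<lambda>y. - 2 * (fst y - fst p) * (weight e p y)\<^sup>2)"
    "dy (weight e p) = (\<lambda>y. - 2 * (snd y - snd p) * (weight e p y)\<^sup>2)"
    unfolding weight_def[abs_def]
      pderiv_real_comp[where F=inverse and G="\<lambda>t. - (inverse t)\<^sup>2", OF Ck_reg_sq[of "Suc 0"] d]
    by (simp_all add: pderiv_reg_sq algebra_simps)
qed

lemma angular_deriv_weight: "e > 0 \<Longrightarrow> angular_deriv p (weight e p) y = 0"
  by (simp add: angular_deriv_def pderiv_weight algebra_simps)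

lemma weight_rot: "weight e p (rot p \<alpha> y) = weight e p y"
proof -
  have "(norm (rot p \<alpha> y - p))\<^sup>2 = (norm (y - p))\<^sup>2" by (simp add: norm_rot)
  then show ?thesis by (simp add: weight_def reg_sq_def norm_prod_def)
qed

text \<open>The squared distance times the squared length of the gradient is the square of its
  angular part plus the square of its radial part. Dropping the latter and enlarging the squared
  distance to \<open>reg_sq\<close> gives a bound independent of \<open>e\<close>.\<close>

lemma weight_angular_deriv_le:
  assumes "e > 0"
  shows "weight e p y * (angular_deriv p u y)\<^sup>2 \<le> (dx u y)\<^sup>2 + (dy u y)\<^sup>2"
proof -
  define X Y where "X = fst y - fst p" and "Y = snd y - snd p"
  have "(X * dy u y - Y * dx u y)\<^sup>2 + (X * dx u y + Y * dy u y)\<^sup>2 = (X\<^sup>2 + Y\<^sup>2) * ((dx u y)\<^sup>2 + (dy u y)\<^sup>2)"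
    by (simp only: power2_eq_square) algebra
  moreover have "0 \<le> (X * dx u y + Y * dy u y)\<^sup>2" by simp
  moreover have "(X\<^sup>2 + Y\<^sup>2) * ((dx u y)\<^sup>2 + (dy u y)\<^sup>2) \<le> reg_sq e p y * ((dx u y)\<^sup>2 + (dy u y)\<^sup>2)"
    by (intro mult_right_mono) (simp_all add: reg_sq_def X_def Y_def)
  ultimately have "(X * dy u y - Y * dx u y)\<^sup>2 \<le> reg_sq e p y * ((dx u y)\<^sup>2 + (dy u y)\<^sup>2)"
    by linarith
  then have "(angular_deriv p u y)\<^sup>2 \<le> reg_sq e p y * ((dx u y)\<^sup>2 + (dy u y)\<^sup>2)"
    by (simp only: angular_deriv_def X_def Y_def)
  then show ?thesis
    using reg_sq_pos[OF assms, of p y] by (simp add: weight_def field_simps)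
qed

lemma energy_integrable:
  assumes "Ck 1 u" "vanishes_beyond R u"
  shows "integrable lborel (\<lambda>y. (dx u y)\<^sup>2)" "integrable lborel (\<lambda>y. (dy u y)\<^sup>2)"
    "integrable lborel (\<lambda>y. (dx u y)\<^sup>2 + (dy u y)\<^sup>2)"
proof -
  have "continuous_on UNIV (dx u)" "continuous_on UNIV (dy u)"
    using assms Ck_continuous[of 0] Ck_Suc_dx[of 0 u] Ck_Suc_dy[of 0 u] by (auto simp del: Ck.simps)
  then show *: "integrable lborel (\<lambda>y. (dx u y)\<^sup>2)" "integrable lborel (\<lambda>y. (dy u y)\<^sup>2)"
    unfolding power2_eq_square
    by (auto intro!: continuous_bounded_support_integrable[of _ R] continuous_on_mult vanishes_beyond_mult_left
        vanishes_beyond_pderiv assms)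
  show "integrable lborel (\<lambda>y. (dx u y)\<^sup>2 + (dy u y)\<^sup>2)" using * by simp
qed

lemma energy_nonneg: "energy u \<ge> 0"
  by (simp add: energy_def)

lemma integral_weight_angular_le:
  assumes e: "e > 0" and b: "Ck 1 b" "vanishes_beyond R b"
  shows "(\<integral>y. weight e p y * (angular_deriv p b y)\<^sup>2 \<partial>lborel) \<le> energy b"
  unfolding energy_def
proof (rule integral_mono)
  show "integrable lborel (\<lambda>y. weight e p y * (angular_deriv p b y)\<^sup>2)"
    unfolding power2_eq_square using b
    by (intro continuous_bounded_support_integrable[of _ R] continuous_on_mult Ck_continuous[OF Ck_weight[OF e]]
        Ck_continuous[OF Ck_angular_deriv[of 0]] vanishes_beyond_mult_right vanishes_beyond_angular_deriv) auto
qed (use weight_angular_deriv_le[OF e] energy_integrable[OF b] in auto)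

text \<open>The integrand has an angular derivative on \<open>c\<close> only; one has to be put on
  \<open>b\<close> as well. Rotating \<open>b\<close> by an angle \<alpha> turns the integral into a
  function \<open>F\<close> whose value at 0 is the target. Up to sign \<open>F\<close> is the
  derivative of the \<open>2 * pi\<close>-periodic function \<open>H\<close>, so it vanishes at some
  angle, and \<open>F 0\<close> is at most \<open>2 * pi\<close> times a value of \<open>F'\<close>,
  in which both factors carry angular derivatives.\<close>

lemma weighted_jacobian_le:
  assumes e: "e > 0" and b: "Ck 2 b" "vanishes_beyond R b" and c: "Ck 2 c" "vanishes_beyond R c"
  shows "\<bar>\<integral>y. weight e p y * b y * angular_deriv p c y \<partial>lborel\<bar> \<le> 2 * pi * (sqrt (energy b) * sqrt (energy c))"
proof -
  let ?w = "weight e p" and ?D = "angular_deriv p"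
  define R' where "R' = R + 2 * norm p"
  define F where "F \<alpha> = (\<integral>y. ?w y * b (rot p \<alpha> y) * ?D c y \<partial>lborel)" for \<alpha>
  define H where "H \<alpha> = (\<integral>y. ?w y * b (rot p \<alpha> y) * c y \<partial>lborel)" for \<alpha>
  define F' where "F' \<alpha> = (\<integral>y. ?w y * ?D b (rot p \<alpha> y) * ?D c y \<partial>lborel)" for \<alpha>
  define H' where "H' \<alpha> = (\<integral>y. ?w y * ?D b (rot p \<alpha> y) * c y \<partial>lborel)" for \<alpha>
  have bS: "Ck (Suc (Suc 0)) b" "Ck (Suc (Suc 0)) c" using b c by (simp_all add: numeral_2_eq_2)
  have b1: "Ck (Suc 0) b" "Ck (Suc 0) c" "Ck (Suc 0) (?D b)" "Ck (Suc 0) (?D c)" "Ck (Suc 0) ?w"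
    using bS Ck_SucD Ck_angular_deriv Ck_weight[OF e] by blast+
  have cont: "continuous_on UNIV b" "continuous_on UNIV c" "continuous_on UNIV (?D b)" "continuous_on UNIV (?D c)" "continuous_on UNIV ?w"
    using b1 Ck_continuous by blast+
  have DbDc: "vanishes_beyond R (?D b)" "vanishes_beyond R (?D c)"
    by (intro vanishes_beyond_angular_deriv b c)+
  note crot = continuous_on_compose2[OF cont(1) continuous_on_rot(1)] continuous_on_compose2[OF cont(3) continuous_on_rot(1)]
    continuous_on_compose2[OF cont(1) continuous_on_rot(2)] continuous_on_compose2[OF cont(3) continuous_on_rot(2)]
  have csnd: "continuous_on UNIV (\<lambda>z::real \<times> plane. g (snd z))" if "continuous_on UNIV g" for g :: "plane \<Rightarrow> real"
    by (rule continuous_on_compose2[OF that]) (auto intro!: continuous_intros)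
  have crot2: "continuous_on UNIV (\<lambda>z. ?D b (rot p (fst z) (snd z)))"
    using continuous_on_compose2[OF cont(3) continuous_on_rot(2)] by (simp add: split_beta)
  have derF: "(F has_real_derivative F' \<alpha>) (at \<alpha>)" for \<alpha>
    unfolding F_def[abs_def] F'_def
  proof (rule has_real_derivative_integral[where R=R])
    show "((\<lambda>t. ?w y * b (rot p t y) * ?D c y) has_real_derivative ?w y * ?D b (rot p t y) * ?D c y) (at t)" for t y
      by (intro DERIV_cmult_right DERIV_cmult rot_has_real_derivative[OF b1(1)])
    show "continuous_on UNIV (\<lambda>y. ?w y * b (rot p t y) * ?D c y)" for t
      by (intro continuous_on_mult cont crot) auto
    show "continuous_on UNIV (\<lambda>(t, y). ?w y * ?D b (rot p t y) * ?D c y)"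
      unfolding split_beta by (intro continuous_on_mult csnd cont crot2)
    show "vanishes_beyond R (\<lambda>y. ?w y * b (rot p t y) * ?D c y)" for t
      by (intro vanishes_beyond_mult_right DbDc)
  qed
  have derH: "(H has_real_derivative H' \<alpha>) (at \<alpha>)" for \<alpha>
    unfolding H_def[abs_def] H'_def
  proof (rule has_real_derivative_integral[where R=R])
    show "((\<lambda>t. ?w y * b (rot p t y) * c y) has_real_derivative ?w y * ?D b (rot p t y) * c y) (at t)" for t y
      by (intro DERIV_cmult_right DERIV_cmult rot_has_real_derivative[OF b1(1)])
    show "continuous_on UNIV (\<lambda>y. ?w y * b (rot p t y) * c y)" for t
      by (intro continuous_on_mult cont crot) auto
    show "continuous_on UNIV (\<lambda>(t, y). ?w y * ?D b (rot p t y) * c y)"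
      unfolding split_beta by (intro continuous_on_mult csnd cont crot2)
    show "vanishes_beyond R (\<lambda>y. ?w y * b (rot p t y) * c y)" for t
      by (intro vanishes_beyond_mult_right c)
  qed
  \<comment> \<open>Integration by parts along the flow: the integral of the angular derivative of
    the triple product vanishes, and the weight contributes no term.\<close>
  have H'F: "H' \<alpha> = - F \<alpha>" for \<alpha>
  proof -
    let ?br = "\<lambda>y. b (rot p \<alpha> y)"
    have br: "Ck (Suc 0) ?br" by (rule Ck_rot[OF b1(1)])
    have wb: "Ck (Suc 0) (\<lambda>y. ?w y * ?br y)" by (intro Ck_mult b1 br)
    have "?D (\<lambda>y. ?w y * ?br y * c y) = (\<lambda>y. ?w y * ?D b (rot p \<alpha> y) * c y + ?w y * b (rot p \<alpha> y) * ?D c y)"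
      unfolding angular_deriv_mult[OF wb b1(2)] angular_deriv_mult[OF b1(5) br] angular_deriv_rot[OF b1(1)]
      by (simp add: angular_deriv_weight[OF e])
    moreover have "(\<integral>y. ?D (\<lambda>y. ?w y * ?br y * c y) y \<partial>lborel) = 0"
      by (rule integral_angular_deriv_eq_0[where R=R])
        (simp_all only: One_nat_def Ck_mult[OF wb b1(2)] vanishes_beyond_mult_right[OF c(2)])
    moreover have "integrable lborel (\<lambda>y. ?w y * ?D b (rot p \<alpha> y) * c y)"
      "integrable lborel (\<lambda>y. ?w y * b (rot p \<alpha> y) * ?D c y)"
      by (rule continuous_bounded_support_integrable[where R=R];
          intro continuous_on_mult cont crot vanishes_beyond_mult_right c DbDc; simp)+
    ultimately show ?thesis
      by (simp add: H'_def F_def)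
  qed
  \<comment> \<open>Periodicity gives equal end values, hence a critical point of \<open>H\<close>,
    which is a zero of \<open>F\<close>.\<close>
  have "H 0 = H (2 * pi)" by (simp add: H_def rot_0 rot_2pi)
  with MVT2[of 0 "2 * pi" H H', OF _ derH] obtain \<beta> where \<beta>: "0 < \<beta>" "\<beta> < 2 * pi" "H' \<beta> = 0"
    by auto
  have F\<beta>: "F \<beta> = 0" using H'F[of \<beta>] \<beta> by simp
  obtain \<gamma> where \<gamma>: "F \<beta> - F 0 = \<beta> * F' \<gamma>"
    using MVT2[of 0 \<beta> F F', OF _ derF] \<beta> by auto
  have "\<bar>F' \<gamma>\<bar> \<le> sqrt (energy b) * sqrt (energy c)"
  proof -
    \<comment> \<open>One square root of the weight goes to each factor. As the weight is radial,
      the square of the first factor is a rotated function, and \<open>integral_rot\<close> removes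
      the rotation.\<close>
    let ?u = "\<lambda>y. sqrt (?w y) * ?D b (rot p \<gamma> y)" and ?v = "\<lambda>y. sqrt (?w y) * ?D c y"
    have w0: "?w y \<ge> 0" for y using weight_pos[OF e, of p y] by simp
    have sq: "(\<lambda>y. (?u y)\<^sup>2) = (\<lambda>y. (\<lambda>y. ?w y * (?D b y)\<^sup>2) (rot p \<gamma> y))" "(\<lambda>y. (?v y)\<^sup>2) = (\<lambda>y. ?w y * (?D c y)\<^sup>2)"
      "(\<lambda>y. ?u y * ?v y) = (\<lambda>y. ?w y * ?D b (rot p \<gamma> y) * ?D c y)"
      by (auto simp: power_mult_distrib w0 weight_rot mult_ac intro!: ext)
    have cu: "continuous_on UNIV ?u" "continuous_on UNIV ?v"
      by (intro continuous_on_mult continuous_on_real_sqrt cont crot; simp)+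
    have m: "?u \<in> borel_measurable lborel" "?v \<in> borel_measurable lborel"
      using cu by (auto intro: borel_measurable_continuous_onI)
    have vu: "vanishes_beyond R' ?u" "vanishes_beyond R ?v"
      unfolding R'_def by (intro vanishes_beyond_mult_right vanishes_beyond_rot DbDc)+
    have i: "integrable lborel (\<lambda>y. (?u y)\<^sup>2)" "integrable lborel (\<lambda>y. (?v y)\<^sup>2)"
      unfolding power2_eq_square
      by (rule continuous_bounded_support_integrable, intro continuous_on_mult cu, rule vanishes_beyond_mult_right, rule vu)+
    have "(\<integral>y. (?u y)\<^sup>2 \<partial>lborel) = (\<integral>y. ?w y * (?D b y)\<^sup>2 \<partial>lborel)"
      unfolding sq
    proof (rule integral_rot)
      show "Ck 1 (\<lambda>y. ?w y * (?D b y)\<^sup>2)"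
        unfolding power2_eq_square One_nat_def by (intro Ck_mult b1)
      show "vanishes_beyond R (\<lambda>y. ?w y * (?D b y)\<^sup>2)"
        unfolding power2_eq_square by (intro vanishes_beyond_mult_right DbDc)
    qed
    also have "\<dots> \<le> energy b"
      using b1 b by (intro integral_weight_angular_le[OF e]) auto
    finally have "sqrt (\<integral>y. (?u y)\<^sup>2 \<partial>lborel) \<le> sqrt (energy b)" by simp
    moreover have "sqrt (\<integral>y. (?v y)\<^sup>2 \<partial>lborel) \<le> sqrt (energy c)"
      using integral_weight_angular_le[OF e _ c(2), of p] b1 unfolding sq by simp
    ultimately have "sqrt (\<integral>y. (?u y)\<^sup>2 \<partial>lborel) * sqrt (\<integral>y. (?v y)\<^sup>2 \<partial>lborel) \<le> sqrt (energy b) * sqrt (energy c)"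
      by (intro mult_mono) (auto simp: energy_nonneg)
    then show ?thesis
      using integral_Cauchy_Schwarz(2)[OF m i] unfolding sq F'_def by linarith
  qed
  then have "\<beta> * \<bar>F' \<gamma>\<bar> \<le> 2 * pi * (sqrt (energy b) * sqrt (energy c))"
    using \<beta> by (intro mult_mono) auto
  moreover have "\<bar>F 0\<bar> = \<beta> * \<bar>F' \<gamma>\<bar>"
    using \<gamma> F\<beta> \<beta> by (metis abs_minus_cancel abs_mult abs_of_pos diff_0)
  ultimately show ?thesis
    by (simp add: F_def rot_0)
qed

section \<open>The regularized logarithmic potential of a Jacobian\<close>

definition log_kernel :: "real \<Rightarrow> plane \<Rightarrow> plane \<Rightarrow> real" where
  "log_kernel e p y = ln (reg_sq e p y) / 2"

text \<open>Apart from the factor \<open>2 * pi\<close>, an approximate identity as \<open>e\<close> tends to 0; it is the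
  Laplacian of the logarithmic kernel.\<close>

definition poisson :: "real \<Rightarrow> plane \<Rightarrow> real" where
  "poisson e z = 2 * e\<^sup>2 * (weight e 0 z)\<^sup>2"

lemma Ck_log_kernel: "e > 0 \<Longrightarrow> Ck k (log_kernel e p)"
  using Ck_cmult[OF Ck_ln[OF Ck_reg_sq reg_sq_pos], of e k "1/2" p]
  by (simp add: log_kernel_def[abs_def])

lemma pderiv_log_kernel:
  assumes "e > 0"
  shows "dx (log_kernel e p) = (\<lambda>y. (fst y - fst p) * weight e p y)"
    "dy (log_kernel e p) = (\<lambda>y. (snd y - snd p) * weight e p y)"
proof -
  have d: "((\<lambda>t. ln t / 2) has_real_derivative inverse (reg_sq e p y) / 2) (at (reg_sq e p y))" for y
    by (intro DERIV_cdivide) (use DERIV_ln[OF reg_sq_pos[OF assms, of p y]] in simp)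
  show "dx (log_kernel e p) = (\<lambda>y. (fst y - fst p) * weight e p y)"
    "dy (log_kernel e p) = (\<lambda>y. (snd y - snd p) * weight e p y)"
    unfolding log_kernel_def[abs_def]
      pderiv_real_comp[where F="\<lambda>t. ln t / 2" and G="\<lambda>t. inverse t / 2", OF Ck_reg_sq[of "Suc 0"] d]
    by (simp_all add: pderiv_reg_sq weight_def algebra_simps)
qed

text \<open>The logarithm is harmonic away from its pole. Here a factor
  \<open>weight * reg_sq = 1\<close> brings both terms to the second power of the weight; the
  distances cancel, and only a multiple of the squared \<open>e\<close> survives.\<close>

lemma laplacian_log_kernel:
  assumes "e > 0"
  shows "dx (dx (log_kernel e 0)) z + dy (dy (log_kernel e 0)) z = poisson e z"
proof -
  have w: "weight e 0 z * reg_sq e 0 z = 1"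
    using reg_sq_pos[OF assms, of 0 z] by (simp add: weight_def)
  have "dx (\<lambda>y. (fst y - fst 0) * weight e 0 y) z + dy (\<lambda>y. (snd y - snd 0) * weight e 0 y) z
    = 2 * weight e 0 z - 2 * ((fst z)\<^sup>2 + (snd z)\<^sup>2) * (weight e 0 z)\<^sup>2"
    unfolding pderiv_mult[OF Ck_diff[OF Ck_fst Ck_const] Ck_weight[OF assms, of "Suc 0"]]
      pderiv_mult[OF Ck_diff[OF Ck_snd Ck_const] Ck_weight[OF assms, of "Suc 0"]]
      pderiv_diff[OF Ck_fst Ck_const] pderiv_diff[OF Ck_snd Ck_const] pderiv_fst pderiv_snd pderiv_const pderiv_weight[OF assms]
    by (simp add: power2_eq_square algebra_simps)
  also have "\<dots> = 2 * weight e 0 z * (weight e 0 z * reg_sq e 0 z) - 2 * ((fst z)\<^sup>2 + (snd z)\<^sup>2) * (weight e 0 z)\<^sup>2"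
    by (simp add: w)
  also have "\<dots> = poisson e z"
    by (simp add: poisson_def reg_sq_def power2_eq_square algebra_simps)
  finally show ?thesis
    unfolding pderiv_log_kernel[OF assms] .
qed

lemma log_kernel_diff: "log_kernel e 0 (x - y) = log_kernel e x y"
  by (simp add: log_kernel_def reg_sq_def power2_commute)

lemma continuous_jacobian:
  assumes "Ck 1 b" "Ck 1 c" shows "continuous_on UNIV (jacobian b c)"
  unfolding jacobian_def[abs_def]
  by (intro continuous_on_diff continuous_on_mult Ck_continuous[of 0] Ck_Suc_dx Ck_Suc_dy assms[unfolded One_nat_def])

lemma vanishes_beyond_jacobian:
  "vanishes_beyond R c \<Longrightarrow> vanishes_beyond R (jacobian b c)"
  unfolding jacobian_def[abs_def]
  by (intro vanishes_beyond_diff vanishes_beyond_mult_right vanishes_beyond_pderiv)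

text \<open>Since mixed derivatives commute, the Jacobian is the divergence of \<open>b\<close>
  times the rotated gradient of \<open>c\<close>. Moving that divergence onto the kernel pairs the
  radial gradient of the kernel with a rotated gradient, which leaves the weight times an angular
  derivative of \<open>c\<close>: the situation of \<open>weighted_jacobian_le\<close>.\<close>

lemma log_potential_bound:
  assumes e: "e > 0" and b: "Ck 2 b" "vanishes_beyond R b" and c: "Ck 2 c" "vanishes_beyond R c"
  shows "\<bar>conv (log_kernel e 0) (jacobian b c) x\<bar> \<le> 2 * pi * (sqrt (energy b) * sqrt (energy c))"
proof -
  let ?k = "log_kernel e x"
  have b2: "Ck (Suc (Suc 0)) b" "Ck (Suc (Suc 0)) c" using b c by (simp_all add: numeral_2_eq_2)
  note b1 = b2[THEN Ck_SucD]
  note c1 = Ck_Suc_dx[OF b2(2)] Ck_Suc_dy[OF b2(2)]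
  note k1 = Ck_log_kernel[OF e, of "Suc 0" x]
  have kb: "Ck (Suc 0) (\<lambda>y. ?k y * b y)" by (intro Ck_mult k1 b1)
  let ?U = "\<lambda>y. ?k y * b y * dy c y" and ?V = "\<lambda>y. ?k y * b y * dx c y"
  have UV: "Ck (Suc 0) ?U" "Ck (Suc 0) ?V" "vanishes_beyond R ?U" "vanishes_beyond R ?V"
    by (intro Ck_mult kb c1 vanishes_beyond_mult_right vanishes_beyond_pderiv c)+
  have "jacobian b c y * ?k y = dx ?U y - dy ?V y - weight e x y * b y * angular_deriv x c y" for y
    unfolding pderiv_mult[OF kb c1(1)] pderiv_mult[OF kb c1(2)] pderiv_mult[OF k1 b1(1)] dx_dy_commute[OF b2(2)]
      pderiv_log_kernel[OF e]
    by (simp add: jacobian_def angular_deriv_def algebra_simps)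
  then have eq: "conv (log_kernel e 0) (jacobian b c) x
    = (\<integral>y. dx ?U y - dy ?V y - weight e x y * b y * angular_deriv x c y \<partial>lborel)"
    by (simp add: conv_def log_kernel_diff mult.commute)
  have "integrable lborel (dx ?U)" "integrable lborel (dy ?V)"
    using UV by (auto intro!: continuous_bounded_support_integrable[of _ R] vanishes_beyond_pderiv Ck_continuous[of 0] Ck_Suc_dx Ck_Suc_dy simp del: Ck.simps)
  moreover have "integrable lborel (\<lambda>y. weight e x y * b y * angular_deriv x c y)"
    by (intro continuous_bounded_support_integrable[of _ R] continuous_on_mult Ck_continuous[OF Ck_weight[OF e]]
        Ck_continuous[OF b1(1)] Ck_continuous[OF Ck_angular_deriv[OF b1(2)]] vanishes_beyond_mult_right vanishes_beyond_angular_deriv c)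
  ultimately have "conv (log_kernel e 0) (jacobian b c) x = - (\<integral>y. weight e x y * b y * angular_deriv x c y \<partial>lborel)"
    unfolding eq using integral_dx_eq_0[OF _ UV(3)] integral_dy_eq_0[OF _ UV(4)] UV by simp
  then show ?thesis
    using weighted_jacobian_le[OF e b c, of x] by simp
qed

text \<open>The pointwise bound comes from the identity for the squares of the cross and the inner
  product of two vectors. The L^1 bound controls the Laplacian of the potential, which enters the
  energy estimate multiplied by the bound on the potential itself.\<close>

lemma integral_jacobian_le:
  assumes b: "Ck 1 b" "vanishes_beyond R b" and c: "Ck 1 c" "vanishes_beyond R c"
  shows "(\<integral>y. \<bar>jacobian b c y\<bar> \<partial>lborel) \<le> sqrt (energy b) * sqrt (energy c)"
proof -
  let ?n = "\<lambda>u y. sqrt ((dx u y)\<^sup>2 + (dy u y)\<^sup>2)"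
  have cont: "continuous_on UNIV (dx u)" "continuous_on UNIV (dy u)" if "Ck 1 u" for u
    using that Ck_continuous[of 0] Ck_Suc_dx[of 0 u] Ck_Suc_dy[of 0 u] by (auto simp del: Ck.simps)
  have m: "?n u \<in> borel_measurable lborel" if "Ck 1 u" for u
    using cont[OF that] by (auto intro!: borel_measurable_continuous_onI continuous_intros)
  have sq: "(?n u y)\<^sup>2 = (dx u y)\<^sup>2 + (dy u y)\<^sup>2" for u y by simp
  note CS = integral_Cauchy_Schwarz[OF m[OF b(1)] m[OF c(1)], unfolded sq, OF energy_integrable(3)[OF b] energy_integrable(3)[OF c]]
  have "\<bar>jacobian b c y\<bar> \<le> ?n b y * ?n c y" for y
  proof -
    have "(jacobian b c y)\<^sup>2 \<le> ((dx b y)\<^sup>2 + (dy b y)\<^sup>2) * ((dx c y)\<^sup>2 + (dy c y)\<^sup>2)"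
    proof -
      have "(jacobian b c y)\<^sup>2 + (dx b y * dx c y + dy b y * dy c y)\<^sup>2 = ((dx b y)\<^sup>2 + (dy b y)\<^sup>2) * ((dx c y)\<^sup>2 + (dy c y)\<^sup>2)"
        by (simp only: power2_eq_square jacobian_def) algebra
      then show ?thesis using zero_le_power2[of "dx b y * dx c y + dy b y * dy c y"] by linarith
    qed
    then have "sqrt ((jacobian b c y)\<^sup>2) \<le> sqrt (((dx b y)\<^sup>2 + (dy b y)\<^sup>2) * ((dx c y)\<^sup>2 + (dy c y)\<^sup>2))"
      by (rule real_sqrt_le_mono)
    then show ?thesis by (simp only: real_sqrt_mult real_sqrt_abs)
  qed
  then have "(\<integral>y. \<bar>jacobian b c y\<bar> \<partial>lborel) \<le> (\<integral>y. ?n b y * ?n c y \<partial>lborel)"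
    using CS(1) continuous_bounded_support_integrable[OF continuous_jacobian[OF b(1) c(1)] vanishes_beyond_jacobian[OF c(2)]]
    by (intro integral_mono) auto
  also have "\<dots> \<le> sqrt (energy b) * sqrt (energy c)"
    using CS(2) by (simp add: energy_def)
  finally show ?thesis .
qed

section \<open>The Poisson kernel as an approximate identity\<close>

lemma nn_integral_inverse_1_plus_square: "(\<integral>\<^sup>+ x. ennreal (inverse (1 + x\<^sup>2)) \<partial>lborel) < \<infinity>"
proof -
  let ?f = "\<lambda>x::real. inverse (1 + x\<^sup>2)"
  have 1: "(\<integral>\<^sup>+ x. ennreal (?f x) * indicator {0..} x \<partial>lborel) = ennreal (pi / 2 - arctan 0)"
    by (rule nn_integral_FTC_atLeast)
      (auto intro!: DERIV_arctan tendsto_arctan_at_top)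
  have 2: "(\<integral>\<^sup>+ x. ennreal (?f x) * indicator {..0} x \<partial>lborel) = ennreal (pi / 2 - arctan 0)"
  proof -
    have "(\<integral>\<^sup>+ x. ennreal (?f x) * indicator {..0} x \<partial>lborel) = (\<integral>\<^sup>+ x. ennreal (?f x) * indicator {0..} x \<partial>lborel)"
      by (subst nn_integral_real_affine[where c="-1" and t=0]) (auto simp: indicator_def intro!: nn_integral_cong)
    then show ?thesis using 1 by simp
  qed
  have "(\<integral>\<^sup>+ x. ennreal (?f x) \<partial>lborel) \<le>
    (\<integral>\<^sup>+ x. ennreal (?f x) * indicator {0..} x + ennreal (?f x) * indicator {..0} x \<partial>lborel)"
    by (intro nn_integral_mono) (auto simp: indicator_def)
  also have "\<dots> = ennreal (pi / 2 - arctan 0) + ennreal (pi / 2 - arctan 0)"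
    by (subst nn_integral_add) (simp_all only: 1 2, auto)
  also have "\<dots> < \<infinity>" by simp
  finally show ?thesis .
qed

lemma continuous_poisson: "e > 0 \<Longrightarrow> continuous_on UNIV (poisson e)"
  unfolding poisson_def[abs_def] by (intro continuous_intros Ck_continuous[OF Ck_weight])

lemma poisson_pos: "e > 0 \<Longrightarrow> poisson e z > 0"
  using weight_pos[of e 0 z] by (simp add: poisson_def)

text \<open>The kernel is dominated by a product of functions of one coordinate each, so
  integrability follows from Tonelli and the arctangent instead of polar coordinates.\<close>

lemma integrable_poisson: "integrable lborel (poisson 1)"
proof (rule integrableI_bounded)
  show "poisson 1 \<in> borel_measurable lborel"
    using continuous_poisson[of 1] by (auto intro: borel_measurable_continuous_onI)
  have le: "poisson 1 (x, y) \<le> 2 * (inverse (1 + x\<^sup>2) * inverse (1 + y\<^sup>2))" for x y :: real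
  proof -
    have "(1 + x\<^sup>2) * (1 + y\<^sup>2) \<le> (x\<^sup>2 + y\<^sup>2 + 1)\<^sup>2"
    proof -
      have "(x\<^sup>2 + y\<^sup>2 + 1)\<^sup>2 = (1 + x\<^sup>2) * (1 + y\<^sup>2) + (x\<^sup>2 + y\<^sup>2 + x\<^sup>2 * x\<^sup>2 + y\<^sup>2 * y\<^sup>2 + x\<^sup>2 * y\<^sup>2)"
        by (simp only: power2_eq_square) algebra
      then show ?thesis by simp
    qed
    moreover have "(1 + x\<^sup>2) * (1 + y\<^sup>2) > 0" by (intro mult_pos_pos) (simp_all add: add_pos_nonneg)
    ultimately have "inverse ((x\<^sup>2 + y\<^sup>2 + 1)\<^sup>2) \<le> inverse ((1 + x\<^sup>2) * (1 + y\<^sup>2))"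
      by (rule le_imp_inverse_le)
    then show ?thesis
      by (simp add: poisson_def weight_def reg_sq_def power_inverse)
  qed
  have "(\<integral>\<^sup>+ z. ennreal (norm (poisson 1 z)) \<partial>lborel)
    \<le> (\<integral>\<^sup>+ z. ennreal 2 * (ennreal (inverse (1 + (fst z)\<^sup>2)) * ennreal (inverse (1 + (snd z)\<^sup>2))) \<partial>(lborel :: plane measure))"
  proof (rule nn_integral_mono)
    fix z :: plane
    have "norm (poisson 1 z) \<le> 2 * (inverse (1 + (fst z)\<^sup>2) * inverse (1 + (snd z)\<^sup>2))"
      using le[of "fst z" "snd z"] poisson_pos[of 1 z] by simp
    then have "ennreal (norm (poisson 1 z)) \<le> ennreal (2 * (inverse (1 + (fst z)\<^sup>2) * inverse (1 + (snd z)\<^sup>2)))"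
      by (rule ennreal_leI)
    then show "ennreal (norm (poisson 1 z)) \<le> ennreal 2 * (ennreal (inverse (1 + (fst z)\<^sup>2)) * ennreal (inverse (1 + (snd z)\<^sup>2)))"
      by (subst (asm) ennreal_mult, simp, simp, subst (asm) ennreal_mult) simp_all
  qed
  also have "\<dots> = ennreal 2 * (\<integral>\<^sup>+ z. ennreal (inverse (1 + (fst z)\<^sup>2)) * ennreal (inverse (1 + (snd z)\<^sup>2)) \<partial>(lborel \<Otimes>\<^sub>M lborel))"
    unfolding lborel_prod[symmetric] by (rule nn_integral_cmult) measurable
  also have "(\<integral>\<^sup>+ z. ennreal (inverse (1 + (fst z)\<^sup>2)) * ennreal (inverse (1 + (snd z)\<^sup>2)) \<partial>(lborel \<Otimes>\<^sub>M lborel))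
    = (\<integral>\<^sup>+ x. \<integral>\<^sup>+ y. ennreal (inverse (1 + x\<^sup>2)) * ennreal (inverse (1 + y\<^sup>2)) \<partial>lborel \<partial>lborel)"
    by (subst lborel.nn_integral_fst[symmetric]) auto
  also have "\<dots> = (\<integral>\<^sup>+ x. ennreal (inverse (1 + x\<^sup>2)) \<partial>lborel) * (\<integral>\<^sup>+ y. ennreal (inverse (1 + y\<^sup>2)) \<partial>lborel)"
    by (simp add: nn_integral_cmult nn_integral_multc)
  also have "ennreal 2 * \<dots> < \<infinity>"
    using nn_integral_inverse_1_plus_square by (simp add: ennreal_mult_less_top)
  finally show "(\<integral>\<^sup>+ z. ennreal (norm (poisson 1 z)) \<partial>lborel) < \<infinity>" .
qed

text \<open>Its value is \<open>2 * pi\<close>; it is kept symbolic, and positivity lets the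
  estimates divide by it.\<close>

definition poisson_mass :: real where
  "poisson_mass = (\<integral>z. poisson 1 z \<partial>lborel)"

lemma poisson_mass_pos: "poisson_mass > 0"
proof -
  have "poisson_mass \<noteq> 0"
  proof
    assume "poisson_mass = 0"
    then have "AE z in lborel. poisson 1 z = 0"
      unfolding poisson_mass_def using integrable_poisson poisson_pos[of 1]
      by (subst (asm) integral_nonneg_eq_0_iff_AE) (auto intro!: AE_I2 less_imp_le)
    then have "AE z in lborel::plane measure. False"
      using poisson_pos[of 1] by (auto elim!: eventually_mono) (metis less_irrefl zero_less_one)
    then have "UNIV \<in> null_sets (lborel :: plane measure)" by (simp add: AE_iff_null)
    then show False by (simp add: null_sets_def)
  qed
  moreover have "poisson_mass \<ge> 0"
    unfolding poisson_mass_def by (intro Bochner_Integration.integral_nonneg less_imp_le poisson_pos) simp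
  ultimately show ?thesis by simp
qed

lemma lborel_integral_plane_affine:
  fixes f :: "plane \<Rightarrow> real"
  assumes "c \<noteq> 0" "f \<in> borel_measurable borel"
  shows "(\<integral>y. f y \<partial>lborel) = c\<^sup>2 * (\<integral>z. f (t + c *\<^sub>R z) \<partial>lborel)"
proof -
  have "(\<integral>y. f y \<partial>lborel) = (\<integral>y. f y \<partial>(density (distr lborel borel (\<lambda>x. t + c *\<^sub>R x)) (\<lambda>_. \<bar>c\<bar>^DIM(plane))))"
    using lborel_affine[OF assms(1), of t] by simp
  also have "\<dots> = (\<integral>y. c\<^sup>2 *\<^sub>R f y \<partial>(distr lborel borel (\<lambda>x. t + c *\<^sub>R x)))"
    using assms(2) by (subst integral_density) (auto simp: numeral_2_eq_2)
  also have "\<dots> = (\<integral>z. c\<^sup>2 *\<^sub>R f (t + c *\<^sub>R z) \<partial>lborel)"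
    using assms(2) by (subst integral_distr) auto
  finally show ?thesis by simp
qed

lemma poisson_scale:
  assumes "e > 0" shows "e\<^sup>2 * poisson e (e *\<^sub>R z) = poisson 1 z"
proof -
  have "reg_sq e 0 (e *\<^sub>R z) = e\<^sup>2 * reg_sq 1 0 z"
    by (simp add: reg_sq_def power2_eq_square algebra_simps)
  then show ?thesis
    using assms by (simp add: poisson_def weight_def power2_eq_square field_simps)
qed

text \<open>Substituting y = x - e z moves the parameter from the kernel into the argument of
  \<open>m\<close>. From here on the weight is the fixed function \<open>poisson 1\<close>, ready
  for dominated convergence and for Fubini.\<close>

lemma conv_poisson:
  assumes e: "e > 0" and m: "continuous_on UNIV m"
  shows "conv (poisson e) m x = (\<integral>z. poisson 1 z * m (x - e *\<^sub>R z) \<partial>lborel)"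
proof -
  have "continuous_on UNIV (\<lambda>y. poisson e (x - y) * m y)"
    by (intro continuous_on_mult continuous_on_diff_compose continuous_poisson e m)
  then have "conv (poisson e) m x = (- e)\<^sup>2 * (\<integral>z. poisson e (x - (x + (- e) *\<^sub>R z)) * m (x + (- e) *\<^sub>R z) \<partial>lborel)"
    unfolding conv_def using e by (intro lborel_integral_plane_affine) (auto intro: borel_measurable_continuous_onI)
  also have "\<dots> = (\<integral>z. e\<^sup>2 * poisson e (e *\<^sub>R z) * m (x - e *\<^sub>R z) \<partial>lborel)"
    by (simp add: mult.assoc)
  finally show ?thesis by (simp only: poisson_scale[OF e])
qed

lemma poisson_mult_le: "\<bar>s\<bar> \<le> B \<Longrightarrow> norm (poisson 1 z * s) \<le> B * poisson 1 z"
  using mult_left_mono[of "\<bar>s\<bar>" B "poisson 1 z"] poisson_pos[of 1 z] by (simp add: abs_mult mult.commute)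

lemma integrable_poisson_mult:
  assumes m: "continuous_on UNIV m" "\<And>x. \<bar>m x\<bar> \<le> B"
  shows "integrable lborel (\<lambda>z. poisson 1 z * m (x - e *\<^sub>R z))"
proof (rule Bochner_Integration.integrable_bound)
  show "integrable lborel (\<lambda>z. B * poisson 1 z)" using integrable_poisson by simp
  have "continuous_on UNIV (\<lambda>z. poisson 1 z * m (x - e *\<^sub>R z))"
    by (intro continuous_on_mult continuous_poisson continuous_on_compose2[OF m(1)] continuous_intros) auto
  then show "(\<lambda>z. poisson 1 z * m (x - e *\<^sub>R z)) \<in> borel_measurable lborel"
    by (auto intro: borel_measurable_continuous_onI)
  show "AE z in lborel. norm (poisson 1 z * m (x - e *\<^sub>R z)) \<le> norm (B * poisson 1 z)"
    by (rule AE_I2, rule order_trans[OF poisson_mult_le[OF m(2)]]) simp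
qed

lemma conv_poisson_bound:
  assumes e: "e > 0" and m: "continuous_on UNIV m" "\<And>x. \<bar>m x\<bar> \<le> B"
  shows "\<bar>conv (poisson e) m x\<bar> \<le> poisson_mass * B"
proof -
  have "norm (\<integral>z. poisson 1 z * m (x - e *\<^sub>R z) \<partial>lborel) \<le> (\<integral>z. norm (poisson 1 z * m (x - e *\<^sub>R z)) \<partial>lborel)"
    by (rule integral_norm_bound)
  also have "\<dots> \<le> (\<integral>z. B * poisson 1 z \<partial>lborel)"
    by (intro integral_mono integrable_norm integrable_poisson_mult[OF m] poisson_mult_le m integrable_mult_right integrable_poisson)
  finally show ?thesis
    by (simp add: conv_poisson[OF e m(1)] poisson_mass_def mult.commute)
qed

lemma conv_poisson_tendsto:
  assumes m: "continuous_on UNIV m" "\<And>x. \<bar>m x\<bar> \<le> B" and e: "\<And>n. e n > 0" "e \<longlonglongrightarrow> 0"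
  shows "(\<lambda>n. conv (poisson (e n)) m x) \<longlonglongrightarrow> poisson_mass * m x"
proof -
  have "(\<lambda>n. \<integral>z. poisson 1 z * m (x - e n *\<^sub>R z) \<partial>lborel) \<longlonglongrightarrow> (\<integral>z. poisson 1 z * m x \<partial>lborel)"
  proof (rule integral_dominated_convergence[where w="\<lambda>z. B * poisson 1 z"])
    show "integrable lborel (\<lambda>z. B * poisson 1 z)" using integrable_poisson by simp
    show "(\<lambda>z. poisson 1 z * m x) \<in> borel_measurable lborel"
      "(\<lambda>z. poisson 1 z * m (x - e n *\<^sub>R z)) \<in> borel_measurable lborel" for n
      using integrable_poisson integrable_poisson_mult[OF m] by (auto dest!: borel_measurable_integrable)
    show "AE z in lborel. norm (poisson 1 z * m (x - e n *\<^sub>R z)) \<le> B * poisson 1 z" for n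
      by (rule AE_I2, rule poisson_mult_le[OF m(2)])
    show "AE z in lborel. (\<lambda>n. poisson 1 z * m (x - e n *\<^sub>R z)) \<longlonglongrightarrow> poisson 1 z * m x"
    proof (rule AE_I2)
      fix z
      have "(\<lambda>n. x - e n *\<^sub>R z) \<longlonglongrightarrow> x - 0 *\<^sub>R z"
        by (intro tendsto_intros e)
      then have "(\<lambda>n. m (x - e n *\<^sub>R z)) \<longlonglongrightarrow> m x"
        by (intro continuous_on_tendsto_compose[OF m(1)]) auto
      then show "(\<lambda>n. poisson 1 z * m (x - e n *\<^sub>R z)) \<longlonglongrightarrow> poisson 1 z * m x"
        by (intro tendsto_intros)
    qed
  qed
  then show ?thesis
    by (simp add: conv_poisson[OF e(1) m(1)] poisson_mass_def)
qed

text \<open>A Caccioppoli estimate: the divergence of \<open>\<eta> * \<eta> * f\<close> times the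
  gradient of \<open>f\<close> integrates to 0. It trades the local energy of \<open>f\<close> for
  its supremum times the mass of its Laplacian, plus a term for the cutoff.\<close>

lemma cutoff_energy_bound:
  assumes f: "Ck 2 f" "\<And>x. \<bar>f x\<bar> \<le> M" and \<eta>: "Ck 1 \<eta>" "vanishes_beyond R \<eta>"
  shows "(\<integral>x. (\<eta> x)\<^sup>2 * ((dx f x)\<^sup>2 + (dy f x)\<^sup>2) \<partial>lborel)
    \<le> 2 * M * (\<integral>x. (\<eta> x)\<^sup>2 * \<bar>dx (dx f) x + dy (dy f) x\<bar> \<partial>lborel) + 4 * M\<^sup>2 * energy \<eta>"
proof -
  note c1 = \<eta>(1)[unfolded One_nat_def]
  have f2: "Ck (Suc (Suc 0)) f" using f by (simp add: numeral_2_eq_2)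
  note f1 = Ck_SucD[OF f2]
  note d1 = Ck_Suc_dx[OF f2] Ck_Suc_dy[OF f2]
  have s: "Ck (Suc 0) (\<lambda>x. \<eta> x * \<eta> x * f x)" "Ck (Suc 0) (\<lambda>x. \<eta> x * \<eta> x)" by (intro Ck_mult c1 f1)+
  let ?U = "\<lambda>x. \<eta> x * \<eta> x * f x * dx f x" and ?V = "\<lambda>x. \<eta> x * \<eta> x * f x * dy f x"
  have UV: "Ck (Suc 0) ?U" "Ck (Suc 0) ?V" "vanishes_beyond R ?U" "vanishes_beyond R ?V"
    by (intro Ck_mult s d1 vanishes_beyond_mult_left \<eta>)+
  note cont = Ck_continuous[OF c1] Ck_continuous[OF Ck_Suc_dx[OF c1]] Ck_continuous[OF Ck_Suc_dy[OF c1]]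
    Ck_continuous[OF d1(1)] Ck_continuous[OF d1(2)] Ck_continuous[OF Ck_Suc_dx[OF d1(1)]] Ck_continuous[OF Ck_Suc_dy[OF d1(2)]]
  have i1: "integrable lborel (\<lambda>x. (\<eta> x)\<^sup>2 * ((dx f x)\<^sup>2 + (dy f x)\<^sup>2))"
    "integrable lborel (\<lambda>x. (\<eta> x)\<^sup>2 * \<bar>dx (dx f) x + dy (dy f) x\<bar>)"
    by (intro continuous_bounded_support_integrable[of _ R] continuous_intros cont;
        simp add: vanishes_beyond_def vanishes_beyondD[OF \<eta>(2)])+
  have i2: "integrable lborel (dx ?U)" "integrable lborel (dy ?V)"
    using UV by (auto intro!: continuous_bounded_support_integrable[of _ R] vanishes_beyond_pderiv Ck_continuous[of 0] Ck_Suc_dx Ck_Suc_dy simp del: Ck.simps)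
  \<comment> \<open>Young's inequality absorbs half of the left side in the terms where the
    derivative falls on the cutoff; solving for the left side doubles everything else, hence the
    factors 2, 2 and 4.\<close>
  have point: "(\<eta> x)\<^sup>2 * ((dx f x)\<^sup>2 + (dy f x)\<^sup>2) \<le> 2 * (dx ?U x + dy ?V x)
      + (2 * M * ((\<eta> x)\<^sup>2 * \<bar>dx (dx f) x + dy (dy f) x\<bar>) + 4 * M\<^sup>2 * ((dx \<eta> x)\<^sup>2 + (dy \<eta> x)\<^sup>2))" for x
  proof -
    define X p q P Q L F where "X = \<eta> x" and "p = dx \<eta> x" and "q = dy \<eta> x" and "P = dx f x" and "Q = dy f x"
      and "L = dx (dx f) x + dy (dy f) x" and "F = f x"
    have UV_eq: "dx ?U x + dy ?V x = X\<^sup>2 * (P\<^sup>2 + Q\<^sup>2) + X\<^sup>2 * (F * L) + 2 * X * F * (p * P + q * Q)"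
      unfolding pderiv_mult[OF s(1) d1(1)] pderiv_mult[OF s(1) d1(2)] pderiv_mult[OF s(2) f1] pderiv_mult[OF c1 c1]
        X_def p_def q_def P_def Q_def L_def F_def by (simp add: power2_eq_square algebra_simps)
    have "- (2 * X * F * p * P) \<le> X\<^sup>2 * P\<^sup>2 / 2 + 2 * (F\<^sup>2 * p\<^sup>2)" for p P :: real
      using zero_le_power2[of "X * P + 2 * F * p"] by (simp add: power2_eq_square algebra_simps)
    from this[of p P] this[of q Q]
    have 1: "- (2 * X * F * (p * P + q * Q)) \<le> X\<^sup>2 * (P\<^sup>2 + Q\<^sup>2) / 2 + 2 * (F\<^sup>2 * (p\<^sup>2 + q\<^sup>2))"
      by (simp add: algebra_simps add_divide_distrib)
    have "F\<^sup>2 \<le> M\<^sup>2"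
      using f(2)[of x] unfolding F_def by (metis abs_ge_zero power2_abs power_mono)
    then have 2: "F\<^sup>2 * (p\<^sup>2 + q\<^sup>2) \<le> M\<^sup>2 * (p\<^sup>2 + q\<^sup>2)" by (intro mult_right_mono) auto
    have "- (F * L) \<le> \<bar>F\<bar> * \<bar>L\<bar>" by (metis abs_ge_minus_self abs_mult)
    also have "\<dots> \<le> M * \<bar>L\<bar>" using f(2)[of x] by (intro mult_right_mono) (auto simp: F_def)
    finally have 3: "X\<^sup>2 * - (F * L) \<le> X\<^sup>2 * (M * \<bar>L\<bar>)" by (intro mult_left_mono) auto
    show ?thesis
      unfolding UV_eq unfolding X_def[symmetric] p_def[symmetric] q_def[symmetric] P_def[symmetric] Q_def[symmetric] L_def[symmetric]
      using 1 2 3 by (simp add: algebra_simps add_divide_distrib)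
  qed
  have "(\<integral>x. (\<eta> x)\<^sup>2 * ((dx f x)\<^sup>2 + (dy f x)\<^sup>2) \<partial>lborel) \<le> (\<integral>x. 2 * (dx ?U x + dy ?V x)
      + (2 * M * ((\<eta> x)\<^sup>2 * \<bar>dx (dx f) x + dy (dy f) x\<bar>) + 4 * M\<^sup>2 * ((dx \<eta> x)\<^sup>2 + (dy \<eta> x)\<^sup>2)) \<partial>lborel)"
    by (intro integral_mono Bochner_Integration.integrable_add integrable_mult_right i1 i2 energy_integrable[OF \<eta>] point)
  also have "\<dots> = 2 * ((\<integral>x. dx ?U x \<partial>lborel) + (\<integral>x. dy ?V x \<partial>lborel))
      + (2 * M * (\<integral>x. (\<eta> x)\<^sup>2 * \<bar>dx (dx f) x + dy (dy f) x\<bar> \<partial>lborel) + 4 * M\<^sup>2 * energy \<eta>)"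
    unfolding energy_def using i1 i2 energy_integrable[OF \<eta>] by simp
  finally show ?thesis
    using integral_dx_eq_0[OF _ UV(3)] integral_dy_eq_0[OF _ UV(4)] UV by simp
qed

text \<open>Convolution with a kernel of mass \<open>poisson_mass\<close> raises the L^1 norm at
  most by that factor. Nonnegative integrals let Fubini apply before integrability is known; the
  cutoff makes the left side integrable.\<close>

lemma integral_cutoff_conv_poisson_le:
  assumes e: "e > 0" and m: "continuous_on UNIV m" "vanishes_beyond R m"
    and \<eta>: "continuous_on UNIV \<eta>" "vanishes_beyond R' \<eta>" "\<And>x. 0 \<le> \<eta> x \<and> \<eta> x \<le> 1"
  shows "(\<integral>x. (\<eta> x)\<^sup>2 * \<bar>conv (poisson e) m x\<bar> \<partial>lborel) \<le> poisson_mass * (\<integral>x. \<bar>m x\<bar> \<partial>lborel)"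
proof -
  let ?I = "\<integral>x. \<bar>m x\<bar> \<partial>lborel"
  obtain B where B: "\<And>x. \<bar>m x\<bar> \<le> B" using continuous_bounded_support_bounded[OF m] by metis
  have am: "continuous_on UNIV (\<lambda>x. \<bar>m x\<bar>)" "\<And>x. \<bar>\<bar>m x\<bar>\<bar> \<le> B" "integrable lborel (\<lambda>x. \<bar>m x\<bar>)"
    using m B continuous_bounded_support_integrable[OF m] by (auto intro!: continuous_intros)
  have cP: "continuous_on UNIV (conv (poisson e) m)"
    by (rule continuous_on_conv[OF continuous_poisson[OF e] m])
  have i: "integrable lborel (\<lambda>x. (\<eta> x)\<^sup>2 * \<bar>conv (poisson e) m x\<bar>)"
    by (intro continuous_bounded_support_integrable[of _ R'] continuous_intros \<eta> cP)
      (simp add: vanishes_beyond_def vanishes_beyondD[OF \<eta>(2)])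
  have P0: "0 \<le> poisson 1 z" for z by (intro less_imp_le poisson_pos) simp
  have 1: "ennreal ((\<eta> x)\<^sup>2 * \<bar>conv (poisson e) m x\<bar>) \<le> (\<integral>\<^sup>+ z. ennreal (poisson 1 z * \<bar>m (x - e *\<^sub>R z)\<bar>) \<partial>lborel)" for x
  proof -
    have "(\<eta> x)\<^sup>2 \<le> 1" using \<eta>(3)[of x] by (simp add: power_le_one)
    then have "(\<eta> x)\<^sup>2 * \<bar>conv (poisson e) m x\<bar> \<le> \<bar>conv (poisson e) m x\<bar>"
      using mult_right_mono[of "(\<eta> x)\<^sup>2" 1 "\<bar>conv (poisson e) m x\<bar>"] by simp
    also have "\<dots> \<le> (\<integral>z. norm (poisson 1 z * m (x - e *\<^sub>R z)) \<partial>lborel)"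
      unfolding conv_poisson[OF e m(1)] using integral_norm_bound[of lborel "\<lambda>z. poisson 1 z * m (x - e *\<^sub>R z)"] by simp
    also have "\<dots> = (\<integral>z. poisson 1 z * \<bar>m (x - e *\<^sub>R z)\<bar> \<partial>lborel)"
      by (simp add: abs_mult P0)
    finally have "ennreal ((\<eta> x)\<^sup>2 * \<bar>conv (poisson e) m x\<bar>) \<le> ennreal \<dots>"
      by (rule ennreal_leI)
    also have "\<dots> = (\<integral>\<^sup>+ z. ennreal (poisson 1 z * \<bar>m (x - e *\<^sub>R z)\<bar>) \<partial>lborel)"
      by (rule nn_integral_eq_integral[symmetric])
        (use integrable_poisson_mult[OF am(1,2)] P0 in auto)
    finally show ?thesis .
  qed
  have "ennreal (\<integral>x. (\<eta> x)\<^sup>2 * \<bar>conv (poisson e) m x\<bar> \<partial>lborel) = (\<integral>\<^sup>+ x. ennreal ((\<eta> x)\<^sup>2 * \<bar>conv (poisson e) m x\<bar>) \<partial>lborel)"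
    by (rule nn_integral_eq_integral[symmetric, OF i]) simp
  also have "\<dots> \<le> (\<integral>\<^sup>+ x. \<integral>\<^sup>+ z. ennreal (poisson 1 z * \<bar>m (x - e *\<^sub>R z)\<bar>) \<partial>lborel \<partial>lborel)"
    by (intro nn_integral_mono 1)
  also have "\<dots> = (\<integral>\<^sup>+ z. \<integral>\<^sup>+ x. ennreal (poisson 1 z * \<bar>m (x - e *\<^sub>R z)\<bar>) \<partial>lborel \<partial>lborel)"
  proof (rule lborel_pair.Fubini'[symmetric])
    have "continuous_on UNIV (\<lambda>q::plane \<times> plane. poisson 1 (snd q) * \<bar>m (fst q - e *\<^sub>R snd q)\<bar>)"
      by (intro continuous_intros continuous_on_compose2[OF continuous_poisson[of 1]] continuous_on_compose2[OF m(1)]) auto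
    from borel_measurable_continuous_onI[OF this]
    show "(\<lambda>(x, z). ennreal (poisson 1 z * \<bar>m (x - e *\<^sub>R z)\<bar>)) \<in> borel_measurable (lborel \<Otimes>\<^sub>M lborel)"
      unfolding lborel_prod split_beta by (intro measurable_compose[OF _ measurable_ennreal]) simp
  qed
  also have "\<dots> = (\<integral>\<^sup>+ z. ennreal (poisson 1 z) * ennreal ?I \<partial>lborel)"
  proof (rule nn_integral_cong)
    fix z :: plane
    have mm: "(\<lambda>x. \<bar>m x\<bar>) \<in> borel_measurable borel" using am(1) by (rule borel_measurable_continuous_onI)
    have ms: "(\<lambda>x. \<bar>m (x - e *\<^sub>R z)\<bar>) \<in> borel_measurable borel"
      by (intro borel_measurable_continuous_onI continuous_on_compose2[OF am(1)] continuous_intros) auto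
    have "(\<integral>\<^sup>+ x. ennreal (poisson 1 z * \<bar>m (x - e *\<^sub>R z)\<bar>) \<partial>lborel) = ennreal (poisson 1 z) * (\<integral>\<^sup>+ x. ennreal (\<bar>m (x - e *\<^sub>R z)\<bar>) \<partial>lborel)"
      using ms by (simp add: ennreal_mult P0 nn_integral_cmult)
    also have "(\<integral>\<^sup>+ x. ennreal (\<bar>m (x - e *\<^sub>R z)\<bar>) \<partial>lborel) = (\<integral>\<^sup>+ x. ennreal \<bar>m x\<bar> \<partial>lborel)"
    proof -
      have "(\<integral>\<^sup>+ x. ennreal \<bar>m x\<bar> \<partial>lborel) = (\<integral>\<^sup>+ x. ennreal \<bar>m x\<bar> \<partial>(distr lborel borel ((+) (- e *\<^sub>R z))))"
        by (simp only: lborel_distr_plus)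
      also have "\<dots> = (\<integral>\<^sup>+ x. ennreal \<bar>m (- e *\<^sub>R z + x)\<bar> \<partial>lborel)"
        using mm by (subst nn_integral_distr) auto
      finally show ?thesis by simp
    qed
    also have "\<dots> = ennreal ?I"
      by (rule nn_integral_eq_integral[OF am(3)]) simp
    finally show "(\<integral>\<^sup>+ x. ennreal (poisson 1 z * \<bar>m (x - e *\<^sub>R z)\<bar>) \<partial>lborel) = ennreal (poisson 1 z) * ennreal ?I" .
  qed
  also have "\<dots> = (\<integral>\<^sup>+ z. ennreal (poisson 1 z) \<partial>lborel) * ennreal ?I"
    by (rule nn_integral_multc) (use borel_measurable_integrable[OF integrable_poisson] in auto)
  also have "(\<integral>\<^sup>+ z. ennreal (poisson 1 z) \<partial>lborel) = ennreal poisson_mass"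
    unfolding poisson_mass_def by (rule nn_integral_eq_integral[OF integrable_poisson]) (simp add: P0)
  also have "ennreal poisson_mass * ennreal ?I = ennreal (poisson_mass * ?I)"
    using poisson_mass_pos by (simp add: ennreal_mult)
  finally show ?thesis
    using poisson_mass_pos by (subst (asm) ennreal_le_iff) (auto intro!: mult_nonneg_nonneg)
qed

text \<open>The logarithmic potential \<open>f\<close> of the Jacobian is bounded, hence has bounded
  energy on the support of the cutoff, and the integral of \<open>\<psi>\<close> against its Laplacian only sees the
  gradient of \<open>\<psi>\<close>.\<close>

lemma wente_inequality:
  assumes b: "Ck 2 b" "vanishes_beyond R b" and c: "Ck 2 c" "vanishes_beyond R c"
    and \<eta>: "Ck 1 \<eta>" "vanishes_beyond R' \<eta>" "\<And>x. 0 \<le> \<eta> x \<and> \<eta> x \<le> 1"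
    and \<psi>: "integrable lborel \<psi>"
    and g: "g1 \<in> borel_measurable lborel" "g2 \<in> borel_measurable lborel"
      "integrable lborel (\<lambda>x. (g1 x)\<^sup>2)" "integrable lborel (\<lambda>x. (g2 x)\<^sup>2)"
      "\<And>x. \<eta> x \<noteq> 1 \<Longrightarrow> g1 x = 0 \<and> g2 x = 0"
    and weak: "\<And>\<phi>. Ck 1 \<phi> \<Longrightarrow> integrable lborel (\<lambda>x. \<psi> x * dx \<phi> x) \<and> (\<integral>x. \<psi> x * dx \<phi> x \<partial>lborel) = - (\<integral>x. g1 x * \<phi> x \<partial>lborel)"
      "\<And>\<phi>. Ck 1 \<phi> \<Longrightarrow> integrable lborel (\<lambda>x. \<psi> x * dy \<phi> x) \<and> (\<integral>x. \<psi> x * dy \<phi> x \<partial>lborel) = - (\<integral>x. g2 x * \<phi> x \<partial>lborel)"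
  shows "\<bar>\<integral>x. \<psi> x * jacobian b c x \<partial>lborel\<bar> \<le> sqrt (4 * pi * poisson_mass + 16 * pi\<^sup>2 * energy \<eta>) / poisson_mass
    * (sqrt (\<integral>x. (g1 x)\<^sup>2 \<partial>lborel) + sqrt (\<integral>x. (g2 x)\<^sup>2 \<partial>lborel)) * (sqrt (energy b) * sqrt (energy c))"
proof -
  let ?m = "jacobian b c" and ?s = "sqrt (energy b) * sqrt (energy c)"
  have b1: "Ck 1 b" "Ck 1 c" using Ck_mono[OF b(1), of 1] Ck_mono[OF c(1), of 1] by simp_all
  have m: "continuous_on UNIV ?m" "vanishes_beyond R ?m"
    by (intro continuous_jacobian vanishes_beyond_jacobian b1 c)+
  obtain B where B: "\<And>x. \<bar>?m x\<bar> \<le> B" "B \<ge> 0" using continuous_bounded_support_bounded[OF m] by metis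
  \<comment> \<open>What \<open>cutoff_energy_bound\<close> gives with \<open>2 * pi * ?s\<close> as
    bound for the potential and \<open>poisson_mass * ?s\<close> as bound for the mass of its
    Laplacian.\<close>
  define A where "A = (4 * pi * poisson_mass + 16 * pi\<^sup>2 * energy \<eta>) * ?s\<^sup>2"
  let ?G1 = "sqrt (\<integral>x. (g1 x)\<^sup>2 \<partial>lborel)" and ?G2 = "sqrt (\<integral>x. (g2 x)\<^sup>2 \<partial>lborel)"
  have s0: "?s \<ge> 0" by (simp add: energy_nonneg)
  have main: "\<bar>\<integral>x. \<psi> x * conv (poisson e) ?m x \<partial>lborel\<bar> \<le> (?G1 + ?G2) * sqrt A" if e: "e > 0" for e
  proof -
    define f where "f = conv (log_kernel e 0) ?m"
    have k: "Ck n (log_kernel e 0)" for n by (rule Ck_log_kernel[OF e])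
    have f2: "Ck 2 f" unfolding f_def by (rule Ck_conv[OF k m])
    have df: "dx f = conv (dx (log_kernel e 0)) ?m" "dy f = conv (dy (log_kernel e 0)) ?m"
      unfolding f_def by (rule pderiv_conv[OF k m])+
    have dk: "Ck 1 (dx (log_kernel e 0))" "Ck 1 (dy (log_kernel e 0))"
      using Ck_Suc_dx[OF k] Ck_Suc_dy[OF k] by blast+
    have ddf: "dx (dx f) = conv (dx (dx (log_kernel e 0))) ?m" "dy (dy f) = conv (dy (dy (log_kernel e 0))) ?m"
      unfolding df by (rule pderiv_conv(1)[OF dk(1) m] pderiv_conv(2)[OF dk(2) m])+
    have lap: "dx (dx f) x + dy (dy f) x = conv (poisson e) ?m x" for x
    proof -
      have "integrable lborel (\<lambda>y. K (x - y) * ?m y)" if "continuous_on UNIV K" for K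
        by (rule continuous_bounded_support_integrable[of _ R];
            intro continuous_on_mult continuous_on_diff_compose that m vanishes_beyond_mult_right)
      note i = this[OF Ck_continuous[OF Ck_Suc_dx[OF dk(1)[unfolded One_nat_def]]]] this[OF Ck_continuous[OF Ck_Suc_dy[OF dk(2)[unfolded One_nat_def]]]]
      have "dx (dx f) x + dy (dy f) x = (\<integral>y. dx (dx (log_kernel e 0)) (x - y) * ?m y + dy (dy (log_kernel e 0)) (x - y) * ?m y \<partial>lborel)"
        unfolding ddf conv_def using i by simp
      also have "\<dots> = (\<integral>y. (dx (dx (log_kernel e 0)) (x - y) + dy (dy (log_kernel e 0)) (x - y)) * ?m y \<partial>lborel)"
        by (simp only: distrib_right)
      finally show ?thesis
        unfolding laplacian_log_kernel[OF e] conv_def .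
    qed
    have fM: "\<bar>f x\<bar> \<le> 2 * pi * ?s" for x
      unfolding f_def by (rule log_potential_bound[OF e b c])
    have A: "(\<integral>x. (\<eta> x)\<^sup>2 * ((dx f x)\<^sup>2 + (dy f x)\<^sup>2) \<partial>lborel) \<le> A"
    proof -
      have 1: "(\<integral>x. (\<eta> x)\<^sup>2 * \<bar>conv (poisson e) ?m x\<bar> \<partial>lborel) \<le> poisson_mass * ?s"
      proof -
        have "(\<integral>x. (\<eta> x)\<^sup>2 * \<bar>conv (poisson e) ?m x\<bar> \<partial>lborel) \<le> poisson_mass * (\<integral>x. \<bar>?m x\<bar> \<partial>lborel)"
          by (rule integral_cutoff_conv_poisson_le[OF e m Ck_continuous[OF \<eta>(1)] \<eta>(2,3)])
        also have "\<dots> \<le> poisson_mass * ?s"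
          using integral_jacobian_le[OF b1(1) b(2) b1(2) c(2)] poisson_mass_pos by (intro mult_left_mono) auto
        finally show ?thesis .
      qed
      have "(\<integral>x. (\<eta> x)\<^sup>2 * ((dx f x)\<^sup>2 + (dy f x)\<^sup>2) \<partial>lborel)
        \<le> 2 * (2 * pi * ?s) * (\<integral>x. (\<eta> x)\<^sup>2 * \<bar>conv (poisson e) ?m x\<bar> \<partial>lborel) + 4 * (2 * pi * ?s)\<^sup>2 * energy \<eta>"
        using cutoff_energy_bound[OF f2 fM \<eta>(1,2)] unfolding lap .
      also have "\<dots> \<le> 2 * (2 * pi * ?s) * (poisson_mass * ?s) + 4 * (2 * pi * ?s)\<^sup>2 * energy \<eta>"
        using 1 s0 by (intro add_right_mono mult_left_mono) auto
      also have "2 * (2 * pi * s) * (poisson_mass * s) + 4 * (2 * pi * s)\<^sup>2 * E = (4 * pi * poisson_mass + 16 * pi\<^sup>2 * E) * s\<^sup>2" for s E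
        by (simp add: power2_eq_square algebra_simps)
      finally show ?thesis unfolding A_def .
    qed
    have dC: "Ck 1 (dx f)" "Ck 1 (dy f)" using f2 Ck_Suc_dx[of 1 f] Ck_Suc_dy[of 1 f] by (auto simp: numeral_2_eq_2)
    \<comment> \<open>Wherever \<open>g\<close> is nonzero the cutoff equals 1, so it can be
      inserted for free, and the Cauchy-Schwarz inequality then meets only the cut-off energy
      bounded by \<open>A\<close>.\<close>
    have part: "\<bar>\<integral>x. g x * h x \<partial>lborel\<bar> \<le> sqrt (\<integral>x. (g x)\<^sup>2 \<partial>lborel) * sqrt A"
      if gm: "g \<in> borel_measurable lborel" "integrable lborel (\<lambda>x. (g x)\<^sup>2)" "\<And>x. \<eta> x \<noteq> 1 \<Longrightarrow> g x = 0"
        and h: "continuous_on UNIV h" "\<And>x. (h x)\<^sup>2 \<le> (dx f x)\<^sup>2 + (dy f x)\<^sup>2" for g h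
    proof -
      have ch: "continuous_on UNIV (\<lambda>x. \<eta> x * h x)" "vanishes_beyond R' (\<lambda>x. \<eta> x * h x)"
        by (intro continuous_on_mult Ck_continuous[OF \<eta>(1)] h vanishes_beyond_mult_left \<eta>)+
      have ih: "integrable lborel (\<lambda>x. (\<eta> x * h x)\<^sup>2)"
        unfolding power2_eq_square
        by (rule continuous_bounded_support_integrable[of _ R'], intro continuous_on_mult ch(1), rule vanishes_beyond_mult_left, rule ch(2))
      have "continuous_on UNIV (\<lambda>x. (\<eta> x)\<^sup>2 * ((dx f x)\<^sup>2 + (dy f x)\<^sup>2))"
        using Ck_continuous[OF \<eta>(1)] Ck_continuous[OF dC(1)] Ck_continuous[OF dC(2)] by (intro continuous_intros)
      then have iA: "integrable lborel (\<lambda>x. (\<eta> x)\<^sup>2 * ((dx f x)\<^sup>2 + (dy f x)\<^sup>2))"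
        by (rule continuous_bounded_support_integrable[of _ R']) (simp add: vanishes_beyond_def vanishes_beyondD[OF \<eta>(2)])
      have "(\<lambda>x. g x * h x) = (\<lambda>x. g x * (\<eta> x * h x))"
      proof
        show "g x * h x = g x * (\<eta> x * h x)" for x using gm(3)[of x] by (cases "\<eta> x = 1") auto
      qed
      then have "\<bar>\<integral>x. g x * h x \<partial>lborel\<bar> = \<bar>\<integral>x. g x * (\<eta> x * h x) \<partial>lborel\<bar>" by simp
      also have "\<dots> \<le> sqrt (\<integral>x. (g x)\<^sup>2 \<partial>lborel) * sqrt (\<integral>x. (\<eta> x * h x)\<^sup>2 \<partial>lborel)"
        using ch(1) by (intro integral_Cauchy_Schwarz gm ih) (auto intro: borel_measurable_continuous_onI)
      also have "\<dots> \<le> sqrt (\<integral>x. (g x)\<^sup>2 \<partial>lborel) * sqrt A"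
      proof (intro mult_left_mono real_sqrt_le_mono)
        have "(\<integral>x. (\<eta> x * h x)\<^sup>2 \<partial>lborel) \<le> (\<integral>x. (\<eta> x)\<^sup>2 * ((dx f x)\<^sup>2 + (dy f x)\<^sup>2) \<partial>lborel)"
          by (intro integral_mono ih iA) (simp add: power_mult_distrib mult_left_mono h(2))
        then show "(\<integral>x. (\<eta> x * h x)\<^sup>2 \<partial>lborel) \<le> A" using A by simp
      qed simp
      finally show ?thesis .
    qed
    \<comment> \<open>The derivatives of \<open>f\<close> are C^1 but need not have bounded support;
      the weak identities are available for such functions too.\<close>
    have "(\<integral>x. \<psi> x * conv (poisson e) ?m x \<partial>lborel) = (\<integral>x. \<psi> x * dx (dx f) x + \<psi> x * dy (dy f) x \<partial>lborel)"
      by (simp only: lap[symmetric] distrib_left)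
    also have "\<dots> = - (\<integral>x. g1 x * dx f x \<partial>lborel) - (\<integral>x. g2 x * dy f x \<partial>lborel)"
      using weak(1)[OF dC(1)] weak(2)[OF dC(2)] by simp
    finally have "\<bar>\<integral>x. \<psi> x * conv (poisson e) ?m x \<partial>lborel\<bar> \<le> \<bar>\<integral>x. g1 x * dx f x \<partial>lborel\<bar> + \<bar>\<integral>x. g2 x * dy f x \<partial>lborel\<bar>"
      by simp
    also have "\<dots> \<le> ?G1 * sqrt A + ?G2 * sqrt A"
      by (intro add_mono part g Ck_continuous[OF dC(1)] Ck_continuous[OF dC(2)]) (use g(5) in auto)
    finally show ?thesis by (simp add: distrib_right)
  qed
  \<comment> \<open>Letting e tend to 0: the averages of the Jacobian converge to it up to the mass
    and stay below \<open>poisson_mass * B\<close>, so a multiple of the absolute value of \<psi>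
    dominates.\<close>
  have lim: "(\<lambda>n. \<integral>x. \<psi> x * conv (poisson (inverse (real (Suc n)))) ?m x \<partial>lborel) \<longlonglongrightarrow> (\<integral>x. \<psi> x * (poisson_mass * ?m x) \<partial>lborel)"
  proof (rule integral_dominated_convergence[where w="\<lambda>x. poisson_mass * B * \<bar>\<psi> x\<bar>"])
    have mc: "?m \<in> borel_measurable lborel" "conv (poisson (inverse (real (Suc n)))) ?m \<in> borel_measurable lborel" for n
      using m(1) continuous_on_conv[OF continuous_poisson m, of "inverse (real (Suc n))"] by (auto intro: borel_measurable_continuous_onI)
    show "(\<lambda>x. \<psi> x * (poisson_mass * ?m x)) \<in> borel_measurable lborel"
      "(\<lambda>x. \<psi> x * conv (poisson (inverse (real (Suc n)))) ?m x) \<in> borel_measurable lborel" for n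
      using borel_measurable_integrable[OF \<psi>] mc by auto
    show "integrable lborel (\<lambda>x. poisson_mass * B * \<bar>\<psi> x\<bar>)" using \<psi> by simp
    show "AE x in lborel. (\<lambda>n. \<psi> x * conv (poisson (inverse (real (Suc n)))) ?m x) \<longlonglongrightarrow> \<psi> x * (poisson_mass * ?m x)"
      by (intro AE_I2 tendsto_mult tendsto_const conv_poisson_tendsto[OF m(1) B(1)] LIMSEQ_inverse_real_of_nat) simp
    show "AE x in lborel. norm (\<psi> x * conv (poisson (inverse (real (Suc n)))) ?m x) \<le> poisson_mass * B * \<bar>\<psi> x\<bar>" for n
    proof (rule AE_I2)
      fix x
      have "\<bar>conv (poisson (inverse (real (Suc n)))) ?m x\<bar> \<le> poisson_mass * B"
        by (rule conv_poisson_bound[OF _ m(1) B(1)]) simp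
      then show "norm (\<psi> x * conv (poisson (inverse (real (Suc n)))) ?m x) \<le> poisson_mass * B * \<bar>\<psi> x\<bar>"
        using mult_right_mono[of _ "poisson_mass * B" "\<bar>\<psi> x\<bar>"] unfolding real_norm_def abs_mult mult.commute[of "\<bar>\<psi> x\<bar>"] by simp
    qed
  qed
  have "\<bar>\<integral>x. \<psi> x * (poisson_mass * ?m x) \<partial>lborel\<bar> \<le> (?G1 + ?G2) * sqrt A"
    by (rule LIMSEQ_le_const2[OF tendsto_rabs[OF lim]]) (use main in auto)
  also have "(\<integral>x. \<psi> x * (poisson_mass * ?m x) \<partial>lborel) = poisson_mass * (\<integral>x. \<psi> x * ?m x \<partial>lborel)"
    by (simp add: mult.left_commute)
  finally have "poisson_mass * \<bar>\<integral>x. \<psi> x * ?m x \<partial>lborel\<bar> \<le> (?G1 + ?G2) * sqrt A"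
    using poisson_mass_pos by (simp add: abs_mult)
  moreover have "sqrt A = sqrt (4 * pi * poisson_mass + 16 * pi\<^sup>2 * energy \<eta>) * ?s"
    unfolding A_def real_sqrt_mult[of _ "?s\<^sup>2"] using s0 by (simp only: real_sqrt_abs abs_of_nonneg)
  ultimately show ?thesis
    using poisson_mass_pos by (simp add: field_simps)
qed

section \<open>Test functions\<close>

text \<open>The functions \<open>t\<^sup>-\<^sup>k exp(- 1 / t)\<close>, extended by 0; their span is closed under derivatives.\<close>

definition flat :: "nat \<Rightarrow> real \<Rightarrow> real" where
  "flat k t = (if t \<le> 0 then 0 else inverse t ^ k * exp (- inverse t))"

lemma flat_nonpos: "t \<le> 0 \<Longrightarrow> flat k t = 0"
  and flat_pos: "t > 0 \<Longrightarrow> flat k t > 0"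
  and flat_nonneg: "flat k t \<ge> 0"
  by (simp_all add: flat_def)

lemma flat_tendsto_0: "(flat k \<longlongrightarrow> 0) (at 0)"
proof (rule filterlim_split_at)
  show "(flat k \<longlongrightarrow> 0) (at_left 0)"
    by (rule tendsto_eventually) (auto simp: eventually_at_filter flat_nonpos)
  have "((\<lambda>t. inverse t ^ k / exp (inverse t)) \<longlongrightarrow> 0) (at_right (0::real))"
    by (rule filterlim_compose[OF tendsto_power_div_exp_0 filterlim_inverse_at_top_right])
  then show "(flat k \<longlongrightarrow> 0) (at_right 0)"
    by (rule filterlim_mono_eventually)
      (auto simp: eventually_at_filter flat_def exp_minus field_simps)
qed

lemma flat_has_real_derivative:
  "(flat k has_real_derivative - real k * flat (Suc k) t + flat (Suc (Suc k)) t) (at t)"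
proof -
  consider "t < 0" | "t = 0" | "t > 0" by linarith
  then show ?thesis
  proof cases
    case 1
    have "(flat k has_real_derivative 0) (at t)"
      by (rule has_field_derivative_transform_within_open[where f="\<lambda>t. 0" and S="{..<0}"]) (use 1 in \<open>auto simp: flat_nonpos\<close>)
    then show ?thesis using 1 by (simp add: flat_nonpos)
  next
    case 2
    \<comment> \<open>Dividing by \<open>y\<close> raises the index by one, so the difference
      quotient at 0 is \<open>flat (Suc k)\<close>, which tends to 0.\<close>
    have "((\<lambda>y. (flat k y - flat k 0) / (y - 0)) \<longlongrightarrow> 0) (at 0)"
    proof (rule filterlim_mono_eventually[OF flat_tendsto_0[of "Suc k"] order_refl order_refl])
      show "\<forall>\<^sub>F y in at 0. flat (Suc k) y = (flat k y - flat k 0) / (y - 0)"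
        by (auto simp: eventually_at_filter flat_def field_simps)
    qed
    then show ?thesis
      using 2 by (simp add: has_field_derivative_iff flat_nonpos)
  next
    case 3
    let ?s = "inverse t"
    have inv: "(inverse has_real_derivative - (?s * ?s)) (at t)"
      using DERIV_inverse[of t] 3 by (simp add: power2_eq_square)
    have pow: "((\<lambda>t. inverse t ^ k) has_real_derivative - real k * ?s ^ Suc k) (at t)"
    proof (cases k)
      case (Suc j)
      show ?thesis
        by (rule DERIV_cong[OF DERIV_power[OF inv, of k]]) (simp add: Suc algebra_simps)
    qed simp
    have "((\<lambda>t. exp (- inverse t)) has_real_derivative exp (- ?s) * (?s * ?s)) (at t)"
      using DERIV_chain2[OF DERIV_exp DERIV_minus[OF inv]] by simp
    from DERIV_mult[OF pow this]
    have "((\<lambda>t. inverse t ^ k * exp (- inverse t)) has_real_derivative - real k * flat (Suc k) t + flat (Suc (Suc k)) t) (at t)"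
      using 3 by (simp add: flat_def mult_ac)
    then show ?thesis
      by (rule has_field_derivative_transform_within_open[where S="{0<..}"]) (use 3 in \<open>auto simp: flat_def\<close>)
  qed
qed

lemma Ck_flat: "Ck m u \<Longrightarrow> Ck m (\<lambda>x. flat k (u x))"
proof (induction m arbitrary: k)
  case 0
  have "continuous_on UNIV (flat k)"
    by (rule DERIV_continuous_on, rule has_field_derivative_at_within, rule flat_has_real_derivative)
  then show ?case
    using 0 by (auto intro: continuous_on_compose2)
next
  case (Suc m)
  note u = Ck_SucD[OF Suc.prems]
  have a: "Ck m (\<lambda>x. - real k * flat (Suc k) (u x) + flat (Suc (Suc k)) (u x))"
    by (rule Ck_add[OF Ck_cmult[OF Suc.IH[OF u]] Suc.IH[OF u]])
  show ?case
    unfolding Ck.simps pderiv_real_comp[where F="flat k", OF Suc.prems flat_has_real_derivative]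
    using pderiv_real_comp(3)[where F="flat k", OF Suc.prems flat_has_real_derivative]
      Ck_mult[OF a Ck_Suc_dx[OF Suc.prems]] Ck_mult[OF a Ck_Suc_dy[OF Suc.prems]] by blast
qed

text \<open>The usual smooth transition from 0 to 1 on the unit interval; the two summands of the
  denominator never vanish together. It gives the cutoffs here and a partition of unity
  later.\<close>

definition step :: "real \<Rightarrow> real" where
  "step t = flat 0 t * inverse (flat 0 t + flat 0 (1 - t))"

lemma step_denominator: "flat 0 t + flat 0 (1 - t) > 0"
  using flat_pos[of t 0] flat_pos[of "1 - t" 0] flat_nonneg[of 0 t] flat_nonneg[of 0 "1 - t"]
  by (cases "t > 0") auto

lemma step_0: "t \<le> 0 \<Longrightarrow> step t = 0"
  by (simp add: step_def flat_nonpos)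

lemma step_1: "t \<ge> 1 \<Longrightarrow> step t = 1"
  using flat_pos[of t 0] by (simp add: step_def flat_nonpos)

lemma step_bounds: "0 \<le> step t" "step t \<le> 1"
  using step_denominator[of t] flat_nonneg[of 0 t] flat_nonneg[of 0 "1 - t"]
  by (auto simp: step_def field_simps)

lemma Ck_step: "Ck m u \<Longrightarrow> Ck m (\<lambda>x. step (u x))"
  unfolding step_def
  by (intro Ck_mult Ck_inverse Ck_add Ck_flat Ck_diff Ck_const) (simp_all add: step_denominator less_imp_neq[symmetric])

section \<open>Cutoffs and approximations of box indicators\<close>

lemma cutoff_exists:
  obtains \<eta> R' where "\<And>k. Ck k \<eta>" "vanishes_beyond R' \<eta>" "\<And>x. 0 \<le> \<eta> x \<and> \<eta> x \<le> 1" "\<And>x. norm x \<le> R \<Longrightarrow> \<eta> x = 1"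
proof -
  \<comment> \<open>A function of the squared norm is smooth at the origin. The argument of
    \<open>step\<close> is at least 2 on the ball of radius \<open>R\<close> and not positive beyond
    the radius \<open>\<bar>R\<bar> + 2\<close>.\<close>
  define \<eta> where "\<eta> x = step (R\<^sup>2 + 2 - ((fst x)\<^sup>2 + (snd x)\<^sup>2))" for x :: plane
  have n: "(fst x)\<^sup>2 + (snd x)\<^sup>2 = (norm x)\<^sup>2" for x :: plane
    by (simp add: norm_prod_def)
  show ?thesis
  proof (rule that[of \<eta> "\<bar>R\<bar> + 2"])
    show "Ck k \<eta>" for k
      unfolding \<eta>_def[abs_def] power2_eq_square
      by (intro Ck_step Ck_diff Ck_add Ck_mult Ck_const Ck_fst Ck_snd)
    show "vanishes_beyond (\<bar>R\<bar> + 2) \<eta>"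
      unfolding vanishes_beyond_def
    proof (intro allI impI)
      fix x :: plane assume "\<bar>R\<bar> + 2 < norm x"
      then have "(\<bar>R\<bar> + 2)\<^sup>2 \<le> (norm x)\<^sup>2" by (intro power_mono) auto
      moreover have "(\<bar>R\<bar> + 2)\<^sup>2 \<ge> R\<^sup>2 + 2" by (simp add: power2_eq_square algebra_simps)
      ultimately show "\<eta> x = 0" unfolding \<eta>_def n by (intro step_0) linarith
    qed
    show "0 \<le> \<eta> x \<and> \<eta> x \<le> 1" for x
      by (simp add: \<eta>_def step_bounds)
    show "\<eta> x = 1" if "norm x \<le> R" for x
    proof -
      have "(norm x)\<^sup>2 \<le> R\<^sup>2" using that by (intro power_mono) auto
      then show ?thesis unfolding \<eta>_def n by (intro step_1) simp
    qed
  qed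
qed

lemma test_function_box:
  assumes "cbox a b \<subseteq> \<Omega>"
  obtains \<phi> where "\<And>n::nat. test_function \<Omega> (\<phi> n)" "\<And>n x. 0 \<le> \<phi> n x \<and> \<phi> n x \<le> 1"
    "\<And>x. (\<lambda>n. \<phi> n x) \<longlonglongrightarrow> indicator (box a b) x"
proof -
  define \<beta> where "\<beta> x = flat 0 (fst x - fst a) * flat 0 (fst b - fst x) * (flat 0 (snd x - snd a) * flat 0 (snd b - snd x))" for x :: plane
  \<comment> \<open>Saturation: \<open>\<phi> n\<close> stays below 1, vanishes where \<beta> does,
    and tends to 1 wherever \<beta> is positive, that is, inside the box.\<close>
  define \<phi> where "\<phi> n x = real n * \<beta> x * inverse (1 + real n * \<beta> x)" for n x
  have C\<beta>: "Ck k \<beta>" for k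
    unfolding \<beta>_def[abs_def] by (intro Ck_mult Ck_flat Ck_diff Ck_const Ck_fst Ck_snd)
  have \<beta>0: "\<beta> x \<ge> 0" for x unfolding \<beta>_def by (intro mult_nonneg_nonneg flat_nonneg)
  have d: "1 + real n * \<beta> x > 0" for n x
    by (intro add_pos_nonneg mult_nonneg_nonneg \<beta>0) simp_all
  have box: "x \<in> box a b \<longleftrightarrow> fst a < fst x \<and> fst x < fst b \<and> snd a < snd x \<and> snd x < snd b" for x
    by (auto simp: mem_box Basis_prod_def inner_prod_def)
  have in_box: "\<beta> x > 0" if "x \<in> box a b" for x
    using that unfolding box \<beta>_def by (intro mult_pos_pos flat_pos) auto
  have out_box: "\<beta> x = 0" if "x \<notin> box a b" for x
    using that unfolding box \<beta>_def by (auto simp: not_less flat_nonpos)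
  show ?thesis
  proof (rule that[of \<phi>])
    fix n :: nat
    have "{x. \<phi> n x \<noteq> 0} \<subseteq> cbox a b"
    proof
      fix x assume "x \<in> {x. \<phi> n x \<noteq> 0}"
      then have "x \<in> box a b" using out_box[of x] by (auto simp: \<phi>_def)
      then show "x \<in> cbox a b" using box_subset_cbox by blast
    qed
    then have cl: "closure {x. \<phi> n x \<noteq> 0} \<subseteq> cbox a b"
      by (rule closure_minimal) (rule closed_cbox)
    then have "compact (closure {x. \<phi> n x \<noteq> 0})"
      using compact_cbox[of a b] by (metis closed_closure compact_Int_closed inf.absorb2)
    moreover have "Ck k (\<phi> n)" for k
      unfolding \<phi>_def by (intro Ck_mult Ck_const Ck_inverse Ck_add C\<beta>) (use d in \<open>simp add: less_imp_neq[symmetric]\<close>)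
    ultimately show "test_function \<Omega> (\<phi> n)"
      using cl assms by (simp add: test_function_def smooth_def)
  next
    show "0 \<le> \<phi> n x \<and> \<phi> n x \<le> 1" for n x
      using d[of n x] \<beta>0[of x] by (simp add: \<phi>_def field_simps)
  next
    fix x
    show "(\<lambda>n. \<phi> n x) \<longlonglongrightarrow> indicator (box a b) x"
    proof (cases "x \<in> box a b")
      case True
      have "filterlim (\<lambda>n. \<beta> x * real n) at_top sequentially"
        by (rule filterlim_tendsto_pos_mult_at_top[OF tendsto_const in_box[OF True] filterlim_real_sequentially])
      then have "filterlim (\<lambda>n. 1 + real n * \<beta> x) at_top sequentially"
        by (intro filterlim_tendsto_add_at_top[OF tendsto_const]) (simp add: mult.commute)
      then have "(\<lambda>n. 1 - inverse (1 + real n * \<beta> x)) \<longlonglongrightarrow> 1 - 0"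
        by (intro tendsto_diff tendsto_const tendsto_inverse_0_at_top)
      moreover have "\<phi> n x = 1 - inverse (1 + real n * \<beta> x)" for n
        using d[of n x] by (simp add: \<phi>_def field_simps)
      ultimately show ?thesis using True by simp
    next
      case False
      then show ?thesis by (simp add: \<phi>_def out_box)
    qed
  qed
qed

text \<open>The positive and negative parts of \<open>V\<close> are densities of two measures that
  agree on boxes, a generating family closed under intersection. Hence the measures agree, and a
  number with equal positive and negative parts is 0.\<close>

lemma AE_zero_if_box_integrals_zero:
  fixes V :: "plane \<Rightarrow> real"
  assumes V: "integrable lborel V" and zero: "\<And>a b. (\<integral>x. indicator (box a b) x * V x \<partial>lborel) = 0"
  shows "AE x in lborel. V x = 0"
proof -
  have [measurable]: "V \<in> borel_measurable lborel" using V by auto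
  let ?M = "\<lambda>s. density lborel (\<lambda>x. ennreal (max 0 (s * V x)))"
  have em: "emeasure (?M s) X = ennreal (\<integral>x. indicator X x * max 0 (s * V x) \<partial>lborel)"
    if "X \<in> sets borel" for s X
  proof -
    have "integrable lborel (\<lambda>x. max 0 (s * V x))" using V by simp
    then have "integrable lborel (\<lambda>x. indicator X x *\<^sub>R max 0 (s * V x))"
      using that by (intro integrable_mult_indicator) auto
    then have "(\<integral>\<^sup>+ x. ennreal (indicator X x * max 0 (s * V x)) \<partial>lborel) = ennreal (\<integral>x. indicator X x * max 0 (s * V x) \<partial>lborel)"
      by (intro nn_integral_eq_integral) auto
    moreover have "emeasure (?M s) X = (\<integral>\<^sup>+ x. ennreal (indicator X x * max 0 (s * V x)) \<partial>lborel)"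
      using that by (subst emeasure_density) (auto intro!: nn_integral_cong simp: indicator_def)
    ultimately show ?thesis by simp
  qed
  have "?M 1 = ?M (-1)"
  proof (rule measure_eqI_generator_eq)
    let ?E = "range (\<lambda>(a, b). box a b::plane set)"
    have "box a b \<in> ?E" for a b :: plane
      by (rule range_eqI[of _ _ "(a, b)"]) simp
    note in_E = this
    show "Int_stable ?E"
    proof (rule Int_stableI)
      fix A B assume "A \<in> ?E" "B \<in> ?E"
      then obtain p q where "A = box (fst p) (snd p)" "B = box (fst q) (snd q)"
        unfolding split_beta by blast
      then show "A \<inter> B \<in> ?E"
        by (simp only: box_Int_box in_E)
    qed
    show "?E \<subseteq> Pow UNIV" "sets (?M 1) = sigma_sets UNIV ?E" "sets (?M (-1)) = sigma_sets UNIV ?E"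
      by (simp_all add: borel_eq_box)
    let ?A = "\<lambda>n::nat. box (- (real n *\<^sub>R One)) (real n *\<^sub>R One) :: plane set"
    show "range ?A \<subseteq> ?E" "(\<Union>i. ?A i) = UNIV"
      unfolding UN_box_eq_UNIV by auto
    show "emeasure (?M 1) (?A i) \<noteq> \<infinity>" for i by (subst em) auto
    show "emeasure (?M 1) X = emeasure (?M (-1)) X" if X: "X \<in> ?E" for X
    proof -
      obtain a b where X_eq: "X = box a b" using X by auto
      have i: "integrable lborel (\<lambda>x. indicator X x *\<^sub>R max 0 (s * V x))" for s
        using V by (intro integrable_mult_indicator) (auto simp: X_eq)
      have "(\<integral>x. indicator X x * max 0 (1 * V x) \<partial>lborel) - (\<integral>x. indicator X x * max 0 (-1 * V x) \<partial>lborel)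
        = (\<integral>x. indicator X x * max 0 (1 * V x) - indicator X x * max 0 (-1 * V x) \<partial>lborel)"
        using i[of 1] i[of "-1"] by (simp only: real_scaleR_def Bochner_Integration.integral_diff)
      also have "\<dots> = (\<integral>x. indicator X x * V x \<partial>lborel)"
        by (intro Bochner_Integration.integral_cong) (auto simp: indicator_def)
      finally have "(\<integral>x. indicator X x * max 0 (1 * V x) \<partial>lborel) = (\<integral>x. indicator X x * max 0 (-1 * V x) \<partial>lborel)"
        using zero[of a b] by (simp add: X_eq)
      moreover have "X \<in> sets borel" by (simp add: X_eq)
      ultimately show ?thesis by (simp only: em)
    qed
  qed
  moreover have "(\<integral>\<^sup>+ x. ennreal (max 0 (1 * V x)) \<partial>lborel) \<noteq> \<infinity>"
    using V by (subst nn_integral_eq_integral) auto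
  ultimately have "AE x in lborel. ennreal (max 0 (1 * V x)) = ennreal (max 0 (-1 * V x))"
    by (subst finite_density_unique[symmetric]) auto
  then show ?thesis
    by eventually_elim (auto simp: max_def split: if_splits)
qed

lemma test_function_vanishes: "test_function \<Omega> \<phi> \<Longrightarrow> x \<notin> \<Omega> \<Longrightarrow> \<phi> x = 0"
  unfolding test_function_def using closure_subset[of "{x. \<phi> x \<noteq> 0}"] by blast

lemma test_function_Ck: "test_function \<Omega> \<phi> \<Longrightarrow> Ck k \<phi>"
  by (simp add: test_function_def smooth_def)

lemma test_function_vanishes_beyond:
  assumes "test_function \<Omega> \<phi>" obtains R where "vanishes_beyond R \<phi>"
proof -
  have "bounded (closure {x. \<phi> x \<noteq> 0})"
    using assms by (auto simp: test_function_def intro: compact_imp_bounded)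
  then obtain R where "\<And>x. x \<in> closure {x. \<phi> x \<noteq> 0} \<Longrightarrow> norm x \<le> R"
    unfolding bounded_iff by blast
  then have "vanishes_beyond R \<phi>"
    unfolding vanishes_beyond_def using closure_subset[of "{x. \<phi> x \<noteq> 0}"] by (force simp: not_le[symmetric])
  then show ?thesis by (rule that)
qed

lemma test_function_pderiv_vanishes:
  assumes "test_function \<Omega> \<phi>" "x \<notin> \<Omega>" shows "dx \<phi> x = 0" "dy \<phi> x = 0"
proof -
  let ?S = "- closure {x. \<phi> x \<noteq> 0}"
  have "x \<in> ?S" using assms by (auto simp: test_function_def)
  have "(\<phi> has_derivative (\<lambda>v. fst v * 0 + snd v * 0)) (at x)"
  proof (rule has_derivative_transform_within_open[where s="?S" and f="\<lambda>x. 0"])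
    show "0 = \<phi> y" if "y \<in> ?S" for y
      using that closure_subset[of "{x. \<phi> x \<noteq> 0}"] by auto
  qed (use \<open>x \<in> ?S\<close> in auto)
  from pderiv_eqI[OF this] show "dx \<phi> x = 0" "dy \<phi> x = 0" by auto
qed

lemma test_function_lincomb:
  assumes "test_function \<Omega> u" "test_function \<Omega> v"
  shows "test_function \<Omega> (\<lambda>x. a * u x + b * v x)"
proof -
  let ?K = "closure {x. u x \<noteq> 0} \<union> closure {x. v x \<noteq> 0}"
  have K: "compact ?K" "?K \<subseteq> \<Omega>" using assms by (auto simp: test_function_def intro: compact_Un)
  have "{x. a * u x + b * v x \<noteq> 0} \<subseteq> ?K"
  proof
    fix x assume "x \<in> {x. a * u x + b * v x \<noteq> 0}"
    then have "x \<in> {x. u x \<noteq> 0} \<or> x \<in> {x. v x \<noteq> 0}" by force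
    then show "x \<in> ?K"
      using closure_subset[of "{x. u x \<noteq> 0}"] closure_subset[of "{x. v x \<noteq> 0}"] by blast
  qed
  then have cl: "closure {x. a * u x + b * v x \<noteq> 0} \<subseteq> ?K"
    by (rule closure_minimal) (rule compact_imp_closed[OF K(1)])
  then have "compact (closure {x. a * u x + b * v x \<noteq> 0})"
    using compact_Int_closed[OF K(1) closed_closure] by (metis (no_types, lifting) inf.absorb2)
  moreover have "smooth (\<lambda>x. a * u x + b * v x)"
    using assms by (auto simp: test_function_def smooth_def intro!: Ck_add Ck_cmult)
  ultimately show ?thesis using order_trans[OF cl K(2)] by (simp add: test_function_def)
qed

text \<open>The fundamental lemma of the calculus of variations. Test functions converge to
  indicators of boxes whose closure lies in \<Omega>; countably many such boxes, up to boundaries of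
  measure zero, exhaust \<Omega>.\<close>

lemma AE_zero_if_test_integrals_zero:
  fixes W :: "plane \<Rightarrow> real"
  assumes \<Omega>: "open \<Omega>" and W: "integrable lborel W"
    and zero: "\<And>\<phi>. test_function \<Omega> \<phi> \<Longrightarrow> (\<integral>x. W x * \<phi> x \<partial>lborel) = 0"
  shows "AE x in lborel. x \<in> \<Omega> \<longrightarrow> W x = 0"
proof -
  have [measurable]: "W \<in> borel_measurable lborel" using W by auto
  have box0: "(\<integral>x. W x * indicator (box a b) x \<partial>lborel) = 0" if ab: "cbox a b \<subseteq> \<Omega>" for a b
  proof -
    obtain \<phi> where \<phi>: "\<And>n::nat. test_function \<Omega> (\<phi> n)" "\<And>n x. 0 \<le> \<phi> n x \<and> \<phi> n x \<le> 1"
      "\<And>x. (\<lambda>n. \<phi> n x) \<longlonglongrightarrow> indicator (box a b) x"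
      by (rule test_function_box[OF ab]) (rule that)
    have \<phi>m: "\<phi> n \<in> borel_measurable lborel" for n
      using test_function_Ck[OF \<phi>(1), of 0] by (auto intro: borel_measurable_continuous_onI)
    have "(\<lambda>n. \<integral>x. W x * \<phi> n x \<partial>lborel) \<longlonglongrightarrow> (\<integral>x. W x * indicator (box a b) x \<partial>lborel)"
    proof (rule integral_dominated_convergence[where w="\<lambda>x. \<bar>W x\<bar>"])
      show "integrable lborel (\<lambda>x. \<bar>W x\<bar>)" using W by simp
      show "AE x in lborel. (\<lambda>n. W x * \<phi> n x) \<longlonglongrightarrow> W x * indicator (box a b) x"
        by (intro AE_I2 tendsto_mult tendsto_const \<phi>)
      show "AE x in lborel. norm (W x * \<phi> n x) \<le> \<bar>W x\<bar>" for n
      proof (rule AE_I2)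
        show "norm (W x * \<phi> n x) \<le> \<bar>W x\<bar>" for x
          using \<phi>(2)[of n x] by (simp add: abs_mult mult_left_le)
      qed
      show "(\<lambda>x. W x * indicator (box a b) x) \<in> borel_measurable lborel"
        "(\<lambda>x. W x * \<phi> n x) \<in> borel_measurable lborel" for n
        using W \<phi>m by (auto intro!: borel_measurable_times)
    qed
    then show ?thesis
      by (simp add: zero[OF \<phi>(1)] LIMSEQ_const_iff)
  qed
  obtain \<D> where \<D>: "countable \<D>" "\<D> \<subseteq> Pow \<Omega>" "\<And>X. X \<in> \<D> \<Longrightarrow> \<exists>a b. X = cbox a b" "\<Union>\<D> = \<Omega>"
    by (rule open_countable_Union_open_cbox[OF \<Omega>]) (rule that)
  have "AE x in lborel. x \<in> X \<longrightarrow> W x = 0" if X: "X \<in> \<D>" for X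
  proof -
    obtain c d where cd: "X = cbox c d" "cbox c d \<subseteq> \<Omega>" using \<D>(2) \<D>(3)[OF X] X by blast
    \<comment> \<open>Restricting \<open>W\<close> to one box turns every box to be tested into a
      subbox of it, whose closure still lies in \<Omega>.\<close>
    have "AE x in lborel. indicator (box c d) x * W x = 0"
    proof (rule AE_zero_if_box_integrals_zero)
      show "integrable lborel (\<lambda>x. indicator (box c d) x * W x)"
        using integrable_mult_indicator[OF _ W, of "box c d"] by simp
      fix a b :: plane
      obtain l u where lu: "box a b \<inter> box c d = box l u" by (rule that[OF box_Int_box])
      have "(\<integral>x. indicator (box a b) x * (indicator (box c d) x * W x) \<partial>lborel) = (\<integral>x. W x * indicator (box l u) x \<partial>lborel)"
        unfolding lu[symmetric] by (intro Bochner_Integration.integral_cong) (auto simp: indicator_def)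
      also have "\<dots> = 0"
      proof (cases "box l u = {}")
        case False
        then have "closure (box l u) \<subseteq> closure (box c d)" using lu by (intro closure_mono) blast
        moreover have "box c d \<noteq> {}" using False lu by blast
        ultimately have "cbox l u \<subseteq> cbox c d" using False by (simp add: closure_box)
        then show ?thesis using cd by (intro box0) blast
      next
        case True
        show ?thesis unfolding True by simp
      qed
      finally show "(\<integral>x. indicator (box a b) x * (indicator (box c d) x * W x) \<partial>lborel) = 0" .
    qed
    moreover have "AE x in lborel. x \<notin> cbox c d - box c d"
    proof (rule AE_not_in)
      show "cbox c d - box c d \<in> null_sets lborel"
      proof (rule null_setsI)
        show "emeasure lborel (cbox c d - box c d) = 0"
          using emeasure_Diff[of lborel "box c d" "cbox c d"] box_subset_cbox[of c d]
          by (simp add: emeasure_lborel_box_eq emeasure_lborel_cbox_eq)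
        show "cbox c d - box c d \<in> sets lborel"
          unfolding sets_lborel by (intro sets.Diff borel_closed borel_open closed_cbox open_box)
      qed
    qed
    ultimately show ?thesis
    proof eventually_elim
      case (elim x)
      then show ?case by (cases "x \<in> box c d") (simp_all add: cd)
    qed
  qed
  then have "AE x in lborel. \<forall>X\<in>\<D>. x \<in> X \<longrightarrow> W x = 0"
    by (subst AE_ball_countable[OF \<D>(1)]) blast
  then show ?thesis
  proof eventually_elim
    case (elim x)
    show ?case
    proof
      assume "x \<in> \<Omega>"
      then obtain X where "X \<in> \<D>" "x \<in> X" using \<D>(4) by blast
      then show "W x = 0" using elim by blast
    qed
  qed
qed

section \<open>Sobolev spaces\<close>

lemma borel_measurable_norm_euclidean:
  fixes f :: "'a \<Rightarrow> 'b::euclidean_space"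
  shows "f \<in> borel_measurable M \<Longrightarrow> (\<lambda>x. norm (f x)) \<in> borel_measurable M"
  by measurable

locale bounded_open =
  fixes \<Omega> :: "plane set"
  assumes open_\<Omega>: "open \<Omega>" and bounded_\<Omega>: "bounded \<Omega>"
begin

section \<open>Square integrable functions\<close>

lemma \<Omega>_sets: "\<Omega> \<in> sets lborel" "\<Omega> \<in> sets borel"
  using open_\<Omega> by auto

text \<open>Putting the indicator inside the function turns set integrals into integrals of the
  extension by 0, to which the rules for the whole plane apply.\<close>

lemma L2_iff:
  "u \<in> L2 \<Omega> \<longleftrightarrow> (\<lambda>x. indicator \<Omega> x *\<^sub>R u x) \<in> borel_measurable lborel \<and>
    integrable lborel (\<lambda>x. (norm (indicator \<Omega> x *\<^sub>R u x))\<^sup>2)"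
proof -
  have "(\<lambda>x. (norm (indicator \<Omega> x *\<^sub>R u x))\<^sup>2) = (\<lambda>x. indicator \<Omega> x *\<^sub>R (norm (u x))\<^sup>2)"
    by (auto simp: indicator_def)
  then show ?thesis
    by (simp add: L2_def set_borel_measurable_def set_integrable_def)
qed

lemma L2_norm_eq: "L2_norm \<Omega> u = sqrt (\<integral>x. (norm (indicator \<Omega> x *\<^sub>R u x))\<^sup>2 \<partial>lborel)"
proof -
  have "(\<lambda>x. (norm (indicator \<Omega> x *\<^sub>R u x))\<^sup>2) = (\<lambda>x. indicator \<Omega> x *\<^sub>R (norm (u x))\<^sup>2)"
    by (auto simp: indicator_def)
  then show ?thesis
    by (simp add: L2_norm_def set_lebesgue_integral_def)
qed

lemma L2_norm_square: "(L2_norm \<Omega> u)\<^sup>2 = (\<integral>x. (norm (indicator \<Omega> x *\<^sub>R u x))\<^sup>2 \<partial>lborel)"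
  unfolding L2_norm_eq by (intro real_sqrt_pow2 Bochner_Integration.integral_nonneg) simp

lemma L2_norm_nonneg: "L2_norm \<Omega> u \<ge> 0"
  unfolding L2_norm_eq by (intro real_sqrt_ge_zero Bochner_Integration.integral_nonneg) simp

lemma L2_lincomb:
  assumes "u \<in> L2 \<Omega>" "v \<in> L2 \<Omega>"
  shows "(\<lambda>x. a *\<^sub>R u x + b *\<^sub>R v x) \<in> L2 \<Omega>"
proof -
  let ?u = "\<lambda>x. indicator \<Omega> x *\<^sub>R u x" and ?v = "\<lambda>x. indicator \<Omega> x *\<^sub>R v x"
  have m: "?u \<in> borel_measurable lborel" "?v \<in> borel_measurable lborel"
    and i: "integrable lborel (\<lambda>x. (norm (?u x))\<^sup>2)" "integrable lborel (\<lambda>x. (norm (?v x))\<^sup>2)"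
    using assms by (auto simp: L2_iff)
  have eq: "indicator \<Omega> x *\<^sub>R (a *\<^sub>R u x + b *\<^sub>R v x) = a *\<^sub>R ?u x + b *\<^sub>R ?v x" for x
    by (auto simp: indicator_def)
  show ?thesis
    unfolding L2_iff eq
  proof
    show mm: "(\<lambda>x. a *\<^sub>R ?u x + b *\<^sub>R ?v x) \<in> borel_measurable lborel"
      by (intro borel_measurable_add borel_measurable_scaleR borel_measurable_const m)
    show "integrable lborel (\<lambda>x. (norm (a *\<^sub>R ?u x + b *\<^sub>R ?v x))\<^sup>2)"
    proof (rule Bochner_Integration.integrable_bound)
      show "integrable lborel (\<lambda>x. 2 * a\<^sup>2 * (norm (?u x))\<^sup>2 + 2 * b\<^sup>2 * (norm (?v x))\<^sup>2)"
        using i by (intro Bochner_Integration.integrable_add integrable_mult_right)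
      show "(\<lambda>x. (norm (a *\<^sub>R ?u x + b *\<^sub>R ?v x))\<^sup>2) \<in> borel_measurable lborel"
        by (intro borel_measurable_power borel_measurable_norm_euclidean mm)
      show "AE x in lborel. norm ((norm (a *\<^sub>R ?u x + b *\<^sub>R ?v x))\<^sup>2) \<le> norm (2 * a\<^sup>2 * (norm (?u x))\<^sup>2 + 2 * b\<^sup>2 * (norm (?v x))\<^sup>2)"
      proof (rule AE_I2)
        fix x
        let ?A = "\<bar>a\<bar> * norm (?u x)" and ?B = "\<bar>b\<bar> * norm (?v x)"
        have "norm (a *\<^sub>R ?u x + b *\<^sub>R ?v x) \<le> ?A + ?B"
          using norm_triangle_ineq[of "a *\<^sub>R ?u x" "b *\<^sub>R ?v x"] by (simp only: norm_scaleR)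
        then have "(norm (a *\<^sub>R ?u x + b *\<^sub>R ?v x))\<^sup>2 \<le> (?A + ?B)\<^sup>2"
          by (intro power_mono) auto
        also have "\<dots> \<le> 2 * ?A\<^sup>2 + 2 * ?B\<^sup>2"
          using zero_le_power2[of "?A - ?B"] by (simp add: power2_eq_square algebra_simps)
        also have "\<dots> = 2 * a\<^sup>2 * (norm (?u x))\<^sup>2 + 2 * b\<^sup>2 * (norm (?v x))\<^sup>2"
          by (simp only: power_mult_distrib power2_abs mult.assoc)
        finally show "norm ((norm (a *\<^sub>R ?u x + b *\<^sub>R ?v x))\<^sup>2) \<le> norm (2 * a\<^sup>2 * (norm (?u x))\<^sup>2 + 2 * b\<^sup>2 * (norm (?v x))\<^sup>2)"
          unfolding real_norm_def abs_power2 by (rule order_trans[OF _ abs_ge_self])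
      qed
    qed
  qed
qed

lemma L2_mult_integrable:
  fixes u v :: "plane \<Rightarrow> real"
  assumes "u \<in> L2 \<Omega>" "v \<in> L2 \<Omega>"
  shows "set_integrable lborel \<Omega> (\<lambda>x. u x * v x)"
    and "\<bar>LINT x:\<Omega>|lborel. u x * v x\<bar> \<le> L2_norm \<Omega> u * L2_norm \<Omega> v"
proof -
  let ?u = "\<lambda>x. indicator \<Omega> x *\<^sub>R u x" and ?v = "\<lambda>x. indicator \<Omega> x *\<^sub>R v x"
  have m: "?u \<in> borel_measurable lborel" "?v \<in> borel_measurable lborel"
    and i: "integrable lborel (\<lambda>x. (?u x)\<^sup>2)" "integrable lborel (\<lambda>x. (?v x)\<^sup>2)"
    using assms by (simp_all only: L2_iff real_norm_def power2_abs)
  have eq: "(\<lambda>x. indicator \<Omega> x *\<^sub>R (u x * v x)) = (\<lambda>x. ?u x * ?v x)"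
    by (auto simp: indicator_def)
  show "set_integrable lborel \<Omega> (\<lambda>x. u x * v x)"
    unfolding set_integrable_def eq by (rule integral_Cauchy_Schwarz(1)[OF m i])
  show "\<bar>LINT x:\<Omega>|lborel. u x * v x\<bar> \<le> L2_norm \<Omega> u * L2_norm \<Omega> v"
    unfolding set_lebesgue_integral_def eq L2_norm_eq real_norm_def power2_abs
    by (rule integral_Cauchy_Schwarz(2)[OF m i])
qed

lemma L2_norm_of: "u \<in> L2 \<Omega> \<Longrightarrow> (\<lambda>x. norm (u x)) \<in> L2 \<Omega>"
  and L2_norm_norm: "L2_norm \<Omega> (\<lambda>x. norm (u x)) = L2_norm \<Omega> u"
proof -
  have eq: "(\<lambda>x. indicator \<Omega> x *\<^sub>R norm (u x)) = (\<lambda>x. norm (indicator \<Omega> x *\<^sub>R u x))" for u :: "plane \<Rightarrow> 'a"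
    by (auto simp: indicator_def)
  have eq': "(norm (indicator \<Omega> x *\<^sub>R norm (u x)))\<^sup>2 = (norm (indicator \<Omega> x *\<^sub>R u x))\<^sup>2" for x
    by (simp add: indicator_def)
  show "u \<in> L2 \<Omega> \<Longrightarrow> (\<lambda>x. norm (u x)) \<in> L2 \<Omega>"
    unfolding L2_iff eq' by (simp only: eq borel_measurable_norm_euclidean simp_thms)
  show "L2_norm \<Omega> (\<lambda>x. norm (u x)) = L2_norm \<Omega> u"
    unfolding L2_norm_eq eq' ..
qed

lemma L2_norm_lincomb:
  assumes "u \<in> L2 \<Omega>" "v \<in> L2 \<Omega>"
  shows "L2_norm \<Omega> (\<lambda>x. a *\<^sub>R u x + b *\<^sub>R v x) \<le> \<bar>a\<bar> * L2_norm \<Omega> u + \<bar>b\<bar> * L2_norm \<Omega> v"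
proof (rule power2_le_imp_le)
  let ?u = "\<lambda>x. norm (indicator \<Omega> x *\<^sub>R u x)" and ?v = "\<lambda>x. norm (indicator \<Omega> x *\<^sub>R v x)"
  let ?A = "L2_norm \<Omega> u" and ?B = "L2_norm \<Omega> v"
  have i: "integrable lborel (\<lambda>x. (?u x)\<^sup>2)" "integrable lborel (\<lambda>x. (?v x)\<^sup>2)"
    and iw: "integrable lborel (\<lambda>x. (norm (indicator \<Omega> x *\<^sub>R (a *\<^sub>R u x + b *\<^sub>R v x)))\<^sup>2)"
    using assms L2_lincomb[OF assms] by (simp_all only: L2_iff)
  have eq: "(\<lambda>x. indicator \<Omega> x *\<^sub>R (norm (u x) * norm (v x))) = (\<lambda>x. ?u x * ?v x)"
    by (auto simp: indicator_def)
  have uv: "integrable lborel (\<lambda>x. ?u x * ?v x)" "(\<integral>x. ?u x * ?v x \<partial>lborel) \<le> ?A * ?B"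
    using L2_mult_integrable[OF L2_norm_of[OF assms(1)] L2_norm_of[OF assms(2)]]
    unfolding set_integrable_def set_lebesgue_integral_def eq L2_norm_norm by auto
  have "(L2_norm \<Omega> (\<lambda>x. a *\<^sub>R u x + b *\<^sub>R v x))\<^sup>2 \<le> (\<integral>x. a\<^sup>2 * (?u x)\<^sup>2 + 2 * (\<bar>a\<bar> * \<bar>b\<bar>) * (?u x * ?v x) + b\<^sup>2 * (?v x)\<^sup>2 \<partial>lborel)"
    unfolding L2_norm_square
  proof (rule integral_mono[OF iw])
    show "integrable lborel (\<lambda>x. a\<^sup>2 * (?u x)\<^sup>2 + 2 * (\<bar>a\<bar> * \<bar>b\<bar>) * (?u x * ?v x) + b\<^sup>2 * (?v x)\<^sup>2)"
      using i uv by (intro Bochner_Integration.integrable_add integrable_mult_right)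
    fix x
    have "norm (indicator \<Omega> x *\<^sub>R (a *\<^sub>R u x + b *\<^sub>R v x)) \<le> \<bar>a\<bar> * ?u x + \<bar>b\<bar> * ?v x"
      using norm_triangle_ineq[of "a *\<^sub>R u x" "b *\<^sub>R v x"] by (simp add: indicator_def)
    then have "(norm (indicator \<Omega> x *\<^sub>R (a *\<^sub>R u x + b *\<^sub>R v x)))\<^sup>2 \<le> (\<bar>a\<bar> * ?u x + \<bar>b\<bar> * ?v x)\<^sup>2"
      by (intro power_mono) auto
    also have "\<dots> = \<bar>a\<bar>\<^sup>2 * (?u x)\<^sup>2 + 2 * (\<bar>a\<bar> * \<bar>b\<bar>) * (?u x * ?v x) + \<bar>b\<bar>\<^sup>2 * (?v x)\<^sup>2"
      by (simp only: power2_eq_square) algebra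
    finally show "(norm (indicator \<Omega> x *\<^sub>R (a *\<^sub>R u x + b *\<^sub>R v x)))\<^sup>2 \<le> a\<^sup>2 * (?u x)\<^sup>2 + 2 * (\<bar>a\<bar> * \<bar>b\<bar>) * (?u x * ?v x) + b\<^sup>2 * (?v x)\<^sup>2"
      by (simp only: power2_abs)
  qed
  also have "\<dots> = a\<^sup>2 * ?A\<^sup>2 + 2 * (\<bar>a\<bar> * \<bar>b\<bar>) * (\<integral>x. ?u x * ?v x \<partial>lborel) + b\<^sup>2 * ?B\<^sup>2"
    unfolding L2_norm_square using i uv(1)
    by (simp only: Bochner_Integration.integral_add Bochner_Integration.integrable_add integrable_mult_right integral_mult_right_zero)
  also have "\<dots> \<le> a\<^sup>2 * ?A\<^sup>2 + 2 * (\<bar>a\<bar> * \<bar>b\<bar>) * (?A * ?B) + b\<^sup>2 * ?B\<^sup>2"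
    using uv(2) by (intro add_mono mult_left_mono) auto
  also have "\<dots> = \<bar>a\<bar>\<^sup>2 * ?A\<^sup>2 + 2 * (\<bar>a\<bar> * \<bar>b\<bar>) * (?A * ?B) + \<bar>b\<bar>\<^sup>2 * ?B\<^sup>2"
    by (simp only: power2_abs)
  also have "\<dots> = (\<bar>a\<bar> * ?A + \<bar>b\<bar> * ?B)\<^sup>2"
    by (simp only: power2_eq_square) algebra
  finally show "(L2_norm \<Omega> (\<lambda>x. a *\<^sub>R u x + b *\<^sub>R v x))\<^sup>2 \<le> (\<bar>a\<bar> * ?A + \<bar>b\<bar> * ?B)\<^sup>2" .
qed (simp add: L2_norm_nonneg)

text \<open>The parallelogram law; it makes the objective strongly concave. Differences are written
  as linear combinations to match \<open>H1_lincomb\<close>.\<close>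

lemma L2_norm_diff_square:
  fixes u v :: "plane \<Rightarrow> 'b::euclidean_space"
  assumes "u \<in> L2 \<Omega>" "v \<in> L2 \<Omega>"
  shows "(L2_norm \<Omega> (\<lambda>x. (1/2) *\<^sub>R u x + (1/2) *\<^sub>R v x))\<^sup>2 =
    (L2_norm \<Omega> u)\<^sup>2 / 2 + (L2_norm \<Omega> v)\<^sup>2 / 2 - (L2_norm \<Omega> (\<lambda>x. 1 *\<^sub>R u x + (-1) *\<^sub>R v x))\<^sup>2 / 4"
proof -
  let ?I = "\<lambda>u::plane \<Rightarrow> 'b. \<lambda>x. (norm (indicator \<Omega> x *\<^sub>R u x))\<^sup>2"
  have "(norm ((1/2) *\<^sub>R p + (1/2) *\<^sub>R q))\<^sup>2 = (norm p)\<^sup>2 / 2 + (norm q)\<^sup>2 / 2 - (norm (1 *\<^sub>R p + (-1) *\<^sub>R q))\<^sup>2 / 4" for p q :: 'b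
    unfolding power2_norm_eq_inner by (simp add: inner_commute algebra_simps add_divide_distrib diff_divide_distrib)
  then have "?I (\<lambda>x. (1/2) *\<^sub>R u x + (1/2) *\<^sub>R v x) x = ?I u x / 2 + ?I v x / 2 - ?I (\<lambda>x. 1 *\<^sub>R u x + (-1) *\<^sub>R v x) x / 4" for x
    by (simp add: indicator_def)
  moreover have "integrable lborel (?I u)" "integrable lborel (?I v)" "integrable lborel (?I (\<lambda>x. 1 *\<^sub>R u x + (-1) *\<^sub>R v x))"
    using assms L2_lincomb[OF assms, of 1 "-1"] by (simp_all only: L2_iff)
  ultimately show ?thesis
    unfolding L2_norm_square by simp
qed

lemma L2_norm_cong_AE:
  assumes "u \<in> L2 \<Omega>" "v \<in> L2 \<Omega>" "AE x in lborel. x \<in> \<Omega> \<longrightarrow> u x = v x"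
  shows "L2_norm \<Omega> u = L2_norm \<Omega> v"
proof -
  have "(\<integral>x. (norm (indicator \<Omega> x *\<^sub>R u x))\<^sup>2 \<partial>lborel) = (\<integral>x. (norm (indicator \<Omega> x *\<^sub>R v x))\<^sup>2 \<partial>lborel)"
  proof (rule integral_cong_AE)
    show "(\<lambda>x. (norm (indicator \<Omega> x *\<^sub>R u x))\<^sup>2) \<in> borel_measurable lborel" "(\<lambda>x. (norm (indicator \<Omega> x *\<^sub>R v x))\<^sup>2) \<in> borel_measurable lborel"
      using assms(1,2) by (auto simp only: L2_iff intro: borel_measurable_integrable)
    show "AE x in lborel. (norm (indicator \<Omega> x *\<^sub>R u x))\<^sup>2 = (norm (indicator \<Omega> x *\<^sub>R v x))\<^sup>2"
      using assms(3) by eventually_elim (simp add: indicator_def)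
  qed
  then show ?thesis by (simp only: L2_norm_eq)
qed

lemma L2_fst_snd:
  fixes g :: "plane \<Rightarrow> plane"
  assumes "g \<in> L2 \<Omega>"
  shows "(\<lambda>x. fst (g x)) \<in> L2 \<Omega>" "(\<lambda>x. snd (g x)) \<in> L2 \<Omega>"
    "L2_norm \<Omega> (\<lambda>x. fst (g x)) \<le> L2_norm \<Omega> g" "L2_norm \<Omega> (\<lambda>x. snd (g x)) \<le> L2_norm \<Omega> g"
proof -
  let ?g = "\<lambda>x. indicator \<Omega> x *\<^sub>R g x"
  have m: "?g \<in> borel_measurable lborel" and i: "integrable lborel (\<lambda>x. (norm (?g x))\<^sup>2)"
    using assms by (simp_all only: L2_iff)
  have "h \<in> L2 \<Omega> \<and> L2_norm \<Omega> h \<le> L2_norm \<Omega> g"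
    if "(\<lambda>x. indicator \<Omega> x *\<^sub>R h x) \<in> borel_measurable lborel" and le: "\<And>x. norm (h x) \<le> norm (g x)" for h :: "plane \<Rightarrow> real"
  proof -
    have le2: "(norm (indicator \<Omega> x *\<^sub>R h x))\<^sup>2 \<le> (norm (?g x))\<^sup>2" for x
      using le[of x] by (intro power_mono) (simp_all add: indicator_def)
    have ih: "integrable lborel (\<lambda>x. (norm (indicator \<Omega> x *\<^sub>R h x))\<^sup>2)"
    proof (rule Bochner_Integration.integrable_bound[OF i])
      show "(\<lambda>x. (norm (indicator \<Omega> x *\<^sub>R h x))\<^sup>2) \<in> borel_measurable lborel"
        by (intro borel_measurable_power borel_measurable_norm_euclidean that)
      show "AE x in lborel. norm ((norm (indicator \<Omega> x *\<^sub>R h x))\<^sup>2) \<le> norm ((norm (?g x))\<^sup>2)"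
        using le2 by (intro AE_I2) (simp only: real_norm_def abs_power2)
    qed
    have "L2_norm \<Omega> h \<le> L2_norm \<Omega> g"
      unfolding L2_norm_eq by (intro real_sqrt_le_mono integral_mono ih i le2)
    then show ?thesis using that ih by (simp only: L2_iff)
  qed
  note * = this
  have eq: "(\<lambda>x. indicator \<Omega> x *\<^sub>R fst (g x)) = (\<lambda>x. fst (?g x))" "(\<lambda>x. indicator \<Omega> x *\<^sub>R snd (g x)) = (\<lambda>x. snd (?g x))"
    by (auto simp: indicator_def)
  have mm: "(\<lambda>x. fst (?g x)) \<in> borel_measurable lborel" "(\<lambda>x. snd (?g x)) \<in> borel_measurable lborel"
    by (rule measurable_compose[OF m], rule borel_measurable_continuous_onI, intro continuous_on_fst continuous_on_snd continuous_on_id)+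
  have "norm (fst (g x)) \<le> norm (g x)" "norm (snd (g x)) \<le> norm (g x)" for x
    using norm_fst_le[of "fst (g x)" "snd (g x)"] norm_snd_le[of "snd (g x)" "fst (g x)"] by simp_all
  with *[OF mm(1)[folded eq]] *[OF mm(2)[folded eq]]
  show "(\<lambda>x. fst (g x)) \<in> L2 \<Omega>" "(\<lambda>x. snd (g x)) \<in> L2 \<Omega>"
    "L2_norm \<Omega> (\<lambda>x. fst (g x)) \<le> L2_norm \<Omega> g" "L2_norm \<Omega> (\<lambda>x. snd (g x)) \<le> L2_norm \<Omega> g"
    by blast+
qed

lemma continuous_L2:
  fixes u :: "plane \<Rightarrow> 'b::euclidean_space"
  assumes "continuous_on UNIV u" shows "u \<in> L2 \<Omega>"
proof -
  have "set_borel_measurable lborel \<Omega> u"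
    unfolding set_borel_measurable_def
    by (intro borel_measurable_scaleR borel_measurable_indicator \<Omega>_sets) (simp add: borel_measurable_continuous_onI[OF assms])
  moreover have "set_integrable lborel (closure \<Omega>) (\<lambda>x. (norm (u x))\<^sup>2)"
    unfolding set_integrable_def
    by (intro borel_integrable_compact) (auto intro!: continuous_intros continuous_on_subset[OF assms] simp: compact_closure bounded_\<Omega>)
  then have "set_integrable lborel \<Omega> (\<lambda>x. (norm (u x))\<^sup>2)"
    by (rule set_integrable_subset) (simp_all add: \<Omega>_sets closure_subset)
  ultimately show ?thesis by (simp add: L2_def)
qed

lemma Ck_L2: "Ck k u \<Longrightarrow> u \<in> L2 \<Omega>"
  by (rule continuous_L2[OF Ck_continuous])

lemma Ck_gradient_L2:
  assumes "Ck 1 u" shows "dx u \<in> L2 \<Omega>" "dy u \<in> L2 \<Omega>" "(\<lambda>x. (dx u x, dy u x)) \<in> L2 \<Omega>"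
proof -
  have c: "continuous_on UNIV (dx u)" "continuous_on UNIV (dy u)"
    using assms Ck_continuous[of 0] Ck_Suc_dx[of 0 u] Ck_Suc_dy[of 0 u] by (auto simp del: Ck.simps)
  show "dx u \<in> L2 \<Omega>" "dy u \<in> L2 \<Omega>" "(\<lambda>x. (dx u x, dy u x)) \<in> L2 \<Omega>"
    by (rule continuous_L2[OF c(1)], rule continuous_L2[OF c(2)], rule continuous_L2[OF continuous_on_Pair[OF c]])
qed

lemma L2_integrable:
  fixes u :: "plane \<Rightarrow> real"
  assumes "u \<in> L2 \<Omega>" shows "set_integrable lborel \<Omega> u"
  using L2_mult_integrable(1)[OF assms Ck_L2[OF Ck_const[of 0 1]]] by simp

lemma set_integral_eq_integral_if_vanishing:
  fixes u :: "plane \<Rightarrow> real"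
  assumes "\<And>x. x \<notin> \<Omega> \<Longrightarrow> u x = 0" shows "(LINT x:\<Omega>|lborel. u x) = (\<integral>x. u x \<partial>lborel)"
  unfolding set_lebesgue_integral_def
  by (intro Bochner_Integration.integral_cong) (use assms in \<open>auto simp: indicator_def\<close>)

section \<open>Weak gradients\<close>

lemma weak_gradient_Ck:
  assumes u: "Ck 1 u" shows "weak_gradient \<Omega> u (\<lambda>x. (dx u x, dy u x))"
  unfolding weak_gradient_def
proof (intro conjI allI impI)
  show "(\<lambda>x. (dx u x, dy u x)) \<in> L2 \<Omega>" by (rule Ck_gradient_L2[OF u])
  fix \<phi> assume \<phi>: "test_function \<Omega> \<phi>"
  obtain R where R: "vanishes_beyond R \<phi>" using test_function_vanishes_beyond[OF \<phi>] .
  note u1 = u[unfolded One_nat_def] and p1 = test_function_Ck[OF \<phi>, of "Suc 0"]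
  have up: "Ck 1 (\<lambda>x. u x * \<phi> x)" "vanishes_beyond R (\<lambda>x. u x * \<phi> x)"
    by (intro Ck_mult u test_function_Ck[OF \<phi>] vanishes_beyond_mult_right R)+
  have i: "integrable lborel (\<lambda>x. v x * w x)" if "continuous_on UNIV v" "continuous_on UNIV w" "vanishes_beyond R w" for v w :: "plane \<Rightarrow> real"
    by (intro continuous_bounded_support_integrable[of _ R] continuous_on_mult vanishes_beyond_mult_right that)
  note c = Ck_continuous[OF u1] Ck_continuous[OF p1] Ck_continuous[OF Ck_Suc_dx[OF u1]] Ck_continuous[OF Ck_Suc_dy[OF u1]]
    Ck_continuous[OF Ck_Suc_dx[OF p1]] Ck_continuous[OF Ck_Suc_dy[OF p1]]
  note v = vanishes_beyond_pderiv[OF R]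
  have "(\<integral>x. u x * dx \<phi> x \<partial>lborel) = - (\<integral>x. dx u x * \<phi> x \<partial>lborel)"
    using integral_dx_eq_0[OF up] i[OF c(3,2) R] i[OF c(1,5) v(1)] by (simp add: pderiv_mult[OF u1 p1])
  moreover have "(\<integral>x. u x * dy \<phi> x \<partial>lborel) = - (\<integral>x. dy u x * \<phi> x \<partial>lborel)"
    using integral_dy_eq_0[OF up] i[OF c(4,2) R] i[OF c(1,6) v(2)] by (simp add: pderiv_mult[OF u1 p1])
  ultimately show
    "(LINT x:\<Omega>|lborel. u x * dx \<phi> x) = - (LINT x:\<Omega>|lborel. fst (dx u x, dy u x) * \<phi> x)"
    "(LINT x:\<Omega>|lborel. u x * dy \<phi> x) = - (LINT x:\<Omega>|lborel. snd (dx u x, dy u x) * \<phi> x)"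
    using test_function_vanishes[OF \<phi>] test_function_pderiv_vanishes[OF \<phi>]
    by (simp_all add: set_integral_eq_integral_if_vanishing)
qed

text \<open>The fundamental lemma on each component. It makes the choice in \<open>wgrad\<close>
  harmless: a gradient computed by any means can be substituted through
  \<open>wgrad_eq\<close>.\<close>

lemma weak_gradient_unique:
  assumes g: "weak_gradient \<Omega> u g" and h: "weak_gradient \<Omega> u h"
  shows "AE x in lborel. x \<in> \<Omega> \<longrightarrow> g x = h x"
proof -
  have component: "AE x in lborel. x \<in> \<Omega> \<longrightarrow> p x = q x"
    if pq: "p \<in> L2 \<Omega>" "q \<in> L2 \<Omega>" and eq: "\<And>\<phi>. test_function \<Omega> \<phi> \<Longrightarrow> (LINT x:\<Omega>|lborel. p x * \<phi> x) = (LINT x:\<Omega>|lborel. q x * \<phi> x)"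
    for p q :: "plane \<Rightarrow> real"
  proof -
    let ?W = "\<lambda>x. indicator \<Omega> x *\<^sub>R p x - indicator \<Omega> x *\<^sub>R q x"
    have W: "integrable lborel ?W"
      using L2_integrable[OF pq(1)] L2_integrable[OF pq(2)] unfolding set_integrable_def by (rule Bochner_Integration.integrable_diff)
    have "AE x in lborel. x \<in> \<Omega> \<longrightarrow> ?W x = 0"
    proof (rule AE_zero_if_test_integrals_zero[OF open_\<Omega> W])
      fix \<phi> assume \<phi>: "test_function \<Omega> \<phi>"
      have "\<phi> \<in> L2 \<Omega>" using Ck_L2[OF test_function_Ck[OF \<phi>, of 0]] .
      then have i: "integrable lborel (\<lambda>x. indicator \<Omega> x *\<^sub>R (p x * \<phi> x))" "integrable lborel (\<lambda>x. indicator \<Omega> x *\<^sub>R (q x * \<phi> x))"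
        using L2_mult_integrable(1)[OF pq(1)] L2_mult_integrable(1)[OF pq(2)] by (simp_all only: set_integrable_def)
      have "(\<integral>x. ?W x * \<phi> x \<partial>lborel) = (\<integral>x. indicator \<Omega> x *\<^sub>R (p x * \<phi> x) - indicator \<Omega> x *\<^sub>R (q x * \<phi> x) \<partial>lborel)"
        by (intro Bochner_Integration.integral_cong) (simp_all add: algebra_simps)
      also have "\<dots> = (LINT x:\<Omega>|lborel. p x * \<phi> x) - (LINT x:\<Omega>|lborel. q x * \<phi> x)"
        unfolding set_lebesgue_integral_def by (rule Bochner_Integration.integral_diff[OF i])
      also have "\<dots> = 0" by (simp add: eq[OF \<phi>])
      finally show "(\<integral>x. ?W x * \<phi> x \<partial>lborel) = 0" .
    qed
    then show ?thesis by eventually_elim simp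
  qed
  have L: "g \<in> L2 \<Omega>" "h \<in> L2 \<Omega>" using g h by (auto simp: weak_gradient_def)
  have e1: "(LINT x:\<Omega>|lborel. fst (g x) * \<phi> x) = (LINT x:\<Omega>|lborel. fst (h x) * \<phi> x)"
    "(LINT x:\<Omega>|lborel. snd (g x) * \<phi> x) = (LINT x:\<Omega>|lborel. snd (h x) * \<phi> x)" if "test_function \<Omega> \<phi>" for \<phi>
    using g[unfolded weak_gradient_def, THEN conjunct2, rule_format, OF that]
      h[unfolded weak_gradient_def, THEN conjunct2, rule_format, OF that] by simp_all
  have "AE x in lborel. x \<in> \<Omega> \<longrightarrow> fst (g x) = fst (h x)"
    by (rule component[OF L2_fst_snd(1)[OF L(1)] L2_fst_snd(1)[OF L(2)] e1(1)])
  moreover have "AE x in lborel. x \<in> \<Omega> \<longrightarrow> snd (g x) = snd (h x)"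
    by (rule component[OF L2_fst_snd(2)[OF L(1)] L2_fst_snd(2)[OF L(2)] e1(2)])
  ultimately show ?thesis by eventually_elim (simp add: prod_eq_iff)
qed

lemma weak_gradient_lincomb:
  assumes u: "u \<in> L2 \<Omega>" "weak_gradient \<Omega> u g" and v: "v \<in> L2 \<Omega>" "weak_gradient \<Omega> v h"
  shows "weak_gradient \<Omega> (\<lambda>x. a * u x + b * v x) (\<lambda>x. a *\<^sub>R g x + b *\<^sub>R h x)"
  unfolding weak_gradient_def
proof (intro conjI allI impI)
  have L: "g \<in> L2 \<Omega>" "h \<in> L2 \<Omega>" using u v by (auto simp: weak_gradient_def)
  show "(\<lambda>x. a *\<^sub>R g x + b *\<^sub>R h x) \<in> L2 \<Omega>" by (rule L2_lincomb[OF L])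
  fix \<phi> assume \<phi>: "test_function \<Omega> \<phi>"
  have lin: "(LINT x:\<Omega>|lborel. (a * p x + b * q x) * \<zeta> x) = a * (LINT x:\<Omega>|lborel. p x * \<zeta> x) + b * (LINT x:\<Omega>|lborel. q x * \<zeta> x)"
    if "p \<in> L2 \<Omega>" "q \<in> L2 \<Omega>" "\<zeta> \<in> L2 \<Omega>" for p q \<zeta> :: "plane \<Rightarrow> real"
  proof -
    have "(LINT x:\<Omega>|lborel. (a * p x + b * q x) * \<zeta> x) = (LINT x:\<Omega>|lborel. a * (p x * \<zeta> x) + b * (q x * \<zeta> x))"
      by (simp add: algebra_simps)
    also have "\<dots> = a * (LINT x:\<Omega>|lborel. p x * \<zeta> x) + b * (LINT x:\<Omega>|lborel. q x * \<zeta> x)"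
      using L2_mult_integrable(1)[OF that(1,3)] L2_mult_integrable(1)[OF that(2,3)]
      by (subst set_integral_add(2)) simp_all
    finally show ?thesis .
  qed
  have L\<phi>: "\<phi> \<in> L2 \<Omega>" "dx \<phi> \<in> L2 \<Omega>" "dy \<phi> \<in> L2 \<Omega>"
    using Ck_L2[OF test_function_Ck[OF \<phi>, of 0]] Ck_gradient_L2[OF test_function_Ck[OF \<phi>]] by auto
  note w = u(2)[unfolded weak_gradient_def, THEN conjunct2, rule_format, OF \<phi>] v(2)[unfolded weak_gradient_def, THEN conjunct2, rule_format, OF \<phi>]
  show "(LINT x:\<Omega>|lborel. (a * u x + b * v x) * dx \<phi> x) = - (LINT x:\<Omega>|lborel. fst (a *\<^sub>R g x + b *\<^sub>R h x) * \<phi> x)"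
    using w by (simp add: lin u v L\<phi> L2_fst_snd[OF L(1)] L2_fst_snd[OF L(2)])
  show "(LINT x:\<Omega>|lborel. (a * u x + b * v x) * dy \<phi> x) = - (LINT x:\<Omega>|lborel. snd (a *\<^sub>R g x + b *\<^sub>R h x) * \<phi> x)"
    using w by (simp add: lin u v L\<phi> L2_fst_snd[OF L(1)] L2_fst_snd[OF L(2)])
qed

lemma H1_L2: "u \<in> H1 \<Omega> \<Longrightarrow> u \<in> L2 \<Omega>"
  by (simp add: H1_def)

lemma weak_gradient_wgrad: "u \<in> H1 \<Omega> \<Longrightarrow> weak_gradient \<Omega> u (wgrad \<Omega> u)"
  unfolding H1_def wgrad_def by (metis (mono_tags, lifting) mem_Collect_eq someI_ex)

lemma wgrad_L2: "u \<in> H1 \<Omega> \<Longrightarrow> wgrad \<Omega> u \<in> L2 \<Omega>"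
  using weak_gradient_wgrad by (auto simp: weak_gradient_def)

lemma wgrad_eq:
  assumes "u \<in> L2 \<Omega>" "weak_gradient \<Omega> u g"
  shows "u \<in> H1 \<Omega>" "AE x in lborel. x \<in> \<Omega> \<longrightarrow> wgrad \<Omega> u x = g x" "L2_norm \<Omega> (wgrad \<Omega> u) = L2_norm \<Omega> g"
proof -
  show H: "u \<in> H1 \<Omega>" using assms by (auto simp: H1_def)
  show "AE x in lborel. x \<in> \<Omega> \<longrightarrow> wgrad \<Omega> u x = g x"
    by (rule weak_gradient_unique[OF weak_gradient_wgrad[OF H] assms(2)])
  then show "L2_norm \<Omega> (wgrad \<Omega> u) = L2_norm \<Omega> g"
    using wgrad_L2[OF H] assms(2) by (intro L2_norm_cong_AE) (auto simp: weak_gradient_def)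
qed

lemma H1_lincomb:
  assumes u: "u \<in> H1 \<Omega>" and v: "v \<in> H1 \<Omega>"
  shows "(\<lambda>x. a * u x + b * v x) \<in> H1 \<Omega>"
    "AE x in lborel. x \<in> \<Omega> \<longrightarrow> wgrad \<Omega> (\<lambda>x. a * u x + b * v x) x = a *\<^sub>R wgrad \<Omega> u x + b *\<^sub>R wgrad \<Omega> v x"
    "L2_norm \<Omega> (wgrad \<Omega> (\<lambda>x. a * u x + b * v x)) = L2_norm \<Omega> (\<lambda>x. a *\<^sub>R wgrad \<Omega> u x + b *\<^sub>R wgrad \<Omega> v x)"
  using wgrad_eq[OF _ weak_gradient_lincomb[OF H1_L2[OF u] weak_gradient_wgrad[OF u] H1_L2[OF v] weak_gradient_wgrad[OF v]], of a b]
    L2_lincomb[OF H1_L2[OF u] H1_L2[OF v], of a b] by simp_all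

lemma Ck_H1:
  assumes "Ck 1 u"
  shows "u \<in> H1 \<Omega>" "AE x in lborel. x \<in> \<Omega> \<longrightarrow> wgrad \<Omega> u x = (dx u x, dy u x)"
  using wgrad_eq[OF Ck_L2[OF assms] weak_gradient_Ck[OF assms]] by simp_all

lemma H1_norm_tendsto_0_iff:
  "(\<lambda>k. H1_norm \<Omega> (u k)) \<longlonglongrightarrow> 0 \<longleftrightarrow>
    (\<lambda>k. L2_norm \<Omega> (u k)) \<longlonglongrightarrow> 0 \<and> (\<lambda>k. L2_norm \<Omega> (wgrad \<Omega> (u k))) \<longlonglongrightarrow> 0"
proof
  assume *: "(\<lambda>k. H1_norm \<Omega> (u k)) \<longlonglongrightarrow> 0"
  have le: "L2_norm \<Omega> (u k) \<le> H1_norm \<Omega> (u k)" "L2_norm \<Omega> (wgrad \<Omega> (u k)) \<le> H1_norm \<Omega> (u k)" for k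
    unfolding H1_norm_def by (intro real_le_rsqrt, simp)+
  show "(\<lambda>k. L2_norm \<Omega> (u k)) \<longlonglongrightarrow> 0 \<and> (\<lambda>k. L2_norm \<Omega> (wgrad \<Omega> (u k))) \<longlonglongrightarrow> 0"
    by (intro conjI; rule tendsto_sandwich[OF always_eventually always_eventually tendsto_const *])
      (simp_all add: L2_norm_nonneg le)
next
  assume *: "(\<lambda>k. L2_norm \<Omega> (u k)) \<longlonglongrightarrow> 0 \<and> (\<lambda>k. L2_norm \<Omega> (wgrad \<Omega> (u k))) \<longlonglongrightarrow> 0"
  have "(\<lambda>k. sqrt ((L2_norm \<Omega> (u k))\<^sup>2 + (L2_norm \<Omega> (wgrad \<Omega> (u k)))\<^sup>2)) \<longlonglongrightarrow> sqrt (0\<^sup>2 + 0\<^sup>2)"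
    using * by (intro tendsto_intros) auto
  then show "(\<lambda>k. H1_norm \<Omega> (u k)) \<longlonglongrightarrow> 0"
    by (simp add: H1_norm_def)
qed

section \<open>The space of functions with zero boundary values\<close>

lemma H10_H1: "u \<in> H10 \<Omega> \<Longrightarrow> u \<in> H1 \<Omega>"
  by (simp add: H10_def)

lemma H10_lincomb:
  assumes u: "u \<in> H10 \<Omega>" and v: "v \<in> H10 \<Omega>"
  shows "(\<lambda>x. a * u x + b * v x) \<in> H10 \<Omega>"
proof -
  obtain p q where p: "\<And>k. test_function \<Omega> (p k)" "(\<lambda>k. H1_norm \<Omega> (\<lambda>x. p k x - u x)) \<longlonglongrightarrow> 0"
    and q: "\<And>k. test_function \<Omega> (q k)" "(\<lambda>k. H1_norm \<Omega> (\<lambda>x. q k x - v x)) \<longlonglongrightarrow> 0"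
    using u v unfolding H10_def by blast
  have pu: "(\<lambda>x. p k x - u x) \<in> H1 \<Omega>" "(\<lambda>x. q k x - v x) \<in> H1 \<Omega>" for k
    using H1_lincomb(1)[OF Ck_H1(1)[OF test_function_Ck[OF p(1)[of k]]] H10_H1[OF u], of 1 "-1"]
      H1_lincomb(1)[OF Ck_H1(1)[OF test_function_Ck[OF q(1)[of k]]] H10_H1[OF v], of 1 "-1"] by simp_all
  have eq: "(\<lambda>x. (a * p k x + b * q k x) - (a * u x + b * v x)) = (\<lambda>x. a * (p k x - u x) + b * (q k x - v x))" for k
    by (auto simp: algebra_simps)
  have lim: "(\<lambda>k. \<bar>a\<bar> * F (\<lambda>x. p k x - u x) + \<bar>b\<bar> * F (\<lambda>x. q k x - v x)) \<longlonglongrightarrow> 0"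
    if "(\<lambda>k. F (\<lambda>x. p k x - u x)) \<longlonglongrightarrow> 0" "(\<lambda>k. F (\<lambda>x. q k x - v x)) \<longlonglongrightarrow> 0" for F :: "(plane \<Rightarrow> real) \<Rightarrow> real"
    using tendsto_add[OF tendsto_mult_left[OF that(1), of "\<bar>a\<bar>"] tendsto_mult_left[OF that(2), of "\<bar>b\<bar>"]] by simp
  note pl = p(2)[unfolded H1_norm_tendsto_0_iff] and ql = q(2)[unfolded H1_norm_tendsto_0_iff]
  have "(\<lambda>k. H1_norm \<Omega> (\<lambda>x. (a * p k x + b * q k x) - (a * u x + b * v x))) \<longlonglongrightarrow> 0"
    unfolding eq H1_norm_tendsto_0_iff
  proof
    show "(\<lambda>k. L2_norm \<Omega> (\<lambda>x. a * (p k x - u x) + b * (q k x - v x))) \<longlonglongrightarrow> 0"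
      by (rule tendsto_sandwich[OF always_eventually always_eventually tendsto_const lim[of "L2_norm \<Omega>", OF pl[THEN conjunct1] ql[THEN conjunct1]]])
        (use L2_norm_nonneg L2_norm_lincomb[OF H1_L2[OF pu(1)] H1_L2[OF pu(2)]] in \<open>auto simp: real_scaleR_def[symmetric] simp del: real_scaleR_def\<close>)
    show "(\<lambda>k. L2_norm \<Omega> (wgrad \<Omega> (\<lambda>x. a * (p k x - u x) + b * (q k x - v x)))) \<longlonglongrightarrow> 0"
      unfolding H1_lincomb(3)[OF pu]
      by (rule tendsto_sandwich[OF always_eventually always_eventually tendsto_const lim[of "\<lambda>u. L2_norm \<Omega> (wgrad \<Omega> u)", OF pl[THEN conjunct2] ql[THEN conjunct2]]])
        (use L2_norm_nonneg L2_norm_lincomb[OF wgrad_L2[OF pu(1)] wgrad_L2[OF pu(2)]] in auto)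
  qed
  moreover have "test_function \<Omega> (\<lambda>x. a * p k x + b * q k x)" for k
    by (rule test_function_lincomb[OF p(1) q(1)])
  ultimately show ?thesis
    unfolding H10_def using H1_lincomb(1)[OF H10_H1[OF u] H10_H1[OF v], of a b]
    by (intro CollectI conjI exI[of _ "\<lambda>k x. a * p k x + b * q k x"]) simp_all
qed

lemma test_function_H10:
  assumes "test_function \<Omega> u" shows "u \<in> H10 \<Omega>"
proof -
  have "Ck 1 (\<lambda>x::plane. 0)" by (rule Ck_const)
  have "H1_norm \<Omega> (\<lambda>x. u x - u x) = 0"
  proof -
    have "L2_norm \<Omega> (wgrad \<Omega> (\<lambda>x. 0)) = L2_norm \<Omega> (\<lambda>x. (dx (\<lambda>x. 0) x, dy (\<lambda>x. 0) x))"
      by (rule wgrad_eq(3)[OF Ck_L2[OF Ck_const[of 0]] weak_gradient_Ck[OF Ck_const]])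
    also have "\<dots> = 0"
      by (simp add: pderiv_const L2_norm_eq zero_prod_def[symmetric])
    finally show ?thesis by (simp add: H1_norm_def L2_norm_eq)
  qed
  then have "(\<lambda>k::nat. H1_norm \<Omega> (\<lambda>x. u x - u x)) \<longlonglongrightarrow> 0" by simp
  then show ?thesis
    unfolding H10_def using Ck_H1(1)[OF test_function_Ck[OF assms]] assms
    by (intro CollectI conjI exI[of _ "\<lambda>k. u"]) simp_all
qed

end

section \<open>Lipschitz boundaries and extension into the holes\<close>

definition dir_deriv :: "plane \<Rightarrow> (plane \<Rightarrow> real) \<Rightarrow> plane \<Rightarrow> real" where
  "dir_deriv v w x = fst v * dx w x + snd v * dy w x"

lemma dir_deriv_axes: "dir_deriv (1, 0) w = dx w" "dir_deriv (0, 1) w = dy w"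
  by (auto simp: dir_deriv_def)

lemma dir_deriv_has_real_derivative:
  assumes "Ck (Suc k) w"
  shows "((\<lambda>t. w (x + t *\<^sub>R v)) has_real_derivative dir_deriv v w (x + t *\<^sub>R v)) (at t)"
proof -
  have "((\<lambda>t. x + t *\<^sub>R v) has_derivative (\<lambda>h. h *\<^sub>R v)) (at t)"
    by (auto intro!: derivative_eq_intros)
  from has_derivative_compose[OF this Ck_Suc_has_derivative[OF assms]] show ?thesis
    unfolding has_field_derivative_def
    by (rule has_derivative_eq_rhs) (auto simp: dir_deriv_def algebra_simps)
qed

lemma dir_deriv_lipschitz:
  assumes w: "Ck (Suc k) w" and K: "\<And>y. \<bar>dir_deriv v w y\<bar> \<le> K"
  shows "\<bar>w (x + s *\<^sub>R v) - w (x + t *\<^sub>R v)\<bar> \<le> K * \<bar>s - t\<bar>"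
proof -
  have "norm (w (x + s *\<^sub>R v) - w (x + t *\<^sub>R v)) \<le> K * norm (s - t)"
    by (rule field_differentiable_bound[where S=UNIV and f'="\<lambda>t. dir_deriv v w (x + t *\<^sub>R v)"])
      (use dir_deriv_has_real_derivative[OF w] K in auto)
  then show ?thesis by simp
qed

lemma continuous_dir_deriv: "Ck 1 w \<Longrightarrow> continuous_on UNIV (dir_deriv v w)"
  unfolding dir_deriv_def[abs_def]
  using Ck_continuous[OF Ck_Suc_dx[of 0 w]] Ck_continuous[OF Ck_Suc_dy[of 0 w]]
  by (auto intro!: continuous_intros)

lemma vanishes_beyond_dir_deriv: "vanishes_beyond R w \<Longrightarrow> vanishes_beyond R (dir_deriv v w)"
  unfolding dir_deriv_def[abs_def]
  by (intro vanishes_beyond_add vanishes_beyond_mult_right vanishes_beyond_pderiv)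

lemma integral_dir_deriv_eq_0:
  assumes "Ck 1 w" "vanishes_beyond R w"
  shows "(\<integral>x. dir_deriv v w x \<partial>lborel) = 0"
proof -
  have "integrable lborel (dx w)" "integrable lborel (dy w)"
    using assms Ck_continuous[OF Ck_Suc_dx[of 0 w]] Ck_continuous[OF Ck_Suc_dy[of 0 w]] vanishes_beyond_pderiv[OF assms(2)]
    by (auto intro!: continuous_bounded_support_integrable)
  then show ?thesis
    using integral_dx_eq_0[OF assms] integral_dy_eq_0[OF assms] by (simp add: dir_deriv_def)
qed

lemma dir_deriv_mult:
  assumes "Ck (Suc k) u" "Ck (Suc k) w"
  shows "dir_deriv v (\<lambda>x. u x * w x) = (\<lambda>x. dir_deriv v u x * w x + u x * dir_deriv v w x)"
  by (rule ext) (simp add: dir_deriv_def pderiv_mult[OF assms] algebra_simps)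

lemma dir_deriv_diff_const:
  assumes "Ck (Suc k) u" shows "dir_deriv v (\<lambda>x. u x - c) = dir_deriv v u"
  by (rule ext) (simp add: dir_deriv_def pderiv_diff[OF assms Ck_const] pderiv_const)

lemma pderiv_transform_open:
  assumes "open S" "x \<in> S" "\<And>y. y \<in> S \<Longrightarrow> u y = w y" "Ck (Suc k) u"
  shows "dx w x = dx u x" "dy w x = dy u x"
proof -
  have "(w has_derivative (\<lambda>v. fst v * dx u x + snd v * dy u x)) (at x)"
    by (rule has_derivative_transform_within_open[OF Ck_Suc_has_derivative[OF assms(4)] assms(1-3)])
  from pderiv_eqI[OF this] show "dx w x = dx u x" "dy w x = dy u x" by auto
qed

lemma dir_deriv_eq_0_outside:
  assumes "\<And>y. \<rho> \<le> dist x0 y \<Longrightarrow> w y = 0" "\<rho> < dist x0 x"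
  shows "dir_deriv v w x = 0"
proof -
  have "open {y. \<rho> < dist x0 y}" by (intro open_Collect_less continuous_intros)
  from pderiv_transform_open[OF this, where x=x and u="\<lambda>x. 0" and w=w and k=0, OF _ _ Ck_const] assms
  show ?thesis by (simp add: dir_deriv_def pderiv_const)
qed

text \<open>In the plane an orthonormal pair is a unit vector and its quarter turn, up to the
  orientation \<open>d\<close>, which is the determinant. The explicit components make the change of
  variables below elementary.\<close>

lemma orthonormal_plane:
  fixes e1 e2 :: plane
  assumes "norm e1 = 1" "norm e2 = 1" "e1 \<bullet> e2 = 0"
  obtains d where "d\<^sup>2 = 1" "fst e2 = - d * snd e1" "snd e2 = d * fst e1"
    "(fst e1)\<^sup>2 + (snd e1)\<^sup>2 = 1"
proof -
  let ?p = "fst e1" and ?q = "snd e1" and ?p' = "fst e2" and ?q' = "snd e2"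
  have n: "?p * ?p + ?q * ?q = 1" "?p' * ?p' + ?q' * ?q' = 1" "?p * ?p' + ?q * ?q' = 0"
    using assms unfolding norm_eq_1 inner_prod_def by simp_all
  define d where "d = ?p * ?q' - ?q * ?p'"
  have "d * ?q = ?q' * (?p * ?q) - (?q * ?q) * ?p'" by (simp add: d_def algebra_simps)
  also have "?q' * (?p * ?q) = ?p * (?q * ?q')" by simp
  also have "?q * ?q' = - (?p * ?p')" using n(3) by linarith
  also have "?p * - (?p * ?p') - (?q * ?q) * ?p' = - ((?p * ?p + ?q * ?q) * ?p')" by (simp add: algebra_simps)
  finally have 1: "?p' = - d * ?q" using n(1) by simp
  have "d * ?p = (?p * ?p) * ?q' - ?q * (?p * ?p')" by (simp add: d_def algebra_simps)
  also have "?p * ?p' = - (?q * ?q')" using n(3) by linarith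
  also have "(?p * ?p) * ?q' - ?q * - (?q * ?q') = (?p * ?p + ?q * ?q) * ?q'" by (simp add: algebra_simps)
  finally have 2: "?q' = d * ?p" using n(1) by simp
  have "d\<^sup>2 * (?p * ?p + ?q * ?q) = 1"
    using n(2) unfolding 1 2 by (simp add: power2_eq_square algebra_simps)
  then have "d\<^sup>2 = 1" using n(1) by simp
  then show ?thesis using that[of d] 1 2 n(1) by (simp add: power2_eq_square)
qed

lemma orthonormal_plane_expansion:
  fixes e1 e2 x :: plane
  assumes "norm e1 = 1" "norm e2 = 1" "e1 \<bullet> e2 = 0"
  shows "x = (x \<bullet> e1) *\<^sub>R e1 + (x \<bullet> e2) *\<^sub>R e2"
proof -
  obtain d where d: "d\<^sup>2 = 1" "fst e2 = - d * snd e1" "snd e2 = d * fst e1" "(fst e1)\<^sup>2 + (snd e1)\<^sup>2 = 1"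
    using orthonormal_plane[OF assms] .
  have "fst ((x \<bullet> e1) *\<^sub>R e1 + (x \<bullet> e2) *\<^sub>R e2) =
      fst x * ((fst e1)\<^sup>2 + d\<^sup>2 * (snd e1)\<^sup>2) + snd x * (fst e1 * snd e1 - d\<^sup>2 * (fst e1 * snd e1))"
    "snd ((x \<bullet> e1) *\<^sub>R e1 + (x \<bullet> e2) *\<^sub>R e2) =
      fst x * (fst e1 * snd e1 - d\<^sup>2 * (fst e1 * snd e1)) + snd x * ((snd e1)\<^sup>2 + d\<^sup>2 * (fst e1)\<^sup>2)"
    by (simp_all add: inner_prod_def d(2,3) power2_eq_square algebra_simps)
  then show ?thesis
    using d(1,4) by (simp add: prod_eq_iff add.commute)
qed

lemma inner_orthonormal_combination:
  fixes e1 e2 :: plane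
  assumes "norm e1 = 1" "norm e2 = 1" "e1 \<bullet> e2 = 0"
  shows "(s *\<^sub>R e1 + t *\<^sub>R e2) \<bullet> e1 = s" "(s *\<^sub>R e1 + t *\<^sub>R e2) \<bullet> e2 = t"
  using assms by (simp_all add: inner_add_left norm_eq_1 inner_commute[of e2 e1])

text \<open>The rotation is factored into substitutions in one real variable: with \<open>t\<close>
  fixed the first coordinate replaces \<open>s\<close>, then with the first coordinate fixed the
  second replaces \<open>t\<close>. The factors \<open>\<bar>inverse p\<bar>\<close> and
  \<open>\<bar>p\<bar>\<close> cancel. When \<open>p = 0\<close> the axes are merely exchanged up to
  sign.\<close>

lemma nn_integral_orthonormal_coordinates:
  fixes e1 e2 :: plane and F :: "plane \<Rightarrow> ennreal"
  assumes e: "norm e1 = 1" "norm e2 = 1" "e1 \<bullet> e2 = 0" and F[measurable]: "F \<in> borel_measurable borel"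
  shows "(\<integral>\<^sup>+ x. F x \<partial>lborel) = (\<integral>\<^sup>+ s. \<integral>\<^sup>+ t. F (s *\<^sub>R e1 + t *\<^sub>R e2) \<partial>lborel \<partial>lborel)"
proof -
  obtain d where d: "d\<^sup>2 = 1" "fst e2 = - d * snd e1" "snd e2 = d * fst e1" "(fst e1)\<^sup>2 + (snd e1)\<^sup>2 = 1"
    using orthonormal_plane[OF e] .
  define p q where "p = fst e1" and "q = snd e1"
  have e_eq: "s *\<^sub>R e1 + t *\<^sub>R e2 = (p * s - d * q * t, q * s + d * p * t)" for s t
    using d by (simp add: prod_eq_iff p_def q_def)
  have dabs: "\<bar>d\<bar> = 1" using d(1) by (metis abs_1 power2_eq_1_iff abs_minus_cancel)
  have pq: "p\<^sup>2 + q\<^sup>2 = 1" using d(4) by (simp add: p_def q_def)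
  have lb: "(lborel :: plane measure) = lborel \<Otimes>\<^sub>M lborel" by (simp add: lborel_prod)
  have F2[measurable]: "F \<in> borel_measurable (lborel \<Otimes>\<^sub>M lborel)"
    using F by (simp add: lborel_prod)
  have F3[measurable]: "F \<in> borel_measurable (borel \<Otimes>\<^sub>M borel)"
    using F by (simp add: borel_prod)
  have Fub: "(\<integral>\<^sup>+ x. F x \<partial>lborel) = (\<integral>\<^sup>+ x. \<integral>\<^sup>+ y. F (x, y) \<partial>lborel \<partial>lborel)"
    unfolding lb by (rule lborel.nn_integral_fst[symmetric]) measurable
  have swap: "(\<integral>\<^sup>+ y. \<integral>\<^sup>+ x. G x y \<partial>lborel \<partial>lborel) = (\<integral>\<^sup>+ x. \<integral>\<^sup>+ y. G x y \<partial>lborel \<partial>lborel)"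
    if "case_prod G \<in> borel_measurable (borel \<Otimes>\<^sub>M borel)" for G :: "real \<Rightarrow> real \<Rightarrow> ennreal"
    by (rule lborel_pair.Fubini') (use that in simp)
  have cm: "\<bar>c\<bar> * \<bar>inverse c\<bar> = 1" if "c \<noteq> 0" for c :: real
    using that by (simp add: abs_mult[symmetric])
  show ?thesis
  proof (cases "p = 0")
    case False
    have "(\<integral>\<^sup>+ s. \<integral>\<^sup>+ t. F (p * s - d * q * t, q * s + d * p * t) \<partial>lborel \<partial>lborel)
      = (\<integral>\<^sup>+ t. \<integral>\<^sup>+ s. F (p * s - d * q * t, q * s + d * p * t) \<partial>lborel \<partial>lborel)"
      by (rule swap[symmetric]) measurable
    also have "\<dots> = (\<integral>\<^sup>+ t. ennreal \<bar>inverse p\<bar> * (\<integral>\<^sup>+ X. F (X, q * inverse p * X + d * inverse p * t) \<partial>lborel) \<partial>lborel)"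
    proof (rule nn_integral_cong)
      fix t :: real
      have arg1: "p * (d * q * t * inverse p + inverse p * X) - d * q * t = X" for X
        using False by (simp add: field_simps)
      have arg2: "q * (d * q * t * inverse p + inverse p * X) + d * p * t = q * inverse p * X + d * inverse p * t" for X
      proof -
        have "q * (d * q * t * inverse p + inverse p * X) + d * p * t = q * inverse p * X + d * t * inverse p * (p\<^sup>2 + q\<^sup>2)"
          using False by (simp add: field_simps power2_eq_square)
        then show ?thesis by (simp add: pq mult_ac)
      qed
      show "(\<integral>\<^sup>+ s. F (p * s - d * q * t, q * s + d * p * t) \<partial>lborel) =
        ennreal \<bar>inverse p\<bar> * (\<integral>\<^sup>+ X. F (X, q * inverse p * X + d * inverse p * t) \<partial>lborel)"
        using False by (subst nn_integral_real_affine[where c="inverse p" and t="d * q * t * inverse p"])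
          (simp_all only: arg1 arg2, auto)
    qed
    also have "\<dots> = ennreal \<bar>inverse p\<bar> * (\<integral>\<^sup>+ t. \<integral>\<^sup>+ X. F (X, q * inverse p * X + d * inverse p * t) \<partial>lborel \<partial>lborel)"
      by (rule nn_integral_cmult) measurable
    also have "(\<integral>\<^sup>+ t. \<integral>\<^sup>+ X. F (X, q * inverse p * X + d * inverse p * t) \<partial>lborel \<partial>lborel)
      = (\<integral>\<^sup>+ X. \<integral>\<^sup>+ t. F (X, q * inverse p * X + d * inverse p * t) \<partial>lborel \<partial>lborel)"
      by (rule swap) measurable
    also have "\<dots> = (\<integral>\<^sup>+ X. ennreal \<bar>p\<bar> * (\<integral>\<^sup>+ Y. F (X, Y) \<partial>lborel) \<partial>lborel)"
    proof (rule nn_integral_cong)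
      fix X :: real
      have dn: "d * inverse p \<noteq> 0" using False dabs by auto
      have "ennreal \<bar>p\<bar> * (\<integral>\<^sup>+ Y. F (X, Y) \<partial>lborel)
        = ennreal \<bar>p\<bar> * (ennreal \<bar>d * inverse p\<bar> * (\<integral>\<^sup>+ t. F (X, q * inverse p * X + d * inverse p * t) \<partial>lborel))"
        by (subst nn_integral_real_affine[where c="d * inverse p" and t="q * inverse p * X", OF _ dn]) auto
      also have "\<dots> = ennreal (\<bar>p\<bar> * \<bar>inverse p\<bar>) * (\<integral>\<^sup>+ t. F (X, q * inverse p * X + d * inverse p * t) \<partial>lborel)"
        by (simp add: mult.assoc[symmetric] ennreal_mult[symmetric] abs_mult dabs)
      finally show "(\<integral>\<^sup>+ t. F (X, q * inverse p * X + d * inverse p * t) \<partial>lborel) = ennreal \<bar>p\<bar> * (\<integral>\<^sup>+ Y. F (X, Y) \<partial>lborel)"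
        unfolding cm[OF False] by simp
    qed
    also have "ennreal \<bar>inverse p\<bar> * (\<integral>\<^sup>+ X. ennreal \<bar>p\<bar> * (\<integral>\<^sup>+ Y. F (X, Y) \<partial>lborel) \<partial>lborel) =
      ennreal (\<bar>p\<bar> * \<bar>inverse p\<bar>) * (\<integral>\<^sup>+ X. \<integral>\<^sup>+ Y. F (X, Y) \<partial>lborel \<partial>lborel)"
      by (subst nn_integral_cmult) (simp_all add: mult.assoc[symmetric] ennreal_mult[symmetric] mult.commute)
    finally show ?thesis
      unfolding e_eq Fub cm[OF False] by simp
  next
    case True
    then have q: "q\<^sup>2 = 1" using pq by simp
    then have qabs: "\<bar>q\<bar> = 1" by (metis abs_1 power2_eq_1_iff abs_minus_cancel)
    have q0: "q \<noteq> 0" "- d * q \<noteq> 0" using qabs dabs by auto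
    have "(\<integral>\<^sup>+ s. \<integral>\<^sup>+ t. F (p * s - d * q * t, q * s + d * p * t) \<partial>lborel \<partial>lborel)
      = (\<integral>\<^sup>+ s. \<integral>\<^sup>+ t. F (0 + (- d * q) * t, q * s) \<partial>lborel \<partial>lborel)"
      by (simp add: True)
    also have "\<dots> = (\<integral>\<^sup>+ s. \<integral>\<^sup>+ x. F (x, 0 + q * s) \<partial>lborel \<partial>lborel)"
    proof (rule nn_integral_cong)
      fix s :: real
      show "(\<integral>\<^sup>+ t. F (0 + (- d * q) * t, q * s) \<partial>lborel) = (\<integral>\<^sup>+ x. F (x, 0 + q * s) \<partial>lborel)"
        by (subst nn_integral_real_affine[where c="- d * q" and t=0, OF _ q0(2)]) (simp_all add: abs_mult dabs qabs)
    qed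
    also have "\<dots> = (\<integral>\<^sup>+ x. \<integral>\<^sup>+ s. F (x, 0 + q * s) \<partial>lborel \<partial>lborel)"
      by (rule swap) measurable
    also have "\<dots> = (\<integral>\<^sup>+ x. \<integral>\<^sup>+ y. F (x, y) \<partial>lborel \<partial>lborel)"
    proof (rule nn_integral_cong)
      fix x :: real
      show "(\<integral>\<^sup>+ s. F (x, 0 + q * s) \<partial>lborel) = (\<integral>\<^sup>+ y. F (x, y) \<partial>lborel)"
        by (subst (2) nn_integral_real_affine[where c="q" and t=0, OF _ q0(1)]) (simp_all add: qabs)
    qed
    finally show ?thesis
      unfolding e_eq Fub by simp
  qed
qed

section \<open>Boundary terms near a Lipschitz graph\<close>

context bounded_open
begin

text \<open>Shifting \<open>\<Omega>\<close> by \<open>h v\<close> changes it only within distance of order \<open>h\<close> of the boundary graph,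
  which avoids the normal vector of a Lipschitz graph.\<close>

lemma boundary_estimate:
  assumes chart: "lipschitz_chart \<Omega> x0 r e1 e2 \<gamma>" and L: "L-lipschitz_on UNIV \<gamma>"
    and w: "Ck 1 w" "\<And>y. r' \<le> dist x0 y \<Longrightarrow> w y = 0" "r' < r" and v: "norm v = 1"
  shows "integrable lborel (\<lambda>s. \<bar>w (s *\<^sub>R e1 + \<gamma> s *\<^sub>R e2)\<bar>)"
    and "\<bar>LINT x:\<Omega>|lborel. dir_deriv v w x\<bar> \<le> 2 * (1 + L) * (\<integral>s. \<bar>w (s *\<^sub>R e1 + \<gamma> s *\<^sub>R e2)\<bar> \<partial>lborel)"
proof -
  have r: "r > 0" and e: "norm e1 = 1" "norm e2 = 1" "e1 \<bullet> e2 = 0"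
    and \<Omega>r: "\<Omega> \<inter> ball x0 r = {x \<in> ball x0 r. \<gamma> (x \<bullet> e1) < x \<bullet> e2}"
    using chart by (auto simp: lipschitz_chart_def)
  have L0: "L \<ge> 0" using L by (rule lipschitz_on_nonneg)
  have \<gamma>L: "\<bar>\<gamma> s - \<gamma> t\<bar> \<le> L * \<bar>s - t\<bar>" for s t
    using lipschitz_onD[OF L, of s t] by (simp add: dist_real_def)
  have c\<gamma>: "continuous_on UNIV \<gamma>" by (rule lipschitz_on_continuous_on[OF L])
  let ?G = "\<lambda>s. s *\<^sub>R e1 + \<gamma> s *\<^sub>R e2"
  define s0 where "s0 = x0 \<bullet> e1"
  let ?I = "{s0 - r..s0 + r}"
  have coord: "dist x0 (s *\<^sub>R e1 + t *\<^sub>R e2) \<ge> \<bar>s - s0\<bar>" for s t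
  proof -
    have "s - s0 = (s *\<^sub>R e1 + t *\<^sub>R e2 - x0) \<bullet> e1"
      by (simp only: inner_diff_left inner_orthonormal_combination(1)[OF e] s0_def)
    then have "\<bar>s - s0\<bar> \<le> norm (s *\<^sub>R e1 + t *\<^sub>R e2 - x0) * norm e1"
      using Cauchy_Schwarz_ineq2 by metis
    then show ?thesis by (simp add: e dist_norm norm_minus_commute)
  qed
  have w0: "w (s *\<^sub>R e1 + t *\<^sub>R e2) = 0" if "s \<notin> ?I" for s t
  proof (rule w(2))
    have "r < \<bar>s - s0\<bar>" using that by auto
    then show "r' \<le> dist x0 (s *\<^sub>R e1 + t *\<^sub>R e2)" using coord[of s t] w(3) by linarith
  qed
  have cw: "continuous_on UNIV w" by (rule Ck_continuous[OF w(1)])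
  have w1: "Ck (Suc 0) w" using w(1) by simp
  have cwG: "continuous_on UNIV (\<lambda>s. \<bar>w (?G s)\<bar>)"
    by (intro continuous_intros continuous_on_compose2[OF cw] continuous_on_compose2[OF c\<gamma>]) auto
  show iW: "integrable lborel (\<lambda>s. \<bar>w (?G s)\<bar>)"
  proof -
    have "integrable lborel (\<lambda>s. indicator ?I s *\<^sub>R \<bar>w (?G s)\<bar>)"
      by (intro borel_integrable_compact compact_Icc continuous_on_subset[OF cwG]) auto
    moreover have "(\<lambda>s. indicator ?I s *\<^sub>R \<bar>w (?G s)\<bar>) = (\<lambda>s. \<bar>w (?G s)\<bar>)"
    proof
      show "indicator ?I s *\<^sub>R \<bar>w (?G s)\<bar> = \<bar>w (?G s)\<bar>" for s
        by (cases "s \<in> ?I") (simp_all only: indicator_simps w0 abs_zero scaleR_one scaleR_zero_right not_False_eq_True)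
    qed
    ultimately show ?thesis by (simp only:)
  qed
  have vb: "vanishes_beyond (norm x0 + \<bar>r'\<bar>) w"
    unfolding vanishes_beyond_def
  proof (intro allI impI w(2))
    fix x :: plane assume "norm x0 + \<bar>r'\<bar> < norm x"
    then show "r' \<le> dist x0 x" using norm_triangle_ineq2[of x x0] by (simp add: dist_norm norm_minus_commute)
  qed
  obtain K1 where K1: "K1 \<ge> 0" "\<And>x. \<bar>dir_deriv v w x\<bar> \<le> K1"
    using continuous_bounded_support_bounded[OF continuous_dir_deriv[OF w(1)] vanishes_beyond_dir_deriv[OF vb]] by blast
  obtain K2 where K2: "K2 \<ge> 0" "\<And>x. \<bar>dir_deriv e2 w x\<bar> \<le> K2"
    using continuous_bounded_support_bounded[OF continuous_dir_deriv[OF w(1)] vanishes_beyond_dir_deriv[OF vb]] by blast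
  let ?W = "\<integral>s. \<bar>w (?G s)\<bar> \<partial>lborel"
  \<comment> \<open>The difference quotient with increment \<open>h\<close>: by translation its
    integral compares \<open>w\<close> over \<Omega> and over the shifted set, so only points in
    exactly one of the two contribute. The summand with \<open>K2\<close> is of order
    \<open>h\<close> and disappears in the limit.\<close>
  have step: "\<bar>LINT x:\<Omega>|lborel. (w (x + h *\<^sub>R v) - w x) / h\<bar> \<le> 2 * (1 + L) * (?W + K2 * ((1 + L) * h) * (2 * r))"
    if h: "h > 0" "h < r - r'" for h
  proof -
    \<comment> \<open>A shift by \<open>h\<close> in a unit direction changes the height over the
      graph by at most \<open>h\<close> directly and \<open>L * h\<close> through \<gamma>, so
      points that change sides lie in the strip \<open>?N\<close> of half-width
      \<open>a\<close>.\<close>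
    define a where "a = (1 + L) * h"
    have a0: "a \<ge> 0" using h L0 by (simp add: a_def)
    let ?N = "{x. \<bar>x \<bullet> e2 - \<gamma> (x \<bullet> e1)\<bar> \<le> a}"
    have wm: "w \<in> borel_measurable borel" by (rule borel_measurable_continuous_onI[OF cw])
    have iw: "integrable lborel (\<lambda>x. indicator \<Omega> x *\<^sub>R w (x + t *\<^sub>R v))" for t
    proof -
      have "continuous_on UNIV (\<lambda>x. w (x + t *\<^sub>R v))"
        by (intro continuous_on_compose2[OF cw] continuous_intros) auto
      from L2_integrable[OF continuous_L2[OF this]] show ?thesis by (simp add: set_integrable_def)
    qed
    have iw': "integrable lborel (\<lambda>x. indicator \<Omega> (x - h *\<^sub>R v) *\<^sub>R w x)"
    proof (rule Bochner_Integration.integrable_bound)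
      show "integrable lborel w" by (rule continuous_bounded_support_integrable[OF cw vb])
      have "(\<lambda>x. indicator \<Omega> (x - h *\<^sub>R v) :: real) \<in> borel_measurable borel"
        by (rule measurable_compose[of "\<lambda>x. x - h *\<^sub>R v" _ borel])
          (auto intro!: borel_measurable_continuous_onI continuous_intros borel_measurable_indicator \<Omega>_sets)
      then show "(\<lambda>x. indicator \<Omega> (x - h *\<^sub>R v) *\<^sub>R w x) \<in> borel_measurable lborel"
        using wm by simp
      show "AE x in lborel. norm (indicator \<Omega> (x - h *\<^sub>R v) *\<^sub>R w x) \<le> norm (w x)"
        by (intro AE_I2) (simp add: indicator_def)
    qed
    have shift: "(\<integral>x. indicator \<Omega> x *\<^sub>R w (x + h *\<^sub>R v) \<partial>lborel) = (\<integral>x. indicator \<Omega> (x - h *\<^sub>R v) *\<^sub>R w x \<partial>lborel)"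
      using lborel_integral_plane_affine[of 1 "\<lambda>x. indicator \<Omega> (x - h *\<^sub>R v) *\<^sub>R w x" "h *\<^sub>R v"] borel_measurable_integrable[OF iw']
      by (simp add: add.commute)
    have diff: "\<bar>indicator \<Omega> (x - h *\<^sub>R v) *\<^sub>R w x - indicator \<Omega> x *\<^sub>R w x\<bar> \<le> indicator ?N x * \<bar>w x\<bar>" for x
    proof (cases "w x = 0 \<or> (x - h *\<^sub>R v \<in> \<Omega> \<longleftrightarrow> x \<in> \<Omega>)")
      case True
      then show ?thesis by (auto simp: indicator_def)
    next
      case False
      then have "dist x0 x < r'" using w(2)[of x] by (meson not_le)
      moreover have "dist x (x - h *\<^sub>R v) = h" using v h by (simp add: dist_norm)
      ultimately have in_ball: "x \<in> ball x0 r" "x - h *\<^sub>R v \<in> ball x0 r"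
        using h w(3) dist_triangle[of x0 "x - h *\<^sub>R v" x] by auto
      let ?F = "\<lambda>x. x \<bullet> e2 - \<gamma> (x \<bullet> e1)"
      have iff: "y \<in> \<Omega> \<longleftrightarrow> ?F y > 0" if "y \<in> ball x0 r" for y
      proof -
        have "y \<in> \<Omega> \<longleftrightarrow> y \<in> \<Omega> \<inter> ball x0 r" using that by blast
        also have "\<dots> \<longleftrightarrow> ?F y > 0" unfolding \<Omega>r using that by simp
        finally show ?thesis .
      qed
      have "\<bar>v \<bullet> e1\<bar> \<le> 1" "\<bar>v \<bullet> e2\<bar> \<le> 1"
        using Cauchy_Schwarz_ineq2[of v e1] Cauchy_Schwarz_ineq2[of v e2] v e by simp_all
      then have "h * \<bar>v \<bullet> e1\<bar> \<le> h" "h * \<bar>v \<bullet> e2\<bar> \<le> h" using h by (simp_all add: mult_left_le)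
      then have ve: "\<bar>h * (v \<bullet> e1)\<bar> \<le> h" "\<bar>h * (v \<bullet> e2)\<bar> \<le> h" using h by (simp_all add: abs_mult)
      have "\<bar>?F x - ?F (x - h *\<^sub>R v)\<bar> \<le> \<bar>h * (v \<bullet> e2)\<bar> + \<bar>\<gamma> (x \<bullet> e1) - \<gamma> ((x - h *\<^sub>R v) \<bullet> e1)\<bar>"
        by (simp add: inner_diff_left)
      also have "\<bar>\<gamma> (x \<bullet> e1) - \<gamma> ((x - h *\<^sub>R v) \<bullet> e1)\<bar> \<le> L * \<bar>h * (v \<bullet> e1)\<bar>"
        using \<gamma>L[of "x \<bullet> e1" "(x - h *\<^sub>R v) \<bullet> e1"] by (simp add: inner_diff_left)
      also have "\<bar>h * (v \<bullet> e2)\<bar> + L * \<bar>h * (v \<bullet> e1)\<bar> \<le> h + L * h"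
        using ve L0 by (intro add_mono mult_left_mono)
      finally have "\<bar>?F x - ?F (x - h *\<^sub>R v)\<bar> \<le> a" by (simp add: a_def algebra_simps)
      moreover have "(?F x > 0) \<noteq> (?F (x - h *\<^sub>R v) > 0)" using False iff[OF in_ball(1)] iff[OF in_ball(2)] by blast
      ultimately have "\<bar>?F x\<bar> \<le> a" by linarith
      then show ?thesis by (simp add: indicator_def)
    qed
    have N_meas: "?N \<in> sets borel"
    proof -
      have "closed ?N"
        by (intro closed_Collect_le continuous_intros continuous_on_compose2[OF c\<gamma>]) auto
      then show ?thesis by (rule borel_closed)
    qed
    let ?J = "\<integral>x. indicator \<Omega> (x - h *\<^sub>R v) *\<^sub>R w x - indicator \<Omega> x *\<^sub>R w x \<partial>lborel"
    have iw0: "integrable lborel (\<lambda>x. indicator \<Omega> x *\<^sub>R w x)" using iw[of 0] by simp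
    have "ennreal \<bar>?J\<bar> \<le> (\<integral>\<^sup>+ x. ennreal (norm (indicator \<Omega> (x - h *\<^sub>R v) *\<^sub>R w x - indicator \<Omega> x *\<^sub>R w x)) \<partial>lborel)"
      using integral_norm_bound_ennreal[OF Bochner_Integration.integrable_diff[OF iw' iw0]] by simp
    also have "\<dots> \<le> (\<integral>\<^sup>+ x. ennreal (indicator ?N x * \<bar>w x\<bar>) \<partial>lborel)"
      by (intro nn_integral_mono ennreal_leI) (use diff in simp)
    also have "\<dots> = (\<integral>\<^sup>+ s. \<integral>\<^sup>+ t. ennreal (indicator ?N (s *\<^sub>R e1 + t *\<^sub>R e2) * \<bar>w (s *\<^sub>R e1 + t *\<^sub>R e2)\<bar>) \<partial>lborel \<partial>lborel)"
      by (rule nn_integral_orthonormal_coordinates[OF e]) (use N_meas wm in simp)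
    \<comment> \<open>In chart coordinates the strip over each \<open>s\<close> is an interval of
      length \<open>2 * a\<close>, on which \<open>w\<close> differs from its value on the graph by
      at most \<open>K2 * a\<close>.\<close>
    also have "\<dots> \<le> (\<integral>\<^sup>+ s. ennreal (2 * a * (indicator ?I s * (\<bar>w (?G s)\<bar> + K2 * a))) \<partial>lborel)"
    proof (rule nn_integral_mono)
      fix s :: real
      let ?c = "indicator ?I s * (\<bar>w (?G s)\<bar> + K2 * a)"
      have c0: "?c \<ge> 0" using K2(1) a0 by (simp add: indicator_def)
      have "indicator ?N (s *\<^sub>R e1 + t *\<^sub>R e2) * \<bar>w (s *\<^sub>R e1 + t *\<^sub>R e2)\<bar> \<le> ?c * indicator {\<gamma> s - a..\<gamma> s + a} t" for t
      proof (cases "s \<in> ?I \<and> s *\<^sub>R e1 + t *\<^sub>R e2 \<in> ?N")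
        case True
        then have t: "\<bar>t - \<gamma> s\<bar> \<le> a" by (simp add: inner_orthonormal_combination[OF e])
        have "\<bar>w (s *\<^sub>R e1 + t *\<^sub>R e2) - w (?G s)\<bar> \<le> K2 * \<bar>t - \<gamma> s\<bar>"
          by (rule dir_deriv_lipschitz[OF w1 K2(2)])
        also have "\<dots> \<le> K2 * a" by (intro mult_left_mono t K2)
        finally have "\<bar>w (s *\<^sub>R e1 + t *\<^sub>R e2)\<bar> \<le> \<bar>w (?G s)\<bar> + K2 * a" by linarith
        moreover have "t \<in> {\<gamma> s - a..\<gamma> s + a}" using t by auto
        ultimately show ?thesis using True by (simp only: indicator_simps mult_1 mult_1_right)
      next
        case False
        then have "indicator ?N (s *\<^sub>R e1 + t *\<^sub>R e2) * \<bar>w (s *\<^sub>R e1 + t *\<^sub>R e2)\<bar> = 0"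
          using w0[of s t] by (cases "s \<in> ?I") (simp_all only: indicator_simps simp_thms mult_zero_left mult_zero_right abs_zero)
        then show ?thesis using c0 by (simp only: mult_nonneg_nonneg indicator_pos_le)
      qed
      then have "(\<integral>\<^sup>+ t. ennreal (indicator ?N (s *\<^sub>R e1 + t *\<^sub>R e2) * \<bar>w (s *\<^sub>R e1 + t *\<^sub>R e2)\<bar>) \<partial>lborel)
        \<le> (\<integral>\<^sup>+ t. ennreal ?c * indicator {\<gamma> s - a..\<gamma> s + a} t \<partial>lborel)"
        by (intro nn_integral_mono)
          (simp only: ennreal_leI ennreal_mult[OF c0 indicator_pos_le, symmetric] ennreal_indicator[symmetric])
      also have "\<dots> = ennreal ?c * ennreal (2 * a)"
        using a0 by (simp add: nn_integral_cmult_indicator)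
      also have "\<dots> = ennreal (2 * a * ?c)"
        using a0 c0 by (simp add: ennreal_mult mult.commute)
      finally show "(\<integral>\<^sup>+ t. ennreal (indicator ?N (s *\<^sub>R e1 + t *\<^sub>R e2) * \<bar>w (s *\<^sub>R e1 + t *\<^sub>R e2)\<bar>) \<partial>lborel) \<le> ennreal (2 * a * ?c)" .
    qed
    also have "\<dots> = ennreal (\<integral>s. 2 * a * (\<bar>w (?G s)\<bar> + K2 * a * indicator ?I s) \<partial>lborel)"
    proof -
      have "indicator ?I s * (\<bar>w (?G s)\<bar> + K2 * a) = \<bar>w (?G s)\<bar> + K2 * a * indicator ?I s" for s
        using w0[of s "\<gamma> s"] by (cases "s \<in> ?I") (simp_all only: indicator_simps abs_zero mult_1 mult_1_right mult_zero_left mult_zero_right add_0 simp_thms)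
      moreover have "integrable lborel (\<lambda>s. 2 * a * (\<bar>w (?G s)\<bar> + K2 * a * indicator ?I s))"
        using iW r by (intro integrable_mult_right Bochner_Integration.integrable_add) auto
      ultimately show ?thesis
        using a0 K2(1) by (subst nn_integral_eq_integral) auto
    qed
    also have "(\<integral>s. 2 * a * (\<bar>w (?G s)\<bar> + K2 * a * indicator ?I s) \<partial>lborel) = 2 * a * (?W + K2 * a * (2 * r))"
      using iW r by simp
    finally have "\<bar>?J\<bar> \<le> 2 * a * (?W + K2 * a * (2 * r))"
      using a0 K2(1) r by (subst (asm) ennreal_le_iff) (auto intro!: mult_nonneg_nonneg add_nonneg_nonneg)
    moreover have "(LINT x:\<Omega>|lborel. (w (x + h *\<^sub>R v) - w x) / h) = ?J / h"
    proof -
      have "(LINT x:\<Omega>|lborel. (w (x + h *\<^sub>R v) - w x) / h) = (\<integral>x. (indicator \<Omega> x *\<^sub>R w (x + h *\<^sub>R v) - indicator \<Omega> x *\<^sub>R w x) / h \<partial>lborel)"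
        unfolding set_lebesgue_integral_def by (intro Bochner_Integration.integral_cong) (simp_all add: right_diff_distrib diff_divide_distrib)
      also have "\<dots> = ((\<integral>x. indicator \<Omega> x *\<^sub>R w (x + h *\<^sub>R v) \<partial>lborel) - (\<integral>x. indicator \<Omega> x *\<^sub>R w x \<partial>lborel)) / h"
        using iw[of h] iw0 by simp
      also have "\<dots> = ?J / h"
        unfolding shift using iw' iw0 by simp
      finally show ?thesis .
    qed
    ultimately have "\<bar>LINT x:\<Omega>|lborel. (w (x + h *\<^sub>R v) - w x) / h\<bar> \<le> 2 * a * (?W + K2 * a * (2 * r)) / h"
      using h by (simp add: divide_right_mono)
    also have "\<dots> = 2 * (1 + L) * (?W + K2 * ((1 + L) * h) * (2 * r))"
      using h by (simp add: a_def)
    finally show ?thesis .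
  qed
  define h where "h n = inverse (real (Suc n))" for n
  have h0: "h \<longlonglongrightarrow> 0" "\<And>n. h n > 0"
    unfolding h_def using LIMSEQ_inverse_real_of_nat by auto
  have lhs: "(\<lambda>n. LINT x:\<Omega>|lborel. (w (x + h n *\<^sub>R v) - w x) / h n) \<longlonglongrightarrow> (LINT x:\<Omega>|lborel. dir_deriv v w x)"
    unfolding set_lebesgue_integral_def
  proof (rule integral_dominated_convergence[where w="\<lambda>x. K1 * indicator \<Omega> x"])
    have fin: "emeasure lborel \<Omega> < \<infinity>" using emeasure_bounded_finite[OF bounded_\<Omega>] .
    show "integrable lborel (\<lambda>x. K1 * indicator \<Omega> x)"
      using fin \<Omega>_sets by (intro integrable_mult_right integrable_real_indicator) auto
    show "(\<lambda>x. indicator \<Omega> x *\<^sub>R dir_deriv v w x) \<in> borel_measurable lborel"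
      using borel_measurable_continuous_onI[OF continuous_dir_deriv[OF w(1)]] \<Omega>_sets by simp
    have "continuous_on UNIV (\<lambda>x. (w (x + h n *\<^sub>R v) - w x) / h n)" for n
      using h0(2)[of n] by (intro continuous_intros continuous_on_compose2[OF cw]) auto
    then have "(\<lambda>x. (w (x + h n *\<^sub>R v) - w x) / h n) \<in> borel_measurable borel" for n
      by (rule borel_measurable_continuous_onI)
    then show "(\<lambda>x. indicator \<Omega> x *\<^sub>R ((w (x + h n *\<^sub>R v) - w x) / h n)) \<in> borel_measurable lborel" for n
      using \<Omega>_sets by (intro borel_measurable_scaleR borel_measurable_indicator) simp_all
    show "AE x in lborel. (\<lambda>n. indicator \<Omega> x *\<^sub>R ((w (x + h n *\<^sub>R v) - w x) / h n)) \<longlonglongrightarrow> indicator \<Omega> x *\<^sub>R dir_deriv v w x"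
    proof (intro AE_I2 tendsto_scaleR tendsto_const)
      fix x
      have "((\<lambda>t. w (x + t *\<^sub>R v)) has_real_derivative dir_deriv v w x) (at 0)"
        using dir_deriv_has_real_derivative[OF w1, of x v 0] by simp
      then have "((\<lambda>t. (w (x + t *\<^sub>R v) - w x) / t) \<longlongrightarrow> dir_deriv v w x) (at 0)"
        by (simp add: DERIV_def)
      moreover have "filterlim h (at 0) sequentially"
        using h0 by (auto simp: filterlim_at intro!: always_eventually) (metis less_irrefl)
      ultimately show "(\<lambda>n. (w (x + h n *\<^sub>R v) - w x) / h n) \<longlonglongrightarrow> dir_deriv v w x"
        by (rule filterlim_compose)
    qed
    show "AE x in lborel. norm (indicator \<Omega> x *\<^sub>R ((w (x + h n *\<^sub>R v) - w x) / h n)) \<le> K1 * indicator \<Omega> x" for n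
    proof (rule AE_I2)
      fix x
      have "\<bar>w (x + h n *\<^sub>R v) - w (x + 0 *\<^sub>R v)\<bar> \<le> K1 * \<bar>h n - 0\<bar>"
        by (rule dir_deriv_lipschitz[OF w1 K1(2)])
      then have "\<bar>(w (x + h n *\<^sub>R v) - w x) / h n\<bar> \<le> K1"
        using h0(2)[of n] by (simp add: abs_divide field_simps)
      then show "norm (indicator \<Omega> x *\<^sub>R ((w (x + h n *\<^sub>R v) - w x) / h n)) \<le> K1 * indicator \<Omega> x"
        by (simp add: indicator_def)
    qed
  qed
  have rhs: "(\<lambda>n. 2 * (1 + L) * (?W + K2 * ((1 + L) * h n) * (2 * r))) \<longlonglongrightarrow> 2 * (1 + L) * (?W + K2 * ((1 + L) * 0) * (2 * r))"
    by (intro tendsto_intros h0)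
  have "\<forall>\<^sub>F n in sequentially. h n < r - r'"
    by (rule order_tendstoD(2)[OF h0(1)]) (use w(3) in simp)
  then have "\<forall>\<^sub>F n in sequentially. \<bar>LINT x:\<Omega>|lborel. (w (x + h n *\<^sub>R v) - w x) / h n\<bar> \<le> 2 * (1 + L) * (?W + K2 * ((1 + L) * h n) * (2 * r))"
    by eventually_elim (rule step[OF h0(2)])
  then show "\<bar>LINT x:\<Omega>|lborel. dir_deriv v w x\<bar> \<le> 2 * (1 + L) * ?W"
    using tendsto_le[OF sequentially_bot rhs tendsto_rabs[OF lhs]] by simp
qed

text \<open>Where the trace equals the constant \<open>c\<close>, the factor
  \<open>\<phi> k - c\<close> is small in L^2 on the graph, while \<open>boundary_estimate\<close>
  measures in L^1; Young's inequality with a free parameter \<delta> bridges the two. The trace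
  error is given as a nonnegative integral with values in \<open>ennreal\<close>, so the estimate is
  carried out there.\<close>

lemma boundary_term_tendsto_0:
  assumes chart: "lipschitz_chart \<Omega> x0 r e1 e2 \<gamma>" and \<phi>: "\<And>k. Ck 1 (\<phi> k)"
    and tr: "(\<lambda>k. \<integral>\<^sup>+ s \<in> {s. s *\<^sub>R e1 + \<gamma> s *\<^sub>R e2 \<in> ball x0 r}.
              ennreal ((\<phi> k (s *\<^sub>R e1 + \<gamma> s *\<^sub>R e2) - g (s *\<^sub>R e1 + \<gamma> s *\<^sub>R e2))\<^sup>2) \<partial>lborel) \<longlonglongrightarrow> 0"
    and gm: "g \<in> borel_measurable borel"
    and g: "\<And>s. s *\<^sub>R e1 + \<gamma> s *\<^sub>R e2 \<in> ball x0 r' \<Longrightarrow> g (s *\<^sub>R e1 + \<gamma> s *\<^sub>R e2) = c"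
    and F: "Ck 1 F" "\<And>y. r' \<le> dist x0 y \<Longrightarrow> F y = 0" "r' < r" and v: "norm v = 1"
  shows "(\<lambda>k. LINT x:\<Omega>|lborel. dir_deriv v (\<lambda>x. (\<phi> k x - c) * F x) x) \<longlonglongrightarrow> 0"
proof -
  have r: "r > 0" and e: "norm e1 = 1" "norm e2 = 1" "e1 \<bullet> e2 = 0"
    using chart by (auto simp: lipschitz_chart_def)
  obtain L where L: "L-lipschitz_on UNIV \<gamma>" using chart by (auto simp: lipschitz_chart_def)
  have L0: "L \<ge> 0" using L by (rule lipschitz_on_nonneg)
  let ?G = "\<lambda>s. s *\<^sub>R e1 + \<gamma> s *\<^sub>R e2"
  let ?A = "{s. ?G s \<in> ball x0 r}"
  define a where "a k = (\<integral>\<^sup>+ s \<in> ?A. ennreal ((\<phi> k (?G s) - g (?G s))\<^sup>2) \<partial>lborel)" for k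
  have a_lim: "a \<longlonglongrightarrow> 0" unfolding a_def[abs_def] by (rule tr)
  define I where "I = {x0 \<bullet> e1 - r..x0 \<bullet> e1 + r}"
  have vb: "vanishes_beyond (norm x0 + \<bar>r'\<bar>) F"
    unfolding vanishes_beyond_def
  proof (intro allI impI F(2))
    fix x :: plane assume "norm x0 + \<bar>r'\<bar> < norm x"
    then show "r' \<le> dist x0 x" using norm_triangle_ineq2[of x x0] by (simp add: dist_norm norm_minus_commute)
  qed
  obtain B0 where B0: "B0 \<ge> 0" "\<And>x. \<bar>F x\<bar> \<le> B0"
    using continuous_bounded_support_bounded[OF Ck_continuous[OF F(1)] vb] by blast
  define B where "B = 2 * (1 + L) * (B0 + 1)"
  have Bpos: "B > 0" using L0 B0 by (simp add: B_def add_nonneg_pos)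
  let ?w = "\<lambda>k x. (\<phi> k x - c) * F x"
  have w: "Ck 1 (?w k)" "r' \<le> dist x0 y \<Longrightarrow> ?w k y = 0" for k y
    using \<phi> F by (auto intro!: Ck_mult Ck_diff Ck_const)
  let ?b = "\<lambda>k. \<bar>LINT x:\<Omega>|lborel. dir_deriv v (?w k) x\<bar>"
  have main: "ennreal (?b k) \<le> ennreal (B * \<delta> * (2 * r)) + ennreal (B / \<delta>) * a k" if \<delta>: "\<delta> > 0" for \<delta> k
  proof -
    note be = boundary_estimate[OF chart L w F(3) v, of k]
    have pt: "\<bar>?w k (?G s)\<bar> \<le> (B0 + 1) * (\<delta> * indicator I s + 1 / \<delta> * ((\<phi> k (?G s) - g (?G s))\<^sup>2 * indicator ?A s))" for s
    proof (cases "dist x0 (?G s) < r'")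
      case True
      have sA: "s \<in> ?A" and gc: "g (?G s) = c" using True F(3) g[of s] by simp_all
      have "s - x0 \<bullet> e1 = (?G s - x0) \<bullet> e1"
        by (simp only: inner_diff_left inner_orthonormal_combination(1)[OF e])
      then have "\<bar>s - x0 \<bullet> e1\<bar> \<le> norm (?G s - x0) * norm e1"
        using Cauchy_Schwarz_ineq2 by metis
      then have sI: "s \<in> I" using True F(3) by (simp add: I_def e dist_norm norm_minus_commute abs_le_iff)
      define y where "y = \<bar>\<phi> k (?G s) - c\<bar>"
      have "y \<le> \<delta> + 1 / \<delta> * y\<^sup>2"
      proof -
        have "0 \<le> (y - \<delta> / 2)\<^sup>2 + 3 / 4 * \<delta>\<^sup>2" by simp
        also have "\<dots> = \<delta>\<^sup>2 + y\<^sup>2 - y * \<delta>" by (simp add: power2_eq_square field_simps)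
        finally have "y * \<delta> \<le> \<delta>\<^sup>2 + y\<^sup>2" by simp
        then show ?thesis using \<delta> by (simp add: field_simps power2_eq_square)
      qed
      moreover have "0 \<le> \<delta> + 1 / \<delta> * y\<^sup>2" using \<delta> by simp
      ultimately have "y * \<bar>F (?G s)\<bar> \<le> (\<delta> + 1 / \<delta> * y\<^sup>2) * (B0 + 1)"
        using B0(2)[of "?G s"] by (intro mult_mono) auto
      moreover have "y\<^sup>2 = (\<phi> k (?G s) - g (?G s))\<^sup>2" by (simp add: y_def gc)
      moreover have "\<bar>?w k (?G s)\<bar> = y * \<bar>F (?G s)\<bar>" by (simp add: y_def abs_mult)
      ultimately show ?thesis
        using sA sI by (simp only: indicator_simps mult_1_right mult_1 mult.commute)
    next
      case False
      then have "?w k (?G s) = 0" by (intro w) simp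
      moreover have "0 \<le> (B0 + 1) * (\<delta> * indicator I s + 1 / \<delta> * ((\<phi> k (?G s) - g (?G s))\<^sup>2 * indicator ?A s))"
        using B0(1) \<delta> by (intro mult_nonneg_nonneg add_nonneg_nonneg indicator_pos_le zero_le_power2) auto
      ultimately show ?thesis by (simp only: abs_zero)
    qed
    have cG: "continuous_on UNIV ?G"
      by (intro continuous_intros continuous_on_compose2[OF lipschitz_on_continuous_on[OF L]]) auto
    have "ennreal (?b k) \<le> ennreal (2 * (1 + L) * (\<integral>s. \<bar>?w k (?G s)\<bar> \<partial>lborel))"
      by (rule ennreal_leI[OF be(2)])
    also have "\<dots> = ennreal (2 * (1 + L)) * (\<integral>\<^sup>+ s. ennreal \<bar>?w k (?G s)\<bar> \<partial>lborel)"
      using L0 by (subst nn_integral_eq_integral[OF be(1)]) (simp_all add: ennreal_mult)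
    also have "\<dots> \<le> ennreal (2 * (1 + L)) * (\<integral>\<^sup>+ s. ennreal (B0 + 1) * (ennreal \<delta> * indicator I s) +
        ennreal (B0 + 1) * (ennreal (1 / \<delta>) * (ennreal ((\<phi> k (?G s) - g (?G s))\<^sup>2) * indicator ?A s)) \<partial>lborel)"
    proof (intro mult_left_mono nn_integral_mono)
      fix s
      have "ennreal \<bar>?w k (?G s)\<bar> \<le> ennreal ((B0 + 1) * (\<delta> * indicator I s + 1 / \<delta> * ((\<phi> k (?G s) - g (?G s))\<^sup>2 * indicator ?A s)))"
        by (rule ennreal_leI[OF pt])
      also have "\<dots> = ennreal (B0 + 1) * (ennreal \<delta> * indicator I s) +
        ennreal (B0 + 1) * (ennreal (1 / \<delta>) * (ennreal ((\<phi> k (?G s) - g (?G s))\<^sup>2) * indicator ?A s))"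
      proof -
        have "ennreal (b * (d * p + q * (z * m))) = ennreal b * (ennreal d * ennreal p) + ennreal b * (ennreal q * (ennreal z * ennreal m))"
          if "b \<ge> 0" "d \<ge> 0" "p \<ge> 0" "q \<ge> 0" "z \<ge> 0" "m \<ge> 0" for b d p q z m :: real
          using that by (simp only: distrib_left ennreal_plus ennreal_mult mult_nonneg_nonneg)
        from this[of "B0 + 1" \<delta> "indicator I s" "1 / \<delta>" "(\<phi> k (?G s) - g (?G s))\<^sup>2" "indicator ?A s"] B0(1) \<delta>
        show ?thesis by (simp only: ennreal_indicator indicator_pos_le zero_le_power2) simp
      qed
      finally show "ennreal \<bar>?w k (?G s)\<bar> \<le> ennreal (B0 + 1) * (ennreal \<delta> * indicator I s) +
        ennreal (B0 + 1) * (ennreal (1 / \<delta>) * (ennreal ((\<phi> k (?G s) - g (?G s))\<^sup>2) * indicator ?A s))" .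
    qed simp
    also have "\<dots> = ennreal (2 * (1 + L)) * (ennreal (B0 + 1) * (ennreal \<delta> * ennreal (2 * r)) + ennreal (B0 + 1) * (ennreal (1 / \<delta>) * a k))"
    proof -
      have Gm[measurable]: "?G \<in> borel_measurable borel" by (rule borel_measurable_continuous_onI[OF cG])
      have A[measurable]: "?A \<in> sets borel"
        using measurable_sets[OF Gm, of "ball x0 r"] by (simp add: vimage_def)
      have \<phi>m[measurable]: "\<phi> k \<in> borel_measurable borel" by (rule borel_measurable_continuous_onI[OF Ck_continuous[OF \<phi>]])
      note gm[measurable]
      have I[measurable]: "I \<in> sets borel" by (simp add: I_def)
      have m: "(\<lambda>s. ennreal ((\<phi> k (?G s) - g (?G s))\<^sup>2) * indicator ?A s) \<in> borel_measurable lborel"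
        by measurable
      have "(\<integral>\<^sup>+ s. ennreal \<delta> * indicator I s \<partial>lborel) = ennreal \<delta> * ennreal (2 * r)"
        using r by (simp add: nn_integral_cmult_indicator I_def)
      then show ?thesis
        using m I by (simp add: nn_integral_add nn_integral_cmult a_def)
    qed
    also have "\<dots> = ennreal (B * \<delta> * (2 * r)) + ennreal (B / \<delta>) * a k"
    proof -
      have "ennreal (2 * (1 + L)) * (ennreal (B0 + 1) * (ennreal \<delta> * ennreal (2 * r))) = ennreal (2 * (1 + L) * ((B0 + 1) * (\<delta> * (2 * r))))"
        using L0 B0(1) \<delta> r by (simp only: ennreal_mult'[symmetric] mult_nonneg_nonneg)
      moreover have "ennreal (2 * (1 + L)) * (ennreal (B0 + 1) * (ennreal (1 / \<delta>) * a k)) = ennreal (2 * (1 + L) * ((B0 + 1) * (1 / \<delta>))) * a k"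
      proof -
        have "ennreal p * (ennreal q * (ennreal z * A)) = ennreal (p * (q * z)) * A" if "p \<ge> 0" "q \<ge> 0" "z \<ge> 0" for p q z A
          using that by (simp only: ennreal_mult mult.assoc mult_nonneg_nonneg)
        note * = this
        show ?thesis by (rule *) (use L0 B0(1) \<delta> in auto)
      qed
      moreover have "2 * (1 + L) * ((B0 + 1) * (\<delta> * (2 * r))) = B * \<delta> * (2 * r)" "2 * (1 + L) * ((B0 + 1) * (1 / \<delta>)) = B / \<delta>"
        by (simp_all add: B_def)
      ultimately show ?thesis by (simp only: distrib_left)
    qed
    finally show ?thesis .
  qed
  show ?thesis
  proof (rule tendsto_rabs_zero_cancel, rule LIMSEQ_I)
    fix \<epsilon> :: real assume \<epsilon>: "\<epsilon> > 0"
    \<comment> \<open>Makes the first summand of \<open>main\<close> equal to a quarter of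
      \<epsilon>; the threshold on \<open>a k\<close> does the same for the second.\<close>
    define \<delta> where "\<delta> = \<epsilon> / (4 * (B * (2 * r)))"
    have \<delta>: "\<delta> > 0" using \<epsilon> Bpos r by (simp add: \<delta>_def)
    have "\<forall>\<^sub>F k in sequentially. a k < ennreal (\<epsilon> * \<delta> / (4 * B))"
      by (rule order_tendstoD(2)[OF a_lim]) (use \<epsilon> \<delta> Bpos in simp)
    then obtain N where N: "\<And>k. k \<ge> N \<Longrightarrow> a k < ennreal (\<epsilon> * \<delta> / (4 * B))"
      unfolding eventually_sequentially by blast
    have "norm (?b k - 0) < \<epsilon>" if "k \<ge> N" for k
    proof -
      have "ennreal (?b k) \<le> ennreal (B * \<delta> * (2 * r)) + ennreal (B / \<delta>) * ennreal (\<epsilon> * \<delta> / (4 * B))"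
        by (rule order_trans[OF main[OF \<delta>, of k]]) (intro add_left_mono mult_left_mono less_imp_le[OF N[OF that]] zero_le)
      also have "\<dots> = ennreal (B * \<delta> * (2 * r) + B / \<delta> * (\<epsilon> * \<delta> / (4 * B)))"
        using \<epsilon> \<delta> Bpos r by (simp add: ennreal_mult[symmetric] ennreal_plus[symmetric] del: ennreal_plus)
      also have "B * \<delta> * (2 * r) + B / \<delta> * (\<epsilon> * \<delta> / (4 * B)) = \<epsilon> / 2"
        using \<delta> Bpos r by (simp add: \<delta>_def field_simps)
      finally have "?b k \<le> \<epsilon> / 2" using \<epsilon> by (subst (asm) ennreal_le_iff) auto
      then show ?thesis using \<epsilon> by simp
    qed
    then show "\<exists>N. \<forall>k\<ge>N. norm (?b k - 0) < \<epsilon>" by blast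
  qed
qed

end

section \<open>Localization by a partition of unity\<close>

lemma dir_deriv_sum:
  assumes "\<And>i. i \<in> I \<Longrightarrow> Ck (Suc k) (u i)"
  shows "dir_deriv v (\<lambda>x. \<Sum>i\<in>I. u i x) = (\<lambda>x. \<Sum>i\<in>I. dir_deriv v (u i) x)"
  using assms
proof (induction I rule: infinite_finite_induct)
  case (insert i I)
  have "Ck (Suc k) (u i)" "Ck (Suc k) (\<lambda>x. \<Sum>i\<in>I. u i x)"
    using insert.prems by (auto intro: Ck_sum)
  from pderiv_add[OF this] insert show ?case
    by (simp add: dir_deriv_def[abs_def] algebra_simps fun_eq_iff)
qed (simp_all add: dir_deriv_def[abs_def] pderiv_const)

lemma integrable_mult_continuous:
  fixes f u :: "plane \<Rightarrow> real"
  assumes f: "integrable lborel f" "vanishes_beyond R f" and u: "continuous_on UNIV u"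
  shows "integrable lborel (\<lambda>x. f x * u x)"
proof -
  have "compact (u ` cball 0 R)" by (intro compact_continuous_image continuous_on_subset[OF u]) auto
  then obtain B where "\<forall>y\<in>u ` cball 0 R. norm y \<le> B"
    using compact_imp_bounded bounded_iff by blast
  then have B: "\<bar>u x\<bar> \<le> B" if "x \<in> cball 0 R" for x
    using that by simp
  show ?thesis
  proof (rule Bochner_Integration.integrable_bound)
    show "integrable lborel (\<lambda>x. \<bar>B\<bar> * \<bar>f x\<bar>)" using f by simp
    show "(\<lambda>x. f x * u x) \<in> borel_measurable lborel"
      using borel_measurable_integrable[OF f(1)] borel_measurable_continuous_onI[OF u] by simp
    show "AE x in lborel. norm (f x * u x) \<le> norm (\<bar>B\<bar> * \<bar>f x\<bar>)"
    proof (rule AE_I2)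
      fix x
      show "norm (f x * u x) \<le> norm (\<bar>B\<bar> * \<bar>f x\<bar>)"
      proof (cases "norm x \<le> R")
        case True
        then have "\<bar>u x\<bar> \<le> \<bar>B\<bar>" using B[of x] by auto
        then show ?thesis using mult_left_mono[of "\<bar>u x\<bar>" "\<bar>B\<bar>" "\<bar>f x\<bar>"] by (simp add: abs_mult mult.commute)
      next
        case False
        then show ?thesis using vanishes_beyondD[OF f(2), of x] by simp
      qed
    qed
  qed
qed

text \<open>Bumps are products of the differences \<open>step (t + 1) - step t\<close> in each
  coordinate; along a row of the lattice the sum telescopes to 1 - 0. The explicit bound on the
  centres keeps them in a compact set, on which a covering argument can be run.\<close>

lemma lattice_partition_of_unity:
  fixes \<delta> R :: real
  assumes "\<delta> > 0" "R \<ge> 0"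
  obtains I :: "(nat \<times> nat) set" and b :: "nat \<times> nat \<Rightarrow> plane \<Rightarrow> real" and p
  where "finite I" "\<And>i k. Ck k (b i)" "\<And>i y. \<delta> \<le> dist (p i) y \<Longrightarrow> b i y = 0"
    "\<And>i. i \<in> I \<Longrightarrow> norm (p i) \<le> 2 * (R + \<delta>)" "\<And>x. norm x \<le> R \<Longrightarrow> (\<Sum>i\<in>I. b i x) = 1"
proof -
  \<comment> \<open>Each factor is supported in an interval of half-length \<open>h\<close>, so a
    bump reaches less than \<open>2 * h\<close> from its centre.\<close>
  define h where "h = \<delta> / 2"
  define N where "N = nat \<lceil>R / h\<rceil>"
  have h: "h > 0" using assms by (simp add: h_def)
  have "R / h \<ge> 0" using h assms(2) by simp
  then have "real N = of_int \<lceil>R / h\<rceil>" by (simp add: N_def)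
  then have N: "R / h \<le> real N" "real N \<le> R / h + 1"
    using of_int_ceiling_le_add_one[of "R / h"] le_of_int_ceiling[of "R / h"] by simp_all
  then have Nh: "R \<le> real N * h" "real N * h \<le> R + h"
    using h by (simp_all add: field_simps)
  define B where "B t = step (t + 1) - step t" for t
  have B0: "B t = 0" if "\<bar>t\<bar> \<ge> 1" for t
    using that by (cases "t \<ge> 1") (auto simp: B_def step_0 step_1 abs_real_def split: if_splits)
  have B_sum: "(\<Sum>i<2 * N + 1. B (t - (real i - real N))) = 1" if "\<bar>t\<bar> \<le> real N" for t
  proof -
    have "B (t - (real i - real N)) = - step (t + real N + 1 - real (Suc i)) - - step (t + real N + 1 - real i)" for i
      by (simp add: B_def algebra_simps)
    then have "(\<Sum>i<2 * N + 1. B (t - (real i - real N))) =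
      (\<Sum>i<2 * N + 1. - step (t + real N + 1 - real (Suc i)) - - step (t + real N + 1 - real i))"
      by (intro sum.cong refl)
    also have "\<dots> = - step (t + real N + 1 - real (2 * N + 1)) - - step (t + real N + 1 - real 0)"
      by (rule sum_lessThan_telescope)
    also have "\<dots> = 1"
      using that by (simp add: step_0 step_1)
    finally show ?thesis .
  qed
  define b where "b ij x = B (fst x / h - (real (fst ij) - real N)) * B (snd x / h - (real (snd ij) - real N))" for ij :: "nat \<times> nat" and x :: plane
  define p where "p ij = (h * (real (fst ij) - real N), h * (real (snd ij) - real N))" for ij :: "nat \<times> nat"
  let ?I = "{..<2 * N + 1} \<times> {..<2 * N + 1}"
  show ?thesis
  proof (rule that[of ?I b p])
    show "finite ?I" by simp
    show "Ck k (b i)" for i k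
      unfolding b_def B_def divide_inverse
      by (intro Ck_mult Ck_diff Ck_step Ck_add Ck_const Ck_fst Ck_snd)
    show "b i y = 0" if "\<delta> \<le> dist (p i) y" for i y
    proof (rule ccontr)
      assume "b i y \<noteq> 0"
      then have Bn: "B (fst y / h - (real (fst i) - real N)) \<noteq> 0" "B (snd y / h - (real (snd i) - real N)) \<noteq> 0"
        by (simp_all add: b_def)
      have "\<bar>t\<bar> < 1" if "B t \<noteq> 0" for t
        using B0[of t] that by linarith
      from this[OF Bn(1)] this[OF Bn(2)]
      have "\<bar>fst y / h - (real (fst i) - real N)\<bar> < 1" "\<bar>snd y / h - (real (snd i) - real N)\<bar> < 1" .
      then have "h * \<bar>fst y / h - (real (fst i) - real N)\<bar> < h * 1" "h * \<bar>snd y / h - (real (snd i) - real N)\<bar> < h * 1"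
        using h by (intro mult_strict_left_mono; simp)+
      moreover have "h * \<bar>a / h - b\<bar> = \<bar>a - h * b\<bar>" for a b
      proof -
        have "a - h * b = h * (a / h - b)" using h by (simp add: field_simps)
        then show ?thesis using h by (simp only: abs_mult abs_of_pos)
      qed
      ultimately have "\<bar>fst y - fst (p i)\<bar> < h" "\<bar>snd y - snd (p i)\<bar> < h"
        by (simp_all add: p_def)
      moreover have "norm (p i - y) \<le> \<bar>fst (p i - y)\<bar> + \<bar>snd (p i - y)\<bar>"
        using norm_Pair_le[of "fst (p i - y)" "snd (p i - y)"] unfolding prod.collapse real_norm_def .
      ultimately show False
        using that by (simp add: dist_norm h_def abs_minus_commute[of "fst (p i)"] abs_minus_commute[of "snd (p i)"])
    qed
    show "norm (p i) \<le> 2 * (R + \<delta>)" if "i \<in> ?I" for i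
    proof -
      have i: "\<bar>real (fst i) - real N\<bar> \<le> real N" "\<bar>real (snd i) - real N\<bar> \<le> real N"
        using that by (auto simp: mem_Times_iff abs_le_iff)
      have "norm (p i) \<le> \<bar>h * (real (fst i) - real N)\<bar> + \<bar>h * (real (snd i) - real N)\<bar>"
        unfolding p_def using norm_Pair_le[of "h * (real (fst i) - real N)" "h * (real (snd i) - real N)"] by simp
      also have "\<dots> = h * \<bar>real (fst i) - real N\<bar> + h * \<bar>real (snd i) - real N\<bar>"
        using h by (simp add: abs_mult)
      also have "\<dots> \<le> h * real N + h * real N"
        using h i by (intro add_mono mult_left_mono) auto
      also have "\<dots> \<le> 2 * (R + \<delta>)"
        using Nh h assms by (simp add: h_def mult.commute)
      finally show ?thesis .
    qed
    show "(\<Sum>i\<in>?I. b i x) = 1" if "norm x \<le> R" for x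
    proof -
      have "\<bar>fst x\<bar> \<le> R" "\<bar>snd x\<bar> \<le> R"
        using that norm_fst_le[of "fst x" "snd x"] norm_snd_le[of "snd x" "fst x"] by auto
      then have "\<bar>fst x\<bar> / h \<le> real N" "\<bar>snd x\<bar> / h \<le> real N"
        using N(1) h divide_right_mono[of "\<bar>fst x\<bar>" R h] divide_right_mono[of "\<bar>snd x\<bar>" R h] by linarith+
      then have "\<bar>fst x / h\<bar> \<le> real N" "\<bar>snd x / h\<bar> \<le> real N"
        using h by (simp_all add: abs_divide)
      then have "(\<Sum>i<2 * N + 1. B (fst x / h - (real i - real N))) * (\<Sum>j<2 * N + 1. B (snd x / h - (real j - real N))) = 1"
        by (simp only: B_sum mult_1)
      then show ?thesis
        unfolding sum_product sum.cartesian_product by (simp add: b_def split_beta)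
    qed
  qed
qed

section \<open>Holes and constant boundary values\<close>

locale lipschitz_domain = bounded_open +
  assumes connected_\<Omega>: "connected \<Omega>" and lipschitz_\<Omega>: "lipschitz_boundary \<Omega>"
begin

text \<open>In a chart the complement is the part on or below the graph. A point of it is joined to
  \<open>x0\<close> by going vertically up to the graph and then along the graph; both pieces avoid
  \<Omega>. Consequently hole values cannot jump at the boundary.\<close>

lemma complement_locally_connected_at_boundary:
  assumes chart: "lipschitz_chart \<Omega> x0 r e1 e2 \<gamma>"
  obtains \<rho> where "0 < \<rho>" "\<rho> < r" "\<And>y. y \<in> ball x0 \<rho> \<Longrightarrow> y \<notin> \<Omega> \<Longrightarrow> connected_component (- \<Omega>) x0 y"
    "\<And>s. s *\<^sub>R e1 + \<gamma> s *\<^sub>R e2 \<in> ball x0 r \<Longrightarrow> s *\<^sub>R e1 + \<gamma> s *\<^sub>R e2 \<notin> \<Omega>"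
proof -
  have r: "r > 0" and e: "norm e1 = 1" "norm e2 = 1" "e1 \<bullet> e2 = 0" and x0: "x0 \<in> frontier \<Omega>"
    and \<Omega>r: "\<Omega> \<inter> ball x0 r = {x \<in> ball x0 r. \<gamma> (x \<bullet> e1) < x \<bullet> e2}"
    using chart by (auto simp: lipschitz_chart_def)
  obtain L where L: "L-lipschitz_on UNIV \<gamma>" using chart by (auto simp: lipschitz_chart_def)
  have L0: "L \<ge> 0" using L by (rule lipschitz_on_nonneg)
  have \<gamma>L: "\<bar>\<gamma> s - \<gamma> t\<bar> \<le> L * \<bar>s - t\<bar>" for s t
    using lipschitz_onD[OF L, of s t] by (simp add: dist_real_def)
  have c\<gamma>: "continuous_on A \<gamma>" for A using lipschitz_on_continuous_on[OF L] continuous_on_subset by blast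
  let ?P = "\<lambda>s t. s *\<^sub>R e1 + t *\<^sub>R e2"
  note ip = inner_orthonormal_combination[OF e]
  define s0 t0 where "s0 = x0 \<bullet> e1" and "t0 = x0 \<bullet> e2"
  have x0_eq: "x0 = ?P s0 t0" unfolding s0_def t0_def by (rule orthonormal_plane_expansion[OF e])
  have out: "?P s t \<notin> \<Omega>" if "?P s t \<in> ball x0 r" "t \<le> \<gamma> s" for s t
  proof
    assume "?P s t \<in> \<Omega>"
    then have "?P s t \<in> {x \<in> ball x0 r. \<gamma> (x \<bullet> e1) < x \<bullet> e2}" using that(1) \<Omega>r by blast
    then show False using that(2) by (simp add: ip)
  qed
  have "t0 = \<gamma> s0"
  proof (rule antisym)
    have "x0 \<notin> \<Omega>" using x0 open_\<Omega> by (simp add: frontier_def interior_open)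
    moreover have "x0 \<in> ball x0 r" using r by simp
    ultimately have "x0 \<notin> {x \<in> ball x0 r. \<gamma> (x \<bullet> e1) < x \<bullet> e2}" using \<Omega>r by blast
    then show "t0 \<le> \<gamma> s0" using \<open>x0 \<in> ball x0 r\<close> by (simp add: s0_def t0_def)
    show "\<gamma> s0 \<le> t0"
    proof (rule ccontr)
      assume "\<not> \<gamma> s0 \<le> t0"
      let ?U = "ball x0 r \<inter> {x. x \<bullet> e2 < \<gamma> (x \<bullet> e1)}"
      have "open ?U"
        by (intro open_Int open_ball open_Collect_less continuous_intros continuous_on_compose2[OF c\<gamma>[of UNIV]]) auto
      moreover have "x0 \<in> ?U" using \<open>\<not> \<gamma> s0 \<le> t0\<close> r by (simp add: s0_def t0_def)
      moreover have "x0 \<in> closure \<Omega>" using x0 by (simp add: frontier_def)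
      ultimately have "?U \<inter> \<Omega> \<noteq> {}"
        using open_Int_closure_eq_empty[of ?U \<Omega>] by blast
      then obtain z where "z \<in> ?U" "z \<in> \<Omega>" by blast
      then have "z \<in> {x \<in> ball x0 r. \<gamma> (x \<bullet> e1) < x \<bullet> e2}" using \<Omega>r by blast
      then show False using \<open>z \<in> ?U\<close> by auto
    qed
  qed
  note t0 = this
  \<comment> \<open>Within horizontal distance \<rho> the height of the graph deviates from that of
    \<open>x0\<close> by at most \<open>L * \<rho>\<close>, so all paths stay within
    \<open>(2 + L) * \<rho>\<close> of \<open>x0\<close>; dividing by \<open>3 + L\<close> keeps
    this below \<open>r\<close>.\<close>
  define \<rho> where "\<rho> = r / (3 + L)"
  have \<rho>0: "0 < \<rho>" using r L0 by (simp add: \<rho>_def)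
  have "(3 + L) * \<rho> = r" using L0 by (simp add: \<rho>_def)
  then have "(2 + L) * \<rho> = r - \<rho>" by (simp add: algebra_simps)
  moreover have "(2 + L) * \<rho> > 0" using \<rho>0 L0 by simp
  ultimately have \<rho>: "0 < \<rho>" "(2 + L) * \<rho> < r" "\<rho> < r"
    using \<rho>0 by linarith+
  have in_ball: "?P s t \<in> ball x0 r" if "\<bar>s - s0\<bar> \<le> \<rho>" "\<bar>t - t0\<bar> \<le> (1 + L) * \<rho>" for s t
  proof -
    have "?P s t - x0 = (s - s0) *\<^sub>R e1 + (t - t0) *\<^sub>R e2"
      by (subst x0_eq) (simp add: algebra_simps)
    then have "norm (?P s t - x0) \<le> norm ((s - s0) *\<^sub>R e1) + norm ((t - t0) *\<^sub>R e2)"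
      by (simp only: norm_triangle_ineq)
    then have "norm (?P s t - x0) \<le> \<bar>s - s0\<bar> + \<bar>t - t0\<bar>" by (simp add: e)
    also have "\<dots> \<le> \<rho> + (1 + L) * \<rho>" using that by (intro add_mono)
    also have "\<dots> < r" using \<rho> by (simp add: algebra_simps)
    finally show ?thesis by (simp add: dist_norm norm_minus_commute)
  qed
  show ?thesis
  proof (rule that[OF \<rho>(1,3)])
    show "?P s (\<gamma> s) \<notin> \<Omega>" if "?P s (\<gamma> s) \<in> ball x0 r" for s
      by (rule out[OF that order_refl])
    fix y assume y: "y \<in> ball x0 \<rho>" "y \<notin> \<Omega>"
    define s t where "s = y \<bullet> e1" and "t = y \<bullet> e2"
    have y_eq: "y = ?P s t" unfolding s_def t_def by (rule orthonormal_plane_expansion[OF e])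
    have "\<bar>(y - x0) \<bullet> e1\<bar> \<le> norm (y - x0)" "\<bar>(y - x0) \<bullet> e2\<bar> \<le> norm (y - x0)"
      using Cauchy_Schwarz_ineq2[of "y - x0" e1] Cauchy_Schwarz_ineq2[of "y - x0" e2] e by simp_all
    then have st: "\<bar>s - s0\<bar> \<le> \<rho>" "\<bar>t - t0\<bar> \<le> \<rho>"
      using y(1) by (simp_all add: s_def t_def s0_def t0_def inner_diff_left dist_norm norm_minus_commute)
    have "y \<in> ball x0 r" using y(1) \<rho>(3) by simp
    then have "y \<notin> {x \<in> ball x0 r. \<gamma> (x \<bullet> e1) < x \<bullet> e2}" using \<Omega>r y(2) by blast
    then have t_le: "t \<le> \<gamma> s" using \<open>y \<in> ball x0 r\<close> by (simp add: s_def t_def)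
    have graph: "\<bar>\<gamma> \<sigma> - t0\<bar> \<le> (1 + L) * \<rho>" if "\<bar>\<sigma> - s0\<bar> \<le> \<rho>" for \<sigma>
    proof -
      have "\<bar>\<gamma> \<sigma> - t0\<bar> \<le> L * \<bar>\<sigma> - s0\<bar>" unfolding t0 by (rule \<gamma>L)
      also have "\<dots> \<le> L * \<rho>" using that L0 by (intro mult_left_mono)
      also have "\<dots> \<le> (1 + L) * \<rho>" using \<rho>(1) by (simp add: algebra_simps)
      finally show ?thesis .
    qed
    have "connected ((\<lambda>\<tau>. ?P s \<tau>) ` {t..\<gamma> s})"
      by (intro connected_continuous_image continuous_intros) auto
    moreover have "(\<lambda>\<tau>. ?P s \<tau>) ` {t..\<gamma> s} \<subseteq> - \<Omega>"
    proof (rule image_subsetI)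
      fix \<tau> assume \<tau>: "\<tau> \<in> {t..\<gamma> s}"
      have "\<bar>\<tau> - t0\<bar> \<le> (1 + L) * \<rho>"
      proof -
        have "\<rho> \<le> (1 + L) * \<rho>" using L0 \<rho>(1) by (simp add: algebra_simps)
        then show ?thesis using st(2) graph[OF st(1)] \<tau>(1) by (simp add: abs_le_iff)
      qed
      from out[OF in_ball[OF st(1) this]] \<tau> show "?P s \<tau> \<in> - \<Omega>" by simp
    qed
    ultimately have 1: "connected_component (- \<Omega>) y (?P s (\<gamma> s))"
      unfolding connected_component_def using t_le y_eq by (intro exI[of _ "(\<lambda>\<tau>. ?P s \<tau>) ` {t..\<gamma> s}"]) auto
    have "connected ((\<lambda>\<sigma>. ?P \<sigma> (\<gamma> \<sigma>)) ` {s0 - \<rho>..s0 + \<rho>})"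
      by (intro connected_continuous_image continuous_intros c\<gamma>) auto
    moreover have "(\<lambda>\<sigma>. ?P \<sigma> (\<gamma> \<sigma>)) ` {s0 - \<rho>..s0 + \<rho>} \<subseteq> - \<Omega>"
    proof (rule image_subsetI)
      fix \<sigma> assume \<sigma>: "\<sigma> \<in> {s0 - \<rho>..s0 + \<rho>}"
      then have "\<bar>\<sigma> - s0\<bar> \<le> \<rho>" by (auto simp: abs_le_iff)
      from out[OF in_ball[OF this graph[OF this]]] show "?P \<sigma> (\<gamma> \<sigma>) \<in> - \<Omega>" by simp
    qed
    moreover have "x0 \<in> (\<lambda>\<sigma>. ?P \<sigma> (\<gamma> \<sigma>)) ` {s0 - \<rho>..s0 + \<rho>}"
      by (rule image_eqI[of _ _ s0]) (use x0_eq t0 \<rho>(1) in auto)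
    moreover have "?P s (\<gamma> s) \<in> (\<lambda>\<sigma>. ?P \<sigma> (\<gamma> \<sigma>)) ` {s0 - \<rho>..s0 + \<rho>}"
      by (rule imageI) (use st(1) in \<open>auto simp: abs_le_iff\<close>)
    ultimately have 2: "connected_component (- \<Omega>) x0 (?P s (\<gamma> s))"
      unfolding connected_component_def by blast
    show "connected_component (- \<Omega>) x0 y"
      by (rule connected_component_trans[OF 2 connected_component_sym[OF 1]])
  qed
qed

text \<open>The value attached to the component of the complement that contains \<open>x\<close>,
  read off at an arbitrary boundary point of that component. For admissible traces
  \<open>hole_value_boundary\<close> shows that the choice does not matter.\<close>

definition hole_value :: "(plane \<Rightarrow> real) \<Rightarrow> plane \<Rightarrow> real" where
  "hole_value g x = (if x \<in> outside \<Omega> then 0 else g (SOME z. z \<in> frontier (connected_component_set (- \<Omega>) x)))"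

lemma hole_value_cong:
  assumes "connected_component (- \<Omega>) x y" shows "hole_value g x = hole_value g y"
proof -
  have "connected_component_set (- \<Omega>) x = connected_component_set (- \<Omega>) y"
    using assms connected_component_eq by (metis mem_Collect_eq)
  moreover have "x \<notin> \<Omega>" "y \<notin> \<Omega>" using assms connected_component_in by blast+
  ultimately show ?thesis by (simp add: hole_value_def outside_def)
qed

text \<open>Connectedness of \<Omega> makes the boundary of each component of the complement
  connected, hence contained in a single component of the boundary of \<Omega>, where the trace is
  constant.\<close>

lemma hole_value_boundary:
  assumes x: "x \<in> frontier \<Omega>" and g0: "\<And>y. y \<in> exterior_boundary \<Omega> \<Longrightarrow> g y = 0"
    and gc: "\<And>\<Gamma>. \<Gamma> \<in> components (frontier \<Omega>) \<Longrightarrow> \<exists>c. \<forall>y\<in>\<Gamma>. g y = c"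
  shows "g x = hole_value g x"
proof -
  have x\<Omega>: "x \<notin> \<Omega>" using x open_\<Omega> by (simp add: frontier_def interior_open)
  \<comment> \<open>A boundary point of \<Omega> is never interior to a set that avoids \<Omega>, so
    it is on the frontier of whatever part of the complement contains it.\<close>
  have fr: "x \<in> frontier T" if "T \<subseteq> - \<Omega>" "x \<in> T" for T
  proof -
    have "interior T \<subseteq> - closure \<Omega>"
      using interior_mono[OF that(1)] by (simp add: interior_complement)
    then show ?thesis
      using x that(2) closure_subset[of T] by (auto simp: frontier_def)
  qed
  show ?thesis
  proof (cases "x \<in> outside \<Omega>")
    case True
    have "outside \<Omega> \<subseteq> - \<Omega>" by (auto simp: outside_def)
    then have "x \<in> exterior_boundary \<Omega>" using fr True by (simp add: exterior_boundary_def)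
    then show ?thesis using g0 True by (simp add: hole_value_def)
  next
    case False
    let ?C = "connected_component_set (- \<Omega>) x"
    have xC: "x \<in> ?C" using x\<Omega> by (simp add: connected_component_refl)
    have "x \<in> frontier ?C" by (rule fr[OF connected_component_subset xC])
    then have z: "(SOME z. z \<in> frontier ?C) \<in> frontier ?C" by (rule someI)
    have C: "?C \<in> components (- \<Omega>)" using x\<Omega> by (intro componentsI) simp
    have conn: "connected (frontier ?C)" by (rule connected_frontier_component_complement[OF connected_\<Omega> C])
    have "frontier ?C \<subseteq> frontier \<Omega>"
      using frontier_of_components_subset[OF C] by (simp add: frontier_complement)
    then obtain \<Gamma> where "\<Gamma> \<in> components (frontier \<Omega>)" "frontier ?C \<subseteq> \<Gamma>"
      using exists_component_superset[of "frontier ?C" "frontier \<Omega>"] conn \<open>x \<in> frontier ?C\<close> by blast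
    then show ?thesis
      using gc[of \<Gamma>] z \<open>x \<in> frontier ?C\<close> False by (metis hole_value_def subsetD)
  qed
qed

text \<open>A Lipschitz boundary keeps different components of the complement apart: near a boundary
  point there is only one. This makes the extension continuous on the complement, hence integrable
  on compact parts of it.\<close>

lemma hole_value_locally_constant:
  assumes "x \<notin> \<Omega>"
  obtains \<rho> where "0 < \<rho>" "\<And>y. y \<in> ball x \<rho> \<Longrightarrow> y \<notin> \<Omega> \<Longrightarrow> hole_value g y = hole_value g x"
proof (cases "x \<in> frontier \<Omega>")
  case True
  then obtain r e1 e2 \<gamma> where "lipschitz_chart \<Omega> x r e1 e2 \<gamma>"
    using lipschitz_\<Omega> by (auto simp: lipschitz_boundary_def)
  from complement_locally_connected_at_boundary[OF this] obtain \<rho> where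
    "0 < \<rho>" "\<And>y. y \<in> ball x \<rho> \<Longrightarrow> y \<notin> \<Omega> \<Longrightarrow> connected_component (- \<Omega>) x y" by metis
  then show ?thesis using that hole_value_cong by metis
next
  case False
  then have "x \<in> - closure \<Omega>" using assms open_\<Omega> by (simp add: frontier_def interior_open)
  then obtain \<rho> where \<rho>: "0 < \<rho>" "ball x \<rho> \<subseteq> - closure \<Omega>"
    using open_contains_ball[of "- closure \<Omega>"] by (metis closed_closure open_Compl)
  have "connected_component (- \<Omega>) x y" if "y \<in> ball x \<rho>" for y
    unfolding connected_component_def
    by (rule exI[of _ "ball x \<rho>"]) (use \<rho> that closure_subset[of \<Omega>] in auto)
  then show ?thesis using that[OF \<rho>(1)] hole_value_cong by metis
qed

lemma continuous_on_hole_value: "continuous_on (- \<Omega>) (hole_value g)"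
  unfolding continuous_on_def
proof
  fix x assume "x \<in> - \<Omega>"
  then obtain \<rho> where \<rho>: "0 < \<rho>" "\<And>y. y \<in> ball x \<rho> \<Longrightarrow> y \<notin> \<Omega> \<Longrightarrow> hole_value g y = hole_value g x"
    using hole_value_locally_constant[of x g] by auto
  have "\<forall>\<^sub>F y in at x within - \<Omega>. hole_value g y = hole_value g x"
    unfolding eventually_at using \<rho> by (intro exI[of _ \<rho>]) (auto simp: dist_commute)
  then show "(hole_value g \<longlongrightarrow> hole_value g x) (at x within - \<Omega>)"
    by (rule tendsto_eventually)
qed

end

section \<open>Weak gradients on the whole plane\<close>

context bounded_open
begin

lemma L2_inner:
  fixes g :: "plane \<Rightarrow> plane"
  assumes "g \<in> L2 \<Omega>" "norm v = 1"
  shows "(\<lambda>x. v \<bullet> g x) \<in> L2 \<Omega>" "L2_norm \<Omega> (\<lambda>x. v \<bullet> g x) \<le> 2 * L2_norm \<Omega> g"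
proof -
  have eq: "v \<bullet> g x = fst v *\<^sub>R fst (g x) + snd v *\<^sub>R snd (g x)" for x
    by (simp add: inner_prod_def)
  have v: "\<bar>fst v\<bar> \<le> 1" "\<bar>snd v\<bar> \<le> 1"
    using norm_fst_le[of "fst v" "snd v"] norm_snd_le[of "snd v" "fst v"] assms(2) by simp_all
  show "(\<lambda>x. v \<bullet> g x) \<in> L2 \<Omega>"
    unfolding eq by (rule L2_lincomb[OF L2_fst_snd(1,2)[OF assms(1)]])
  have "L2_norm \<Omega> (\<lambda>x. v \<bullet> g x) \<le> \<bar>fst v\<bar> * L2_norm \<Omega> (\<lambda>x. fst (g x)) + \<bar>snd v\<bar> * L2_norm \<Omega> (\<lambda>x. snd (g x))"
    unfolding eq by (rule L2_norm_lincomb[OF L2_fst_snd(1,2)[OF assms(1)]])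
  also have "\<dots> \<le> 1 * L2_norm \<Omega> g + 1 * L2_norm \<Omega> g"
    by (intro add_mono mult_mono v L2_fst_snd(3,4)[OF assms(1)] L2_norm_nonneg) auto
  finally show "L2_norm \<Omega> (\<lambda>x. v \<bullet> g x) \<le> 2 * L2_norm \<Omega> g" by simp
qed

text \<open>The product rule splits the left side into a part with \<open>\<phi> k\<close> and a
  part with its gradient, both continuous in the H^1 norm. Where the left side is also known to tend
  to 0, uniqueness of limits yields integration by parts for \<psi>.\<close>

lemma smooth_approximation_limit:
  assumes \<psi>: "\<psi> \<in> H1 \<Omega>" and \<phi>: "\<And>k. Ck 1 (\<phi> k)" and lim: "(\<lambda>k. H1_norm \<Omega> (\<lambda>x. \<phi> k x - \<psi> x)) \<longlonglongrightarrow> 0"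
    and F: "Ck 1 F" and v: "norm v = 1"
  shows "(\<lambda>k. LINT x:\<Omega>|lborel. dir_deriv v (\<lambda>x. (\<phi> k x - c) * F x) x) \<longlonglongrightarrow>
    (LINT x:\<Omega>|lborel. (\<psi> x - c) * dir_deriv v F x) + (LINT x:\<Omega>|lborel. (v \<bullet> wgrad \<Omega> \<psi> x) * F x)"
proof -
  have dF: "dir_deriv v F \<in> L2 \<Omega>" by (rule continuous_L2[OF continuous_dir_deriv[OF F]])
  have FL: "F \<in> L2 \<Omega>" by (rule Ck_L2[OF F])
  have d: "(\<lambda>x. \<phi> k x - \<psi> x) \<in> H1 \<Omega>" for k
    using H1_lincomb(1)[OF Ck_H1(1)[OF \<phi>[of k]] \<psi>, of 1 "-1"] by simp
  have g: "(\<lambda>x. v \<bullet> wgrad \<Omega> (\<lambda>x. \<phi> k x - \<psi> x) x) \<in> L2 \<Omega>" for k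
    by (rule L2_inner[OF wgrad_L2[OF d] v])
  have \<psi>c: "(\<lambda>x. \<psi> x - c) \<in> L2 \<Omega>"
    using L2_lincomb[OF H1_L2[OF \<psi>] Ck_L2[OF Ck_const[of 0 1]], of 1 "- c"] by simp
  have ae: "AE x in lborel. x \<in> \<Omega> \<longrightarrow> v \<bullet> wgrad \<Omega> (\<lambda>x. \<phi> k x - \<psi> x) x = dir_deriv v (\<phi> k) x - v \<bullet> wgrad \<Omega> \<psi> x" for k
  proof -
    have "AE x in lborel. x \<in> \<Omega> \<longrightarrow> wgrad \<Omega> (\<lambda>x. 1 * \<phi> k x + (-1) * \<psi> x) x = 1 *\<^sub>R wgrad \<Omega> (\<phi> k) x + (-1) *\<^sub>R wgrad \<Omega> \<psi> x"
      by (rule H1_lincomb(2)[OF Ck_H1(1)[OF \<phi>] \<psi>])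
    with Ck_H1(2)[OF \<phi>[of k]] show ?thesis
    proof eventually_elim
      case (elim x)
      show ?case
      proof
        assume "x \<in> \<Omega>"
        with elim have "wgrad \<Omega> (\<lambda>x. \<phi> k x - \<psi> x) x = (dx (\<phi> k) x, dy (\<phi> k) x) - wgrad \<Omega> \<psi> x" by simp
        then show "v \<bullet> wgrad \<Omega> (\<lambda>x. \<phi> k x - \<psi> x) x = dir_deriv v (\<phi> k) x - v \<bullet> wgrad \<Omega> \<psi> x"
          by (simp only: inner_diff_right) (simp add: inner_prod_def dir_deriv_def)
      qed
    qed
  qed
  note i1 = L2_mult_integrable(1)[OF \<psi>c dF] and i2 = L2_mult_integrable(1)[OF L2_inner(1)[OF wgrad_L2[OF \<psi>] v] FL]
    and i3 = L2_mult_integrable(1)[OF H1_L2[OF d] dF] and i4 = L2_mult_integrable(1)[OF g FL]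
  let ?e = "\<lambda>k. (LINT x:\<Omega>|lborel. (\<phi> k x - \<psi> x) * dir_deriv v F x) + (LINT x:\<Omega>|lborel. (v \<bullet> wgrad \<Omega> (\<lambda>x. \<phi> k x - \<psi> x) x) * F x)"
  let ?l = "(LINT x:\<Omega>|lborel. (\<psi> x - c) * dir_deriv v F x) + (LINT x:\<Omega>|lborel. (v \<bullet> wgrad \<Omega> \<psi> x) * F x)"
  have eq: "(LINT x:\<Omega>|lborel. dir_deriv v (\<lambda>x. (\<phi> k x - c) * F x) x) = ?l + ?e k" for k
  proof -
    have "(LINT x:\<Omega>|lborel. (v \<bullet> wgrad \<Omega> (\<lambda>x. \<phi> k x - \<psi> x) x) * F x) = (LINT x:\<Omega>|lborel. (dir_deriv v (\<phi> k) x - v \<bullet> wgrad \<Omega> \<psi> x) * F x)"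
      "set_integrable lborel \<Omega> (\<lambda>x. (dir_deriv v (\<phi> k) x - v \<bullet> wgrad \<Omega> \<psi> x) * F x)"
    proof -
      have L: "(\<lambda>x. 1 *\<^sub>R dir_deriv v (\<phi> k) x + (-1) *\<^sub>R (v \<bullet> wgrad \<Omega> \<psi> x)) \<in> L2 \<Omega>"
        by (rule L2_lincomb[OF continuous_L2[OF continuous_dir_deriv[OF \<phi>]] L2_inner(1)[OF wgrad_L2[OF \<psi>] v]])
      show i5: "set_integrable lborel \<Omega> (\<lambda>x. (dir_deriv v (\<phi> k) x - v \<bullet> wgrad \<Omega> \<psi> x) * F x)"
        using L2_mult_integrable(1)[OF L FL] by simp
      show "(LINT x:\<Omega>|lborel. (v \<bullet> wgrad \<Omega> (\<lambda>x. \<phi> k x - \<psi> x) x) * F x) = (LINT x:\<Omega>|lborel. (dir_deriv v (\<phi> k) x - v \<bullet> wgrad \<Omega> \<psi> x) * F x)"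
        unfolding set_lebesgue_integral_def
      proof (rule integral_cong_AE)
        show "(\<lambda>x. indicator \<Omega> x *\<^sub>R ((v \<bullet> wgrad \<Omega> (\<lambda>x. \<phi> k x - \<psi> x) x) * F x)) \<in> borel_measurable lborel"
          "(\<lambda>x. indicator \<Omega> x *\<^sub>R ((dir_deriv v (\<phi> k) x - v \<bullet> wgrad \<Omega> \<psi> x) * F x)) \<in> borel_measurable lborel"
          by (rule borel_measurable_integrable[OF i4[unfolded set_integrable_def]],
            rule borel_measurable_integrable[OF i5[unfolded set_integrable_def]])
        show "AE x in lborel. indicator \<Omega> x *\<^sub>R ((v \<bullet> wgrad \<Omega> (\<lambda>x. \<phi> k x - \<psi> x) x) * F x) =
          indicator \<Omega> x *\<^sub>R ((dir_deriv v (\<phi> k) x - v \<bullet> wgrad \<Omega> \<psi> x) * F x)"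
          using ae[of k] by eventually_elim (simp add: indicator_def)
      qed
    qed
    then have "?l + ?e k = (LINT x:\<Omega>|lborel. ((\<psi> x - c) * dir_deriv v F x + (v \<bullet> wgrad \<Omega> \<psi> x) * F x) +
      ((\<phi> k x - \<psi> x) * dir_deriv v F x + (dir_deriv v (\<phi> k) x - v \<bullet> wgrad \<Omega> \<psi> x) * F x))"
      using i1 i2 i3[of k] by (simp only: set_integral_add)
    also have "\<dots> = (LINT x:\<Omega>|lborel. dir_deriv v (\<lambda>x. (\<phi> k x - c) * F x) x)"
      using \<phi>[of k] F by (subst dir_deriv_mult[of 0]) (simp_all add: dir_deriv_diff_const[of 0] Ck_diff Ck_const algebra_simps)
    finally show ?thesis by simp
  qed
  have "?e \<longlonglongrightarrow> 0"
  proof (rule tendsto_rabs_zero_cancel, rule tendsto_sandwich[OF always_eventually always_eventually tendsto_const])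
    let ?A = "\<lambda>k. L2_norm \<Omega> (\<lambda>x. \<phi> k x - \<psi> x)" and ?B = "\<lambda>k. L2_norm \<Omega> (wgrad \<Omega> (\<lambda>x. \<phi> k x - \<psi> x))"
    have "\<bar>?e k\<bar> \<le> ?A k * L2_norm \<Omega> (dir_deriv v F) + 2 * ?B k * L2_norm \<Omega> F" for k
    proof -
      have "\<bar>?e k\<bar> \<le> ?A k * L2_norm \<Omega> (dir_deriv v F) + L2_norm \<Omega> (\<lambda>x. v \<bullet> wgrad \<Omega> (\<lambda>x. \<phi> k x - \<psi> x) x) * L2_norm \<Omega> F"
        using L2_mult_integrable(2)[OF H1_L2[OF d] dF, of k] L2_mult_integrable(2)[OF g FL, of k] by linarith
      also have "\<dots> \<le> ?A k * L2_norm \<Omega> (dir_deriv v F) + 2 * ?B k * L2_norm \<Omega> F"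
        by (intro add_left_mono mult_right_mono L2_inner(2)[OF wgrad_L2[OF d] v] L2_norm_nonneg)
      finally show ?thesis .
    qed
    then show "\<forall>k. \<bar>?e k\<bar> \<le> ?A k * L2_norm \<Omega> (dir_deriv v F) + 2 * ?B k * L2_norm \<Omega> F" by blast
    have AB: "?A \<longlonglongrightarrow> 0" "?B \<longlonglongrightarrow> 0" using lim unfolding H1_norm_tendsto_0_iff by blast+
    have "(\<lambda>k. ?A k * L2_norm \<Omega> (dir_deriv v F) + 2 * ?B k * L2_norm \<Omega> F) \<longlonglongrightarrow> 0 * L2_norm \<Omega> (dir_deriv v F) + 2 * 0 * L2_norm \<Omega> F"
      by (intro tendsto_intros AB)
    then show "(\<lambda>k. ?A k * L2_norm \<Omega> (dir_deriv v F) + 2 * ?B k * L2_norm \<Omega> F) \<longlonglongrightarrow> 0" by simp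
  qed simp
  from tendsto_add[OF tendsto_const this, of ?l] show ?thesis
    unfolding eq by simp
qed

end

text \<open>\<open>g\<close> on \<open>\<Omega>\<close>, extended by 0, is the weak gradient on the whole plane of a function with bounded
  support. For \<open>\<psi>\<close> in \<open>\<H>\<close> the extension takes the constant boundary values into the holes.\<close>

definition extendable_gradient :: "plane set \<Rightarrow> (plane \<Rightarrow> plane) \<Rightarrow> bool" where
  "extendable_gradient \<Omega> g \<longleftrightarrow> g \<in> L2 \<Omega> \<and> (\<exists>\<psi> R. integrable lborel \<psi> \<and> vanishes_beyond R \<psi> \<and>
    (\<forall>F v. Ck 1 F \<longrightarrow> norm v = 1 \<longrightarrow>
      (\<integral>x. \<psi> x * dir_deriv v F x \<partial>lborel) = - (LINT x:\<Omega>|lborel. (v \<bullet> g x) * F x)))"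

context lipschitz_domain
begin

text \<open>That the gradient extended by 0 is the weak gradient of the extended function can be
  checked locally: in the interior and in the exterior there is no boundary term, and near a
  boundary point the constant boundary value is subtracted so that the term tends to 0. A partition
  of unity fitted to these neighbourhoods assembles the general test function.\<close>

lemma H_space_extendable:
  assumes "\<psi> \<in> H_space \<Omega>" shows "extendable_gradient \<Omega> (wgrad \<Omega> \<psi>)"
proof -
  note H = assms[unfolded H_space_def mem_Collect_eq]
  obtain g where g: "has_trace \<Omega> \<psi> g \<and> (\<forall>x\<in>exterior_boundary \<Omega>. g x = 0) \<and>
      (\<forall>\<Gamma>\<in>components (frontier \<Omega>). \<exists>c. \<forall>x\<in>\<Gamma>. g x = c)"
    using H[THEN conjunct2] by (rule exE) (rule that)
  note \<psi> = H[THEN conjunct1] and tr = g[THEN conjunct1]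
    and g0 = g[THEN conjunct2, THEN conjunct1, rule_format]
    and gc = g[THEN conjunct2, THEN conjunct2, rule_format]
  have gm: "g \<in> borel_measurable borel"
    using tr[unfolded has_trace_def] by (rule conjunct1)
  obtain \<phi> where \<phi>_all: "(\<forall>k. smooth (\<phi> k)) \<and> (\<lambda>k. H1_norm \<Omega> (\<lambda>x. \<phi> k x - \<psi> x)) \<longlonglongrightarrow> 0 \<and>
        (\<forall>x0 r e1 e2 \<gamma>. lipschitz_chart \<Omega> x0 r e1 e2 \<gamma> \<longrightarrow>
           (\<lambda>k. \<integral>\<^sup>+ s \<in> {s. s *\<^sub>R e1 + \<gamma> s *\<^sub>R e2 \<in> ball x0 r}.
              ennreal ((\<phi> k (s *\<^sub>R e1 + \<gamma> s *\<^sub>R e2) - g (s *\<^sub>R e1 + \<gamma> s *\<^sub>R e2))\<^sup>2) \<partial>lborel) \<longlonglongrightarrow> 0)"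
    using tr[unfolded has_trace_def, THEN conjunct2] by (rule exE) (rule that)
  note \<phi> = \<phi>_all[THEN conjunct1, rule_format]
    and lim = \<phi>_all[THEN conjunct2, THEN conjunct1]
    and tr_lim = \<phi>_all[THEN conjunct2, THEN conjunct2, rule_format]
  have \<phi>1: "Ck 1 (\<phi> k)" for k using \<phi> by (rule smooth_Ck)
  let ?E = "hole_value g"
  define \<psi>t where "\<psi>t x = (if x \<in> \<Omega> then \<psi> x else ?E x)" for x
  have "bounded (\<Omega> \<union> inside \<Omega>)" using bounded_\<Omega> bounded_inside[OF bounded_\<Omega>] by (simp only: bounded_Un simp_thms)
  then obtain R0 where R0: "\<And>x. x \<in> \<Omega> \<union> inside \<Omega> \<Longrightarrow> norm x \<le> R0" unfolding bounded_iff by blast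
  define R where "R = max 0 R0"
  have vb: "vanishes_beyond R \<psi>t"
    unfolding vanishes_beyond_def
  proof (intro allI impI)
    fix x :: plane assume "R < norm x"
    then have "x \<notin> \<Omega> \<union> inside \<Omega>" using R0[of x] by (auto simp: R_def)
    then have "x \<in> outside \<Omega>" "x \<notin> \<Omega>" using inside_Un_outside[of \<Omega>] by blast+
    then show "\<psi>t x = 0" by (simp add: \<psi>t_def hole_value_def)
  qed
  have \<Omega>R: "norm x \<le> R" if "x \<in> \<Omega>" for x using R0[of x] that by (simp add: R_def)
  have int: "integrable lborel \<psi>t"
  proof -
    let ?K = "- \<Omega> \<inter> cball 0 R"
    have "compact ?K" using open_\<Omega> by (intro closed_Int_compact) auto
    then have "integrable lborel (\<lambda>x. indicator ?K x *\<^sub>R ?E x)"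
      by (rule borel_integrable_compact) (rule continuous_on_subset[OF continuous_on_hole_value], blast)
    moreover have "integrable lborel (\<lambda>x. indicator \<Omega> x *\<^sub>R \<psi> x)"
      using L2_integrable[OF H1_L2[OF \<psi>]] by (simp add: set_integrable_def)
    ultimately have "integrable lborel (\<lambda>x. indicator \<Omega> x *\<^sub>R \<psi> x + indicator ?K x *\<^sub>R ?E x)"
      by (intro Bochner_Integration.integrable_add)
    moreover have "(\<lambda>x. indicator \<Omega> x *\<^sub>R \<psi> x + indicator ?K x *\<^sub>R ?E x) = \<psi>t"
    proof
      fix x
      show "indicator \<Omega> x *\<^sub>R \<psi> x + indicator ?K x *\<^sub>R ?E x = \<psi>t x"
        using vanishes_beyondD[OF vb, of x] by (auto simp: indicator_def \<psi>t_def not_le split: if_splits)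
    qed
    ultimately show ?thesis by (simp only:)
  qed
  define defect where "defect v F = (\<integral>x. \<psi>t x * dir_deriv v F x \<partial>lborel) + (LINT x:\<Omega>|lborel. (v \<bullet> wgrad \<Omega> \<psi> x) * F x)" for v F
  have idF: "integrable lborel (\<lambda>x. \<psi>t x * dir_deriv v F x)" if "Ck 1 F" for v F
    by (rule integrable_mult_continuous[OF int vb continuous_dir_deriv[OF that]])
  have igF: "set_integrable lborel \<Omega> (\<lambda>x. (v \<bullet> wgrad \<Omega> \<psi> x) * F x)" if "Ck 1 F" "norm v = 1" for v F
    by (rule L2_mult_integrable(1)[OF L2_inner(1)[OF wgrad_L2[OF \<psi>] that(2)] Ck_L2[OF that(1)]])
  \<comment> \<open>Near \<open>x0\<close> the extension equals the constant \<open>c\<close>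
    outside \<Omega>. Subtracting \<open>c\<close> is free because a derivative with bounded support
    has integral 0; afterwards only the integral over \<Omega> remains, which the smooth
    approximations evaluate.\<close>
  have key: "defect v F = 0"
    if F: "Ck 1 F" "\<And>y. \<rho> \<le> dist x0 y \<Longrightarrow> F y = 0" and v: "norm v = 1"
      and E: "\<And>y. y \<in> ball x0 \<rho>' \<Longrightarrow> y \<notin> \<Omega> \<Longrightarrow> ?E y = c" "\<rho> < \<rho>'"
      and z: "(\<lambda>k. LINT x:\<Omega>|lborel. dir_deriv v (\<lambda>x. (\<phi> k x - c) * F x) x) \<longlonglongrightarrow> 0"
    for F x0 \<rho> \<rho>' v c
  proof -
    have Fvb: "vanishes_beyond (norm x0 + \<bar>\<rho>\<bar>) F"
      unfolding vanishes_beyond_def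
    proof (intro allI impI F(2))
      fix x :: plane assume "norm x0 + \<bar>\<rho>\<bar> < norm x"
      then show "\<rho> \<le> dist x0 x" using norm_triangle_ineq2[of x x0] by (simp add: dist_norm norm_minus_commute)
    qed
    have idd: "integrable lborel (dir_deriv v F)"
      by (rule continuous_bounded_support_integrable[OF continuous_dir_deriv[OF F(1)] vanishes_beyond_dir_deriv[OF Fvb]])
    have "(\<integral>x. \<psi>t x * dir_deriv v F x \<partial>lborel) = (\<integral>x. \<psi>t x * dir_deriv v F x \<partial>lborel) - c * (\<integral>x. dir_deriv v F x \<partial>lborel)"
      by (simp add: integral_dir_deriv_eq_0[OF F(1) Fvb])
    also have "\<dots> = (\<integral>x. \<psi>t x * dir_deriv v F x - c * dir_deriv v F x \<partial>lborel)"
      using idd idF[OF F(1)] by simp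
    also have "\<dots> = (LINT x:\<Omega>|lborel. (\<psi> x - c) * dir_deriv v F x)"
      unfolding set_lebesgue_integral_def
    proof (rule Bochner_Integration.integral_cong[OF refl])
      fix x
      show "\<psi>t x * dir_deriv v F x - c * dir_deriv v F x = indicator \<Omega> x *\<^sub>R ((\<psi> x - c) * dir_deriv v F x)"
      proof (cases "x \<in> \<Omega>")
        case False
        have "?E x = c \<or> dir_deriv v F x = 0"
        proof (cases "dist x0 x < \<rho>'")
          case True
          then show ?thesis using E(1)[of x] False by simp
        next
          case False
          then have "dir_deriv v F x = 0" using E(2) by (intro dir_deriv_eq_0_outside[of \<rho> x0] F(2)) linarith+
          then show ?thesis ..
        qed
        then show ?thesis using False by (auto simp: \<psi>t_def)
      qed (simp add: \<psi>t_def left_diff_distrib)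
    qed
    finally show ?thesis
      unfolding defect_def using LIMSEQ_unique[OF z smooth_approximation_limit[OF \<psi> \<phi>1 lim F(1) v]] by simp
  qed
  have local: "\<exists>\<rho>>0. \<forall>F v. Ck 1 F \<longrightarrow> norm v = 1 \<longrightarrow> (\<forall>y. \<rho> \<le> dist x0 y \<longrightarrow> F y = 0) \<longrightarrow> defect v F = 0" for x0
  proof (cases "x0 \<in> \<Omega>")
    case True
    then obtain \<rho> where \<rho>: "\<rho> > 0" "ball x0 \<rho> \<subseteq> \<Omega>" using open_\<Omega> open_contains_ball by blast
    show ?thesis
    proof (intro exI[of _ "\<rho> / 2"] conjI allI impI)
      show "\<rho> / 2 > 0" using \<rho> by simp
      fix F v assume F: "Ck 1 F" and v: "norm (v::plane) = 1" and F0: "\<forall>y. \<rho> / 2 \<le> dist x0 y \<longrightarrow> F y = 0"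
      have F0': "\<rho> / 2 \<le> dist x0 y \<Longrightarrow> F y = 0" for y using F0 by blast
      have z: "(LINT x:\<Omega>|lborel. dir_deriv v (\<lambda>x. (\<phi> k x - 0) * F x) x) = 0" for k
      proof -
        have w: "Ck 1 (\<lambda>x. (\<phi> k x - 0) * F x)" by (intro Ck_mult Ck_diff Ck_const \<phi>1 F)
        have w0: "(\<phi> k y - 0) * F y = 0" if "\<rho> / 2 \<le> dist x0 y" for y using F0'[OF that] by simp
        have "(LINT x:\<Omega>|lborel. dir_deriv v (\<lambda>x. (\<phi> k x - 0) * F x) x) = (\<integral>x. dir_deriv v (\<lambda>x. (\<phi> k x - 0) * F x) x \<partial>lborel)"
        proof (rule set_integral_eq_integral_if_vanishing)
          fix x assume "x \<notin> \<Omega>"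
          then have "\<rho> \<le> dist x0 x" using \<rho>(2) by (meson mem_ball not_le subsetD)
          then show "dir_deriv v (\<lambda>x. (\<phi> k x - 0) * F x) x = 0"
            using \<rho>(1) by (intro dir_deriv_eq_0_outside[of "\<rho> / 2" x0] w0) linarith+
        qed
        also have "\<dots> = 0"
        proof (rule integral_dir_deriv_eq_0[OF w])
          show "vanishes_beyond (norm x0 + \<bar>\<rho> / 2\<bar>) (\<lambda>x. (\<phi> k x - 0) * F x)"
            unfolding vanishes_beyond_def
          proof (intro allI impI w0)
            fix x :: plane assume "norm x0 + \<bar>\<rho> / 2\<bar> < norm x"
            then show "\<rho> / 2 \<le> dist x0 x" using norm_triangle_ineq2[of x x0] by (simp add: dist_norm norm_minus_commute)
          qed
        qed
        finally show ?thesis .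
      qed
      show "defect v F = 0"
      proof (rule key[of F "\<rho> / 2" x0 v \<rho> 0, OF F F0' v])
        show "?E y = 0" if "y \<in> ball x0 \<rho>" "y \<notin> \<Omega>" for y using that \<rho>(2) by blast
        show "\<rho> / 2 < \<rho>" using \<rho>(1) by simp
        show "(\<lambda>k. LINT x:\<Omega>|lborel. dir_deriv v (\<lambda>x. (\<phi> k x - 0) * F x) x) \<longlonglongrightarrow> 0"
          unfolding z by (rule tendsto_const)
      qed
    qed
  next
    case False
    note x0\<Omega> = this
    show ?thesis
    proof (cases "x0 \<in> frontier \<Omega>")
      case True
      then obtain r e1 e2 \<gamma> where chart: "lipschitz_chart \<Omega> x0 r e1 e2 \<gamma>"
        using lipschitz_\<Omega> unfolding lipschitz_boundary_def by blast
      obtain \<rho> where \<rho>: "0 < \<rho>" "\<rho> < r" "\<And>y. y \<in> ball x0 \<rho> \<Longrightarrow> y \<notin> \<Omega> \<Longrightarrow> connected_component (- \<Omega>) x0 y"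
        "\<And>s. s *\<^sub>R e1 + \<gamma> s *\<^sub>R e2 \<in> ball x0 r \<Longrightarrow> s *\<^sub>R e1 + \<gamma> s *\<^sub>R e2 \<notin> \<Omega>"
        by (rule complement_locally_connected_at_boundary[OF chart]) blast
      have Ec: "?E y = ?E x0" if "y \<in> ball x0 \<rho>" "y \<notin> \<Omega>" for y
        using hole_value_cong[OF \<rho>(3)[OF that]] by simp
      have graph_frontier: "s *\<^sub>R e1 + \<gamma> s *\<^sub>R e2 \<in> frontier \<Omega>" if s: "s *\<^sub>R e1 + \<gamma> s *\<^sub>R e2 \<in> ball x0 r" for s
      proof -
        have e: "norm e1 = 1" "norm e2 = 1" "e1 \<bullet> e2 = 0"
          and \<Omega>r: "\<Omega> \<inter> ball x0 r = {x \<in> ball x0 r. \<gamma> (x \<bullet> e1) < x \<bullet> e2}"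
          using chart by (auto simp: lipschitz_chart_def)
        let ?z = "s *\<^sub>R e1 + \<gamma> s *\<^sub>R e2"
        have "?z \<in> closure \<Omega>"
        proof -
          \<comment> \<open>Points just above the graph belong to \<Omega>, so the graph lies in its
            closure.\<close>
          define zn where "zn n = s *\<^sub>R e1 + (\<gamma> s + inverse (real (Suc n))) *\<^sub>R e2" for n
          have zl: "zn \<longlonglongrightarrow> s *\<^sub>R e1 + (\<gamma> s + 0) *\<^sub>R e2"
            unfolding zn_def by (intro tendsto_intros LIMSEQ_inverse_real_of_nat)
          then have "\<forall>\<^sub>F n in sequentially. zn n \<in> ball x0 r"
            using topological_tendstoD[OF zl open_ball, of x0 r] s by simp
          moreover have "zn n \<in> \<Omega>" if "zn n \<in> ball x0 r" for n
          proof -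
            have "\<gamma> (zn n \<bullet> e1) < zn n \<bullet> e2"
              unfolding zn_def by (simp only: inner_orthonormal_combination[OF e]) simp
            then have "zn n \<in> \<Omega> \<inter> ball x0 r" using that unfolding \<Omega>r by blast
            then show ?thesis by blast
          qed
          ultimately have ev: "\<forall>\<^sub>F n in sequentially. zn n \<in> closure \<Omega>"
            by (auto elim!: eventually_mono intro: closure_subset[THEN subsetD])
          show ?thesis
            using Lim_in_closed_set[OF closed_closure ev sequentially_bot zl] by simp
        qed
        moreover have "?z \<notin> interior \<Omega>" using \<rho>(4)[OF s] interior_subset by blast
        ultimately show ?thesis by (simp add: frontier_def)
      qed
      show ?thesis
      proof (intro exI[of _ "\<rho> / 2"] conjI allI impI)
        show "\<rho> / 2 > 0" using \<rho> by simp
        fix F v assume F: "Ck 1 F" and v: "norm (v::plane) = 1" and F0: "\<forall>y. \<rho> / 2 \<le> dist x0 y \<longrightarrow> F y = 0"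
        have F0': "\<rho> / 2 \<le> dist x0 y \<Longrightarrow> F y = 0" for y using F0 by blast
        have z: "(\<lambda>k. LINT x:\<Omega>|lborel. dir_deriv v (\<lambda>x. (\<phi> k x - ?E x0) * F x) x) \<longlonglongrightarrow> 0"
        proof (rule boundary_term_tendsto_0[where r'="\<rho> / 2", OF chart \<phi>1 tr_lim[OF chart] gm _ F F0' _ v])
          show "\<rho> / 2 < r" using \<rho> by simp
          fix s assume s: "s *\<^sub>R e1 + \<gamma> s *\<^sub>R e2 \<in> ball x0 (\<rho> / 2)"
          have "s *\<^sub>R e1 + \<gamma> s *\<^sub>R e2 \<in> ball x0 r" "s *\<^sub>R e1 + \<gamma> s *\<^sub>R e2 \<in> ball x0 \<rho>"
            using s \<rho> by simp_all
          then show "g (s *\<^sub>R e1 + \<gamma> s *\<^sub>R e2) = ?E x0"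
            using hole_value_boundary[OF graph_frontier g0 gc] Ec \<rho>(4) by metis
        qed
        show "defect v F = 0"
        proof (rule key[of F "\<rho> / 2" x0 v \<rho> "?E x0", OF F F0' v Ec _ z])
          show "\<rho> / 2 < \<rho>" using \<rho>(1) by simp
        qed
      qed
    next
      case False
      then have "x0 \<in> - closure \<Omega>" using x0\<Omega> open_\<Omega> by (simp add: frontier_def interior_open)
      then obtain \<rho>1 where \<rho>1: "0 < \<rho>1" "ball x0 \<rho>1 \<subseteq> - closure \<Omega>"
        using open_contains_ball[of "- closure \<Omega>"] closed_closure[of \<Omega>] open_Compl by blast
      obtain \<rho>2 where \<rho>2: "0 < \<rho>2" "\<And>y. y \<in> ball x0 \<rho>2 \<Longrightarrow> y \<notin> \<Omega> \<Longrightarrow> ?E y = ?E x0"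
        by (rule hole_value_locally_constant[OF x0\<Omega>, of g]) blast
      define \<rho> where "\<rho> = min \<rho>1 \<rho>2"
      have \<rho>: "0 < \<rho>" "\<rho> \<le> \<rho>1" "\<rho> \<le> \<rho>2" using \<rho>1(1) \<rho>2(1) by (simp_all add: \<rho>_def)
      show ?thesis
      proof (intro exI[of _ "\<rho> / 2"] conjI allI impI)
        show "\<rho> / 2 > 0" using \<rho> by simp
        fix F v assume F: "Ck 1 F" and v: "norm (v::plane) = 1" and F0: "\<forall>y. \<rho> / 2 \<le> dist x0 y \<longrightarrow> F y = 0"
        have F0': "\<rho> / 2 \<le> dist x0 y \<Longrightarrow> F y = 0" for y using F0 by blast
        have z: "(LINT x:\<Omega>|lborel. dir_deriv v (\<lambda>x. (\<phi> k x - ?E x0) * F x) x) = 0" for k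
        proof -
          have w0: "(\<phi> k y - ?E x0) * F y = 0" if "\<rho> / 2 \<le> dist x0 y" for y using F0'[OF that] by simp
          have "indicator \<Omega> x *\<^sub>R dir_deriv v (\<lambda>x. (\<phi> k x - ?E x0) * F x) x = 0" for x
          proof (cases "x \<in> \<Omega>")
            case True
            then have "x \<notin> ball x0 \<rho>1" using \<rho>1(2) closure_subset[of \<Omega>] by blast
            then have "\<rho> / 2 < dist x0 x" using \<rho> by simp
            then have "dir_deriv v (\<lambda>x. (\<phi> k x - ?E x0) * F x) x = 0"
              by (intro dir_deriv_eq_0_outside[of "\<rho> / 2" x0] w0)
            then show ?thesis by (simp only: scaleR_zero_right)
          qed simp
          then show ?thesis unfolding set_lebesgue_integral_def by (simp only: integral_zero)
        qed
        show "defect v F = 0"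
        proof (rule key[of F "\<rho> / 2" x0 v \<rho> "?E x0", OF F F0' v])
          show "?E y = ?E x0" if "y \<in> ball x0 \<rho>" "y \<notin> \<Omega>" for y
            using that \<rho>(3) by (intro \<rho>2(2)) simp_all
          show "\<rho> / 2 < \<rho>" using \<rho>(1) by simp
          show "(\<lambda>k. LINT x:\<Omega>|lborel. dir_deriv v (\<lambda>x. (\<phi> k x - ?E x0) * F x) x) \<longlonglongrightarrow> 0"
            unfolding z by (rule tendsto_const)
        qed
      qed
    qed
  qed
  obtain \<rho> where \<rho>: "\<And>x0. \<rho> x0 > 0" "\<And>x0 F v. Ck 1 F \<Longrightarrow> norm v = 1 \<Longrightarrow> (\<And>y. \<rho> x0 \<le> dist x0 y \<Longrightarrow> F y = 0) \<Longrightarrow> defect v F = 0"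
    using local by metis
  have "defect v F = 0" if F: "Ck 1 F" and v: "norm v = 1" for F v
  proof -
    \<comment> \<open>A Lebesgue number for the cover by local neighbourhoods. The ball of radius
      \<open>2 * (R + 2)\<close> contains the centres of all bumps, whose norms are at most
      \<open>2 * (R + 1 + \<delta>)\<close> with \<open>\<delta> \<le> 1\<close>.\<close>
    obtain \<epsilon> where \<epsilon>: "0 < \<epsilon>" "\<And>x. x \<in> cball 0 (2 * (R + 2)) \<Longrightarrow> \<exists>G\<in>range (\<lambda>x. ball x (\<rho> x)). ball x \<epsilon> \<subseteq> G"
    proof (rule Heine_Borel_lemma[of "cball (0::plane) (2 * (R + 2))" "range (\<lambda>x. ball x (\<rho> x))"])
      show "cball 0 (2 * (R + 2)) \<subseteq> \<Union> (range (\<lambda>x. ball x (\<rho> x)))"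
        using \<rho>(1) centre_in_ball by blast
    qed auto
    define \<delta> where "\<delta> = min \<epsilon> 1"
    have \<delta>: "0 < \<delta>" "\<delta> \<le> 1" "\<delta> \<le> \<epsilon>" using \<epsilon>(1) by (simp_all add: \<delta>_def)
    have R1: "R + 1 \<ge> 0" by (simp add: R_def)
    \<comment> \<open>Summing to 1 on radius \<open>R + 1\<close> rather than \<open>R\<close> makes
      the localized sum agree with \<open>F\<close> on a neighbourhood of the support of the
      extension, so that the derivatives agree there too.\<close>
    obtain I and b :: "nat \<times> nat \<Rightarrow> plane \<Rightarrow> real" and p where part: "finite I" "\<And>i k. Ck k (b i)"
      "\<And>i y. \<delta> \<le> dist (p i) y \<Longrightarrow> b i y = 0"
      "\<And>i. i \<in> I \<Longrightarrow> norm (p i) \<le> 2 * (R + 1 + \<delta>)" "\<And>x. norm x \<le> R + 1 \<Longrightarrow> (\<Sum>i\<in>I. b i x) = 1"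
      by (rule lattice_partition_of_unity[OF \<delta>(1) R1]) blast
    have bF: "Ck 1 (\<lambda>x. b i x * F x)" for i by (intro Ck_mult part F)
    have zero: "defect v (\<lambda>x. b i x * F x) = 0" if "i \<in> I" for i
    proof -
      have "p i \<in> cball 0 (2 * (R + 2))" using part(4)[OF that] \<delta>(2) by simp
      then obtain x where x: "ball (p i) \<epsilon> \<subseteq> ball x (\<rho> x)" using \<epsilon>(2) by blast
      show ?thesis
      proof (rule \<rho>(2)[OF bF v, of x])
        fix y assume "\<rho> x \<le> dist x y"
        then have "y \<notin> ball (p i) \<epsilon>" using x by (meson mem_ball not_le subsetD)
        then show "b i y * F y = 0" using part(3)[of i y] \<delta>(3) by simp
      qed
    qed
    let ?S = "\<lambda>x. \<Sum>i\<in>I. b i x * F x"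
    have S: "Ck 1 ?S" by (intro Ck_sum bF)
    have SF: "?S x = F x" if "norm x \<le> R + 1" for x
      using part(5)[OF that] by (simp add: sum_distrib_right[symmetric])
    have dS: "dir_deriv v ?S x = dir_deriv v F x" if "norm x < R + 1" for x
    proof -
      have "open {x::plane. norm x < R + 1}" by (intro open_Collect_less continuous_intros)
      from pderiv_transform_open[OF this, where x=x and u=F and w="?S" and k=0] that F SF
      show ?thesis by (simp add: dir_deriv_def)
    qed
    have "defect v F = defect v ?S"
    proof -
      have "\<psi>t x * dir_deriv v F x = \<psi>t x * dir_deriv v ?S x" for x
        using dS[of x] vanishes_beyondD[OF vb, of x] by (cases "norm x \<le> R") auto
      moreover have "(LINT x:\<Omega>|lborel. (v \<bullet> wgrad \<Omega> \<psi> x) * F x) = (LINT x:\<Omega>|lborel. (v \<bullet> wgrad \<Omega> \<psi> x) * ?S x)"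
        unfolding set_lebesgue_integral_def
      proof (rule Bochner_Integration.integral_cong[OF refl])
        fix x
        show "indicator \<Omega> x *\<^sub>R ((v \<bullet> wgrad \<Omega> \<psi> x) * F x) = indicator \<Omega> x *\<^sub>R ((v \<bullet> wgrad \<Omega> \<psi> x) * ?S x)"
          using SF[of x] \<Omega>R[of x] by (cases "x \<in> \<Omega>") simp_all
      qed
      ultimately show ?thesis unfolding defect_def by (simp only:)
    qed
    also have "\<dots> = (\<Sum>i\<in>I. defect v (\<lambda>x. b i x * F x))"
    proof -
      have d: "dir_deriv v ?S = (\<lambda>x. \<Sum>i\<in>I. dir_deriv v (\<lambda>x. b i x * F x) x)"
        using bF by (intro dir_deriv_sum[of _ 0]) simp
      have "(\<integral>x. \<psi>t x * dir_deriv v ?S x \<partial>lborel) = (\<Sum>i\<in>I. \<integral>x. \<psi>t x * dir_deriv v (\<lambda>x. b i x * F x) x \<partial>lborel)"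
        unfolding d sum_distrib_left by (intro Bochner_Integration.integral_sum idF bF)
      moreover have "(LINT x:\<Omega>|lborel. (v \<bullet> wgrad \<Omega> \<psi> x) * ?S x) = (\<Sum>i\<in>I. LINT x:\<Omega>|lborel. (v \<bullet> wgrad \<Omega> \<psi> x) * (b i x * F x))"
        unfolding set_lebesgue_integral_def sum_distrib_left scaleR_sum_right
        by (intro Bochner_Integration.integral_sum) (use igF[OF bF v] in \<open>simp add: set_integrable_def\<close>)
      ultimately show ?thesis unfolding defect_def by (simp add: sum.distrib)
    qed
    also have "\<dots> = 0" using zero by simp
    finally show ?thesis .
  qed
  then have "\<forall>F v. Ck 1 F \<longrightarrow> norm v = 1 \<longrightarrow> (\<integral>x. \<psi>t x * dir_deriv v F x \<partial>lborel) = - (LINT x:\<Omega>|lborel. (v \<bullet> wgrad \<Omega> \<psi> x) * F x)"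
    unfolding defect_def by (simp add: eq_neg_iff_add_eq_0)
  then show ?thesis
    unfolding extendable_gradient_def using wgrad_L2[OF \<psi>] int vb by blast
qed

end

section \<open>The trilinear form\<close>

lemma diff_eq_lincomb: "(\<lambda>x. u x - v x) = (\<lambda>x. 1 * u x + (-1) * v x)" for u v :: "plane \<Rightarrow> real"
  by auto

lemma test_function_ess_bounded:
  assumes "test_function \<Omega> \<phi>" shows "ess_bounded \<Omega> \<phi>"
proof -
  obtain R where "vanishes_beyond R \<phi>" using test_function_vanishes_beyond[OF assms] .
  then obtain B where "\<And>x. \<bar>\<phi> x\<bar> \<le> B"
    using continuous_bounded_support_bounded[OF Ck_continuous[OF test_function_Ck[OF assms, of 0]]] by metis
  then show ?thesis unfolding ess_bounded_def by (intro exI[of _ B] AE_I2) simp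
qed

lemma ess_bounded_lincomb:
  assumes "ess_bounded \<Omega> u" "ess_bounded \<Omega> v" shows "ess_bounded \<Omega> (\<lambda>x. a * u x + b * v x)"
proof -
  obtain M N where M: "AE x in lborel. x \<in> \<Omega> \<longrightarrow> \<bar>u x\<bar> \<le> M" and N: "AE x in lborel. x \<in> \<Omega> \<longrightarrow> \<bar>v x\<bar> \<le> N"
    using assms unfolding ess_bounded_def by blast
  have "AE x in lborel. x \<in> \<Omega> \<longrightarrow> \<bar>a * u x + b * v x\<bar> \<le> \<bar>a\<bar> * M + \<bar>b\<bar> * N"
    using M N
  proof eventually_elim
    case (elim x)
    show ?case
    proof
      assume "x \<in> \<Omega>"
      with elim have "\<bar>a\<bar> * \<bar>u x\<bar> \<le> \<bar>a\<bar> * M" "\<bar>b\<bar> * \<bar>v x\<bar> \<le> \<bar>b\<bar> * N" by (simp_all add: mult_left_mono)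
      then show "\<bar>a * u x + b * v x\<bar> \<le> \<bar>a\<bar> * M + \<bar>b\<bar> * N"
        using abs_triangle_ineq[of "a * u x" "b * v x"] by (simp only: abs_mult)
    qed
  qed
  then show ?thesis unfolding ess_bounded_def by (rule exI)
qed

context bounded_open
begin

lemma L2_bounded_mult:
  fixes u b :: "plane \<Rightarrow> real"
  assumes u: "u \<in> L2 \<Omega>" and b: "b \<in> L2 \<Omega>" "ess_bounded \<Omega> b"
  shows "(\<lambda>x. b x * u x) \<in> L2 \<Omega>"
proof -
  obtain M where M: "AE x in lborel. x \<in> \<Omega> \<longrightarrow> \<bar>b x\<bar> \<le> M" using b(2) unfolding ess_bounded_def by blast
  let ?u = "\<lambda>x. indicator \<Omega> x *\<^sub>R u x" and ?b = "\<lambda>x. indicator \<Omega> x *\<^sub>R b x"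
  have m: "?u \<in> borel_measurable lborel" "?b \<in> borel_measurable lborel" and i: "integrable lborel (\<lambda>x. (norm (?u x))\<^sup>2)"
    using u b(1) by (simp_all only: L2_iff)
  have eq: "indicator \<Omega> x *\<^sub>R (b x * u x) = ?b x * ?u x" for x by (simp add: indicator_def)
  have mm: "(\<lambda>x. ?b x * ?u x) \<in> borel_measurable lborel" by (rule borel_measurable_times[OF m(2,1)])
  show ?thesis
    unfolding L2_iff eq
  proof
    show "(\<lambda>x. ?b x * ?u x) \<in> borel_measurable lborel" by (rule mm)
    show "integrable lborel (\<lambda>x. (norm (?b x * ?u x))\<^sup>2)"
    proof (rule Bochner_Integration.integrable_bound)
      show "integrable lborel (\<lambda>x. M\<^sup>2 * (norm (?u x))\<^sup>2)" using i by (rule integrable_mult_right)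
      show "(\<lambda>x. (norm (?b x * ?u x))\<^sup>2) \<in> borel_measurable lborel"
        by (intro borel_measurable_power borel_measurable_norm_euclidean mm)
      show "AE x in lborel. norm ((norm (?b x * ?u x))\<^sup>2) \<le> norm (M\<^sup>2 * (norm (?u x))\<^sup>2)"
        using M
      proof eventually_elim
        case (elim x)
        show ?case
        proof (cases "x \<in> \<Omega>")
          case True
          with elim have "\<bar>b x\<bar>\<^sup>2 \<le> M\<^sup>2" by (intro power_mono) auto
          then have "(b x)\<^sup>2 * (u x)\<^sup>2 \<le> M\<^sup>2 * (u x)\<^sup>2" by (intro mult_right_mono) simp_all
          then show ?thesis using True by (simp add: power_mult_distrib)
        qed simp
      qed
    qed
  qed
qed

lemma Ck_ess_bounded:
  assumes "Ck k u" shows "ess_bounded \<Omega> u"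
proof -
  have "bounded (u ` closure \<Omega>)"
    by (intro compact_imp_bounded compact_continuous_image continuous_on_subset[OF Ck_continuous[OF assms]])
      (simp_all add: compact_closure bounded_\<Omega>)
  then obtain B where "\<forall>y\<in>u ` closure \<Omega>. norm y \<le> B" unfolding bounded_iff by blast
  then have "x \<in> \<Omega> \<longrightarrow> \<bar>u x\<bar> \<le> B" for x using closure_subset[of \<Omega>] by (simp add: subset_iff)
  then show ?thesis unfolding ess_bounded_def by (intro exI[of _ B] AE_I2)
qed

lemma H10_norm_lincomb:
  assumes "u \<in> H1 \<Omega>" "v \<in> H1 \<Omega>"
  shows "H10_norm \<Omega> (\<lambda>x. a * u x + b * v x) \<le> \<bar>a\<bar> * H10_norm \<Omega> u + \<bar>b\<bar> * H10_norm \<Omega> v"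
  unfolding H10_norm_def H1_lincomb(3)[OF assms]
  by (rule L2_norm_lincomb[OF wgrad_L2[OF assms(1)] wgrad_L2[OF assms(2)]])

lemma H10_norm_nonneg: "H10_norm \<Omega> u \<ge> 0"
  unfolding H10_norm_def by (rule L2_norm_nonneg)

lemma H10_norm_minus_commute:
  assumes "u \<in> H1 \<Omega>" "v \<in> H1 \<Omega>"
  shows "H10_norm \<Omega> (\<lambda>x. u x - v x) = H10_norm \<Omega> (\<lambda>x. v x - u x)"
proof -
  have "H10_norm \<Omega> (\<lambda>x. 1 * p x + (-1) * q x) \<le> H10_norm \<Omega> (\<lambda>x. 1 * q x + (-1) * p x)"
    if "p \<in> H1 \<Omega>" "q \<in> H1 \<Omega>" for p q
  proof -
    have d: "(\<lambda>x. 1 * q x + (-1) * p x) \<in> H1 \<Omega>" by (rule H1_lincomb(1)[OF that(2,1)])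
    have "H10_norm \<Omega> (\<lambda>x. (-1) * (1 * q x + (-1) * p x) + 0 * (1 * q x + (-1) * p x)) \<le> \<bar>-1\<bar> * H10_norm \<Omega> (\<lambda>x. 1 * q x + (-1) * p x) + \<bar>0\<bar> * H10_norm \<Omega> (\<lambda>x. 1 * q x + (-1) * p x)"
      by (rule H10_norm_lincomb[OF d d])
    then show ?thesis by simp
  qed
  from this[OF assms] this[OF assms(2,1)] show ?thesis unfolding diff_eq_lincomb by (rule antisym)
qed

lemma H10_norm_triangle:
  assumes "u \<in> H1 \<Omega>" "v \<in> H1 \<Omega>" "w \<in> H1 \<Omega>"
  shows "H10_norm \<Omega> (\<lambda>x. u x - w x) \<le> H10_norm \<Omega> (\<lambda>x. u x - v x) + H10_norm \<Omega> (\<lambda>x. v x - w x)"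
proof -
  have d: "(\<lambda>x. u x - v x) \<in> H1 \<Omega>" "(\<lambda>x. v x - w x) \<in> H1 \<Omega>"
    unfolding diff_eq_lincomb by (intro H1_lincomb(1) assms)+
  have "(\<lambda>x. u x - w x) = (\<lambda>x. 1 * (u x - v x) + 1 * (v x - w x))" by auto
  then show ?thesis using H10_norm_lincomb[OF d, of 1 1] by (simp only: abs_one mult_1)
qed

lemma H10_norm_diff_ge:
  assumes "u \<in> H1 \<Omega>" "v \<in> H1 \<Omega>"
  shows "H10_norm \<Omega> u \<le> H10_norm \<Omega> v + H10_norm \<Omega> (\<lambda>x. u x - v x)"
proof -
  have d: "(\<lambda>x. u x - v x) \<in> H1 \<Omega>" unfolding diff_eq_lincomb by (intro H1_lincomb(1) assms)
  have "u = (\<lambda>x. 1 * v x + 1 * (u x - v x))" by auto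
  then show ?thesis using H10_norm_lincomb[OF assms(2) d, of 1 1] by (simp only: abs_one mult_1)
qed

lemma H10_norm_tendsto:
  assumes u: "\<And>k. u k \<in> H1 \<Omega>" and v: "v \<in> H1 \<Omega>" and lim: "(\<lambda>k. H10_norm \<Omega> (\<lambda>x. u k x - v x)) \<longlonglongrightarrow> 0"
  shows "(\<lambda>k. H10_norm \<Omega> (u k)) \<longlonglongrightarrow> H10_norm \<Omega> v"
proof (rule LIM_zero_cancel, rule tendsto_rabs_zero_cancel, rule tendsto_sandwich[OF always_eventually always_eventually tendsto_const lim])
  have "\<bar>H10_norm \<Omega> (u k) - H10_norm \<Omega> v\<bar> \<le> H10_norm \<Omega> (\<lambda>x. u k x - v x)" for k
    using H10_norm_diff_ge[OF u[of k] v] H10_norm_diff_ge[OF v u[of k]] H10_norm_minus_commute[OF u[of k] v] by linarith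
  then show "\<forall>k. \<bar>H10_norm \<Omega> (u k) - H10_norm \<Omega> v\<bar> \<le> H10_norm \<Omega> (\<lambda>x. u k x - v x)" by blast
qed simp

lemma H10_test_approximation:
  assumes "u \<in> H10 \<Omega>"
  obtains \<phi> where "\<And>k. test_function \<Omega> (\<phi> k)" "(\<lambda>k. L2_norm \<Omega> (\<lambda>x. \<phi> k x - u x)) \<longlonglongrightarrow> 0"
    "(\<lambda>k. H10_norm \<Omega> (\<lambda>x. \<phi> k x - u x)) \<longlonglongrightarrow> 0"
proof -
  note H = assms[unfolded H10_def mem_Collect_eq]
  obtain \<phi> where \<phi>: "(\<forall>k. test_function \<Omega> (\<phi> k)) \<and> (\<lambda>k. H1_norm \<Omega> (\<lambda>x. \<phi> k x - u x)) \<longlonglongrightarrow> 0"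
    using H[THEN conjunct2] by (rule exE) (rule that)
  note l = \<phi>[THEN conjunct2, unfolded H1_norm_tendsto_0_iff]
  show ?thesis
    by (rule that[OF \<phi>[THEN conjunct1, rule_format] l[THEN conjunct1]]) (unfold H10_norm_def, rule l[THEN conjunct2])
qed

lemma sqrt_energy_test:
  assumes "test_function \<Omega> u" shows "sqrt (energy u) = H10_norm \<Omega> u"
proof -
  have "H10_norm \<Omega> u = L2_norm \<Omega> (\<lambda>x. (dx u x, dy u x))"
    unfolding H10_norm_def
    by (rule wgrad_eq(3)[OF Ck_L2[OF test_function_Ck[OF assms, of 0]] weak_gradient_Ck[OF test_function_Ck[OF assms]]])
  also have "\<dots> = sqrt (\<integral>x. (dx u x)\<^sup>2 + (dy u x)\<^sup>2 \<partial>lborel)"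
    unfolding L2_norm_eq
  proof (intro arg_cong[where f=sqrt] Bochner_Integration.integral_cong refl)
    fix x
    show "(norm (indicator \<Omega> x *\<^sub>R (dx u x, dy u x)))\<^sup>2 = (dx u x)\<^sup>2 + (dy u x)\<^sup>2"
      using test_function_pderiv_vanishes[OF assms, of x] by (cases "x \<in> \<Omega>") (simp_all add: norm_Pair)
  qed
  finally show ?thesis by (simp add: energy_def)
qed

text \<open>Moving the gradient off the extended function leaves it paired with
  \<open>dx (\<xi> * dy \<theta>) - dy (\<xi> * dx \<theta>)\<close>; the second derivatives of
  \<theta> cancel, and the Jacobian remains. The cutoff depends on \<Omega> alone, so one constant
  serves all arguments; the factor 2 adds up the two components of \<open>g\<close>.\<close>

lemma trilinear_test_bound:
  obtains C where "C \<ge> 0" "\<And>g \<xi> \<theta>. extendable_gradient \<Omega> g \<Longrightarrow> test_function \<Omega> \<xi> \<Longrightarrow> test_function \<Omega> \<theta> \<Longrightarrow>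
    \<bar>LINT x:\<Omega>|lborel. \<xi> x * (snd (g x) * dx \<theta> x - fst (g x) * dy \<theta> x)\<bar> \<le> C * L2_norm \<Omega> g * (H10_norm \<Omega> \<xi> * H10_norm \<Omega> \<theta>)"
proof -
  obtain R\<Omega> where R\<Omega>: "\<And>x. x \<in> \<Omega> \<Longrightarrow> norm x \<le> R\<Omega>" using bounded_\<Omega> unfolding bounded_iff by blast
  obtain \<eta> R' where \<eta>: "\<And>k. Ck k \<eta>" "vanishes_beyond R' \<eta>" "\<And>x. 0 \<le> \<eta> x \<and> \<eta> x \<le> 1" "\<And>x. norm x \<le> R\<Omega> \<Longrightarrow> \<eta> x = 1"
    by (rule cutoff_exists[of R\<Omega>]) (rule that)
  define D where "D = sqrt (4 * pi * poisson_mass + 16 * pi\<^sup>2 * energy \<eta>) / poisson_mass"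
  have D: "D \<ge> 0" using poisson_mass_pos energy_nonneg[of \<eta>] by (simp add: D_def)
  show ?thesis
  proof (rule that[of "2 * D"])
    show "2 * D \<ge> 0" using D by simp
    fix g \<xi> \<theta> assume g: "extendable_gradient \<Omega> g" and \<xi>: "test_function \<Omega> \<xi>" and \<theta>: "test_function \<Omega> \<theta>"
    note G = g[unfolded extendable_gradient_def]
    note gL = G[THEN conjunct1]
    obtain \<psi> where "\<exists>R. integrable lborel \<psi> \<and> vanishes_beyond R \<psi> \<and> (\<forall>F v. Ck 1 F \<longrightarrow> norm v = 1 \<longrightarrow>
      (\<integral>x. \<psi> x * dir_deriv v F x \<partial>lborel) = - (LINT x:\<Omega>|lborel. (v \<bullet> g x) * F x))"
      using G[THEN conjunct2] by (rule exE) (rule that)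
    then obtain R where P: "integrable lborel \<psi> \<and> vanishes_beyond R \<psi> \<and> (\<forall>F v. Ck 1 F \<longrightarrow> norm v = 1 \<longrightarrow>
      (\<integral>x. \<psi> x * dir_deriv v F x \<partial>lborel) = - (LINT x:\<Omega>|lborel. (v \<bullet> g x) * F x))"
      by (rule exE) (rule that)
    note \<psi> = P[THEN conjunct1] P[THEN conjunct2, THEN conjunct1]
      and weak = P[THEN conjunct2, THEN conjunct2, rule_format]
    have wx: "(\<integral>x. \<psi> x * dx F x \<partial>lborel) = - (LINT x:\<Omega>|lborel. fst (g x) * F x)"
      and wy: "(\<integral>x. \<psi> x * dy F x \<partial>lborel) = - (LINT x:\<Omega>|lborel. snd (g x) * F x)" if "Ck 1 F" for F
      using weak[OF that, of "(1, 0)"] weak[OF that, of "(0, 1)"] by (simp_all add: dir_deriv_axes norm_Pair inner_prod_def)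
    have ipsi: "integrable lborel (\<lambda>x. \<psi> x * u x)" if "continuous_on UNIV u" for u
      by (rule integrable_mult_continuous[OF \<psi> that])
    obtain R1 where R1: "vanishes_beyond R1 \<xi>" using test_function_vanishes_beyond[OF \<xi>] .
    obtain R2 where R2: "vanishes_beyond R2 \<theta>" using test_function_vanishes_beyond[OF \<theta>] .
    have RR: "vanishes_beyond (max R1 R2) \<xi>" "vanishes_beyond (max R1 R2) \<theta>"
      by (rule vanishes_beyond_mono[OF R1], simp, rule vanishes_beyond_mono[OF R2], simp)
    have C2: "Ck 2 \<xi>" "Ck 2 \<theta>" by (rule test_function_Ck[OF \<xi>], rule test_function_Ck[OF \<theta>])
    have \<xi>1: "Ck (Suc 0) \<xi>" and \<theta>2: "Ck (Suc (Suc 0)) \<theta>" by (rule test_function_Ck[OF \<xi>], rule test_function_Ck[OF \<theta>])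
    note d\<theta> = Ck_Suc_dx[OF \<theta>2] Ck_Suc_dy[OF \<theta>2]
    have FF: "Ck 1 (\<lambda>x. \<xi> x * dx \<theta> x)" "Ck 1 (\<lambda>x. \<xi> x * dy \<theta> x)"
      unfolding One_nat_def by (intro Ck_mult \<xi>1 d\<theta>)+
    have L: "(\<lambda>x. \<xi> x * dx \<theta> x) \<in> L2 \<Omega>" "(\<lambda>x. \<xi> x * dy \<theta> x) \<in> L2 \<Omega>" by (rule Ck_L2[OF FF(1)], rule Ck_L2[OF FF(2)])
    have "(LINT x:\<Omega>|lborel. \<xi> x * (snd (g x) * dx \<theta> x - fst (g x) * dy \<theta> x)) =
      (LINT x:\<Omega>|lborel. snd (g x) * (\<xi> x * dx \<theta> x) - fst (g x) * (\<xi> x * dy \<theta> x))"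
      by (simp add: algebra_simps)
    also have "\<dots> = (LINT x:\<Omega>|lborel. snd (g x) * (\<xi> x * dx \<theta> x)) - (LINT x:\<Omega>|lborel. fst (g x) * (\<xi> x * dy \<theta> x))"
      by (rule set_integral_diff(2)[OF L2_mult_integrable(1)[OF L2_fst_snd(2)[OF gL] L(1)] L2_mult_integrable(1)[OF L2_fst_snd(1)[OF gL] L(2)]])
    also have "\<dots> = (\<integral>x. \<psi> x * dx (\<lambda>x. \<xi> x * dy \<theta> x) x \<partial>lborel) - (\<integral>x. \<psi> x * dy (\<lambda>x. \<xi> x * dx \<theta> x) x \<partial>lborel)"
      by (simp add: wx[OF FF(2)] wy[OF FF(1)])
    also have "\<dots> = (\<integral>x. \<psi> x * dx (\<lambda>x. \<xi> x * dy \<theta> x) x - \<psi> x * dy (\<lambda>x. \<xi> x * dx \<theta> x) x \<partial>lborel)"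
      by (rule Bochner_Integration.integral_diff[symmetric];
          rule ipsi, rule Ck_continuous, (rule Ck_Suc_dx | rule Ck_Suc_dy), rule FF[unfolded One_nat_def])
    also have "\<dots> = (\<integral>x. \<psi> x * jacobian \<xi> \<theta> x \<partial>lborel)"
      unfolding pderiv_mult[OF \<xi>1 d\<theta>(1)] pderiv_mult[OF \<xi>1 d\<theta>(2)] dx_dy_commute[OF \<theta>2]
      by (simp add: jacobian_def algebra_simps)
    finally have eq: "(LINT x:\<Omega>|lborel. \<xi> x * (snd (g x) * dx \<theta> x - fst (g x) * dy \<theta> x)) = (\<integral>x. \<psi> x * jacobian \<xi> \<theta> x \<partial>lborel)" .
    let ?g1 = "\<lambda>x. indicator \<Omega> x *\<^sub>R fst (g x)" and ?g2 = "\<lambda>x. indicator \<Omega> x *\<^sub>R snd (g x)"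
    have gm: "?g1 \<in> borel_measurable lborel" "?g2 \<in> borel_measurable lborel"
      and gi: "integrable lborel (\<lambda>x. (?g1 x)\<^sup>2)" "integrable lborel (\<lambda>x. (?g2 x)\<^sup>2)"
      using L2_fst_snd(1,2)[OF gL] by (simp_all only: L2_iff real_norm_def power2_abs)
    have g0: "?g1 x = 0 \<and> ?g2 x = 0" if "\<eta> x \<noteq> 1" for x
      using that \<eta>(4)[of x] R\<Omega>[of x] by (cases "x \<in> \<Omega>") simp_all
    have w1: "integrable lborel (\<lambda>x. \<psi> x * dx F x) \<and> (\<integral>x. \<psi> x * dx F x \<partial>lborel) = - (\<integral>x. ?g1 x * F x \<partial>lborel)" if "Ck 1 F" for F
      using ipsi[OF Ck_continuous[OF Ck_Suc_dx[OF that[unfolded One_nat_def]]]] wx[OF that]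
      by (simp add: set_lebesgue_integral_def mult.assoc)
    have w2: "integrable lborel (\<lambda>x. \<psi> x * dy F x) \<and> (\<integral>x. \<psi> x * dy F x \<partial>lborel) = - (\<integral>x. ?g2 x * F x \<partial>lborel)" if "Ck 1 F" for F
      using ipsi[OF Ck_continuous[OF Ck_Suc_dy[OF that[unfolded One_nat_def]]]] wy[OF that]
      by (simp add: set_lebesgue_integral_def mult.assoc)
    have "\<bar>\<integral>x. \<psi> x * jacobian \<xi> \<theta> x \<partial>lborel\<bar> \<le> D * (sqrt (\<integral>x. (?g1 x)\<^sup>2 \<partial>lborel) + sqrt (\<integral>x. (?g2 x)\<^sup>2 \<partial>lborel)) * (sqrt (energy \<xi>) * sqrt (energy \<theta>))"
      unfolding D_def by (rule wente_inequality[OF C2(1) RR(1) C2(2) RR(2) \<eta>(1,2,3) \<psi>(1) gm gi g0 w1 w2])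
    also have "sqrt (\<integral>x. (?g1 x)\<^sup>2 \<partial>lborel) = L2_norm \<Omega> (\<lambda>x. fst (g x))"
      unfolding L2_norm_eq real_norm_def power2_abs ..
    also have "sqrt (\<integral>x. (?g2 x)\<^sup>2 \<partial>lborel) = L2_norm \<Omega> (\<lambda>x. snd (g x))"
      unfolding L2_norm_eq real_norm_def power2_abs ..
    also have "D * (L2_norm \<Omega> (\<lambda>x. fst (g x)) + L2_norm \<Omega> (\<lambda>x. snd (g x))) * (sqrt (energy \<xi>) * sqrt (energy \<theta>))
      \<le> D * (L2_norm \<Omega> g + L2_norm \<Omega> g) * (sqrt (energy \<xi>) * sqrt (energy \<theta>))"
      using D by (intro mult_right_mono mult_left_mono add_mono L2_fst_snd(3,4)[OF gL] mult_nonneg_nonneg real_sqrt_ge_zero energy_nonneg)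
    finally show "\<bar>LINT x:\<Omega>|lborel. \<xi> x * (snd (g x) * dx \<theta> x - fst (g x) * dy \<theta> x)\<bar> \<le> 2 * D * L2_norm \<Omega> g * (H10_norm \<Omega> \<xi> * H10_norm \<Omega> \<theta>)"
      unfolding eq sqrt_energy_test[OF \<xi>] sqrt_energy_test[OF \<theta>] by (simp add: mult_ac)
  qed
qed

section \<open>The form for essentially bounded first arguments\<close>

abbreviation (input) adv_integral :: "(plane \<Rightarrow> real) \<Rightarrow> (plane \<Rightarrow> plane) \<Rightarrow> (plane \<Rightarrow> plane) \<Rightarrow> real" where
  "adv_integral \<zeta> g h \<equiv> (LINT x:\<Omega>|lborel. \<zeta> x * (perp (g x) \<bullet> h x))"

lemma adv_integral_eq:
  assumes \<zeta>: "\<zeta> \<in> L2 \<Omega>" "ess_bounded \<Omega> \<zeta>" and g: "g \<in> L2 \<Omega>" and h: "h \<in> L2 \<Omega>"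
  shows "adv_integral \<zeta> g h = (LINT x:\<Omega>|lborel. (\<zeta> x * snd (g x)) * fst (h x)) - (LINT x:\<Omega>|lborel. (\<zeta> x * fst (g x)) * snd (h x))"
    "set_integrable lborel \<Omega> (\<lambda>x. (\<zeta> x * snd (g x)) * fst (h x))" "set_integrable lborel \<Omega> (\<lambda>x. (\<zeta> x * fst (g x)) * snd (h x))"
    "set_integrable lborel \<Omega> (\<lambda>x. \<zeta> x * (perp (g x) \<bullet> h x))"
proof -
  show i: "set_integrable lborel \<Omega> (\<lambda>x. (\<zeta> x * snd (g x)) * fst (h x))" "set_integrable lborel \<Omega> (\<lambda>x. (\<zeta> x * fst (g x)) * snd (h x))"
    by (rule L2_mult_integrable(1)[OF L2_bounded_mult[OF L2_fst_snd(2)[OF g] \<zeta>] L2_fst_snd(1)[OF h]],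
        rule L2_mult_integrable(1)[OF L2_bounded_mult[OF L2_fst_snd(1)[OF g] \<zeta>] L2_fst_snd(2)[OF h]])
  have e: "(\<lambda>x. \<zeta> x * (perp (g x) \<bullet> h x)) = (\<lambda>x. (\<zeta> x * snd (g x)) * fst (h x) - (\<zeta> x * fst (g x)) * snd (h x))"
    by (rule ext) (simp add: perp_def inner_prod_def algebra_simps)
  show "adv_integral \<zeta> g h = (LINT x:\<Omega>|lborel. (\<zeta> x * snd (g x)) * fst (h x)) - (LINT x:\<Omega>|lborel. (\<zeta> x * fst (g x)) * snd (h x))"
    unfolding e by (rule set_integral_diff(2)[OF i])
  show "set_integrable lborel \<Omega> (\<lambda>x. \<zeta> x * (perp (g x) \<bullet> h x))"
    unfolding e by (rule set_integral_diff(1)[OF i])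
qed

lemma adv_integral_cong_AE:
  assumes \<zeta>: "\<zeta> \<in> L2 \<Omega>" "ess_bounded \<Omega> \<zeta>" and g: "g \<in> L2 \<Omega>" and h: "h \<in> L2 \<Omega>" "h' \<in> L2 \<Omega>"
    and ae: "AE x in lborel. x \<in> \<Omega> \<longrightarrow> h x = h' x"
  shows "adv_integral \<zeta> g h = adv_integral \<zeta> g h'"
  unfolding set_lebesgue_integral_def
proof (rule integral_cong_AE)
  show "(\<lambda>x. indicator \<Omega> x *\<^sub>R (\<zeta> x * (perp (g x) \<bullet> h x))) \<in> borel_measurable lborel"
    "(\<lambda>x. indicator \<Omega> x *\<^sub>R (\<zeta> x * (perp (g x) \<bullet> h' x))) \<in> borel_measurable lborel"
    by (rule borel_measurable_integrable[OF adv_integral_eq(4)[OF \<zeta> g h(1), unfolded set_integrable_def]],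
        rule borel_measurable_integrable[OF adv_integral_eq(4)[OF \<zeta> g h(2), unfolded set_integrable_def]])
  show "AE x in lborel. indicator \<Omega> x *\<^sub>R (\<zeta> x * (perp (g x) \<bullet> h x)) = indicator \<Omega> x *\<^sub>R (\<zeta> x * (perp (g x) \<bullet> h' x))"
    using ae by eventually_elim (simp add: indicator_def)
qed

lemma adv_integral_lincomb:
  assumes \<zeta>: "\<zeta> \<in> L2 \<Omega>" "ess_bounded \<Omega> \<zeta>" and \<zeta>': "\<zeta>' \<in> L2 \<Omega>" "ess_bounded \<Omega> \<zeta>'"
    and g: "g \<in> L2 \<Omega>" "g' \<in> L2 \<Omega>" and h: "h \<in> L2 \<Omega>" "h' \<in> L2 \<Omega>"
  shows "adv_integral (\<lambda>x. a * \<zeta> x + b * \<zeta>' x) g h = a * adv_integral \<zeta> g h + b * adv_integral \<zeta>' g h"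
    "adv_integral \<zeta> (\<lambda>x. a *\<^sub>R g x + b *\<^sub>R g' x) h = a * adv_integral \<zeta> g h + b * adv_integral \<zeta> g' h"
    "adv_integral \<zeta> g (\<lambda>x. a *\<^sub>R h x + b *\<^sub>R h' x) = a * adv_integral \<zeta> g h + b * adv_integral \<zeta> g h'"
proof -
  have lin: "(LINT x:\<Omega>|lborel. w x) = a * (LINT x:\<Omega>|lborel. u x) + b * (LINT x:\<Omega>|lborel. v x)"
    if "set_integrable lborel \<Omega> u" "set_integrable lborel \<Omega> v" "\<And>x. w x = a * u x + b * v x" for u v w :: "plane \<Rightarrow> real"
  proof -
    have "set_integrable lborel \<Omega> (\<lambda>x. a * u x)" "set_integrable lborel \<Omega> (\<lambda>x. b * v x)"
      using that(1,2) by (auto intro: set_integrable_mult_right)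
    from set_integral_add(2)[OF this] show ?thesis unfolding that(3) by simp
  qed
  show "adv_integral (\<lambda>x. a * \<zeta> x + b * \<zeta>' x) g h = a * adv_integral \<zeta> g h + b * adv_integral \<zeta>' g h"
    by (rule lin[OF adv_integral_eq(4)[OF \<zeta> g(1) h(1)] adv_integral_eq(4)[OF \<zeta>' g(1) h(1)]]) (simp add: algebra_simps)
  show "adv_integral \<zeta> (\<lambda>x. a *\<^sub>R g x + b *\<^sub>R g' x) h = a * adv_integral \<zeta> g h + b * adv_integral \<zeta> g' h"
    by (rule lin[OF adv_integral_eq(4)[OF \<zeta> g(1) h(1)] adv_integral_eq(4)[OF \<zeta> g(2) h(1)]])
      (simp add: perp_def inner_prod_def algebra_simps)
  show "adv_integral \<zeta> g (\<lambda>x. a *\<^sub>R h x + b *\<^sub>R h' x) = a * adv_integral \<zeta> g h + b * adv_integral \<zeta> g h'"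
    by (rule lin[OF adv_integral_eq(4)[OF \<zeta> g(1) h(1)] adv_integral_eq(4)[OF \<zeta> g(1) h(2)]])
      (simp add: perp_def inner_prod_def algebra_simps)
qed

text \<open>The order of the two approximations matters. With a smooth \<theta> the integrand is
  \<zeta> times an L^2 function, so L^2 approximation of \<zeta> by test functions suffices; once
  the bound holds for the given bounded \<zeta>, the product of \<zeta> with \<open>g\<close> is in
  L^2 and the gradient of \<theta> can be approximated.\<close>

lemma trilinear_bound:
  obtains C where "C \<ge> 0" "\<And>g \<zeta> \<theta>. extendable_gradient \<Omega> g \<Longrightarrow> \<zeta> \<in> H10 \<Omega> \<Longrightarrow> ess_bounded \<Omega> \<zeta> \<Longrightarrow> \<theta> \<in> H10 \<Omega> \<Longrightarrow>
    \<bar>adv_integral \<zeta> g (wgrad \<Omega> \<theta>)\<bar> \<le> C * L2_norm \<Omega> g * (H10_norm \<Omega> \<zeta> * H10_norm \<Omega> \<theta>)"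
proof -
  obtain C where C: "C \<ge> 0" "\<And>g \<xi> \<theta>. extendable_gradient \<Omega> g \<Longrightarrow> test_function \<Omega> \<xi> \<Longrightarrow> test_function \<Omega> \<theta> \<Longrightarrow>
    \<bar>LINT x:\<Omega>|lborel. \<xi> x * (snd (g x) * dx \<theta> x - fst (g x) * dy \<theta> x)\<bar> \<le> C * L2_norm \<Omega> g * (H10_norm \<Omega> \<xi> * H10_norm \<Omega> \<theta>)"
    by (rule trilinear_test_bound) (rule that)
  show ?thesis
  proof (rule that[OF C(1)])
    fix g \<zeta> \<theta> assume g: "extendable_gradient \<Omega> g" and \<zeta>: "\<zeta> \<in> H10 \<Omega>" "ess_bounded \<Omega> \<zeta>" and \<theta>: "\<theta> \<in> H10 \<Omega>"
    have gL: "g \<in> L2 \<Omega>" using g by (simp add: extendable_gradient_def)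
    have \<zeta>L: "\<zeta> \<in> L2 \<Omega>" by (rule H1_L2[OF H10_H1[OF \<zeta>(1)]])
    have step1: "\<bar>adv_integral \<zeta> g (wgrad \<Omega> \<theta>')\<bar> \<le> C * L2_norm \<Omega> g * (H10_norm \<Omega> \<zeta> * H10_norm \<Omega> \<theta>')" if \<theta>': "test_function \<Omega> \<theta>'" for \<theta>'
    proof -
      let ?h = "\<lambda>x. snd (g x) * dx \<theta>' x - fst (g x) * dy \<theta>' x"
      have d: "dx \<theta>' \<in> L2 \<Omega>" "dy \<theta>' \<in> L2 \<Omega>" "(\<lambda>x. (dx \<theta>' x, dy \<theta>' x)) \<in> L2 \<Omega>"
        by (intro Ck_gradient_L2 test_function_Ck[OF \<theta>'])+
      have db: "ess_bounded \<Omega> (dx \<theta>')" "ess_bounded \<Omega> (dy \<theta>')"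
        by (rule Ck_ess_bounded[OF Ck_Suc_dx[OF test_function_Ck[OF \<theta>', of "Suc 0"]]],
            rule Ck_ess_bounded[OF Ck_Suc_dy[OF test_function_Ck[OF \<theta>', of "Suc 0"]]])
      have hL: "?h \<in> L2 \<Omega>"
        using L2_lincomb[OF L2_bounded_mult[OF L2_fst_snd(2)[OF gL] d(1) db(1)] L2_bounded_mult[OF L2_fst_snd(1)[OF gL] d(2) db(2)], of 1 "-1"]
        by (simp add: mult.commute)
      have "adv_integral \<zeta> g (wgrad \<Omega> \<theta>') = adv_integral \<zeta> g (\<lambda>x. (dx \<theta>' x, dy \<theta>' x))"
        by (rule adv_integral_cong_AE[OF \<zeta>L \<zeta>(2) gL wgrad_L2[OF Ck_H1(1)[OF test_function_Ck[OF \<theta>']]] d(3) Ck_H1(2)[OF test_function_Ck[OF \<theta>']]])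
      also have "\<dots> = (LINT x:\<Omega>|lborel. \<zeta> x * ?h x)"
        by (simp add: perp_def inner_prod_def)
      finally have eq: "adv_integral \<zeta> g (wgrad \<Omega> \<theta>') = (LINT x:\<Omega>|lborel. \<zeta> x * ?h x)" .
      obtain \<phi> where \<phi>: "\<And>k. test_function \<Omega> (\<phi> k)" "(\<lambda>k. L2_norm \<Omega> (\<lambda>x. \<phi> k x - \<zeta> x)) \<longlonglongrightarrow> 0"
        "(\<lambda>k. H10_norm \<Omega> (\<lambda>x. \<phi> k x - \<zeta> x)) \<longlonglongrightarrow> 0"
        by (rule H10_test_approximation[OF \<zeta>(1)]) (rule that)
      have \<phi>L: "\<phi> k \<in> L2 \<Omega>" for k by (rule Ck_L2[OF test_function_Ck[OF \<phi>(1), of 0]])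
      have dL: "(\<lambda>x. \<phi> k x - \<zeta> x) \<in> L2 \<Omega>" for k
        using L2_lincomb[OF \<phi>L[of k] \<zeta>L, of 1 "-1"] by simp
      have "(\<lambda>k. LINT x:\<Omega>|lborel. \<phi> k x * ?h x) \<longlonglongrightarrow> (LINT x:\<Omega>|lborel. \<zeta> x * ?h x)"
      proof (rule LIM_zero_cancel, rule tendsto_rabs_zero_cancel, rule tendsto_sandwich[OF always_eventually always_eventually tendsto_const])
        show "\<forall>k. \<bar>(LINT x:\<Omega>|lborel. \<phi> k x * ?h x) - (LINT x:\<Omega>|lborel. \<zeta> x * ?h x)\<bar> \<le> L2_norm \<Omega> (\<lambda>x. \<phi> k x - \<zeta> x) * L2_norm \<Omega> ?h"
        proof
          fix k
          have "(LINT x:\<Omega>|lborel. \<phi> k x * ?h x) - (LINT x:\<Omega>|lborel. \<zeta> x * ?h x) = (LINT x:\<Omega>|lborel. \<phi> k x * ?h x - \<zeta> x * ?h x)"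
            by (rule set_integral_diff(2)[symmetric, OF L2_mult_integrable(1)[OF \<phi>L hL] L2_mult_integrable(1)[OF \<zeta>L hL]])
          also have "\<dots> = (LINT x:\<Omega>|lborel. (\<phi> k x - \<zeta> x) * ?h x)" by (simp only: left_diff_distrib)
          finally show "\<bar>(LINT x:\<Omega>|lborel. \<phi> k x * ?h x) - (LINT x:\<Omega>|lborel. \<zeta> x * ?h x)\<bar> \<le> L2_norm \<Omega> (\<lambda>x. \<phi> k x - \<zeta> x) * L2_norm \<Omega> ?h"
            using L2_mult_integrable(2)[OF dL hL, of k] by (simp only:)
        qed
        show "(\<lambda>k. L2_norm \<Omega> (\<lambda>x. \<phi> k x - \<zeta> x) * L2_norm \<Omega> ?h) \<longlonglongrightarrow> 0"
          using tendsto_mult_right[OF \<phi>(2), of "L2_norm \<Omega> ?h"] by simp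
      qed simp
      note lim = tendsto_rabs[OF this]
      have lim2: "(\<lambda>k. C * L2_norm \<Omega> g * (H10_norm \<Omega> (\<phi> k) * H10_norm \<Omega> \<theta>')) \<longlonglongrightarrow> C * L2_norm \<Omega> g * (H10_norm \<Omega> \<zeta> * H10_norm \<Omega> \<theta>')"
        by (intro tendsto_intros H10_norm_tendsto[OF _ H10_H1[OF \<zeta>(1)] \<phi>(3)] Ck_H1(1)[OF test_function_Ck[OF \<phi>(1)]])
      show ?thesis
        unfolding eq by (rule tendsto_le[OF sequentially_bot lim2 lim]) (intro always_eventually allI C(2)[OF g \<phi>(1) \<theta>'])
    qed
    obtain \<phi> where \<phi>: "\<And>k. test_function \<Omega> (\<phi> k)" "(\<lambda>k. L2_norm \<Omega> (\<lambda>x. \<phi> k x - \<theta> x)) \<longlonglongrightarrow> 0"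
      "(\<lambda>k. H10_norm \<Omega> (\<lambda>x. \<phi> k x - \<theta> x)) \<longlonglongrightarrow> 0"
      by (rule H10_test_approximation[OF \<theta>]) (rule that)
    have \<phi>H: "\<phi> k \<in> H1 \<Omega>" for k by (rule Ck_H1(1)[OF test_function_Ck[OF \<phi>(1)]])
    note \<theta>H = H10_H1[OF \<theta>]
    have p: "(\<lambda>x. \<zeta> x * snd (g x)) \<in> L2 \<Omega>" "(\<lambda>x. \<zeta> x * fst (g x)) \<in> L2 \<Omega>"
      by (rule L2_bounded_mult[OF L2_fst_snd(2)[OF gL] \<zeta>L \<zeta>(2)], rule L2_bounded_mult[OF L2_fst_snd(1)[OF gL] \<zeta>L \<zeta>(2)])
    define K where "K = L2_norm \<Omega> (\<lambda>x. \<zeta> x * snd (g x)) + L2_norm \<Omega> (\<lambda>x. \<zeta> x * fst (g x))"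
    have "(\<lambda>k. adv_integral \<zeta> g (wgrad \<Omega> (\<phi> k))) \<longlonglongrightarrow> adv_integral \<zeta> g (wgrad \<Omega> \<theta>)"
    proof (rule LIM_zero_cancel, rule tendsto_rabs_zero_cancel, rule tendsto_sandwich[OF always_eventually always_eventually tendsto_const])
      show "\<forall>k. \<bar>adv_integral \<zeta> g (wgrad \<Omega> (\<phi> k)) - adv_integral \<zeta> g (wgrad \<Omega> \<theta>)\<bar> \<le> K * H10_norm \<Omega> (\<lambda>x. \<phi> k x - \<theta> x)"
      proof
        fix k
        let ?d = "\<lambda>x. 1 *\<^sub>R wgrad \<Omega> (\<phi> k) x + (-1) *\<^sub>R wgrad \<Omega> \<theta> x"
        have dL: "?d \<in> L2 \<Omega>" by (rule L2_lincomb[OF wgrad_L2[OF \<phi>H] wgrad_L2[OF \<theta>H]])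
        have dn: "L2_norm \<Omega> ?d = H10_norm \<Omega> (\<lambda>x. \<phi> k x - \<theta> x)"
          unfolding H10_norm_def diff_eq_lincomb by (rule H1_lincomb(3)[OF \<phi>H \<theta>H, symmetric])
        have e: "adv_integral \<zeta> g (wgrad \<Omega> (\<phi> k)) - adv_integral \<zeta> g (wgrad \<Omega> \<theta>) = adv_integral \<zeta> g ?d"
          unfolding adv_integral_lincomb(3)[OF \<zeta>L \<zeta>(2) \<zeta>L \<zeta>(2) gL gL wgrad_L2[OF \<phi>H] wgrad_L2[OF \<theta>H]] by simp
        define A B where "A = (LINT x:\<Omega>|lborel. (\<zeta> x * snd (g x)) * fst (?d x))" and "B = (LINT x:\<Omega>|lborel. (\<zeta> x * fst (g x)) * snd (?d x))"
        have AB: "adv_integral \<zeta> g ?d = A - B"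
          unfolding A_def B_def by (rule adv_integral_eq(1)[OF \<zeta>L \<zeta>(2) gL dL])
        have A: "\<bar>A\<bar> \<le> L2_norm \<Omega> (\<lambda>x. \<zeta> x * snd (g x)) * L2_norm \<Omega> ?d"
          unfolding A_def by (rule order_trans[OF L2_mult_integrable(2)[OF p(1) L2_fst_snd(1)[OF dL]] mult_left_mono[OF L2_fst_snd(3)[OF dL] L2_norm_nonneg]])
        have B: "\<bar>B\<bar> \<le> L2_norm \<Omega> (\<lambda>x. \<zeta> x * fst (g x)) * L2_norm \<Omega> ?d"
          unfolding B_def by (rule order_trans[OF L2_mult_integrable(2)[OF p(2) L2_fst_snd(2)[OF dL]] mult_left_mono[OF L2_fst_snd(4)[OF dL] L2_norm_nonneg]])
        have "\<bar>A - B\<bar> \<le> K * H10_norm \<Omega> (\<lambda>x. \<phi> k x - \<theta> x)"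
          using A B abs_triangle_ineq4[of A B] unfolding dn K_def distrib_right by linarith
        then show "\<bar>adv_integral \<zeta> g (wgrad \<Omega> (\<phi> k)) - adv_integral \<zeta> g (wgrad \<Omega> \<theta>)\<bar> \<le> K * H10_norm \<Omega> (\<lambda>x. \<phi> k x - \<theta> x)"
          unfolding e AB .
      qed
      show "(\<lambda>k. K * H10_norm \<Omega> (\<lambda>x. \<phi> k x - \<theta> x)) \<longlonglongrightarrow> 0"
        using tendsto_mult_left[OF \<phi>(3), of K] by simp
    qed simp
    note lim = tendsto_rabs[OF this]
    have lim2: "(\<lambda>k. C * L2_norm \<Omega> g * (H10_norm \<Omega> \<zeta> * H10_norm \<Omega> (\<phi> k))) \<longlonglongrightarrow> C * L2_norm \<Omega> g * (H10_norm \<Omega> \<zeta> * H10_norm \<Omega> \<theta>)"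
      by (intro tendsto_intros H10_norm_tendsto[OF \<phi>H \<theta>H \<phi>(3)])
    show "\<bar>adv_integral \<zeta> g (wgrad \<Omega> \<theta>)\<bar> \<le> C * L2_norm \<Omega> g * (H10_norm \<Omega> \<zeta> * H10_norm \<Omega> \<theta>)"
      by (rule tendsto_le[OF sequentially_bot lim2 lim]) (intro always_eventually allI step1 \<phi>(1))
  qed
qed

text \<open>Makes the difference of the gradients of two elements of \<open>H_space\<close>
  admissible in \<open>trilinear_bound\<close> directly from the weak identity, without forming the
  trace of their difference.\<close>

lemma extendable_gradient_diff:
  assumes g: "extendable_gradient \<Omega> g" and h: "extendable_gradient \<Omega> h"
  shows "extendable_gradient \<Omega> (\<lambda>x. 1 *\<^sub>R g x + (-1) *\<^sub>R h x)"
proof -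
  have gL: "g \<in> L2 \<Omega>" "h \<in> L2 \<Omega>" using g h by (simp_all add: extendable_gradient_def)
  have ex: "\<exists>p. integrable lborel (fst p) \<and> vanishes_beyond (snd p) (fst p) \<and> (\<forall>F v. Ck 1 F \<longrightarrow> norm v = 1 \<longrightarrow>
      (\<integral>x. fst p x * dir_deriv v F x \<partial>lborel) = - (LINT x:\<Omega>|lborel. (v \<bullet> g x) * F x))" if "extendable_gradient \<Omega> g" for g
    using that unfolding extendable_gradient_def by (elim conjE exE) (rule_tac x="(\<psi>, R)" in exI, simp)
  obtain p where p: "integrable lborel (fst p) \<and> vanishes_beyond (snd p) (fst p) \<and> (\<forall>F v. Ck 1 F \<longrightarrow> norm v = 1 \<longrightarrow>
      (\<integral>x. fst p x * dir_deriv v F x \<partial>lborel) = - (LINT x:\<Omega>|lborel. (v \<bullet> g x) * F x))"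
    using ex[OF g] by (rule exE) (rule that)
  obtain q where q: "integrable lborel (fst q) \<and> vanishes_beyond (snd q) (fst q) \<and> (\<forall>F v. Ck 1 F \<longrightarrow> norm v = 1 \<longrightarrow>
      (\<integral>x. fst q x * dir_deriv v F x \<partial>lborel) = - (LINT x:\<Omega>|lborel. (v \<bullet> h x) * F x))"
    using ex[OF h] by (rule exE) (rule that)
  note pi = p[THEN conjunct1] and pv = p[THEN conjunct2, THEN conjunct1] and pw = p[THEN conjunct2, THEN conjunct2, rule_format]
  note qi = q[THEN conjunct1] and qv = q[THEN conjunct2, THEN conjunct1] and qw = q[THEN conjunct2, THEN conjunct2, rule_format]
  let ?\<psi> = "\<lambda>x. fst p x - fst q x" and ?R = "max (snd p) (snd q)"
  have "vanishes_beyond ?R ?\<psi>"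
    by (intro vanishes_beyond_diff vanishes_beyond_mono[OF pv] vanishes_beyond_mono[OF qv]) simp_all
  moreover have "integrable lborel ?\<psi>" by (rule Bochner_Integration.integrable_diff[OF pi qi])
  moreover have "(\<integral>x. ?\<psi> x * dir_deriv v F x \<partial>lborel) = - (LINT x:\<Omega>|lborel. (v \<bullet> (1 *\<^sub>R g x + (-1) *\<^sub>R h x)) * F x)"
    if F: "Ck 1 F" and v: "norm v = 1" for F v
  proof -
    have "(\<integral>x. ?\<psi> x * dir_deriv v F x \<partial>lborel) = (\<integral>x. fst p x * dir_deriv v F x - fst q x * dir_deriv v F x \<partial>lborel)"
      by (simp only: left_diff_distrib)
    also have "\<dots> = (\<integral>x. fst p x * dir_deriv v F x \<partial>lborel) - (\<integral>x. fst q x * dir_deriv v F x \<partial>lborel)"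
      by (rule Bochner_Integration.integral_diff[OF integrable_mult_continuous[OF pi pv continuous_dir_deriv[OF F]] integrable_mult_continuous[OF qi qv continuous_dir_deriv[OF F]]])
    also have "\<dots> = - ((LINT x:\<Omega>|lborel. (v \<bullet> g x) * F x) - (LINT x:\<Omega>|lborel. (v \<bullet> h x) * F x))"
      by (simp only: pw[OF F v] qw[OF F v] minus_diff_eq diff_minus_eq_add add.commute uminus_add_conv_diff)
    also have "(LINT x:\<Omega>|lborel. (v \<bullet> g x) * F x) - (LINT x:\<Omega>|lborel. (v \<bullet> h x) * F x) = (LINT x:\<Omega>|lborel. (v \<bullet> g x) * F x - (v \<bullet> h x) * F x)"
      by (rule set_integral_diff(2)[symmetric, OF L2_mult_integrable(1)[OF L2_inner(1)[OF gL(1) v] Ck_L2[OF F]] L2_mult_integrable(1)[OF L2_inner(1)[OF gL(2) v] Ck_L2[OF F]]])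
    also have "\<dots> = (LINT x:\<Omega>|lborel. (v \<bullet> (1 *\<^sub>R g x + (-1) *\<^sub>R h x)) * F x)"
      by (simp add: inner_diff_right left_diff_distrib)
    finally show ?thesis .
  qed
  ultimately show ?thesis
    unfolding extendable_gradient_def using L2_lincomb[OF gL, of 1 "-1"]
    by (intro conjI exI[of _ ?\<psi>] exI[of _ ?R] allI impI) simp_all
qed

end

text \<open>The Cauchy criterion in the shape that the triangle inequality produces when both terms
  are compared with a common target.\<close>

lemma defect_convergent:
  fixes x d :: "nat \<Rightarrow> real"
  assumes x: "\<And>j k. \<bar>x j - x k\<bar> \<le> d j + d k" and d: "d \<longlonglongrightarrow> 0"
  shows "convergent x"
proof (rule Cauchy_convergent, rule metric_CauchyI)
  fix e :: real assume "0 < e"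
  then have "\<forall>\<^sub>F k in sequentially. d k < e / 2" by (intro order_tendstoD(2)[OF d]) simp
  then obtain M where M: "\<And>k. M \<le> k \<Longrightarrow> d k < e / 2" unfolding eventually_sequentially by blast
  have "dist (x j) (x k) < e" if "M \<le> j" "M \<le> k" for j k
    using x[of j k] M[OF that(1)] M[OF that(2)] unfolding dist_real_def by simp
  then show "\<exists>M. \<forall>j\<ge>M. \<forall>k\<ge>M. dist (x j) (x k) < e" by (intro exI[of _ M] allI impI)
qed

section \<open>The continuous extension in the first argument\<close>

context lipschitz_domain
begin

lemma H_space_H1: "\<psi> \<in> H_space \<Omega> \<Longrightarrow> \<psi> \<in> H1 \<Omega>"
  by (simp add: H_space_def)

lemma H10_bounded_approximation:
  assumes "\<xi> \<in> H10 \<Omega>"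
  obtains \<phi> where "\<And>k. \<phi> k \<in> H10 \<Omega>" "\<And>k. ess_bounded \<Omega> (\<phi> k)" "(\<lambda>k. H10_norm \<Omega> (\<lambda>x. \<phi> k x - \<xi> x)) \<longlonglongrightarrow> 0"
proof -
  obtain \<phi> where \<phi>: "\<And>k. test_function \<Omega> (\<phi> k)" "(\<lambda>k. L2_norm \<Omega> (\<lambda>x. \<phi> k x - \<xi> x)) \<longlonglongrightarrow> 0"
    "(\<lambda>k. H10_norm \<Omega> (\<lambda>x. \<phi> k x - \<xi> x)) \<longlonglongrightarrow> 0"
    by (rule H10_test_approximation[OF assms]) (rule that)
  show ?thesis by (rule that[OF test_function_H10[OF \<phi>(1)] test_function_ess_bounded[OF \<phi>(1)] \<phi>(3)])
qed

text \<open>Any two bounded approximations of \<xi> give integrals that differ by at most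
  \<open>M\<close> times the sum of their distances to \<xi>. Hence the limit exists and is common
  to all such sequences; as at least one exists, the description by \<open>THE\<close> has exactly
  one solution.\<close>

lemma advection_limit:
  assumes \<xi>: "\<xi> \<in> H10 \<Omega>" and \<psi>: "\<psi> \<in> H_space \<Omega>" and \<theta>: "\<theta> \<in> H10 \<Omega>"
    and \<zeta>: "\<And>k. \<zeta> k \<in> H10 \<Omega>" "\<And>k. ess_bounded \<Omega> (\<zeta> k)" "(\<lambda>k. H10_norm \<Omega> (\<lambda>x. \<zeta> k x - \<xi> x)) \<longlonglongrightarrow> 0"
  shows "(\<lambda>k. adv_integral (\<zeta> k) (wgrad \<Omega> \<psi>) (wgrad \<Omega> \<theta>)) \<longlonglongrightarrow> advection \<Omega> \<xi> \<psi> \<theta>"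
proof -
  obtain C where C: "C \<ge> 0" "\<And>g \<zeta> \<theta>. extendable_gradient \<Omega> g \<Longrightarrow> \<zeta> \<in> H10 \<Omega> \<Longrightarrow> ess_bounded \<Omega> \<zeta> \<Longrightarrow> \<theta> \<in> H10 \<Omega> \<Longrightarrow>
    \<bar>adv_integral \<zeta> g (wgrad \<Omega> \<theta>)\<bar> \<le> C * L2_norm \<Omega> g * (H10_norm \<Omega> \<zeta> * H10_norm \<Omega> \<theta>)"
    by (rule trilinear_bound) (rule that)
  note gL = wgrad_L2[OF H_space_H1[OF \<psi>]] and hL = wgrad_L2[OF H10_H1[OF \<theta>]]
  define I where "I \<zeta> = adv_integral \<zeta> (wgrad \<Omega> \<psi>) (wgrad \<Omega> \<theta>)" for \<zeta>
  define M where "M = C * L2_norm \<Omega> (wgrad \<Omega> \<psi>) * H10_norm \<Omega> \<theta>"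
  have M0: "0 \<le> M" unfolding M_def by (intro mult_nonneg_nonneg C(1) L2_norm_nonneg H10_norm_nonneg)
  have I_diff: "\<bar>I u - I v\<bar> \<le> M * H10_norm \<Omega> (\<lambda>x. u x - \<xi> x) + M * H10_norm \<Omega> (\<lambda>x. v x - \<xi> x)"
    if u: "u \<in> H10 \<Omega>" "ess_bounded \<Omega> u" and v: "v \<in> H10 \<Omega>" "ess_bounded \<Omega> v" for u v
  proof -
    have "I u - I v = I (\<lambda>x. 1 * u x + (-1) * v x)"
      unfolding I_def adv_integral_lincomb(1)[OF H1_L2[OF H10_H1[OF u(1)]] u(2) H1_L2[OF H10_H1[OF v(1)]] v(2) gL gL hL hL] by simp
    also have "\<bar>I (\<lambda>x. 1 * u x + (-1) * v x)\<bar> \<le> M * H10_norm \<Omega> (\<lambda>x. 1 * u x + (-1) * v x)"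
      using C(2)[OF H_space_extendable[OF \<psi>] H10_lincomb[OF u(1) v(1)] ess_bounded_lincomb[OF u(2) v(2)] \<theta>, of 1 "-1"]
      unfolding I_def M_def by (simp only: mult_ac)
    also have "\<dots> \<le> M * (H10_norm \<Omega> (\<lambda>x. u x - \<xi> x) + H10_norm \<Omega> (\<lambda>x. v x - \<xi> x))"
      using H10_norm_triangle[OF H10_H1[OF u(1)] H10_H1[OF \<xi>] H10_H1[OF v(1)]] H10_norm_minus_commute[OF H10_H1[OF \<xi>] H10_H1[OF v(1)]]
      by (intro mult_left_mono M0) (simp only: diff_eq_lincomb)
    finally show ?thesis by (simp only: distrib_left)
  qed
  obtain \<phi> where \<phi>: "\<And>k. \<phi> k \<in> H10 \<Omega>" "\<And>k. ess_bounded \<Omega> (\<phi> k)" "(\<lambda>k. H10_norm \<Omega> (\<lambda>x. \<phi> k x - \<xi> x)) \<longlonglongrightarrow> 0"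
    by (rule H10_bounded_approximation[OF \<xi>]) (rule that)
  have lim0: "(\<lambda>k. M * H10_norm \<Omega> (\<lambda>x. \<chi>k k x - \<xi> x)) \<longlonglongrightarrow> 0"
    if "(\<lambda>k. H10_norm \<Omega> (\<lambda>x. \<chi>k k x - \<xi> x)) \<longlonglongrightarrow> 0" for \<chi>k
    using tendsto_mult_left[OF that, of M] by simp
  have "convergent (\<lambda>k. I (\<phi> k))"
    by (rule defect_convergent[OF I_diff[OF \<phi>(1,2) \<phi>(1,2)] lim0[OF \<phi>(3)]])
  then obtain t where t: "(\<lambda>k. I (\<phi> k)) \<longlonglongrightarrow> t" unfolding convergent_def by (rule exE)
  define P where "P s \<longleftrightarrow> (\<forall>\<zeta>. (\<forall>k. \<zeta> k \<in> H10 \<Omega> \<and> ess_bounded \<Omega> (\<zeta> k)) \<and>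
     (\<lambda>k. H10_norm \<Omega> (\<lambda>x. \<zeta> k x - \<xi> x)) \<longlonglongrightarrow> 0 \<longrightarrow> (\<lambda>k. I (\<zeta> k)) \<longlonglongrightarrow> s)" for s
  have "P t"
    unfolding P_def
  proof (intro allI impI, elim conjE)
    fix \<zeta> assume z: "\<forall>k. \<zeta> k \<in> H10 \<Omega> \<and> ess_bounded \<Omega> (\<zeta> k)" and zl: "(\<lambda>k. H10_norm \<Omega> (\<lambda>x. \<zeta> k x - \<xi> x)) \<longlonglongrightarrow> 0"
    have "(\<lambda>k. I (\<zeta> k) - I (\<phi> k)) \<longlonglongrightarrow> 0"
    proof (rule tendsto_rabs_zero_cancel, rule tendsto_sandwich[OF always_eventually always_eventually tendsto_const])
      show "\<forall>k. \<bar>I (\<zeta> k) - I (\<phi> k)\<bar> \<le> M * H10_norm \<Omega> (\<lambda>x. \<zeta> k x - \<xi> x) + M * H10_norm \<Omega> (\<lambda>x. \<phi> k x - \<xi> x)"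
        by (intro allI I_diff \<phi>(1,2) z[rule_format, THEN conjunct1] z[rule_format, THEN conjunct2])
      show "(\<lambda>k. M * H10_norm \<Omega> (\<lambda>x. \<zeta> k x - \<xi> x) + M * H10_norm \<Omega> (\<lambda>x. \<phi> k x - \<xi> x)) \<longlonglongrightarrow> 0"
        using tendsto_add[OF lim0[OF zl] lim0[OF \<phi>(3)]] by (simp only: add_0_left)
    qed simp
    from tendsto_add[OF this t] show "(\<lambda>k. I (\<zeta> k)) \<longlonglongrightarrow> t" by simp
  qed
  moreover have "s = t" if "P s" for s
    by (rule LIMSEQ_unique[OF _ t]) (rule that[unfolded P_def, rule_format], intro conjI allI \<phi>)
  ultimately have "P (THE s. P s)" by (rule theI)
  then have "P (advection \<Omega> \<xi> \<psi> \<theta>)" unfolding advection_def P_def I_def .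
  then show ?thesis unfolding P_def I_def by (elim allE[of _ \<zeta>] impE) (intro conjI allI \<zeta>)
qed

lemma advection_lincomb:
  assumes \<xi>: "\<xi> \<in> H10 \<Omega>" and \<eta>: "\<eta> \<in> H10 \<Omega>" and \<psi>: "\<psi> \<in> H_space \<Omega>" and \<theta>: "\<theta> \<in> H10 \<Omega>"
  shows "advection \<Omega> (\<lambda>x. a * \<xi> x + b * \<eta> x) \<psi> \<theta> = a * advection \<Omega> \<xi> \<psi> \<theta> + b * advection \<Omega> \<eta> \<psi> \<theta>"
proof -
  obtain u where u: "\<And>k. u k \<in> H10 \<Omega>" "\<And>k. ess_bounded \<Omega> (u k)" "(\<lambda>k. H10_norm \<Omega> (\<lambda>x. u k x - \<xi> x)) \<longlonglongrightarrow> 0"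
    by (rule H10_bounded_approximation[OF \<xi>]) (rule that)
  obtain v where v: "\<And>k. v k \<in> H10 \<Omega>" "\<And>k. ess_bounded \<Omega> (v k)" "(\<lambda>k. H10_norm \<Omega> (\<lambda>x. v k x - \<eta> x)) \<longlonglongrightarrow> 0"
    by (rule H10_bounded_approximation[OF \<eta>]) (rule that)
  note gL = wgrad_L2[OF H_space_H1[OF \<psi>]] and hL = wgrad_L2[OF H10_H1[OF \<theta>]]
  have "(\<lambda>k. H10_norm \<Omega> (\<lambda>x. (a * u k x + b * v k x) - (a * \<xi> x + b * \<eta> x))) \<longlonglongrightarrow> 0"
  proof (rule tendsto_sandwich[OF always_eventually always_eventually tendsto_const])
    show "\<forall>k. 0 \<le> H10_norm \<Omega> (\<lambda>x. (a * u k x + b * v k x) - (a * \<xi> x + b * \<eta> x))" by (intro allI H10_norm_nonneg)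
    show "\<forall>k. H10_norm \<Omega> (\<lambda>x. (a * u k x + b * v k x) - (a * \<xi> x + b * \<eta> x))
      \<le> \<bar>a\<bar> * H10_norm \<Omega> (\<lambda>x. u k x - \<xi> x) + \<bar>b\<bar> * H10_norm \<Omega> (\<lambda>x. v k x - \<eta> x)"
    proof
      fix k
      have d: "(\<lambda>x. u k x - \<xi> x) \<in> H1 \<Omega>" "(\<lambda>x. v k x - \<eta> x) \<in> H1 \<Omega>"
        unfolding diff_eq_lincomb by (intro H1_lincomb(1) H10_H1 u(1) v(1) \<xi> \<eta>)+
      have "(\<lambda>x. (a * u k x + b * v k x) - (a * \<xi> x + b * \<eta> x)) = (\<lambda>x. a * (u k x - \<xi> x) + b * (v k x - \<eta> x))"
        by (simp add: algebra_simps)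
      then show "H10_norm \<Omega> (\<lambda>x. (a * u k x + b * v k x) - (a * \<xi> x + b * \<eta> x))
        \<le> \<bar>a\<bar> * H10_norm \<Omega> (\<lambda>x. u k x - \<xi> x) + \<bar>b\<bar> * H10_norm \<Omega> (\<lambda>x. v k x - \<eta> x)"
        using H10_norm_lincomb[OF d, of a b] by (simp only:)
    qed
    show "(\<lambda>k. \<bar>a\<bar> * H10_norm \<Omega> (\<lambda>x. u k x - \<xi> x) + \<bar>b\<bar> * H10_norm \<Omega> (\<lambda>x. v k x - \<eta> x)) \<longlonglongrightarrow> 0"
      using tendsto_add[OF tendsto_mult_left[OF u(3), of "\<bar>a\<bar>"] tendsto_mult_left[OF v(3), of "\<bar>b\<bar>"]] by simp
  qed
  from advection_limit[OF H10_lincomb[OF \<xi> \<eta>] \<psi> \<theta> H10_lincomb[OF u(1) v(1)] ess_bounded_lincomb[OF u(2) v(2)] this]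
  have 1: "(\<lambda>k. adv_integral (\<lambda>x. a * u k x + b * v k x) (wgrad \<Omega> \<psi>) (wgrad \<Omega> \<theta>)) \<longlonglongrightarrow> advection \<Omega> (\<lambda>x. a * \<xi> x + b * \<eta> x) \<psi> \<theta>" .
  have 2: "(\<lambda>k. adv_integral (\<lambda>x. a * u k x + b * v k x) (wgrad \<Omega> \<psi>) (wgrad \<Omega> \<theta>)) \<longlonglongrightarrow> a * advection \<Omega> \<xi> \<psi> \<theta> + b * advection \<Omega> \<eta> \<psi> \<theta>"
    unfolding adv_integral_lincomb(1)[OF H1_L2[OF H10_H1[OF u(1)]] u(2) H1_L2[OF H10_H1[OF v(1)]] v(2) gL gL hL hL]
    by (intro tendsto_add tendsto_mult_left advection_limit \<xi> \<eta> \<psi> \<theta> u v)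
  show ?thesis by (rule LIMSEQ_unique[OF 1 2])
qed

text \<open>Both bounds pass to the limit along bounded approximations of \<xi>. For the second,
  \<psi> is exchanged while \<open>\<theta>'\<close> is kept, and then \<theta> while \<psi> is
  kept.\<close>

lemma advection_bounds:
  obtains C where "C \<ge> 0"
    "\<And>\<xi> \<psi> \<theta>. \<xi> \<in> H10 \<Omega> \<Longrightarrow> \<psi> \<in> H_space \<Omega> \<Longrightarrow> \<theta> \<in> H10 \<Omega> \<Longrightarrow>
      \<bar>advection \<Omega> \<xi> \<psi> \<theta>\<bar> \<le> C * H10_norm \<Omega> \<xi> * (H10_norm \<Omega> \<psi> * H10_norm \<Omega> \<theta>)"
    "\<And>\<xi> \<psi> \<theta> \<psi>' \<theta>'. \<xi> \<in> H10 \<Omega> \<Longrightarrow> \<psi> \<in> H_space \<Omega> \<Longrightarrow> \<theta> \<in> H10 \<Omega> \<Longrightarrow> \<psi>' \<in> H_space \<Omega> \<Longrightarrow> \<theta>' \<in> H10 \<Omega> \<Longrightarrow>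
      \<bar>advection \<Omega> \<xi> \<psi>' \<theta>' - advection \<Omega> \<xi> \<psi> \<theta>\<bar>
        \<le> C * H10_norm \<Omega> \<xi> * (H10_norm \<Omega> (\<lambda>x. \<psi>' x - \<psi> x) * H10_norm \<Omega> \<theta>' + H10_norm \<Omega> \<psi> * H10_norm \<Omega> (\<lambda>x. \<theta>' x - \<theta> x))"
proof -
  obtain C where C: "C \<ge> 0" "\<And>g \<zeta> \<theta>. extendable_gradient \<Omega> g \<Longrightarrow> \<zeta> \<in> H10 \<Omega> \<Longrightarrow> ess_bounded \<Omega> \<zeta> \<Longrightarrow> \<theta> \<in> H10 \<Omega> \<Longrightarrow>
    \<bar>adv_integral \<zeta> g (wgrad \<Omega> \<theta>)\<bar> \<le> C * L2_norm \<Omega> g * (H10_norm \<Omega> \<zeta> * H10_norm \<Omega> \<theta>)"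
    by (rule trilinear_bound) (rule that)
  show ?thesis
  proof (rule that[OF C(1)])
    fix \<xi> \<psi> \<theta> assume \<xi>: "\<xi> \<in> H10 \<Omega>" and \<psi>: "\<psi> \<in> H_space \<Omega>" and \<theta>: "\<theta> \<in> H10 \<Omega>"
    obtain u where u: "\<And>k. u k \<in> H10 \<Omega>" "\<And>k. ess_bounded \<Omega> (u k)" "(\<lambda>k. H10_norm \<Omega> (\<lambda>x. u k x - \<xi> x)) \<longlonglongrightarrow> 0"
      by (rule H10_bounded_approximation[OF \<xi>]) (rule that)
    note uN = H10_norm_tendsto[OF H10_H1[OF u(1)] H10_H1[OF \<xi>] u(3)]
    have "(\<lambda>k. C * H10_norm \<Omega> \<psi> * (H10_norm \<Omega> (u k) * H10_norm \<Omega> \<theta>)) \<longlonglongrightarrow> C * H10_norm \<Omega> \<psi> * (H10_norm \<Omega> \<xi> * H10_norm \<Omega> \<theta>)"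
      by (intro tendsto_intros uN)
    from tendsto_le[OF sequentially_bot this tendsto_rabs[OF advection_limit[OF \<xi> \<psi> \<theta> u]]]
    have "\<bar>advection \<Omega> \<xi> \<psi> \<theta>\<bar> \<le> C * H10_norm \<Omega> \<psi> * (H10_norm \<Omega> \<xi> * H10_norm \<Omega> \<theta>)"
      using C(2)[OF H_space_extendable[OF \<psi>] u(1,2) \<theta>] unfolding H10_norm_def by simp
    then show "\<bar>advection \<Omega> \<xi> \<psi> \<theta>\<bar> \<le> C * H10_norm \<Omega> \<xi> * (H10_norm \<Omega> \<psi> * H10_norm \<Omega> \<theta>)" by (simp only: mult_ac)
  next
    fix \<xi> \<psi> \<theta> \<psi>' \<theta>' assume \<xi>: "\<xi> \<in> H10 \<Omega>" and \<psi>: "\<psi> \<in> H_space \<Omega>" "\<psi>' \<in> H_space \<Omega>" and \<theta>: "\<theta> \<in> H10 \<Omega>" "\<theta>' \<in> H10 \<Omega>"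
    note \<psi>H = H_space_H1[OF \<psi>(1)] H_space_H1[OF \<psi>(2)] and \<theta>H = H10_H1[OF \<theta>(1)] H10_H1[OF \<theta>(2)]
    note gL = wgrad_L2[OF \<psi>H(1)] wgrad_L2[OF \<psi>H(2)] and hL = wgrad_L2[OF \<theta>H(1)] wgrad_L2[OF \<theta>H(2)]
    obtain u where u: "\<And>k. u k \<in> H10 \<Omega>" "\<And>k. ess_bounded \<Omega> (u k)" "(\<lambda>k. H10_norm \<Omega> (\<lambda>x. u k x - \<xi> x)) \<longlonglongrightarrow> 0"
      by (rule H10_bounded_approximation[OF \<xi>]) (rule that)
    note uN = H10_norm_tendsto[OF H10_H1[OF u(1)] H10_H1[OF \<xi>] u(3)]
    let ?p = "H10_norm \<Omega> (\<lambda>x. \<psi>' x - \<psi> x)" and ?q = "H10_norm \<Omega> (\<lambda>x. \<theta>' x - \<theta> x)"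
    have "(\<lambda>k. C * H10_norm \<Omega> (u k) * (?p * H10_norm \<Omega> \<theta>' + H10_norm \<Omega> \<psi> * ?q))
        \<longlonglongrightarrow> C * H10_norm \<Omega> \<xi> * (?p * H10_norm \<Omega> \<theta>' + H10_norm \<Omega> \<psi> * ?q)"
      by (intro tendsto_intros uN)
    moreover have "\<bar>adv_integral (u k) (wgrad \<Omega> \<psi>') (wgrad \<Omega> \<theta>') - adv_integral (u k) (wgrad \<Omega> \<psi>) (wgrad \<Omega> \<theta>)\<bar>
        \<le> C * H10_norm \<Omega> (u k) * (?p * H10_norm \<Omega> \<theta>' + H10_norm \<Omega> \<psi> * ?q)" for k
    proof -
      note uL = H1_L2[OF H10_H1[OF u(1)[of k]]] and ub = u(2)[of k]
      let ?g = "\<lambda>x. 1 *\<^sub>R wgrad \<Omega> \<psi>' x + (-1) *\<^sub>R wgrad \<Omega> \<psi> x" and ?d = "\<lambda>x. 1 * \<theta>' x + (-1) * \<theta> x"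
      have d: "?d \<in> H10 \<Omega>" by (rule H10_lincomb[OF \<theta>(2,1)])
      define A B D G H where "A = adv_integral (u k) (wgrad \<Omega> \<psi>') (wgrad \<Omega> \<theta>')" and "B = adv_integral (u k) (wgrad \<Omega> \<psi>) (wgrad \<Omega> \<theta>')"
        and "D = adv_integral (u k) (wgrad \<Omega> \<psi>) (wgrad \<Omega> \<theta>)" and "G = adv_integral (u k) ?g (wgrad \<Omega> \<theta>')"
        and "H = adv_integral (u k) (wgrad \<Omega> \<psi>) (wgrad \<Omega> ?d)"
      have gn: "L2_norm \<Omega> ?g = ?p"
        unfolding H10_norm_def diff_eq_lincomb by (rule H1_lincomb(3)[OF \<psi>H(2,1), symmetric])
      have "G = A - B"
        unfolding A_def B_def G_def adv_integral_lincomb(2)[OF uL ub uL ub gL(2,1) hL(2,2)] by simp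
      moreover have "H = adv_integral (u k) (wgrad \<Omega> \<psi>) (\<lambda>x. 1 *\<^sub>R wgrad \<Omega> \<theta>' x + (-1) *\<^sub>R wgrad \<Omega> \<theta> x)"
        unfolding H_def
        by (rule adv_integral_cong_AE[OF uL ub gL(1) wgrad_L2[OF H10_H1[OF d]] L2_lincomb[OF hL(2,1)] H1_lincomb(2)[OF \<theta>H(2,1)]])
      then have "H = B - D"
        unfolding B_def D_def adv_integral_lincomb(3)[OF uL ub uL ub gL(1,1) hL(2,1)] by simp
      moreover have "\<bar>G\<bar> \<le> C * ?p * (H10_norm \<Omega> (u k) * H10_norm \<Omega> \<theta>')"
        using C(2)[OF extendable_gradient_diff[OF H_space_extendable[OF \<psi>(2)] H_space_extendable[OF \<psi>(1)]] u(1)[of k] ub \<theta>(2)]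
        unfolding G_def gn .
      moreover have "\<bar>H\<bar> \<le> C * H10_norm \<Omega> \<psi> * (H10_norm \<Omega> (u k) * ?q)"
        using C(2)[OF H_space_extendable[OF \<psi>(1)] u(1)[of k] ub d]
        unfolding H_def H10_norm_def[of _ \<psi>] diff_eq_lincomb .
      ultimately have "\<bar>A - D\<bar> \<le> C * ?p * (H10_norm \<Omega> (u k) * H10_norm \<Omega> \<theta>') + C * H10_norm \<Omega> \<psi> * (H10_norm \<Omega> (u k) * ?q)"
        by linarith
      also have "\<dots> = C * H10_norm \<Omega> (u k) * (?p * H10_norm \<Omega> \<theta>' + H10_norm \<Omega> \<psi> * ?q)" by (simp only: distrib_left mult_ac)
      finally show ?thesis unfolding A_def D_def .
    qed
    ultimately show "\<bar>advection \<Omega> \<xi> \<psi>' \<theta>' - advection \<Omega> \<xi> \<psi> \<theta>\<bar> \<le> C * H10_norm \<Omega> \<xi> * (?p * H10_norm \<Omega> \<theta>' + H10_norm \<Omega> \<psi> * ?q)"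
      by (intro tendsto_le[OF sequentially_bot _ tendsto_rabs[OF tendsto_diff[OF advection_limit[OF \<xi> \<psi>(2) \<theta>(2) u] advection_limit[OF \<xi> \<psi>(1) \<theta>(1) u]]]])
        (assumption, intro always_eventually allI)
  qed
qed

lemma integral_gradient_squares:
  assumes "u \<in> H1 \<Omega>" "v \<in> H1 \<Omega>"
  shows "(LINT x:\<Omega>|lborel. a * (norm (wgrad \<Omega> u x))\<^sup>2 + (norm (wgrad \<Omega> v x))\<^sup>2) = a * (H10_norm \<Omega> u)\<^sup>2 + (H10_norm \<Omega> v)\<^sup>2"
    "(LINT x:\<Omega>|lborel. a * (norm (wgrad \<Omega> u x))\<^sup>2) = a * (H10_norm \<Omega> u)\<^sup>2"
proof -
  have i: "set_integrable lborel \<Omega> (\<lambda>x. (norm (wgrad \<Omega> w x))\<^sup>2)" if "w \<in> H1 \<Omega>" for w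
    using wgrad_L2[OF that] unfolding L2_def by simp
  have n: "(H10_norm \<Omega> w)\<^sup>2 = (LINT x:\<Omega>|lborel. (norm (wgrad \<Omega> w x))\<^sup>2)" for w
    unfolding H10_norm_def L2_norm_def
    by (rule real_sqrt_pow2) (unfold set_lebesgue_integral_def, rule Bochner_Integration.integral_nonneg, simp)
  show a: "(LINT x:\<Omega>|lborel. a * (norm (wgrad \<Omega> u x))\<^sup>2) = a * (H10_norm \<Omega> u)\<^sup>2"
    unfolding n by simp
  show "(LINT x:\<Omega>|lborel. a * (norm (wgrad \<Omega> u x))\<^sup>2 + (norm (wgrad \<Omega> v x))\<^sup>2) = a * (H10_norm \<Omega> u)\<^sup>2 + (H10_norm \<Omega> v)\<^sup>2"
    using set_integral_add(2)[OF set_integrable_mult_right[OF i[OF assms(1)], of a] i[OF assms(2)]] unfolding a n by simp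
qed

end

section \<open>Convergence of the optimizers\<close>

lemma min_divide_mult_le: "0 < c \<Longrightarrow> 0 < k \<Longrightarrow> min b (e / (k * c)) * c \<le> e / k" for b c e k :: real
  using mult_right_mono[of "min b (e / (k * c))" "e / (k * c)" c] by (simp add: field_simps)

text \<open>\<open>X\<close> is the space of \<xi> and \<theta>, \<open>Y\<close> that of \<psi>,
  and \<open>W\<close> a common space in which differences can be measured. \<open>N\<close> is the
  norm of the gradient, on \<open>W\<close> a seminorm only. \<open>Y\<close> carries no vector
  space structure; differences of its elements occur only inside \<open>N\<close>.\<close>

locale advection_form =
  fixes W X Y :: "('p \<Rightarrow> real) set" and N :: "('p \<Rightarrow> real) \<Rightarrow> real"
    and adv :: "('p \<Rightarrow> real) \<Rightarrow> ('p \<Rightarrow> real) \<Rightarrow> ('p \<Rightarrow> real) \<Rightarrow> real"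
    and f :: "('p \<Rightarrow> real) \<Rightarrow> real" and C F Pe :: real
  assumes X_W: "u \<in> X \<Longrightarrow> u \<in> W" and Y_W: "u \<in> Y \<Longrightarrow> u \<in> W"
    and X_lincomb: "u \<in> X \<Longrightarrow> v \<in> X \<Longrightarrow> (\<lambda>x. c * u x + d * v x) \<in> X"
    and zero_X: "(\<lambda>x. 0) \<in> X"
    and N_nonneg: "N u \<ge> 0"
    and N_lincomb: "u \<in> X \<Longrightarrow> v \<in> X \<Longrightarrow> N (\<lambda>x. c * u x + d * v x) \<le> \<bar>c\<bar> * N u + \<bar>d\<bar> * N v"
    and N_diff: "u \<in> W \<Longrightarrow> v \<in> W \<Longrightarrow> \<bar>N u - N v\<bar> \<le> N (\<lambda>x. u x - v x)"
    and N_midpoint: "u \<in> X \<Longrightarrow> v \<in> X \<Longrightarrow>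
      (N (\<lambda>x. 1/2 * u x + 1/2 * v x))\<^sup>2 = (N u)\<^sup>2 / 2 + (N v)\<^sup>2 / 2 - (N (\<lambda>x. u x - v x))\<^sup>2 / 4"
    and f_lincomb: "u \<in> X \<Longrightarrow> v \<in> X \<Longrightarrow> f (\<lambda>x. c * u x + d * v x) = c * f u + d * f v"
    and f_bound: "u \<in> X \<Longrightarrow> \<bar>f u\<bar> \<le> F * N u"
    and adv_lincomb: "u \<in> X \<Longrightarrow> v \<in> X \<Longrightarrow> \<psi> \<in> Y \<Longrightarrow> \<theta> \<in> X \<Longrightarrow>
      adv (\<lambda>x. c * u x + d * v x) \<psi> \<theta> = c * adv u \<psi> \<theta> + d * adv v \<psi> \<theta>"
    and adv_bound: "u \<in> X \<Longrightarrow> \<psi> \<in> Y \<Longrightarrow> \<theta> \<in> X \<Longrightarrow> \<bar>adv u \<psi> \<theta>\<bar> \<le> C * N u * (N \<psi> * N \<theta>)"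
    and adv_diff: "u \<in> X \<Longrightarrow> \<psi> \<in> Y \<Longrightarrow> \<theta> \<in> X \<Longrightarrow> \<psi>' \<in> Y \<Longrightarrow> \<theta>' \<in> X \<Longrightarrow>
      \<bar>adv u \<psi>' \<theta>' - adv u \<psi> \<theta>\<bar> \<le> C * N u * (N (\<lambda>x. \<psi>' x - \<psi> x) * N \<theta>' + N \<psi> * N (\<lambda>x. \<theta>' x - \<theta> x))"
    and consts_nonneg: "C \<ge> 0" "F \<ge> 0" "Pe \<ge> 0"
begin

definition Q where "Q a \<xi> \<psi> \<theta> = a * (N \<psi>)\<^sup>2 + (N \<theta>)\<^sup>2 - Pe * adv \<xi> \<psi> \<theta>"
definition J where "J a \<xi> = f \<xi> - (N \<xi>)\<^sup>2 / 4 - a"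
definition feas where "feas V Y' Z a \<xi> \<longleftrightarrow> \<xi> \<in> V \<and> (\<forall>\<psi>\<in>Y'. \<forall>\<theta>\<in>Z. Q a \<xi> \<psi> \<theta> \<ge> 0)"
definition opt where
  "opt V Y' Z a \<xi> \<longleftrightarrow> feas V Y' Z a \<xi> \<and> (\<forall>a' \<xi>'. feas V Y' Z a' \<xi>' \<longrightarrow> J a' \<xi>' \<le> J a \<xi>)"

lemma scale_X: "u \<in> X \<Longrightarrow> (\<lambda>x. c * u x) \<in> X"
  using X_lincomb[of u u c 0] by simp

lemma diff_X: "u \<in> X \<Longrightarrow> v \<in> X \<Longrightarrow> (\<lambda>x. u x - v x) \<in> X"
  using X_lincomb[of u v 1 "-1"] by simp

lemma N_zero: "N (\<lambda>x. 0) = 0"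
  using N_lincomb[OF zero_X zero_X, of 0 0] N_nonneg[of "\<lambda>x. 0"] by simp

lemma N_scale: "u \<in> X \<Longrightarrow> N (\<lambda>x. c * u x) \<le> \<bar>c\<bar> * N u"
  using N_lincomb[of u u c 0] by simp

lemma f_scale: "u \<in> X \<Longrightarrow> f (\<lambda>x. c * u x) = c * f u"
  using f_lincomb[of u u c 0] by simp

lemma f_diff: "u \<in> X \<Longrightarrow> v \<in> X \<Longrightarrow> \<bar>f u - f v\<bar> \<le> F * N (\<lambda>x. u x - v x)"
  using f_lincomb[of u v 1 "-1"] f_bound[OF diff_X, of u v] by simp

lemma adv_scale: "u \<in> X \<Longrightarrow> \<psi> \<in> Y \<Longrightarrow> \<theta> \<in> X \<Longrightarrow> adv (\<lambda>x. c * u x) \<psi> \<theta> = c * adv u \<psi> \<theta>"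
  using adv_lincomb[of u u \<psi> \<theta> c 0] by simp

lemma Pe_C: "Pe * C \<ge> 0" using consts_nonneg by simp

lemma Q_diff:
  assumes "u \<in> X" "v \<in> X" "\<psi> \<in> Y" "\<theta> \<in> X"
  shows "Q a u \<psi> \<theta> \<ge> Q b v \<psi> \<theta> - \<bar>a - b\<bar> * (N \<psi>)\<^sup>2 - Pe * C * N (\<lambda>x. u x - v x) * (N \<psi> * N \<theta>)"
proof -
  have "\<bar>adv u \<psi> \<theta> - adv v \<psi> \<theta>\<bar> \<le> C * N (\<lambda>x. u x - v x) * (N \<psi> * N \<theta>)"
    using adv_bound[OF diff_X[OF assms(1,2)] assms(3,4)] adv_lincomb[OF assms, of 1 "-1"] by simp
  then have "Pe * (adv u \<psi> \<theta> - adv v \<psi> \<theta>) \<le> Pe * (C * N (\<lambda>x. u x - v x) * (N \<psi> * N \<theta>))"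
    using consts_nonneg(3) by (intro mult_left_mono) linarith+
  moreover have "(b - a) * (N \<psi>)\<^sup>2 \<le> \<bar>a - b\<bar> * (N \<psi>)\<^sup>2" by (intro mult_right_mono) auto
  ultimately show ?thesis unfolding Q_def by (simp add: algebra_simps)
qed

text \<open>\<open>Q\<close> is affine in the pair \<open>(a, \<xi>)\<close>, so lower bounds on it
  survive midpoints.\<close>

lemma Q_midpoint:
  assumes "u \<in> X" "v \<in> X" "\<psi> \<in> Y" "\<theta> \<in> X"
  shows "Q (1/2 * a + 1/2 * b) (\<lambda>x. 1/2 * u x + 1/2 * v x) \<psi> \<theta> = 1/2 * Q a u \<psi> \<theta> + 1/2 * Q b v \<psi> \<theta>"
  unfolding Q_def adv_lincomb[OF assms] by (simp add: algebra_simps)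

text \<open>Strong concavity; 1/16 is the 1/4 in front of the squared norm in \<open>J\<close> times
  the 1/4 of the parallelogram law.\<close>

lemma J_midpoint:
  assumes "u \<in> X" "v \<in> X"
  shows "J (1/2 * a + 1/2 * b) (\<lambda>x. 1/2 * u x + 1/2 * v x) = 1/2 * J a u + 1/2 * J b v + (N (\<lambda>x. u x - v x))\<^sup>2 / 16"
  unfolding J_def f_lincomb[OF assms] N_midpoint[OF assms] by (simp add: field_simps)

text \<open>\<open>J a u + a\<close> no longer depends on \<open>a\<close>. The estimate therefore
  compares objectives at nearby \<xi> and also recovers closeness of the numbers \<open>a\<close>
  from that of the values and of the \<xi>.\<close>

lemma J_diff:
  assumes "u \<in> X" "v \<in> X" "N u \<le> B" "N v \<le> B"
  shows "\<bar>(J a u + a) - (J b v + b)\<bar> \<le> (F + B) * N (\<lambda>x. u x - v x)"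
proof -
  let ?d = "N (\<lambda>x. u x - v x)"
  have "\<bar>(N u)\<^sup>2 - (N v)\<^sup>2\<bar> = \<bar>N u - N v\<bar> * (N u + N v)"
    using N_nonneg[of u] N_nonneg[of v] by (simp add: power2_eq_square square_diff_square_factored abs_mult)
  also have "\<dots> \<le> ?d * (2 * B)"
    using assms(3,4) N_nonneg[of u] N_nonneg[of v] by (intro mult_mono N_diff X_W assms(1,2) N_nonneg) simp_all
  finally have "\<bar>(N u)\<^sup>2 - (N v)\<^sup>2\<bar> \<le> 2 * (B * ?d)" by (simp add: mult_ac)
  moreover have "0 \<le> B * ?d" using N_nonneg[of u] N_nonneg assms(3) by (intro mult_nonneg_nonneg) linarith+
  ultimately show ?thesis
    using f_diff[OF assms(1,2)] unfolding J_def distrib_right by linarith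
qed

text \<open>
  An approximately feasible pair becomes feasible after increasing \<open>a\<close> and shrinking \<open>\<xi>\<close>,
  because \<open>Q(a + \<delta>, (1 - \<delta>)\<xi>) = (1 - \<delta>) Q(a, \<xi>) + \<delta> (a + 1) \<parallel>\<nabla>\<psi>\<parallel>\<^sup>2 + \<delta> \<parallel>\<nabla>\<theta>\<parallel>\<^sup>2\<close>.
\<close>

lemma Q_perturb:
  assumes "u \<in> X" "\<psi> \<in> Y" "\<theta> \<in> X" and a: "a \<ge> 0" and \<delta>: "0 \<le> \<delta>" "\<delta> \<le> 1" and \<gamma>: "0 \<le> \<gamma>" "\<gamma> * (1 + Pe * C) \<le> \<delta>"
    and Q: "Q a u \<psi> \<theta> \<ge> - (\<gamma> * (N \<psi>)\<^sup>2) - Pe * C * \<gamma> * (N \<psi> * N \<theta>)"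
  shows "Q (a + \<delta>) (\<lambda>x. (1 - \<delta>) * u x) \<psi> \<theta> \<ge> 0"
proof -
  define p q K where "p = N \<psi>" and "q = N \<theta>" and "K = Pe * C"
  have nn: "0 \<le> p" "0 \<le> q" "0 \<le> K" unfolding p_def q_def K_def by (intro N_nonneg Pe_C)+
  have eq: "Q (a + \<delta>) (\<lambda>x. (1 - \<delta>) * u x) \<psi> \<theta> = (1 - \<delta>) * Q a u \<psi> \<theta> + \<delta> * a * p\<^sup>2 + \<delta> * (p\<^sup>2 + q\<^sup>2)"
    unfolding Q_def adv_scale[OF assms(1-3)] p_def q_def by (simp add: algebra_simps)
  \<comment> \<open>The tolerated infeasibility. The product \<open>p * q\<close> is at most the sum
    of the squares of \<open>p\<close> and \<open>q\<close>, so \<open>R\<close> is at most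
    \<open>\<gamma> * (1 + K)\<close>, hence \<delta>, times that sum, which is the surplus created
    by the perturbation.\<close>
  define R where "R = \<gamma> * p\<^sup>2 + K * \<gamma> * (p * q)"
  have R0: "R \<ge> 0" unfolding R_def using nn \<gamma>(1) by simp
  have "p * q \<le> p\<^sup>2 + q\<^sup>2" using zero_le_power2[of "p - q"] mult_nonneg_nonneg[OF nn(1,2)]
    unfolding power2_diff by linarith
  then have "R \<le> \<gamma> * (p\<^sup>2 + q\<^sup>2) + K * \<gamma> * (p\<^sup>2 + q\<^sup>2)"
    unfolding R_def using nn \<gamma>(1) by (intro add_mono mult_left_mono) simp_all
  also have "\<dots> = (\<gamma> * (1 + K)) * (p\<^sup>2 + q\<^sup>2)" by (simp add: algebra_simps)
  also have "\<dots> \<le> \<delta> * (p\<^sup>2 + q\<^sup>2)" using \<gamma>(2) unfolding K_def by (intro mult_right_mono) simp_all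
  finally have R1: "R \<le> \<delta> * (p\<^sup>2 + q\<^sup>2)" .
  have "(1 - \<delta>) * Q a u \<psi> \<theta> \<ge> (1 - \<delta>) * (- R)"
    using Q \<delta> unfolding R_def p_def q_def K_def by (intro mult_left_mono) linarith+
  moreover have "(1 - \<delta>) * R \<le> 1 * R" using R0 \<delta> by (intro mult_right_mono) simp_all
  moreover have "0 \<le> \<delta> * a * p\<^sup>2" using \<delta> a by simp
  ultimately show ?thesis using R1 unfolding eq mult_minus_right by linarith
qed

lemma J_perturb:
  assumes "u \<in> X" "0 \<le> \<delta>" "\<delta> \<le> 1"
  shows "J (a + \<delta>) (\<lambda>x. (1 - \<delta>) * u x) \<ge> J a u - \<delta> * (F * N u + 1)"
proof -
  have "\<delta> * f u \<le> \<delta> * (F * N u)" using f_bound[OF assms(1)] assms(2) by (intro mult_left_mono) linarith+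
  moreover have "(N (\<lambda>x. (1 - \<delta>) * u x))\<^sup>2 \<le> (N u)\<^sup>2"
  proof (rule power_mono[OF _ N_nonneg])
    have "\<bar>1 - \<delta>\<bar> * N u \<le> 1 * N u" using assms by (intro mult_right_mono N_nonneg) simp
    then show "N (\<lambda>x. (1 - \<delta>) * u x) \<le> N u" using N_scale[OF assms(1), of "1 - \<delta>"] by simp
  qed
  ultimately show ?thesis unfolding J_def f_scale[OF assms(1)] by (simp add: algebra_simps)
qed

text \<open>Comparison with the feasible pair \<open>(0, 0)\<close> bounds a quarter of the squared
  norm plus \<open>a\<close> by \<open>F * N \<xi>\<close>, and testing with \<theta> = 0 shows that
  \<open>a\<close> is nonnegative. The constants do not depend on the spaces, so they serve the
  continuous and all discrete problems alike.\<close>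

lemma optimizer_bounds:
  assumes o: "opt V Y' Z a \<xi>" and V: "V \<subseteq> X" "(\<lambda>x. 0) \<in> V" and Y': "Y' \<subseteq> Y" and Z: "Z \<subseteq> X" "(\<lambda>x. 0) \<in> Z"
  shows "\<xi> \<in> X" "0 \<le> a" "a \<le> F * (4 * F)" "N \<xi> \<le> 4 * F"
proof -
  show \<xi>: "\<xi> \<in> X" using o V unfolding opt_def feas_def by auto
  show a0: "0 \<le> a"
  proof (cases "\<exists>\<psi>\<in>Y'. N \<psi> \<noteq> 0")
    case True
    then obtain \<psi> where \<psi>: "\<psi> \<in> Y'" "N \<psi> \<noteq> 0" by blast
    have "adv \<xi> \<psi> (\<lambda>x. 0) = 0"
      using adv_bound[OF \<xi> subsetD[OF Y' \<psi>(1)] zero_X] by (simp add: N_zero)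
    moreover have "Q a \<xi> \<psi> (\<lambda>x. 0) \<ge> 0" using o \<psi>(1) Z(2) unfolding opt_def feas_def by blast
    ultimately have "0 \<le> a * (N \<psi>)\<^sup>2" by (simp add: Q_def N_zero)
    then show ?thesis using \<psi>(2) by (simp add: zero_le_mult_iff)
  next
    case False
    \<comment> \<open>If \<open>N\<close> vanishes on all of \<open>Y'\<close>, the constraint does
      not see \<open>a\<close>, and lowering \<open>a\<close> would improve the objective.\<close>
    then have "feas V Y' Z (a - 1) \<xi>" using o unfolding opt_def feas_def Q_def by simp
    then have "J (a - 1) \<xi> \<le> J a \<xi>" using o unfolding opt_def by blast
    then show ?thesis by (simp add: J_def)
  qed
  have "adv (\<lambda>x. 0) \<psi> \<theta> = 0" if "\<psi> \<in> Y'" "\<theta> \<in> Z" for \<psi> \<theta>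
    using adv_bound[OF zero_X subsetD[OF Y' that(1)] subsetD[OF Z(1) that(2)]] by (simp add: N_zero)
  then have "feas V Y' Z 0 (\<lambda>x. 0)" unfolding feas_def Q_def using V(2) by simp
  then have "J 0 (\<lambda>x. 0) \<le> J a \<xi>" using o unfolding opt_def by blast
  moreover have "f (\<lambda>x. 0) = 0" using f_bound[OF zero_X] by (simp add: N_zero)
  ultimately have *: "(N \<xi>)\<^sup>2 / 4 + a \<le> F * N \<xi>"
    using f_bound[OF \<xi>] by (simp add: J_def N_zero)
  then have "N \<xi> * N \<xi> \<le> (4 * F) * N \<xi>" using a0 by (simp add: power2_eq_square)
  then show N4: "N \<xi> \<le> 4 * F"
    using N_nonneg[of \<xi>] consts_nonneg(2) by (cases "N \<xi> = 0") (simp_all add: mult_le_cancel_right)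
  show "a \<le> F * (4 * F)"
    using * mult_left_mono[OF N4 consts_nonneg(2)] zero_le_power2[of "N \<xi>"] by linarith
qed

text \<open>
  Replaces weak compactness. The sets \<open>K n\<close> are closed under midpoints and decreasing, so strong
  concavity of \<open>J\<close> makes near-maximizers of \<open>J\<close> on \<open>K n\<close> a Cauchy sequence; its late terms are
  almost feasible.
\<close>

lemma asymptotically_feasible_objective:
  fixes \<alpha> :: "nat \<Rightarrow> real" and \<eta> :: "nat \<Rightarrow> 'p \<Rightarrow> real"
  assumes \<alpha>: "\<And>n. 0 \<le> \<alpha> n" and \<eta>: "\<And>n. \<eta> n \<in> X" "\<And>n. N (\<eta> n) \<le> B"
    and Q: "\<And>\<psi> \<theta> e. \<psi> \<in> Y \<Longrightarrow> \<theta> \<in> X \<Longrightarrow> 0 < e \<Longrightarrow> \<forall>\<^sub>F n in sequentially. Q (\<alpha> n) (\<eta> n) \<psi> \<theta> \<ge> - e"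
    and L: "\<And>a \<xi>. feas X Y X a \<xi> \<Longrightarrow> J a \<xi> \<le> L"
    and \<epsilon>: "0 < \<epsilon>"
  shows "\<forall>\<^sub>F n in sequentially. J (\<alpha> n) (\<eta> n) < L + \<epsilon>"
proof (rule ccontr)
  assume nev: "\<not> ?thesis"
  have fr: "\<exists>m\<ge>n. J (\<alpha> m) (\<eta> m) \<ge> L + \<epsilon>" for n
    using nev unfolding eventually_sequentially not_ex not_all not_imp not_less by blast
  have B0: "0 \<le> B" using \<eta>(2)[of 0] N_nonneg[of "\<eta> 0"] by linarith
  \<comment> \<open>An intersection of convex conditions that all hold along the tail from
    \<open>n\<close>; it stands in for the closed convex hull of that tail.\<close>
  define K where "K n = {(a, \<xi>). 0 \<le> a \<and> \<xi> \<in> X \<and> N \<xi> \<le> B \<and> (\<forall>\<psi>\<in>Y. \<forall>\<theta>\<in>X. \<forall>e\<ge>0.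
    (\<forall>m\<ge>n. Q (\<alpha> m) (\<eta> m) \<psi> \<theta> \<ge> - e) \<longrightarrow> Q a \<xi> \<psi> \<theta> \<ge> - e)}" for n :: nat
  define S where "S n = case_prod J ` K n" for n
  have K_tail: "(\<alpha> m, \<eta> m) \<in> K n" if "n \<le> m" for m n using that \<alpha> \<eta> unfolding K_def by simp
  have K_mono: "K n \<subseteq> K m" if "m \<le> n" for m n
    using le_trans[OF that] unfolding K_def by (intro Collect_mono) (simp only: split_beta, blast)
  have K_mid: "(1/2 * a + 1/2 * b, \<lambda>x. 1/2 * u x + 1/2 * v x) \<in> K n" if u: "(a, u) \<in> K n" and v: "(b, v) \<in> K n" for a b u v n
  proof -
    note u' = u[unfolded K_def mem_Collect_eq prod.case] and v' = v[unfolded K_def mem_Collect_eq prod.case]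
    have X: "u \<in> X" "v \<in> X" "0 \<le> a" "0 \<le> b" "N u \<le> B" "N v \<le> B" using u' v' by simp_all
    have "N (\<lambda>x. 1/2 * u x + 1/2 * v x) \<le> B" using N_lincomb[OF X(1,2), of "1/2" "1/2"] X(5,6) by simp
    moreover have "Q (1/2 * a + 1/2 * b) (\<lambda>x. 1/2 * u x + 1/2 * v x) \<psi> \<theta> \<ge> - e"
      if t: "\<psi> \<in> Y" "\<theta> \<in> X" and e: "0 \<le> e" "\<forall>m\<ge>n. Q (\<alpha> m) (\<eta> m) \<psi> \<theta> \<ge> - e" for \<psi> \<theta> e
    proof -
      have "Q a u \<psi> \<theta> \<ge> - e" "Q b v \<psi> \<theta> \<ge> - e" using u' v' t e by simp_all
      then show ?thesis unfolding Q_midpoint[OF X(1,2) t] by linarith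
    qed
    ultimately show ?thesis using X X_lincomb[OF X(1,2), of "1/2" "1/2"] unfolding K_def by simp
  qed
  have J_le: "J a u \<le> F * B" if "(a, u) \<in> K n" for a u n
  proof -
    have u: "0 \<le> a" "u \<in> X" "N u \<le> B" using that unfolding K_def by simp_all
    show ?thesis
      using f_bound[OF u(2)] mult_left_mono[OF u(3) consts_nonneg(2)] u(1) zero_le_power2[of "N u"] unfolding J_def by linarith
  qed
  have bdd: "bdd_above (S n)" for n
    unfolding S_def bdd_above_def using J_le by (intro exI[of _ "F * B"]) auto
  define s where "s n = Sup (S n)" for n
  have s_ge: "J a u \<le> s n" if "(a, u) \<in> K n" for a u n
    unfolding s_def by (rule cSup_upper[OF _ bdd]) (use that in \<open>auto simp: S_def intro!: image_eqI[of _ _ "(a, u)"]\<close>)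
  have ne: "S n \<noteq> {}" for n using K_tail[of n n] unfolding S_def by auto
  have s_anti: "s n \<le> s m" if "m \<le> n" for m n
    unfolding s_def by (rule cSup_subset_mono[OF ne bdd]) (unfold S_def, rule image_mono[OF K_mono[OF that]])
  have s_low: "L + \<epsilon> \<le> s n" for n
  proof -
    obtain m where "m \<ge> n" "J (\<alpha> m) (\<eta> m) \<ge> L + \<epsilon>" using fr[of n] by blast
    then show ?thesis using s_ge[OF K_tail, of n m] by linarith
  qed
  have "convergent s"
  proof (rule Bseq_monoseq_convergent)
    show "monoseq s" unfolding monoseq_def using s_anti by blast
    have "\<bar>s n\<bar> \<le> \<bar>L + \<epsilon>\<bar> + \<bar>s 0\<bar>" for n using s_low[of n] s_anti[of 0 n] by simp
    then show "Bseq s" by (intro BseqI'[of _ "\<bar>L + \<epsilon>\<bar> + \<bar>s 0\<bar>"]) simp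
  qed
  then obtain \<sigma> where \<sigma>: "s \<longlonglongrightarrow> \<sigma>" unfolding convergent_def by blast
  have "\<exists>p. p \<in> K n \<and> case_prod J p > s n - 1 / real (Suc n)" for n
  proof -
    have "\<exists>y\<in>S n. s n - 1 / real (Suc n) < y" using less_cSup_iff[OF ne bdd, of "s n - 1 / real (Suc n)" n] unfolding s_def by simp
    then show ?thesis unfolding S_def by blast
  qed
  then obtain p where p: "\<And>n. p n \<in> K n" "\<And>n. case_prod J (p n) > s n - 1 / real (Suc n)" by metis
  define a u where "a n = fst (p n)" and "u n = snd (p n)" for n
  have pk: "(a n, u n) \<in> K n" "J (a n) (u n) > s n - 1 / real (Suc n)" for n
    using p[of n] unfolding a_def u_def by (simp_all add: split_beta)
  have au: "0 \<le> a n" "u n \<in> X" "N (u n) \<le> B" for n using pk(1)[of n] unfolding K_def by simp_all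
  define d where "d n = \<bar>s n - \<sigma>\<bar> + 1 / real (Suc n)" for n
  have "(\<lambda>n. \<bar>s n - \<sigma>\<bar> + 1 / real (Suc n)) \<longlonglongrightarrow> 0 + 0"
    by (intro tendsto_add LIMSEQ_Suc[OF lim_1_over_n] tendsto_rabs_zero LIM_zero \<sigma>)
  then have d_lim: "d \<longlonglongrightarrow> 0" unfolding d_def by simp
  have aux: "D \<le> 8 * ((A + p) + (B + q))"
    if "1/2 * x + 1/2 * y + D / 16 \<le> S" "S - p < x" "S' - q < y" "S - \<sigma> \<le> A" "- (S' - \<sigma>) \<le> B" for x y D S S' p q A B :: real
    using that by simp
  \<comment> \<open>The midpoint of near-maximizers from \<open>K m\<close> and \<open>K n\<close>
    still lies in \<open>K m\<close>, so its objective is at most \<open>s m\<close>; the gain from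
    strong concavity is then bounded by the two deficits.\<close>
  have u_le: "(N (\<lambda>x. u m x - u n x))\<^sup>2 \<le> 8 * (d m + d n)" if mn: "m \<le> n" for m n
  proof -
    have "(a n, u n) \<in> K m" using K_mono[OF mn] pk(1)[of n] by blast
    from s_ge[OF K_mid[OF pk(1)[of m] this]]
    have "1/2 * J (a m) (u m) + 1/2 * J (a n) (u n) + (N (\<lambda>x. u m x - u n x))\<^sup>2 / 16 \<le> s m"
      unfolding J_midpoint[OF au(2) au(2)] .
    then show ?thesis unfolding d_def by (rule aux[OF _ pk(2)[of m] pk(2)[of n] abs_ge_self abs_ge_minus_self])
  qed
  have J_near: "\<bar>J (a n) (u n) - \<sigma>\<bar> \<le> d n" for n
    using pk(2)[of n] s_ge[OF pk(1)[of n]] unfolding d_def by linarith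
  \<comment> \<open>Tolerances, chosen from the end backwards: \<delta> costs at most a quarter of
    \<epsilon> in the objective, \<gamma> is the infeasibility that a perturbation by \<delta>
    repairs, and \<tau> is a distance between the \<xi> that keeps the values of \<open>a\<close>
    within \<gamma> as well.\<close>
  define \<delta> where "\<delta> = min 1 (\<epsilon> / (4 * (F * B + 1)))"
  have FB: "0 < F * B + 1" using mult_nonneg_nonneg[OF consts_nonneg(2) B0] by linarith
  have \<delta>: "0 < \<delta>" "\<delta> \<le> 1" unfolding \<delta>_def using \<epsilon> FB by simp_all
  have \<delta>2: "\<delta> * (F * B + 1) \<le> \<epsilon> / 4" unfolding \<delta>_def by (rule min_divide_mult_le[OF FB]) simp
  define \<gamma> where "\<gamma> = \<delta> / (1 + Pe * C)"
  have \<gamma>: "0 < \<gamma>" "\<gamma> * (1 + Pe * C) \<le> \<delta>" unfolding \<gamma>_def using \<delta> Pe_C by simp_all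
  define \<tau> where "\<tau> = min \<gamma> (\<gamma> / (2 * (F + B + 1)))"
  have FB2: "0 < F + B + 1" using consts_nonneg(2) B0 by linarith
  have \<tau>: "0 < \<tau>" "\<tau> \<le> \<gamma>" "(F + B) * \<tau> \<le> \<gamma> / 2"
  proof -
    show "0 < \<tau>" "\<tau> \<le> \<gamma>" unfolding \<tau>_def using \<gamma> FB2 by simp_all
    have "(F + B) * \<tau> \<le> \<tau> * (F + B + 1)" using \<open>0 < \<tau>\<close> by (simp add: algebra_simps)
    also have "\<dots> \<le> \<gamma> / 2" unfolding \<tau>_def by (rule min_divide_mult_le[OF FB2]) simp
    finally show "(F + B) * \<tau> \<le> \<gamma> / 2" .
  qed
  \<comment> \<open>In this order the three bounds keep late \<xi> within \<tau> of each other,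
    since \<open>8 * (d m + d n)\<close> is then at most the square of \<tau>, keep late
    \<open>a\<close> within \<gamma>, and keep the deficit below a quarter of \<epsilon>.\<close>
  have "\<forall>\<^sub>F n in sequentially. d n < min (\<tau>\<^sup>2 / 16) (min (\<gamma> / 4) (\<epsilon> / 4))"
    by (rule order_tendstoD(2)[OF d_lim]) (use \<tau> \<gamma> \<epsilon> in simp)
  then obtain n where n: "\<And>m. n \<le> m \<Longrightarrow> d m < min (\<tau>\<^sup>2 / 16) (min (\<gamma> / 4) (\<epsilon> / 4))"
    unfolding eventually_sequentially by blast
  have close_u: "N (\<lambda>x. u n x - u m x) \<le> \<tau>" if "n \<le> m" for m
  proof (rule power2_le_imp_le)
    show "(N (\<lambda>x. u n x - u m x))\<^sup>2 \<le> \<tau>\<^sup>2" using u_le[OF that] n[of n] n[OF that] by simp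
  qed (use \<tau> in simp)
  have close_a: "\<bar>a n - a m\<bar> \<le> \<gamma>" if "n \<le> m" for m
  proof -
    have "(F + B) * N (\<lambda>x. u n x - u m x) \<le> (F + B) * \<tau>"
      using consts_nonneg(2) B0 by (intro mult_left_mono close_u that) simp
    then show ?thesis
      using J_diff[OF au(2)[of n] au(2)[of m] au(3) au(3), where a="a n" and b="a m"] \<tau>(3) J_near[of n] J_near[of m] n[of n] n[OF that]
      unfolding abs_le_iff min_less_iff_conj by (intro conjI) linarith+
  qed
  have Q_near: "Q (a n) (u n) \<psi> \<theta> \<ge> - (\<gamma> * (N \<psi>)\<^sup>2) - Pe * C * \<gamma> * (N \<psi> * N \<theta>)" if t: "\<psi> \<in> Y" "\<theta> \<in> X" for \<psi> \<theta>
  proof (rule field_le_epsilon)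
    fix e :: real assume e: "0 < e"
    obtain M where M: "\<And>m. M \<le> m \<Longrightarrow> Q (\<alpha> m) (\<eta> m) \<psi> \<theta> \<ge> - e"
      using Q[OF t e] unfolding eventually_sequentially by blast
    \<comment> \<open>\<open>n\<close> is fixed independently of \<psi>, \<theta> and
      \<open>e\<close>, whereas the bound \<open>- e\<close> may set in only at a later index. A
      later near-maximizer satisfies it and is close to the one with index \<open>n\<close>, which
      inherits the bound up to the tolerance \<gamma>.\<close>
    define m where "m = max n M"
    have "Q (a m) (u m) \<psi> \<theta> \<ge> - e"
      using pk(1)[of m] t e M unfolding K_def m_def by auto
    moreover have "\<bar>a n - a m\<bar> * (N \<psi>)\<^sup>2 \<le> \<gamma> * (N \<psi>)\<^sup>2"
      by (intro mult_right_mono close_a) (simp_all add: m_def)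
    moreover have "Pe * C * N (\<lambda>x. u n x - u m x) * (N \<psi> * N \<theta>) \<le> Pe * C * \<gamma> * (N \<psi> * N \<theta>)"
      using close_u[of m] \<tau>(2) by (intro mult_right_mono mult_left_mono Pe_C mult_nonneg_nonneg N_nonneg) (simp add: m_def)
    ultimately show "- (\<gamma> * (N \<psi>)\<^sup>2) - Pe * C * \<gamma> * (N \<psi> * N \<theta>) \<le> Q (a n) (u n) \<psi> \<theta> + e"
      using Q_diff[OF au(2)[of n] au(2)[of m] t, where a="a n" and b="a m"] by linarith
  qed
  have "feas X Y X (a n + \<delta>) (\<lambda>x. (1 - \<delta>) * u n x)"
    unfolding feas_def
    by (intro conjI ballI scale_X au(2) Q_perturb[OF au(2) _ _ au(1) less_imp_le[OF \<delta>(1)] \<delta>(2) less_imp_le[OF \<gamma>(1)] \<gamma>(2) Q_near])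
  from L[OF this] have "J (a n) (u n) - \<delta> * (F * N (u n) + 1) \<le> L"
    using J_perturb[OF au(2)[of n] less_imp_le[OF \<delta>(1)] \<delta>(2), where a="a n"] by linarith
  moreover have "\<delta> * (F * N (u n) + 1) \<le> \<delta> * (F * B + 1)"
    using \<delta>(1) consts_nonneg(2) au(3) by (intro mult_left_mono add_mono) simp_all
  ultimately have "J (a n) (u n) \<le> L + \<epsilon> / 4" using \<delta>2 by linarith
  moreover have "1 / real (Suc n) < \<epsilon> / 4" using n[of n] unfolding d_def by (smt (verit) min_less_iff_conj order_refl)
  ultimately show False using pk(2)[of n] s_low[of n] \<epsilon> by linarith
qed

text \<open>The discrete constraints test fewer functions, but every fixed pair inherits them up to
  an error tending to 0, because the optimizers are uniformly bounded and the test spaces become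
  dense. Density of the spaces \<open>\<Xi> n\<close> enters through the lower bound on the
  values.\<close>

theorem galerkin_convergence:
  fixes \<Xi> \<Psi> \<Theta> :: "nat \<Rightarrow> ('p \<Rightarrow> real) set"
  assumes \<Xi>: "\<And>n. \<Xi> n \<subseteq> X" "\<And>n. (\<lambda>x. 0) \<in> \<Xi> n" "\<And>n c u. u \<in> \<Xi> n \<Longrightarrow> (\<lambda>x. c * u x) \<in> \<Xi> n"
    and \<Psi>: "\<And>n. \<Psi> n \<subseteq> Y" and \<Theta>: "\<And>n. \<Theta> n \<subseteq> X" "\<And>n. (\<lambda>x. 0) \<in> \<Theta> n"
    and dense_\<Xi>: "\<And>u. u \<in> X \<Longrightarrow> \<exists>v. (\<forall>n. v n \<in> \<Xi> n) \<and> (\<lambda>n. N (\<lambda>x. v n x - u x)) \<longlonglongrightarrow> 0"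
    and dense_\<Theta>: "\<And>u. u \<in> X \<Longrightarrow> \<exists>v. (\<forall>n. v n \<in> \<Theta> n) \<and> (\<lambda>n. N (\<lambda>x. v n x - u x)) \<longlonglongrightarrow> 0"
    and dense_\<Psi>: "\<And>u. u \<in> Y \<Longrightarrow> \<exists>v. (\<forall>n. v n \<in> \<Psi> n) \<and> (\<lambda>n. N (\<lambda>x. v n x - u x)) \<longlonglongrightarrow> 0"
    and o: "opt X Y X a' \<xi>'" and o_n: "\<And>n. opt (\<Xi> n) (\<Psi> n) (\<Theta> n) (a n) (\<xi> n)"
  shows "(\<lambda>n. J (a n) (\<xi> n)) \<longlonglongrightarrow> J a' \<xi>'" "a \<longlonglongrightarrow> a'" "(\<lambda>n. N (\<lambda>x. \<xi> n x - \<xi>' x)) \<longlonglongrightarrow> 0"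
proof -
  note b = optimizer_bounds[OF o order_refl zero_X order_refl order_refl zero_X]
  note b_n = optimizer_bounds[OF o_n \<Xi>(1,2) \<Psi> \<Theta>(1,2)]
  let ?L = "J a' \<xi>'" and ?B = "4 * F"
  have L: "J a u \<le> ?L" if "feas X Y X a u" for a u using o that unfolding opt_def by blast
  have asym: "\<forall>\<^sub>F n in sequentially. Q (a n) (\<xi> n) \<psi> \<theta> \<ge> - e" if t: "\<psi> \<in> Y" "\<theta> \<in> X" and e: "0 < e" for \<psi> \<theta> e
  proof -
    obtain v where v: "\<And>n. v n \<in> \<Psi> n" "(\<lambda>n. N (\<lambda>x. v n x - \<psi> x)) \<longlonglongrightarrow> 0" using dense_\<Psi>[OF t(1)] by blast
    obtain w where w: "\<And>n. w n \<in> \<Theta> n" "(\<lambda>n. N (\<lambda>x. w n x - \<theta> x)) \<longlonglongrightarrow> 0" using dense_\<Theta>[OF t(2)] by blast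
    have vY: "v n \<in> Y" and wX: "w n \<in> X" for n using v(1) w(1) \<Psi> \<Theta>(1) by blast+
    have Nv: "(\<lambda>n. N (v n)) \<longlonglongrightarrow> N \<psi>"
      by (rule LIM_zero_cancel, rule tendsto_rabs_zero_cancel, rule tendsto_sandwich[OF always_eventually always_eventually tendsto_const v(2)])
        (simp_all add: N_diff Y_W vY t)
    have Nw: "(\<lambda>n. N (w n)) \<longlonglongrightarrow> N \<theta>"
      by (rule LIM_zero_cancel, rule tendsto_rabs_zero_cancel, rule tendsto_sandwich[OF always_eventually always_eventually tendsto_const w(2)])
        (simp_all add: N_diff X_W wX t)
    \<comment> \<open>Bounds the effect of replacing \<psi> and \<theta> by their approximations;
      \<open>F * (4 * F)\<close> and \<open>?B\<close> are the constants of
      \<open>optimizer_bounds\<close>.\<close>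
    define r where "r n = F * (4 * F) * \<bar>(N (v n))\<^sup>2 - (N \<psi>)\<^sup>2\<bar> + \<bar>(N (w n))\<^sup>2 - (N \<theta>)\<^sup>2\<bar>
      + Pe * (C * ?B * (N (\<lambda>x. v n x - \<psi> x) * N (w n) + N \<psi> * N (\<lambda>x. w n x - \<theta> x)))" for n
    have "(\<lambda>n. F * (4 * F) * \<bar>(N (v n))\<^sup>2 - (N \<psi>)\<^sup>2\<bar> + \<bar>(N (w n))\<^sup>2 - (N \<theta>)\<^sup>2\<bar>
      + Pe * (C * ?B * (N (\<lambda>x. v n x - \<psi> x) * N (w n) + N \<psi> * N (\<lambda>x. w n x - \<theta> x)))) \<longlonglongrightarrow>
        F * (4 * F) * \<bar>(N \<psi>)\<^sup>2 - (N \<psi>)\<^sup>2\<bar> + \<bar>(N \<theta>)\<^sup>2 - (N \<theta>)\<^sup>2\<bar> + Pe * (C * ?B * (0 * N \<theta> + N \<psi> * 0))"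
      by (intro tendsto_intros Nv Nw v(2) w(2))
    then have r: "r \<longlonglongrightarrow> 0" unfolding r_def by simp
    have Qr: "Q (a n) (\<xi> n) \<psi> \<theta> \<ge> - r n" for n
    proof -
      have "Q (a n) (\<xi> n) (v n) (w n) \<ge> 0" using o_n[of n] v(1)[of n] w(1)[of n] unfolding opt_def feas_def by blast
      moreover have "a n * ((N (v n))\<^sup>2 - (N \<psi>)\<^sup>2) \<le> F * (4 * F) * \<bar>(N (v n))\<^sup>2 - (N \<psi>)\<^sup>2\<bar>"
        by (rule order_trans[OF mult_left_mono[OF abs_ge_self b_n(2)] mult_right_mono[OF b_n(3) abs_ge_zero]])
      moreover have "Pe * \<bar>adv (\<xi> n) (v n) (w n) - adv (\<xi> n) \<psi> \<theta>\<bar> \<le>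
        Pe * (C * ?B * (N (\<lambda>x. v n x - \<psi> x) * N (w n) + N \<psi> * N (\<lambda>x. w n x - \<theta> x)))"
        using adv_diff[OF b_n(1)[of n] t vY wX, of n n] b_n(4)[of n]
        by (intro mult_left_mono consts_nonneg, elim order_trans)
          (intro mult_right_mono mult_left_mono consts_nonneg add_nonneg_nonneg mult_nonneg_nonneg N_nonneg)
      moreover have "Pe * (adv (\<xi> n) \<psi> \<theta> - adv (\<xi> n) (v n) (w n)) \<le> Pe * \<bar>adv (\<xi> n) (v n) (w n) - adv (\<xi> n) \<psi> \<theta>\<bar>"
        by (intro mult_left_mono consts_nonneg) simp
      moreover have "(N (w n))\<^sup>2 - (N \<theta>)\<^sup>2 \<le> \<bar>(N (w n))\<^sup>2 - (N \<theta>)\<^sup>2\<bar>" by simp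
      ultimately show ?thesis unfolding Q_def r_def right_diff_distrib by linarith
    qed
    have "\<forall>\<^sub>F n in sequentially. r n < e" by (rule order_tendstoD(2)[OF r e])
    then show ?thesis
    proof eventually_elim
      case (elim n) then show ?case using Qr[of n] by linarith
    qed
  qed
  have upper: "\<forall>\<^sub>F n in sequentially. J (a n) (\<xi> n) < ?L + \<epsilon>" if "0 < \<epsilon>" for \<epsilon>
    by (rule asymptotically_feasible_objective[OF b_n(2) b_n(1) b_n(4) asym L that])
  have lower: "\<forall>\<^sub>F n in sequentially. J (a n) (\<xi> n) > ?L - \<epsilon>" if \<epsilon>: "0 < \<epsilon>" for \<epsilon>
  proof -
    obtain v where v: "\<And>n. v n \<in> \<Xi> n" "(\<lambda>n. N (\<lambda>x. v n x - \<xi>' x)) \<longlonglongrightarrow> 0" using dense_\<Xi>[OF b(1)] by blast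
    have vX: "v n \<in> X" for n using v(1) \<Xi>(1) by blast
    \<comment> \<open>Bounds the approximations of \<open>\<xi>'\<close> once they are within
      distance 1 of it.\<close>
    define M where "M = 4 * F + 1"
    have M: "0 < F * M + 1" using consts_nonneg(2) unfolding M_def by (intro add_nonneg_pos mult_nonneg_nonneg) simp_all
    define \<delta> where "\<delta> = min 1 (\<epsilon> / (4 * (F * M + 1)))"
    have \<delta>: "0 < \<delta>" "\<delta> \<le> 1" unfolding \<delta>_def using \<epsilon> M by simp_all
    have \<delta>2: "\<delta> * (F * M + 1) \<le> \<epsilon> / 4" unfolding \<delta>_def by (rule min_divide_mult_le[OF M]) simp
    define \<gamma> where "\<gamma> = \<delta> / (1 + Pe * C)"
    have \<gamma>: "0 < \<gamma>" "\<gamma> * (1 + Pe * C) \<le> \<delta>" unfolding \<gamma>_def using \<delta> Pe_C by simp_all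
    have FM: "0 < F + M" using consts_nonneg(2) unfolding M_def by simp
    have "\<forall>\<^sub>F n in sequentially. N (\<lambda>x. v n x - \<xi>' x) < min (min 1 \<gamma>) (\<epsilon> / (4 * (F + M)))"
      by (rule order_tendstoD(2)[OF v(2)]) (use \<gamma> \<epsilon> FM in simp)
    then show ?thesis
    proof eventually_elim
      case (elim n)
      let ?d = "N (\<lambda>x. v n x - \<xi>' x)"
      have d: "?d \<le> 1" "?d \<le> \<gamma>" "?d \<le> \<epsilon> / (4 * (F + M))" using elim by simp_all
      have NM: "N (v n) \<le> M" using N_diff[OF X_W[OF vX] X_W[OF b(1)], of n] b(4) d(1) unfolding M_def by linarith
      have Qv: "Q a' (v n) \<psi> \<theta> \<ge> - (\<gamma> * (N \<psi>)\<^sup>2) - Pe * C * \<gamma> * (N \<psi> * N \<theta>)" if t: "\<psi> \<in> Y" "\<theta> \<in> X" for \<psi> \<theta>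
      proof -
        have "Q a' \<xi>' \<psi> \<theta> \<ge> 0" using o t unfolding opt_def feas_def by blast
        moreover have "Pe * C * ?d * (N \<psi> * N \<theta>) \<le> Pe * C * \<gamma> * (N \<psi> * N \<theta>)"
          by (intro mult_right_mono mult_left_mono d Pe_C mult_nonneg_nonneg N_nonneg)
        moreover have "0 \<le> \<gamma> * (N \<psi>)\<^sup>2" using \<gamma> by simp
        ultimately show ?thesis using Q_diff[OF vX[of n] b(1) t, where a=a' and b=a'] by simp
      qed
      have "feas (\<Xi> n) (\<Psi> n) (\<Theta> n) (a' + \<delta>) (\<lambda>x. (1 - \<delta>) * v n x)"
        unfolding feas_def
      proof (intro conjI ballI \<Xi>(3) v(1))
        fix \<psi> \<theta> assume "\<psi> \<in> \<Psi> n" "\<theta> \<in> \<Theta> n"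
        then have t: "\<psi> \<in> Y" "\<theta> \<in> X" using \<Psi> \<Theta>(1) by blast+
        show "0 \<le> Q (a' + \<delta>) (\<lambda>x. (1 - \<delta>) * v n x) \<psi> \<theta>"
          by (rule Q_perturb[OF vX t b(2) less_imp_le[OF \<delta>(1)] \<delta>(2) less_imp_le[OF \<gamma>(1)] \<gamma>(2) Qv[OF t]])
      qed
      then have "J (a' + \<delta>) (\<lambda>x. (1 - \<delta>) * v n x) \<le> J (a n) (\<xi> n)" using o_n[of n] unfolding opt_def by blast
      moreover have "J (a' + \<delta>) (\<lambda>x. (1 - \<delta>) * v n x) \<ge> J a' (v n) - \<delta> * (F * N (v n) + 1)"
        by (rule J_perturb[OF vX less_imp_le[OF \<delta>(1)] \<delta>(2)])
      moreover have "\<delta> * (F * N (v n) + 1) \<le> \<delta> * (F * M + 1)"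
        using \<delta>(1) consts_nonneg(2) NM by (intro mult_left_mono add_mono) simp_all
      moreover have "\<bar>(J a' (v n) + a') - (?L + a')\<bar> \<le> (F + M) * ?d"
        using b(4) by (intro J_diff vX b(1) NM) (simp add: M_def)
      moreover have "(F + M) * ?d \<le> \<epsilon> / 4"
      proof -
        have "?d * (4 * (F + M)) \<le> \<epsilon>" using d(3) FM by (subst pos_le_divide_eq[symmetric]) simp_all
        then show ?thesis by (simp add: algebra_simps)
      qed
      ultimately show ?case using \<delta>2 \<epsilon> by linarith
    qed
  qed
  show J_lim: "(\<lambda>n. J (a n) (\<xi> n)) \<longlonglongrightarrow> ?L"
  proof (rule order_tendstoI)
    fix y assume "y < ?L" then show "\<forall>\<^sub>F n in sequentially. y < J (a n) (\<xi> n)" using lower[of "?L - y"] by simp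
  next
    fix y assume "?L < y" then show "\<forall>\<^sub>F n in sequentially. J (a n) (\<xi> n) < y" using upper[of "y - ?L"] by simp
  qed
  \<comment> \<open>Midpoints with the continuous optimizer are again asymptotically feasible, so
    their objective can exceed \<open>?L\<close> only by little, whereas strong concavity raises it
    by a multiple of the squared distance.\<close>
  let ?a = "\<lambda>n. 1/2 * a n + 1/2 * a'" and ?u = "\<lambda>n x. 1/2 * \<xi> n x + 1/2 * \<xi>' x"
  have mid: "\<forall>\<^sub>F n in sequentially. J (?a n) (?u n) < ?L + \<epsilon>" if "0 < \<epsilon>" for \<epsilon>
  proof (rule asymptotically_feasible_objective[OF _ _ _ _ L that])
    show "0 \<le> ?a n" for n using b(2) b_n(2)[of n] by simp
    show "?u n \<in> X" for n by (rule X_lincomb[OF b_n(1) b(1)])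
    show "N (?u n) \<le> ?B" for n using N_lincomb[OF b_n(1)[of n] b(1), of "1/2" "1/2"] b(4) b_n(4)[of n] by simp
    fix \<psi> \<theta> and e :: real assume t: "\<psi> \<in> Y" "\<theta> \<in> X" and e: "0 < e"
    have "Q a' \<xi>' \<psi> \<theta> \<ge> 0" using o t unfolding opt_def feas_def by blast
    from asym[OF t e] show "\<forall>\<^sub>F n in sequentially. - e \<le> Q (?a n) (?u n) \<psi> \<theta>"
    proof eventually_elim
      case (elim n)
      then show ?case using \<open>Q a' \<xi>' \<psi> \<theta> \<ge> 0\<close> e unfolding Q_midpoint[OF b_n(1) b(1) t] by linarith
    qed
  qed
  have "(\<lambda>n. (N (\<lambda>x. \<xi> n x - \<xi>' x))\<^sup>2) \<longlonglongrightarrow> 0"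
  proof (rule order_tendstoI)
    fix y :: real assume "y < 0" then show "\<forall>\<^sub>F n in sequentially. y < (N (\<lambda>x. \<xi> n x - \<xi>' x))\<^sup>2"
      by (intro always_eventually allI) (meson less_le_trans zero_le_power2)
  next
    fix y :: real assume y: "0 < y"
    \<comment> \<open>With these margins the squared distance is below
      \<open>16 * (y/32 + y/64)\<close>, which is three quarters of \<open>y\<close>.\<close>
    have m: "\<forall>\<^sub>F n in sequentially. J (?a n) (?u n) < ?L + y/32" and l: "\<forall>\<^sub>F n in sequentially. J (a n) (\<xi> n) > ?L - y/32"
      using mid[of "y/32"] lower[of "y/32"] y by simp_all
    from m l show "\<forall>\<^sub>F n in sequentially. (N (\<lambda>x. \<xi> n x - \<xi>' x))\<^sup>2 < y"
    proof eventually_elim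
      case (elim n)
      then show ?case unfolding J_midpoint[OF b_n(1) b(1)] using y by linarith
    qed
  qed
  from tendsto_real_sqrt[OF this] show N_lim: "(\<lambda>n. N (\<lambda>x. \<xi> n x - \<xi>' x)) \<longlonglongrightarrow> 0"
    by (simp add: N_nonneg)
  have "(\<lambda>n. J (a n) (\<xi> n) + a n) \<longlonglongrightarrow> ?L + a'"
  proof (rule LIM_zero_cancel, rule tendsto_rabs_zero_cancel, rule tendsto_sandwich[OF always_eventually always_eventually tendsto_const])
    show "\<forall>n. \<bar>J (a n) (\<xi> n) + a n - (?L + a')\<bar> \<le> (F + ?B) * N (\<lambda>x. \<xi> n x - \<xi>' x)"
      by (intro allI J_diff b b_n)
    show "(\<lambda>n. (F + ?B) * N (\<lambda>x. \<xi> n x - \<xi>' x)) \<longlonglongrightarrow> 0" using tendsto_mult_left[OF N_lim, of "F + ?B"] by simp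
  qed simp
  from tendsto_diff[OF this J_lim] show "a \<longlonglongrightarrow> a'" by simp
qed

end

section \<open>From the abstract setting back to the function spaces\<close>

lemma subspace_of_dim_properties:
  assumes "subspace_of_dim \<Omega> n V X" and zero: "(\<lambda>x. 0) \<in> X" and scale: "\<And>c u. u \<in> X \<Longrightarrow> (\<lambda>x. c * u x) \<in> X"
  shows "V \<subseteq> X" "(\<lambda>x. 0) \<in> V" "u \<in> V \<Longrightarrow> (\<lambda>x. c * u x) \<in> V"
proof -
  obtain b where V: "V = {u \<in> X. \<exists>c :: nat \<Rightarrow> real. AE x in lborel. x \<in> \<Omega> \<longrightarrow> u x = (\<Sum>i<n. c i * b i x)}"
    using assms(1) unfolding subspace_of_dim_def by blast
  show "V \<subseteq> X" unfolding V by blast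
  show "(\<lambda>x. 0) \<in> V" unfolding V using zero by (auto intro!: exI[of _ "\<lambda>_. 0"])
  assume u: "u \<in> V"
  then obtain d where d: "AE x in lborel. x \<in> \<Omega> \<longrightarrow> u x = (\<Sum>i<n. d i * b i x)" unfolding V by blast
  have "AE x in lborel. x \<in> \<Omega> \<longrightarrow> c * u x = (\<Sum>i<n. (c * d i) * b i x)"
    using d by eventually_elim (simp add: sum_distrib_left mult_ac)
  then show "(\<lambda>x. c * u x) \<in> V" using u scale unfolding V by (auto intro!: exI[of _ "\<lambda>i. c * d i"])
qed

lemma optimal_value_eq:
  assumes "optimizer \<Omega> f Pe X Y Z a \<xi>"
  shows "optimal_value \<Omega> f Pe X Y Z = objective \<Omega> f (a, \<xi>)"
proof -
  have m: "(a, \<xi>) \<in> feasible \<Omega> Pe X Y Z" "\<And>p. p \<in> feasible \<Omega> Pe X Y Z \<Longrightarrow> objective \<Omega> f p \<le> objective \<Omega> f (a, \<xi>)"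
    using assms unfolding optimizer_def is_arg_max_def by (blast, force simp: not_less)
  show ?thesis unfolding optimal_value_def by (rule cSup_eq_maximum) (use m in auto)
qed
theorem theorem3p1:
  fixes \<Omega> :: "plane set" and f :: "(plane \<Rightarrow> real) \<Rightarrow> real" and Pe :: real
    and \<Xi> \<Theta> \<Psi> :: "nat \<Rightarrow> (plane \<Rightarrow> real) set"
    and a_star :: real and \<xi>_star :: "plane \<Rightarrow> real"
    and a :: "nat \<Rightarrow> real" and \<xi> :: "nat \<Rightarrow> plane \<Rightarrow> real"
  assumes domain: "open \<Omega>" "connected \<Omega>" "\<Omega> \<noteq> {}" "bounded \<Omega>" "lipschitz_boundary \<Omega>"
    and f: "f \<in> H_minus1 \<Omega>"
    and Pe: "Pe \<ge> 0"
    and \<Xi>: "\<And>n. n \<ge> 1 \<Longrightarrow> subspace_of_dim \<Omega> n (\<Xi> n) (H10 \<Omega>)"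
    and \<Theta>: "\<And>n. n \<ge> 1 \<Longrightarrow> subspace_of_dim \<Omega> n (\<Theta> n) (H10 \<Omega>)"
    and \<Psi>: "\<And>n. n \<ge> 1 \<Longrightarrow> subspace_of_dim \<Omega> n (\<Psi> n) (H_space \<Omega>)"
    and dense_\<Xi>: "\<And>u. u \<in> H10 \<Omega> \<Longrightarrow>
      \<exists>v. (\<forall>n\<ge>1. v n \<in> \<Xi> n) \<and> (\<lambda>n. H10_norm \<Omega> (\<lambda>x. v n x - u x)) \<longlonglongrightarrow> 0"
    and dense_\<Theta>: "\<And>u. u \<in> H10 \<Omega> \<Longrightarrow>
      \<exists>v. (\<forall>n\<ge>1. v n \<in> \<Theta> n) \<and> (\<lambda>n. H10_norm \<Omega> (\<lambda>x. v n x - u x)) \<longlonglongrightarrow> 0"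
    and dense_\<Psi>: "\<And>u. u \<in> H_space \<Omega> \<Longrightarrow>
      \<exists>v. (\<forall>n\<ge>1. v n \<in> \<Psi> n) \<and> (\<lambda>n. H1_norm \<Omega> (\<lambda>x. v n x - u x)) \<longlonglongrightarrow> 0"
    and opt: "optimizer \<Omega> f Pe (H10 \<Omega>) (H_space \<Omega>) (H10 \<Omega>) a_star \<xi>_star"
    and opt_n: "\<And>n. n \<ge> 1 \<Longrightarrow> optimizer \<Omega> f Pe (\<Xi> n) (\<Psi> n) (\<Theta> n) (a n) (\<xi> n)"
  shows "(\<lambda>n. optimal_value \<Omega> f Pe (\<Xi> n) (\<Psi> n) (\<Theta> n))
           \<longlonglongrightarrow> optimal_value \<Omega> f Pe (H10 \<Omega>) (H_space \<Omega>) (H10 \<Omega>)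
       \<and> a \<longlonglongrightarrow> a_star
       \<and> (\<lambda>n. H10_norm \<Omega> (\<lambda>x. \<xi> n x - \<xi>_star x)) \<longlonglongrightarrow> 0"
proof -
  interpret lipschitz_domain \<Omega> by unfold_locales (rule domain)+
  obtain C where C: "C \<ge> 0"
    "\<And>\<xi> \<psi> \<theta>. \<xi> \<in> H10 \<Omega> \<Longrightarrow> \<psi> \<in> H_space \<Omega> \<Longrightarrow> \<theta> \<in> H10 \<Omega> \<Longrightarrow>
      \<bar>advection \<Omega> \<xi> \<psi> \<theta>\<bar> \<le> C * H10_norm \<Omega> \<xi> * (H10_norm \<Omega> \<psi> * H10_norm \<Omega> \<theta>)"
    "\<And>\<xi> \<psi> \<theta> \<psi>' \<theta>'. \<xi> \<in> H10 \<Omega> \<Longrightarrow> \<psi> \<in> H_space \<Omega> \<Longrightarrow> \<theta> \<in> H10 \<Omega> \<Longrightarrow> \<psi>' \<in> H_space \<Omega> \<Longrightarrow> \<theta>' \<in> H10 \<Omega> \<Longrightarrow>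
      \<bar>advection \<Omega> \<xi> \<psi>' \<theta>' - advection \<Omega> \<xi> \<psi> \<theta>\<bar>
        \<le> C * H10_norm \<Omega> \<xi> * (H10_norm \<Omega> (\<lambda>x. \<psi>' x - \<psi> x) * H10_norm \<Omega> \<theta>' + H10_norm \<Omega> \<psi> * H10_norm \<Omega> (\<lambda>x. \<theta>' x - \<theta> x))"
    by (rule advection_bounds) (rule that)
  have f_lin: "f (\<lambda>x. c * u x + d * v x) = c * f u + d * f v" if "u \<in> H10 \<Omega>" "v \<in> H10 \<Omega>" for c d u v
    using f that unfolding H_minus1_def by simp
  obtain F' where F': "\<forall>u\<in>H10 \<Omega>. \<bar>f u\<bar> \<le> F' * H10_norm \<Omega> u" using f unfolding H_minus1_def by blast
  \<comment> \<open>The constant that bounds \<open>f\<close> may have either sign, whereas the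
    locale asks for a nonnegative one.\<close>
  define F where "F = \<bar>F'\<bar>"
  have F: "\<bar>f u\<bar> \<le> F * H10_norm \<Omega> u" if "u \<in> H10 \<Omega>" for u
    using bspec[OF F' that] mult_right_mono[OF abs_ge_self[of F'] H10_norm_nonneg[of u]] unfolding F_def by linarith
  have zero: "(\<lambda>x. 0) \<in> H10 \<Omega>"
    by (rule test_function_H10) (simp add: test_function_def smooth_def Ck_const)
  have N_diff: "\<bar>H10_norm \<Omega> u - H10_norm \<Omega> v\<bar> \<le> H10_norm \<Omega> (\<lambda>x. u x - v x)" if "u \<in> H1 \<Omega>" "v \<in> H1 \<Omega>" for u v
    using H10_norm_diff_ge[OF that] H10_norm_diff_ge[OF that(2,1)] H10_norm_minus_commute[OF that] by linarith
  have N_mid: "(H10_norm \<Omega> (\<lambda>x. 1/2 * u x + 1/2 * v x))\<^sup>2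
      = (H10_norm \<Omega> u)\<^sup>2 / 2 + (H10_norm \<Omega> v)\<^sup>2 / 2 - (H10_norm \<Omega> (\<lambda>x. u x - v x))\<^sup>2 / 4" if "u \<in> H10 \<Omega>" "v \<in> H10 \<Omega>" for u v
    unfolding diff_eq_lincomb H10_norm_def H1_lincomb(3)[OF H10_H1[OF that(1)] H10_H1[OF that(2)]]
    by (rule L2_norm_diff_square[OF wgrad_L2[OF H10_H1[OF that(1)]] wgrad_L2[OF H10_H1[OF that(2)]]])
  interpret A: advection_form "H1 \<Omega>" "H10 \<Omega>" "H_space \<Omega>" "H10_norm \<Omega>" "advection \<Omega>" f C F Pe
  proof
    show "u \<in> H10 \<Omega> \<Longrightarrow> u \<in> H1 \<Omega>" for u by (rule H10_H1)
    show "u \<in> H_space \<Omega> \<Longrightarrow> u \<in> H1 \<Omega>" for u by (rule H_space_H1)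
    show "u \<in> H10 \<Omega> \<Longrightarrow> v \<in> H10 \<Omega> \<Longrightarrow> (\<lambda>x. c * u x + d * v x) \<in> H10 \<Omega>" for u v c d by (rule H10_lincomb)
    show "(\<lambda>x. 0) \<in> H10 \<Omega>" by (rule zero)
    show "0 \<le> H10_norm \<Omega> u" for u by (rule H10_norm_nonneg)
    show "u \<in> H10 \<Omega> \<Longrightarrow> v \<in> H10 \<Omega> \<Longrightarrow> H10_norm \<Omega> (\<lambda>x. c * u x + d * v x) \<le> \<bar>c\<bar> * H10_norm \<Omega> u + \<bar>d\<bar> * H10_norm \<Omega> v" for u v c d
      by (rule H10_norm_lincomb[OF H10_H1 H10_H1])
    show "0 \<le> F" by (simp add: F_def)
  qed (fact N_diff N_mid f_lin F advection_lincomb C Pe)+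
  have Q_eq: "Q_form \<Omega> Pe a \<xi> \<psi> \<theta> = A.Q a \<xi> \<psi> \<theta>" if "\<psi> \<in> H_space \<Omega>" "\<theta> \<in> H10 \<Omega>" for a \<xi> \<psi> \<theta>
    unfolding Q_form_def A.Q_def integral_gradient_squares(1)[OF H_space_H1[OF that(1)] H10_H1[OF that(2)]] ..
  have J_eq: "objective \<Omega> f (a, \<xi>) = A.J a \<xi>" if "\<xi> \<in> H10 \<Omega>" for a \<xi>
    unfolding objective_def A.J_def prod.case integral_gradient_squares(2)[OF H10_H1[OF that] H10_H1[OF that]] by simp
  have feas_eq: "(a, \<xi>) \<in> feasible \<Omega> Pe X Y Z \<longleftrightarrow> A.feas X Y Z a \<xi>" if "Y \<subseteq> H_space \<Omega>" "Z \<subseteq> H10 \<Omega>" for a \<xi> X Y Z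
    using that Q_eq unfolding feasible_def A.feas_def by (simp add: subset_iff)
  have opt_A: "A.opt X Y Z a \<xi>" and val: "optimal_value \<Omega> f Pe X Y Z = A.J a \<xi>"
    if o: "optimizer \<Omega> f Pe X Y Z a \<xi>" and s: "X \<subseteq> H10 \<Omega>" "Y \<subseteq> H_space \<Omega>" "Z \<subseteq> H10 \<Omega>" for a \<xi> X Y Z
  proof -
    have m: "(a, \<xi>) \<in> feasible \<Omega> Pe X Y Z" "\<And>p. p \<in> feasible \<Omega> Pe X Y Z \<Longrightarrow> objective \<Omega> f p \<le> objective \<Omega> f (a, \<xi>)"
      using o unfolding optimizer_def is_arg_max_def by (blast, force simp: not_less)
    have feas: "A.feas X Y Z a \<xi>" using m(1) unfolding feas_eq[OF s(2,3)] .
    then have \<xi>: "\<xi> \<in> H10 \<Omega>" using s(1) unfolding A.feas_def by blast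
    show "A.opt X Y Z a \<xi>"
      unfolding A.opt_def
    proof (intro conjI feas allI impI)
      fix a' \<xi>' assume f': "A.feas X Y Z a' \<xi>'"
      then have \<xi>': "\<xi>' \<in> H10 \<Omega>" using s(1) unfolding A.feas_def by blast
      show "A.J a' \<xi>' \<le> A.J a \<xi>" using m(2)[of "(a', \<xi>')"] f' unfolding feas_eq[OF s(2,3)] J_eq[OF \<xi>] J_eq[OF \<xi>'] by blast
    qed
    show "optimal_value \<Omega> f Pe X Y Z = A.J a \<xi>" unfolding optimal_value_eq[OF o] J_eq[OF \<xi>] ..
  qed
  note sp = subspace_of_dim_properties[OF _ zero A.scale_X]
  have \<Psi>_sub: "\<Psi> n \<subseteq> H_space \<Omega>" if "n \<ge> 1" for n
    using \<Psi>[OF that] unfolding subspace_of_dim_def by blast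
  \<comment> \<open>Nothing is assumed about index 0, so the abstract theorem is applied to the
    sequences shifted by one; \<open>LIMSEQ_imp_Suc\<close> undoes the shift at the end.\<close>
  have 1: "Suc n \<ge> 1" for n by simp
  note \<Xi>_s = sp[OF \<Xi>[OF 1]] and \<Theta>_s = sp[OF \<Theta>[OF 1]]
  have dense_Suc: "\<exists>v. (\<forall>n. v n \<in> V (Suc n)) \<and> (\<lambda>n. H10_norm \<Omega> (\<lambda>x. v n x - u x)) \<longlonglongrightarrow> 0"
    if ex: "\<exists>v. (\<forall>n\<ge>1. v n \<in> V n) \<and> (\<lambda>n. H10_norm \<Omega> (\<lambda>x. v n x - u x)) \<longlonglongrightarrow> 0" for V and u :: "plane \<Rightarrow> real"
  proof -
    obtain v where v: "\<forall>n\<ge>1. v n \<in> V n" and l: "(\<lambda>n. H10_norm \<Omega> (\<lambda>x. v n x - u x)) \<longlonglongrightarrow> 0" using ex by (elim exE conjE) (rule that)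
    show ?thesis by (intro exI[of _ "\<lambda>n. v (Suc n)"] conjI allI v[rule_format] 1 LIMSEQ_Suc[OF l])
  qed
  \<comment> \<open>Convergence in the full H^1 norm gives convergence of the gradients, the part of
    the norm that the abstract setting sees.\<close>
  have dense_\<Psi>': "\<exists>v. (\<forall>n\<ge>1. v n \<in> \<Psi> n) \<and> (\<lambda>n. H10_norm \<Omega> (\<lambda>x. v n x - u x)) \<longlonglongrightarrow> 0" if "u \<in> H_space \<Omega>" for u
    using dense_\<Psi>[OF that] unfolding H1_norm_tendsto_0_iff H10_norm_def by blast
  note conv = A.galerkin_convergence[where \<Xi>="\<lambda>n. \<Xi> (Suc n)" and \<Psi>="\<lambda>n. \<Psi> (Suc n)" and \<Theta>="\<lambda>n. \<Theta> (Suc n)"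
    and a="\<lambda>n. a (Suc n)" and \<xi>="\<lambda>n. \<xi> (Suc n)" and a'=a_star and \<xi>'=\<xi>_star,
    OF \<Xi>_s \<Psi>_sub[OF 1] \<Theta>_s(1,2) dense_Suc[OF dense_\<Xi>] dense_Suc[OF dense_\<Theta>] dense_Suc[OF dense_\<Psi>']
      opt_A[OF opt order_refl order_refl order_refl] opt_A[OF opt_n[OF 1] \<Xi>_s(1) \<Psi>_sub[OF 1] \<Theta>_s(1)]]
  have val_n: "optimal_value \<Omega> f Pe (\<Xi> (Suc n)) (\<Psi> (Suc n)) (\<Theta> (Suc n)) = A.J (a (Suc n)) (\<xi> (Suc n))" for n
    by (rule val[OF opt_n[OF 1] \<Xi>_s(1) \<Psi>_sub[OF 1] \<Theta>_s(1)])
  have "(\<lambda>n. optimal_value \<Omega> f Pe (\<Xi> (Suc n)) (\<Psi> (Suc n)) (\<Theta> (Suc n)))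
      \<longlonglongrightarrow> optimal_value \<Omega> f Pe (H10 \<Omega>) (H_space \<Omega>) (H10 \<Omega>)"
    unfolding val[OF opt order_refl order_refl order_refl] val_n by (rule conv(1))
  from this conv(2,3) show ?thesis by (intro conjI) (rule LIMSEQ_imp_Suc, assumption)+
qed

end
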